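(* Let $\alpha\in(0,\infty)$ and $p\in[1,\infty)$ satisfy $2\le \alpha p<2p+1$, and set $\sigma=(\alpha p-1)/(2p)$. Let $f:\mathbb{R}/\mathcal{L}\mathbb{Z}\to\mathbb{R}^n$ be an arclength parametrization of a closed curve without self-intersections, with unit tangent $\tau=f'$, and assume that $f$ is bi-Lipschitz, i.e. there is a constant $C_{\mathrm b}>0$ with $\mathscr{D}(f)\le C_{\mathrm b}\|\Delta f\|_{\mathbb{R}^n}$. Then the following hold. 1. If $f,\phi,\psi\in W^{1+\sigma,2p}(\mathbb{R}/\mathcal{L}\mathbb{Z},\mathbb{R}^n)\cap W^{1,\infty}(\mathbb{R}/\mathcal{L}\mathbb{Z},\mathbb{R}^n)$, then $\mathscr{M}_{(\alpha,p)}(f)$, $\mathscr{G}_{(\alpha,p)}(f)[\phi]$, $\mathscr{H}_{(\alpha,p)}(f)[\phi,\psi]\in L^1((\mathbb{R}/\mathcal{L}\mathbb{Z})^2)$. Moreover, there exists a positive constant $C$ depending on $\|\tau\|_{W^{\sigma,2p}\cap L^\infty}$, $C_{\mathrm b}$, $\alpha$ and $p$ such that $$\|\mathscr{M}_{(\alpha,p)}(f)\|_{L^1}\le C,\qquad \|\mathscr{G}_{(\alpha,p)}(f)[\phi]\|_{L^1}\le C\|\phi'\|_{W^{\sigma,2p}\cap L^\infty},$$ $$\|\mathscr{H}_{(\alpha,p)}(f)[\phi,\psi]\|_{L^1}\le C\|\phi'\|_{W^{\sigma,2p}\cap L^\infty}\|\psi'\|_{W^{\sigma,2p}\cap L^\infty},$$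 where the $L^1$ norms are over $(\mathbb{R}/\mathcal{L}\mathbb{Z})^2$. 2. Let $\beta\in(0,1]$. If $f,\phi,\psi\in C^{1,\beta}(\mathbb{R}/\mathcal{L}\mathbb{Z},\mathbb{R}^n)$, then $\mathscr{D}(f)^{(\alpha-2\beta)p}\mathscr{M}_{(\alpha,p)}(f)$, $\mathscr{D}(f)^{(\alpha-2\beta)p}\mathscr{G}_{(\alpha,p)}(f)[\phi]$, $\mathscr{D}(f)^{(\alpha-2\beta)p}\mathscr{H}_{(\alpha,p)}(f)[\phi,\psi]\in L^\infty((\mathbb{R}/\mathcal{L}\mathbb{Z})^2)$. Moreover, there exists a positive constant $C$ depending on $\|\tau\|_{C^{0,\beta}}$, $C_{\mathrm b}$, $\alpha$ and $p$ such that $$\|\mathscr{D}(f)^{(\alpha-2\beta)p}\mathscr{M}_{(\alpha,p)}(f)\|_{L^\infty}\le C,\qquad \|\mathscr{D}(f)^{(\alpha-2\beta)p}\mathscr{G}_{(\alpha,p)}(f)[\phi]\|_{L^\infty}\le C\|\phi'\|_{C^{0,\beta}},$$ $$\|\mathscr{D}(f)^{(\alpha-2\beta)p}\mathscr{H}_{(\alpha,p)}(f)[\phi,\psi]\|_{L^\infty}\le C\|\phi'\|_{C^{0,\beta}}\|\psi'\|_{C^{0,\beta}},$$ where the $L^\infty$ norms are over $(\mathbb{R}/\mathcal{L}\mathbb{Z})^2$. 3. Let $\beta\in(0,1]$. If $\tau,\phi',\psi'\in X^\beta(\mathbb{R}/\mathcal{L}\mathbb{Z},\mathbb{R}^n)$,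 then $\mathscr{D}(f)^{(\alpha-2\beta)p}\mathscr{M}_{(\alpha,p)}(f)$, $\mathscr{D}(f)^{(\alpha-2\beta)p}\mathscr{G}_{(\alpha,p)}(f)[\phi]$, $\mathscr{D}(f)^{(\alpha-2\beta)p}\mathscr{H}_{(\alpha,p)}(f)[\phi,\psi]$ can be extended to the diagonal set $\{(s,s)\mid s\in\mathbb{R}/\mathcal{L}\mathbb{Z}\}$ such that these functions are continuous everywhere on $(\mathbb{R}/\mathcal{L}\mathbb{Z})^2$, and they satisfy $$\|\mathscr{D}(f)^{(\alpha-2\beta)p}\mathscr{M}_{(\alpha,p)}(f)\|_{C^0}\le C,\qquad \|\mathscr{D}(f)^{(\alpha-2\beta)p}\mathscr{G}_{(\alpha,p)}(f)[\phi]\|_{C^0}\le C\|\phi'\|_{X^\beta},$$ $$\|\mathscr{D}(f)^{(\alpha-2\beta)p}\mathscr{H}_{(\alpha,p)}(f)[\phi,\psi]\|_{C^0}\le C\|\phi'\|_{X^\beta}\|\psi'\|_{X^\beta}$$ (with $C^0$ norms over $(\mathbb{R}/\mathcal{L}\mathbb{Z})^2$) for some positive constant $C$ depending on $\|\tau\|_{X^\beta}$, $C_{\mathrm b}$, $\alpha$ and $p$. For every $s\in\mathbb{R}/\mathcal{L}\mathbb{Z}$ the limits $$\lim_{(s_1,s_2)\to(s,s)}\mathscr{D}(f)^{(\alpha-2\beta)p}\mathscr{M}_{(\alpha,p)}(f),\quad \lim_{(s_1,s_2)\to(s,s)}\mathscr{D}(f)^{(\alpha-2\beta)p}\mathscr{G}_{(\alpha,p)}(f)[\phi],\quad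 \lim_{(s_1,s_2)\to(s,s)}\mathscr{D}(f)^{(\alpha-2\beta)p}\mathscr{H}_{(\alpha,p)}(f)[\phi,\psi]$$ exist and are finite, and they vanish for every $s\in\mathbb{R}/\mathcal{L}\mathbb{Z}$ when $\beta\in(0,1)$.
   Context: $\mathcal{L}>0$ is the length of the curve. For a function $u$ on $\mathbb{R}/\mathcal{L}\mathbb{Z}$, $\Delta u=u(s_1)-u(s_2)$, and $\Delta s=s_1-s_2$; $|\Delta s|$ is the distance in $\mathbb{R}/\mathcal{L}\mathbb{Z}$. $\mathscr{D}(f)=\mathscr{D}(f(s_1),f(s_2))$ is the intrinsic distance, i.e. the length of the shorter arc of the curve between $f(s_1)$ and $f(s_2)$ (equal to $|\Delta s|$ for an arclength parametrization). Energy density of a closed curve $f$: $$\mathscr{M}_{(\alpha,p)}(f)(s_1,s_2)=\left(\frac1{\|f(s_1)-f(s_2)\|_{\mathbb{R}^n}^\alpha}-\frac1{\mathscr{D}(f(s_1),f(s_2))^\alpha}\right)^p .$$ Variations: for functions $\phi,\psi:\mathbb{R}/\mathcal{L}\mathbb{Z}\to\mathbb{R}^n$ and a geometric quantity $\mathscr{F}(f)$, $\delta\mathscr{F}(f)[\phi]=\frac{d}{d\varepsilon}\mathscr{F}(f+\varepsilon\phi)|_{\varepsilon=0}$ and $\delta^2\mathscr{F}(f)[\phi,\psi]=\frac{\partial^2}{\partial\varepsilon_1\partial\varepsilon_2}\mathscr{F}(f+\varepsilon_1\phi+\varepsilon_2\psi)|_{\varepsilon_1=\varepsilon_2=0}$.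 The functions $\mathscr{G}_{(\alpha,p)}(f)[\phi]$ and $\mathscr{H}_{(\alpha,p)}(f)[\phi,\psi]$ of $(s_1,s_2)$ are defined by $$\mathscr{G}_{(\alpha,p)}(f)[\phi]\,ds_1ds_2=\delta(\mathscr{M}_{(\alpha,p)}(f)\,ds_1ds_2)[\phi],\qquad \mathscr{H}_{(\alpha,p)}(f)[\phi,\psi]\,ds_1ds_2=\delta^2(\mathscr{M}_{(\alpha,p)}(f)\,ds_1ds_2)[\phi,\psi].$$ Here the line elements are also varied: for a perturbed curve $g=f+\varepsilon\phi$ (or $g=f+\varepsilon_1\phi+\varepsilon_2\psi$), parametrized by the same parameter $s$, the distances in $\mathscr{M}_{(\alpha,p)}$ are those of $g$ and $ds_j$ is replaced by $\|g'(s_j)\|_{\mathbb{R}^n}ds_j$. Thus e.g. $\mathscr{G}_{(\alpha,p)}(f)[\phi](s_1,s_2)=\frac{d}{d\varepsilon}\big(\mathscr{M}_{(\alpha,p)}(f+\varepsilon\phi)(s_1,s_2)\,\|\tau(s_1)+\varepsilon\phi'(s_1)\|\,\|\tau(s_2)+\varepsilon\phi'(s_2)\|\big)|_{\varepsilon=0}$. Function spaces on $\mathbb{R}/\mathcal{L}\mathbb{Z}$: for $k\in\{0\}\cup\mathbb{N}$, $0<\sigma<1$, $q\ge1$, $W^{k+\sigma,q}=\{u\in W^{k,q}\mid [u^{(k)}]_{W^{\sigma,q}}<\infty\}$ with $$[v]_{W^{\sigma,q}}=\Big(\iint_{(\mathbb{R}/\mathcal{L}\mathbb{Z})^2}\frac{\|\Delta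 v\|^q}{|\Delta s|^{1+\sigma q}}ds_1ds_2\Big)^{1/q},\qquad \|u\|_{W^{k+\sigma,q}}=(\|u\|_{W^{k,q}}^q+[u^{(k)}]_{W^{\sigma,q}}^q)^{1/q}.$$ $\|\cdot\|_{W^{\sigma,2p}\cap L^\infty}$ is the usual norm of the intersection (the sum of the two norms). For $\beta\in(0,1]$, $C^{k,\beta}=\{u\in C^k\mid[u^{(k)}]_{C^{0,\beta}}<\infty\}$ with $[v]_{C^{0,\beta}}=\sup_{s_1\neq s_2}\|\Delta v\|/|\Delta s|^\beta$ and $\|u\|_{C^{k,\beta}}=\|u\|_{C^k}+[u^{(k)}]_{C^{0,\beta}}$. For $0<\beta<1$ the little Hölder space $h^{k,\beta}$ is the closure of $C^\infty$ in $C^{k,\beta}$, with the $C^{k,\beta}$ norm. $X^\beta=h^{0,\beta}$ for $0<\beta<1$ and $X^1=C^1$.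
   Formalization: In part 3, continuity and the C^0 bounds for the weighted G and H are claimed only for pairs with |Δs| ≠ L/2 (diagonal included): at antipodal pairs the two arcs compete, and G jumps, e.g. for the unit circle with φ = cos(s) f, α=2, p=1. For M they hold on the whole torus. *)

theory Defs
  imports
    "HOL-Analysis.Analysis"
    "HOL-Library.Real_Mod"
    "HOL-Library.Periodic_Fun"
    "HOL-Probability.Essential_Supremum"
begin

text \<open>
  Functions on \<open>\<real>/L\<int>\<close> are \<open>L\<close>-periodic functions on the real line, and functions on
  \<open>(\<real>/L\<int>)\<^sup>2\<close> are functions on the plane that are \<open>L\<close>-periodic in each variable. Integrals over
  \<open>\<real>/L\<int>\<close> and its square are taken over \<open>[0, L]\<close> and \<open>[0, L] \<times> [0, L]\<close>.
\<close>

definition circle_measure :: "real \<Rightarrow> real measure" where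
  "circle_measure L = lebesgue_on {0..L}"

definition torus_measure :: "real \<Rightarrow> (real \<times> real) measure" where
  "torus_measure L = lebesgue_on ({0..L} \<times> {0..L})"

definition circle_dist :: "real \<Rightarrow> real \<Rightarrow> real \<Rightarrow> real" where
  "circle_dist L s1 s2 = min ((s1 - s2) rmod L) (L - (s1 - s2) rmod L)"


section \<open>Curves and energy density\<close>

text \<open>
  Length of the shorter of the two arcs from \<open>g s2\<close> to \<open>g s1\<close> of the closed curve \<open>g\<close> with
  (weak) derivative \<open>g'\<close>; arc length only involves \<open>g'\<close>.
\<close>

definition intrinsic_dist ::
    "real \<Rightarrow> (real \<Rightarrow> 'a::euclidean_space) \<Rightarrow> real \<Rightarrow> real \<Rightarrow> real" where
  "intrinsic_dist L g' s1 s2 =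
     (let r = (s1 - s2) rmod L in
      min (\<integral>s. norm (g' s) \<partial>lebesgue_on {s2..s2 + r})
          (\<integral>s. norm (g' s) \<partial>lebesgue_on {s2 + r..s2 + L}))"

definition energy_density ::
    "real \<Rightarrow> real \<Rightarrow> real \<Rightarrow> (real \<Rightarrow> 'a::euclidean_space) \<Rightarrow> (real \<Rightarrow> 'a)
      \<Rightarrow> real \<times> real \<Rightarrow> real" where
  "energy_density \<alpha> p L g g' =
     (\<lambda>(s1, s2). (1 / norm (g s1 - g s2) powr \<alpha>
                  - 1 / intrinsic_dist L g' s1 s2 powr \<alpha>) powr p)"

text \<open>Density of the energy with respect to \<open>ds1 ds2\<close>, including both line elements of \<open>g\<close>.\<close>

definition energy_form ::
    "real \<Rightarrow> real \<Rightarrow> real \<Rightarrow> (real \<Rightarrow> 'a::euclidean_space) \<Rightarrow> (real \<Rightarrow> 'a)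
      \<Rightarrow> real \<times> real \<Rightarrow> real" where
  "energy_form \<alpha> p L g g' =
     (\<lambda>(s1, s2). energy_density \<alpha> p L g g' (s1, s2) * norm (g' s1) * norm (g' s2))"

definition form1 ::
    "real \<Rightarrow> real \<Rightarrow> real \<Rightarrow> (real \<Rightarrow> 'a::euclidean_space) \<Rightarrow> (real \<Rightarrow> 'a)
      \<Rightarrow> (real \<Rightarrow> 'a) \<Rightarrow> (real \<Rightarrow> 'a) \<Rightarrow> real \<times> real \<Rightarrow> real \<Rightarrow> real" where
  "form1 \<alpha> p L f \<tau> \<phi> \<phi>' x \<epsilon> =
     energy_form \<alpha> p L (\<lambda>s. f s + \<epsilon> *\<^sub>R \<phi> s) (\<lambda>s. \<tau> s + \<epsilon> *\<^sub>R \<phi>' s) x"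

definition form2 ::
    "real \<Rightarrow> real \<Rightarrow> real \<Rightarrow> (real \<Rightarrow> 'a::euclidean_space) \<Rightarrow> (real \<Rightarrow> 'a)
      \<Rightarrow> (real \<Rightarrow> 'a) \<Rightarrow> (real \<Rightarrow> 'a) \<Rightarrow> (real \<Rightarrow> 'a) \<Rightarrow> (real \<Rightarrow> 'a)
      \<Rightarrow> real \<times> real \<Rightarrow> real \<Rightarrow> real \<Rightarrow> real" where
  "form2 \<alpha> p L f \<tau> \<phi> \<phi>' \<psi> \<psi>' x \<epsilon>1 \<epsilon>2 =
     energy_form \<alpha> p L (\<lambda>s. f s + \<epsilon>1 *\<^sub>R \<phi> s + \<epsilon>2 *\<^sub>R \<psi> s)
                       (\<lambda>s. \<tau> s + \<epsilon>1 *\<^sub>R \<phi>' s + \<epsilon>2 *\<^sub>R \<psi>' s) x"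

text \<open>
  The variations \<open>\<G>\<close> and \<open>\<H>\<close>. Since \<^const>\<open>deriv\<close> has an unspecified value where the derivative does
  not exist, existence is expressed separately by the two predicates \<open>_exists\<close>.
\<close>

definition variation1 ::
    "real \<Rightarrow> real \<Rightarrow> real \<Rightarrow> (real \<Rightarrow> 'a::euclidean_space) \<Rightarrow> (real \<Rightarrow> 'a)
      \<Rightarrow> (real \<Rightarrow> 'a) \<Rightarrow> (real \<Rightarrow> 'a) \<Rightarrow> real \<times> real \<Rightarrow> real" where
  "variation1 \<alpha> p L f \<tau> \<phi> \<phi>' x = deriv (form1 \<alpha> p L f \<tau> \<phi> \<phi>' x) 0"

definition variation1_exists ::
    "real \<Rightarrow> real \<Rightarrow> real \<Rightarrow> (real \<Rightarrow> 'a::euclidean_space) \<Rightarrow> (real \<Rightarrow> 'a)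
      \<Rightarrow> (real \<Rightarrow> 'a) \<Rightarrow> (real \<Rightarrow> 'a) \<Rightarrow> real \<times> real \<Rightarrow> bool" where
  "variation1_exists \<alpha> p L f \<tau> \<phi> \<phi>' x \<longleftrightarrow>
     form1 \<alpha> p L f \<tau> \<phi> \<phi>' x field_differentiable (at 0)"

definition variation2 ::
    "real \<Rightarrow> real \<Rightarrow> real \<Rightarrow> (real \<Rightarrow> 'a::euclidean_space) \<Rightarrow> (real \<Rightarrow> 'a)
      \<Rightarrow> (real \<Rightarrow> 'a) \<Rightarrow> (real \<Rightarrow> 'a) \<Rightarrow> (real \<Rightarrow> 'a) \<Rightarrow> (real \<Rightarrow> 'a)
      \<Rightarrow> real \<times> real \<Rightarrow> real" where
  "variation2 \<alpha> p L f \<tau> \<phi> \<phi>' \<psi> \<psi>' x =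
     deriv (\<lambda>\<epsilon>1. deriv (form2 \<alpha> p L f \<tau> \<phi> \<phi>' \<psi> \<psi>' x \<epsilon>1) 0) 0"

definition variation2_exists ::
    "real \<Rightarrow> real \<Rightarrow> real \<Rightarrow> (real \<Rightarrow> 'a::euclidean_space) \<Rightarrow> (real \<Rightarrow> 'a)
      \<Rightarrow> (real \<Rightarrow> 'a) \<Rightarrow> (real \<Rightarrow> 'a) \<Rightarrow> (real \<Rightarrow> 'a) \<Rightarrow> (real \<Rightarrow> 'a)
      \<Rightarrow> real \<times> real \<Rightarrow> bool" where
  "variation2_exists \<alpha> p L f \<tau> \<phi> \<phi>' \<psi> \<psi>' x \<longleftrightarrow>
     (\<forall>\<^sub>F \<epsilon>1 in nhds 0. form2 \<alpha> p L f \<tau> \<phi> \<phi>' \<psi> \<psi>' x \<epsilon>1 field_differentiable (at 0)) \<and>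
     (\<lambda>\<epsilon>1. deriv (form2 \<alpha> p L f \<tau> \<phi> \<phi>' \<psi> \<psi>' x \<epsilon>1) 0) field_differentiable (at 0)"


section \<open>Function spaces\<close>

definition smooth :: "(real \<Rightarrow> 'a::real_normed_vector) \<Rightarrow> bool" where
  "smooth u \<longleftrightarrow>
     (\<exists>D. D 0 = u \<and> (\<forall>(k::nat) s. (D k has_vector_derivative D (Suc k) s) (at s)))"

definition in_Lq :: "real \<Rightarrow> 'b measure \<Rightarrow> ('b \<Rightarrow> 'a::euclidean_space) \<Rightarrow> bool" where
  "in_Lq q M u \<longleftrightarrow> u \<in> borel_measurable M \<and> integrable M (\<lambda>x. norm (u x) powr q)"

definition Lq_norm :: "real \<Rightarrow> 'b measure \<Rightarrow> ('b \<Rightarrow> 'a::euclidean_space) \<Rightarrow> real" where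
  "Lq_norm q M u = (\<integral>x. norm (u x) powr q \<partial>M) powr (1 / q)"

definition in_Linf :: "'b measure \<Rightarrow> ('b \<Rightarrow> 'a::euclidean_space) \<Rightarrow> bool" where
  "in_Linf M u \<longleftrightarrow> u \<in> borel_measurable M \<and> esssup M (\<lambda>x. ereal (norm (u x))) < \<infinity>"

definition Linf_norm :: "'b measure \<Rightarrow> ('b \<Rightarrow> 'a::euclidean_space) \<Rightarrow> real" where
  "Linf_norm M u = real_of_ereal (esssup M (\<lambda>x. ereal (norm (u x))))"

text \<open>The test functions are the smooth functions on \<open>\<real>/L\<int>\<close>.\<close>

definition has_weak_deriv ::
    "real \<Rightarrow> (real \<Rightarrow> 'a::euclidean_space) \<Rightarrow> (real \<Rightarrow> 'a) \<Rightarrow> bool" where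
  "has_weak_deriv L u v \<longleftrightarrow>
     periodic_fun_simple u L \<and> periodic_fun_simple v L \<and>
     integrable (circle_measure L) u \<and> integrable (circle_measure L) v \<and>
     (\<forall>\<eta>::real \<Rightarrow> real. smooth \<eta> \<and> periodic_fun_simple \<eta> L \<longrightarrow>
        (\<integral>s. deriv \<eta> s *\<^sub>R u s \<partial>circle_measure L) = - (\<integral>s. \<eta> s *\<^sub>R v s \<partial>circle_measure L))"

definition frac_quotient ::
    "real \<Rightarrow> real \<Rightarrow> real \<Rightarrow> (real \<Rightarrow> 'a::euclidean_space) \<Rightarrow> real \<times> real \<Rightarrow> real" where
  "frac_quotient L \<sigma> q v =
     (\<lambda>(s1, s2). norm (v s1 - v s2) powr q / circle_dist L s1 s2 powr (1 + \<sigma> * q))"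

definition frac_seminorm ::
    "real \<Rightarrow> real \<Rightarrow> real \<Rightarrow> (real \<Rightarrow> 'a::euclidean_space) \<Rightarrow> real" where
  "frac_seminorm L \<sigma> q v = (\<integral>x. frac_quotient L \<sigma> q v x \<partial>torus_measure L) powr (1 / q)"

definition frac_norm ::
    "real \<Rightarrow> real \<Rightarrow> real \<Rightarrow> (real \<Rightarrow> 'a::euclidean_space) \<Rightarrow> real" where
  "frac_norm L \<sigma> q v =
     (Lq_norm q (circle_measure L) v powr q + frac_seminorm L \<sigma> q v powr q) powr (1 / q)"

definition frac_Linf_norm ::
    "real \<Rightarrow> real \<Rightarrow> real \<Rightarrow> (real \<Rightarrow> 'a::euclidean_space) \<Rightarrow> real" where
  "frac_Linf_norm L \<sigma> q v = frac_norm L \<sigma> q v + Linf_norm (circle_measure L) v"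

text \<open>\<open>W1_frac L \<sigma> q\<close> is \<open>W\<^bsup>1+\<sigma>,q\<^esup>\<close> and \<open>W1_inf L\<close> is \<open>W\<^bsup>1,\<infinity>\<^esup>\<close>.\<close>

definition W1_frac :: "real \<Rightarrow> real \<Rightarrow> real \<Rightarrow> (real \<Rightarrow> 'a::euclidean_space) set" where
  "W1_frac L \<sigma> q =
     {u. \<exists>v. has_weak_deriv L u v \<and>
             in_Lq q (circle_measure L) u \<and> in_Lq q (circle_measure L) v \<and>
             integrable (torus_measure L) (frac_quotient L \<sigma> q v)}"

definition W1_inf :: "real \<Rightarrow> (real \<Rightarrow> 'a::euclidean_space) set" where
  "W1_inf L =
     {u. \<exists>v. has_weak_deriv L u v \<and>
             in_Linf (circle_measure L) u \<and> in_Linf (circle_measure L) v}"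

definition C0_norm :: "(real \<Rightarrow> 'a::euclidean_space) \<Rightarrow> real" where
  "C0_norm v = (SUP s. norm (v s))"

definition holder_quotients ::
    "real \<Rightarrow> real \<Rightarrow> (real \<Rightarrow> 'a::euclidean_space) \<Rightarrow> real set" where
  "holder_quotients L \<beta> v =
     {norm (v s1 - v s2) / circle_dist L s1 s2 powr \<beta> | s1 s2. circle_dist L s1 s2 \<noteq> 0}"

definition holder_norm :: "real \<Rightarrow> real \<Rightarrow> (real \<Rightarrow> 'a::euclidean_space) \<Rightarrow> real" where
  "holder_norm L \<beta> v = C0_norm v + Sup (holder_quotients L \<beta> v)"

definition C0_holder :: "real \<Rightarrow> real \<Rightarrow> (real \<Rightarrow> 'a::euclidean_space) set" where
  "C0_holder L \<beta> =
     {v. periodic_fun_simple v L \<and> continuous_on UNIV v \<and> bdd_above (holder_quotients L \<beta> v)}"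

definition C1_holder :: "real \<Rightarrow> real \<Rightarrow> (real \<Rightarrow> 'a::euclidean_space) set" where
  "C1_holder L \<beta> =
     {u. periodic_fun_simple u L \<and>
         (\<exists>v \<in> C0_holder L \<beta>. \<forall>s. (u has_vector_derivative v s) (at s))}"

definition little_holder :: "real \<Rightarrow> real \<Rightarrow> (real \<Rightarrow> 'a::euclidean_space) set" where
  "little_holder L \<beta> =
     {v \<in> C0_holder L \<beta>.
        \<forall>e>0. \<exists>w. smooth w \<and> periodic_fun_simple w L \<and> holder_norm L \<beta> (\<lambda>s. v s - w s) < e}"

definition X_space :: "real \<Rightarrow> real \<Rightarrow> (real \<Rightarrow> 'a::euclidean_space) set" where
  "X_space L \<beta> =
     (if \<beta> < 1 then little_holder L \<beta>
      else {v. periodic_fun_simple v L \<and> v C1_differentiable_on UNIV})"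

definition X_norm :: "real \<Rightarrow> real \<Rightarrow> (real \<Rightarrow> 'a::euclidean_space) \<Rightarrow> real" where
  "X_norm L \<beta> v =
     (if \<beta> < 1 then holder_norm L \<beta> v
      else C0_norm v + C0_norm (\<lambda>s. vector_derivative v (at s)))"


section \<open>Standing assumptions on the curve\<close>

definition arclength_curve ::
    "real \<Rightarrow> (real \<Rightarrow> 'a::euclidean_space) \<Rightarrow> (real \<Rightarrow> 'a) \<Rightarrow> bool" where
  "arclength_curve L f \<tau> \<longleftrightarrow>
     0 < L \<and> periodic_fun_simple f L \<and> continuous_on UNIV f \<and> inj_on f {0..<L} \<and>
     has_weak_deriv L f \<tau> \<and> (AE s in lebesgue. norm (\<tau> s) = 1)"

definition bi_lipschitz_curve ::
    "real \<Rightarrow> (real \<Rightarrow> 'a::euclidean_space) \<Rightarrow> (real \<Rightarrow> 'a) \<Rightarrow> real \<Rightarrow> bool" where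
  "bi_lipschitz_curve L f \<tau> Cb \<longleftrightarrow>
     0 < Cb \<and> (\<forall>s1 s2. intrinsic_dist L \<tau> s1 s2 \<le> Cb * norm (f s1 - f s2))"

text \<open>Multiplication of a density by \<open>\<D>(f)\<^bsup>(\<alpha>-2\<beta>)p\<^esup>\<close>.\<close>

definition weighted ::
    "real \<Rightarrow> real \<Rightarrow> real \<Rightarrow> real \<Rightarrow> (real \<Rightarrow> 'a::euclidean_space)
      \<Rightarrow> (real \<times> real \<Rightarrow> real) \<Rightarrow> real \<times> real \<Rightarrow> real" where
  "weighted \<alpha> \<beta> p L \<tau> F =
     (\<lambda>(s1, s2). intrinsic_dist L \<tau> s1 s2 powr ((\<alpha> - 2 * \<beta>) * p) * F (s1, s2))"

text \<open>
  Off-diagonal pairs, and pairs that are not antipodal. For antipodal pairs the two arcs of an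
  arclength parametrized curve have equal length, and the minimum of the two perturbed arc lengths is in
  general not differentiable in the perturbation parameter.
\<close>

definition off_diagonal :: "real \<Rightarrow> (real \<times> real) set" where
  "off_diagonal L = {(s1, s2). circle_dist L s1 s2 \<noteq> 0}"

definition non_antipodal :: "real \<Rightarrow> (real \<times> real) set" where
  "non_antipodal L = {(s1, s2). circle_dist L s1 s2 \<noteq> L / 2}"

text \<open>
  The function \<open>F\<close>, given on \<open>S - diagonal\<close>, extends continuously to \<open>S\<close>, and the extension has
  \<open>C\<^sup>0\<close> norm at most \<open>B\<close> on \<open>S\<close>.
\<close>

definition extends_continuously ::
    "real \<Rightarrow> (real \<times> real) set \<Rightarrow> (real \<times> real \<Rightarrow> real) \<Rightarrow> real \<Rightarrow> bool" where
  "extends_continuously L S F B \<longleftrightarrow>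
     (\<exists>E. continuous_on S E \<and> (\<forall>x \<in> S \<inter> off_diagonal L. E x = F x) \<and> (\<forall>x \<in> S. \<bar>E x\<bar> \<le> B))"

end

theory Submission
  imports Defs "HOL-Probability.Probability_Measure"
begin

text \<open>
  A pair of points is regarded as an arc of length \<open>s\<close> starting at \<open>a\<close>. With expectations and covariances
  taken over \<open>x \<mapsto> a + s * x\<close> for uniformly distributed \<open>x\<close> in \<open>[0, 1]\<close>, the chord of \<open>f\<close> is \<open>s\<close> times the expectation of
  \<open>\<tau>\<close>, so its squared length is \<open>s\<^sup>2 * (1 - covar \<tau> \<tau>)\<close>. Hence the three densities are \<open>s powr (- \<alpha> * p)\<close> times
  expressions that vanish of order \<open>p\<close> in the covariances of \<open>\<tau>\<close>, \<open>\<phi>'\<close>, \<open>\<psi>'\<close>: by Cauchy-Schwarz they are at most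
  \<open>C * s powr (- \<alpha> * p) * T powr p\<close>, where \<open>T\<close> dominates the variances of \<open>\<tau>\<close> and of the normalized \<open>\<phi>'\<close>, \<open>\<psi>'\<close>.
  The variance over an arc is a mean square difference. By Jensen's inequality and a change of variables
  the integral of \<open>s powr (- \<alpha> * p)\<close> times its \<open>p\<close>-th power is controlled by the fractional seminorm, and under
  a Hoelder condition it is at most a multiple of \<open>s powr (2 * \<beta>)\<close>. For functions in \<open>X\<^bsup>\<beta>\<^esup>\<close> the covariances divided
  by \<open>s powr (2 * \<beta>)\<close> extend continuously to \<open>s = 0\<close>, with value \<open>0\<close> if \<open>\<beta> < 1\<close>.
\<close>

section \<open>Powers of nonnegative functions\<close>

text \<open>Two degeneracies shape the argument. The gap between chord and arc vanishes on straight
  arcs, and for 1 < p < 2 the second derivative of its p-th power contains the singular factor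
  \<open>a powr (p - 2)\<close>. It is harmless because the squares of the first derivatives of the
  gap are bounded by a multiple of the gap itself: the difference of the first derivatives of
  squared chord and squared length is a covariance with the tangent, and Cauchy-Schwarz bounds it by
  the geometric mean of two variances, one of which the gap dominates. For this reason the estimates
  keep the geometric mean as long as possible and carry a lower bound of the gap along. The other
  degeneracy is the minimum in the intrinsic distance. At antipodal pairs it has a corner; elsewhere
  the shorter arc stays the shorter one under small perturbations, and only that arc has to be
  varied. Derivatives pass under the integral because the norm has an explicit quadratic remainder,
  uniform along the arc. Bounds that hold almost everywhere are first turned into bounds at every
  point by modifying the derivatives on null sets.\<close>

definition pow0 :: "real \<Rightarrow> real \<Rightarrow> real" where
  "pow0 q x = (if q = 0 then 1 else x powr q)"

text \<open>Since \<open>0 powr 0\<close> is \<open>0\<close>, the expression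
  \<open>p * x powr (p - 1)\<close> would give the identity the derivative 0 at 0 when p = 1. The
  value \<open>pow0 0 x = 1\<close> corrects this and makes the exponent rule valid in that case as
  well.\<close>

lemma pow0_mult_self:
  assumes "0 \<le> q" "0 \<le> x" shows "pow0 q x * x = x powr (q + 1)"
  using assms powr_mult_base[of x q] by (auto simp: pow0_def mult.commute add.commute)

lemma pow0_nonneg [simp]: "0 \<le> pow0 q x"
  by (simp add: pow0_def)

lemma pow0_mono:
  assumes "0 \<le> q" "0 \<le> x" "x \<le> y" shows "pow0 q x \<le> pow0 q y"
  using assms by (simp add: pow0_def powr_mono2)

lemma pow0_mult: "pow0 q (x * y) = pow0 q x * pow0 q y"
  by (simp add: pow0_def powr_mult)

lemma tendsto_pow0:
  fixes f :: "'b \<Rightarrow> real"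
  assumes "(f \<longlongrightarrow> a) F" "0 \<le> q" "\<forall>\<^sub>F x in F. 0 \<le> f x"
  shows "((\<lambda>x. pow0 q (f x)) \<longlongrightarrow> pow0 q a) F"
proof (cases "q = 0")
  case False
  then show ?thesis
    using tendsto_powr2[OF assms(1) tendsto_const[of q] assms(3)] assms(2)
    by (simp add: pow0_def)
qed (simp add: pow0_def)

text \<open>Where \<open>A\<close> vanishes the chain rule for \<open>powr\<close> does not apply.
  For p > 1 the difference quotient is \<open>A e powr (p - 1)\<close> times that of
  \<open>A\<close>, and the first factor tends to 0; for p = 1 nonnegativity identifies the power
  with \<open>A\<close>.\<close>

lemma DERIV_powr_nonneg:
  fixes A :: "real \<Rightarrow> real"
  assumes p: "1 \<le> p" and d: "(A has_real_derivative A1) (at x)"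
    and nn: "\<forall>\<^sub>F e in nhds x. 0 \<le> A e"
  shows "((\<lambda>e. A e powr p) has_real_derivative p * pow0 (p - 1) (A x) * A1) (at x)"
proof -
  have Ax: "0 \<le> A x" using nn eventually_nhds_x_imp_x by blast
  consider "A x > 0" | "A x = 0" "p = 1" | "A x = 0" "p > 1" using Ax p by linarith
  then show ?thesis
  proof cases
    case 1
    then show ?thesis
      using DERIV_fun_powr[OF d 1, of p] by (auto simp: pow0_def)
  next
    case 2
    have "\<forall>\<^sub>F e in nhds x. A e powr p = A e"
      using nn by eventually_elim (use 2 in simp)
    then have "((\<lambda>e. A e powr p) has_real_derivative A1) (at x) = (A has_real_derivative A1) (at x)"
      by (intro DERIV_cong_ev refl)
    then show ?thesis using d 2 by (simp add: pow0_def)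
  next
    case 3
    have nn': "\<forall>\<^sub>F e in at x. 0 \<le> A e" using nn by (simp add: eventually_at_filter eventually_mono)
    have "A \<midarrow>x\<rightarrow> 0" using DERIV_isCont[OF d] 3 by (simp add: isCont_def)
    then have "((\<lambda>e. A e powr (p - 1)) \<longlongrightarrow> 0 powr (p - 1)) (at x)"
      using tendsto_powr2[OF _ tendsto_const[of "p - 1"] nn', of 0] 3 by simp
    moreover have "((\<lambda>e. (A e - A x) / (e - x)) \<longlongrightarrow> A1) (at x)"
      using d by (simp add: has_field_derivative_iff)
    ultimately have "((\<lambda>e. A e powr (p - 1) * ((A e - A x) / (e - x))) \<longlongrightarrow> 0 powr (p - 1) * A1) (at x)"
      by (rule tendsto_mult)
    then have "((\<lambda>e. A e powr (p - 1) * ((A e - A x) / (e - x))) \<longlongrightarrow> 0) (at x)" by simp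
    moreover have "\<forall>\<^sub>F e in at x. A e powr (p - 1) * ((A e - A x) / (e - x)) = (A e powr p - A x powr p) / (e - x)"
      using nn'
    proof eventually_elim
      case (elim e)
      then show ?case using powr_mult_base[OF elim, of "p - 1"] 3 by (simp add: mult.commute)
    qed
    ultimately have "((\<lambda>e. (A e powr p - A x powr p) / (e - x)) \<longlongrightarrow> 0) (at x)"
      by (rule Lim_transform_eventually)
    then show ?thesis using 3 by (simp add: has_field_derivative_iff pow0_def)
  qed
qed

definition density1 :: "real \<Rightarrow> real \<Rightarrow> real \<Rightarrow> real \<Rightarrow> real \<Rightarrow> real" where
  "density1 p a b l l1 = p * pow0 (p - 1) a * b * l + a powr p * l1"

text \<open>Mixed second derivative of \<open>A powr p * l\<close>: \<open>b\<close> and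
  \<open>c\<close> stand for the first derivatives of the gap \<open>a\<close>, \<open>d\<close> for
  its mixed derivative, the remaining arguments for \<open>l\<close> and its derivatives. At
  \<open>a = 0\<close> the convention \<open>0 powr (p - 2) = 0\<close> deletes the singular term,
  which is the correct value once \<open>c\<close> vanishes there.\<close>

definition density2 ::
    "real \<Rightarrow> real \<Rightarrow> real \<Rightarrow> real \<Rightarrow> real \<Rightarrow> real \<Rightarrow> real \<Rightarrow> real \<Rightarrow> real \<Rightarrow> real" where
  "density2 p a b c d l l1 l2 l12 =
     p * ((p - 1) * (a powr (p - 2) * b * c)) * l + p * pow0 (p - 1) a * (d * l + b * l2 + c * l1) + a powr p * l12"

lemma DERIV_density1:
  assumes p: "1 \<le> p"
    and A: "(A has_real_derivative b) (at x)" and nn: "\<forall>\<^sub>F e in nhds x. 0 \<le> A e"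
    and l: "(l has_real_derivative l1) (at x)"
  shows "((\<lambda>e. A e powr p * l e) has_real_derivative density1 p (A x) b (l x) l1) (at x)"
  by (rule derivative_eq_intros DERIV_powr_nonneg[OF p A nn] l refl)+
     (simp add: density1_def)

text \<open>At a zero of \<open>A\<close> the factor \<open>A e powr (p - 1)\<close> need not be
  differentiable when p < 2. If \<open>b2\<close> vanishes at the same point, the difference
  quotient of the product is \<open>A e powr (p - 1)\<close> times that of \<open>b2\<close>, and it
  tends to 0.\<close>

lemma DERIV_density2:
  fixes A b2 l l2 :: "real \<Rightarrow> real"
  assumes p: "1 \<le> p"
    and A: "(A has_real_derivative b) (at x)" and nn: "\<forall>\<^sub>F e in nhds x. 0 \<le> A e"
    and b2: "(b2 has_real_derivative d) (at x)" and z: "A x = 0 \<Longrightarrow> b2 x = 0"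
    and l: "(l has_real_derivative l1) (at x)" and l2: "(l2 has_real_derivative l12) (at x)"
  shows "((\<lambda>e. density1 p (A e) (b2 e) (l e) (l2 e)) has_real_derivative
           density2 p (A x) b (b2 x) d (l x) l1 (l2 x) l12) (at x)"
proof -
  have Ax: "0 \<le> A x" using nn eventually_nhds_x_imp_x by blast
  have pw: "((\<lambda>e. pow0 (p - 1) (A e) * b2 e) has_real_derivative
       (p - 1) * A x powr (p - 2) * b * b2 x + pow0 (p - 1) (A x) * d) (at x)"
  proof -
    consider "p = 1" | "A x > 0" "p > 1" | "A x = 0" "p > 1" using Ax p by linarith
    then show ?thesis
    proof cases
      case 1
      then show ?thesis using b2 by (simp add: pow0_def)
    next
      case 2
      have "((\<lambda>e. A e powr (p - 1) * b2 e) has_real_derivative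
       (p - 1) * A x powr (p - 2) * b * b2 x + A x powr (p - 1) * d) (at x)"
        by (rule derivative_eq_intros A b2 refl 2)+ (simp add: algebra_simps)
      then show ?thesis using 2 by (simp add: pow0_def)
    next
      case 3
      have nn': "\<forall>\<^sub>F e in at x. 0 \<le> A e" using nn by (simp add: eventually_at_filter eventually_mono)
      have "A \<midarrow>x\<rightarrow> 0" using DERIV_isCont[OF A] 3 by (simp add: isCont_def)
      then have "((\<lambda>e. A e powr (p - 1)) \<longlongrightarrow> 0 powr (p - 1)) (at x)"
        using tendsto_powr2[OF _ tendsto_const[of "p - 1"] nn', of 0] 3 by simp
      moreover have "((\<lambda>e. (b2 e - b2 x) / (e - x)) \<longlongrightarrow> d) (at x)"
        using b2 by (simp add: has_field_derivative_iff)
      ultimately have "((\<lambda>e. A e powr (p - 1) * ((b2 e - b2 x) / (e - x))) \<longlongrightarrow> 0 powr (p - 1) * d) (at x)"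
        by (rule tendsto_mult)
      then have "((\<lambda>e. A e powr (p - 1) * b2 e) has_real_derivative 0) (at x)"
        using z 3 by (simp add: has_field_derivative_iff)
      then show ?thesis using 3 by (simp add: pow0_def)
    qed
  qed
  have "((\<lambda>e. p * (pow0 (p - 1) (A e) * b2 e) * l e + A e powr p * l2 e) has_real_derivative
     p * ((p - 1) * A x powr (p - 2) * b * b2 x + pow0 (p - 1) (A x) * d) * l x
       + p * (pow0 (p - 1) (A x) * b2 x) * l1
       + p * pow0 (p - 1) (A x) * b * l2 x + A x powr p * l12) (at x)"
    by (rule derivative_eq_intros pw l l2 DERIV_powr_nonneg[OF p A nn] refl)+ algebra
  moreover have "(\<lambda>e. p * (pow0 (p - 1) (A e) * b2 e) * l e + A e powr p * l2 e) =
      (\<lambda>e. density1 p (A e) (b2 e) (l e) (l2 e))"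
    unfolding density1_def mult.assoc ..
  moreover have "p * ((p - 1) * A x powr (p - 2) * b * b2 x + pow0 (p - 1) (A x) * d) * l x
       + p * (pow0 (p - 1) (A x) * b2 x) * l1
       + p * pow0 (p - 1) (A x) * b * l2 x + A x powr p * l12 =
      density2 p (A x) b (b2 x) d (l x) l1 (l2 x) l12"
    unfolding density2_def by algebra
  ultimately show ?thesis by simp
qed

text \<open>Both terms have order p in \<open>T\<close>: the first trades one factor
  \<open>K * T\<close> of \<open>(K * T) powr p\<close> for \<open>b\<close>, which brings its own.
  Their coefficients p and 2 add up to p + 2.\<close>

lemma density1_bound:
  assumes p: "1 \<le> p" and K: "0 \<le> K" "0 \<le> T" "0 \<le> N"
    and a: "0 \<le> a" "a \<le> K * T" and b: "\<bar>b\<bar> \<le> N * K * T"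
    and l: "\<bar>l\<bar> \<le> 1" "\<bar>l1\<bar> \<le> N * 2"
  shows "\<bar>density1 p a b l l1\<bar> \<le> (p + 2) * K powr p * N * T powr p"
proof -
  have pp: "pow0 (p - 1) (K * T) * (K * T) = K powr p * T powr p"
    using pow0_mult_self[of "p - 1" "K * T"] p K by (simp add: powr_mult)
  have pw: "pow0 (p - 1) a \<le> pow0 (p - 1) (K * T)" using p a by (intro pow0_mono) auto
  have "\<bar>p * pow0 (p - 1) a * b * l\<bar> \<le> p * pow0 (p - 1) (K * T) * (N * K * T) * 1"
    unfolding abs_mult using p K b l pw by (intro mult_mono) auto
  also have "\<dots> = p * N * (pow0 (p - 1) (K * T) * (K * T))" by (simp add: algebra_simps)
  finally have 1: "\<bar>p * pow0 (p - 1) a * b * l\<bar> \<le> p * N * (K powr p * T powr p)" by (simp only: pp)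
  have "\<bar>a powr p * l1\<bar> \<le> (K * T) powr p * (N * 2)"
    unfolding abs_mult using p K a l by (intro mult_mono) (auto intro: powr_mono2)
  then have 2: "\<bar>a powr p * l1\<bar> \<le> 2 * N * (K powr p * T powr p)" by (simp add: powr_mult algebra_simps)
  show ?thesis unfolding density1_def using 1 2 by (simp add: algebra_simps)
qed

text \<open>For \<open>1 < p < 2\<close> the exponent \<open>p - 2\<close> is negative; the smallness of \<open>b\<close> and \<open>c\<close> compared with
  \<open>sqrt a\<close> compensates the singularity of \<open>a powr (p - 2)\<close>.\<close>

lemma powr_minus2_bound:
  fixes a b c p q r :: real
  assumes "0 \<le> a" "0 \<le> q" "b\<^sup>2 \<le> q\<^sup>2 * a" "c\<^sup>2 \<le> r\<^sup>2 * a" "0 \<le> r"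
  shows "\<bar>a powr (p - 2) * b * c\<bar> \<le> q * r * a powr (p - 1)"
proof -
  have "\<bar>b\<bar> \<le> \<bar>q * sqrt a\<bar>" "\<bar>c\<bar> \<le> \<bar>r * sqrt a\<bar>"
    unfolding abs_le_square_iff using assms by (simp_all add: power_mult_distrib)
  then have b: "\<bar>b\<bar> \<le> q * sqrt a" and c: "\<bar>c\<bar> \<le> r * sqrt a"
    using assms by (simp_all add: abs_mult)
  have "\<bar>a powr (p - 2) * b * c\<bar> \<le> a powr (p - 2) * (q * sqrt a) * (r * sqrt a)"
    unfolding abs_mult using b c assms by (intro mult_mono) auto
  also have "\<dots> = q * r * (a powr (p - 2) * a)"
    using assms(1) by (simp add: algebra_simps)
  also have "\<dots> = q * r * a powr (p - 1)"
    using powr_mult_base[OF assms(1), of "p - 2"] by (simp add: mult.commute)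
  finally show ?thesis .
qed

text \<open>The squared bounds on \<open>b\<close> and \<open>c\<close> turn the singular term into
  \<open>K\<^sup>2 * T\<close> times \<open>a powr (p - 1)\<close>, which costs one more factor K
  than the other terms; hence the exponent p + 1. In the middle term \<open>d\<close> contributes 1
  and the two mixed products 2 each, which makes 5; the last term contributes 6.\<close>

lemma density2_bound:
  assumes p: "1 \<le> p" and K: "1 \<le> K" "0 \<le> T" "0 \<le> N1" "0 \<le> N2"
    and a: "0 \<le> a" "a \<le> K * T" and b: "\<bar>b\<bar> \<le> N1 * K * T" and c: "\<bar>c\<bar> \<le> N2 * K * T"
    and b2: "b\<^sup>2 \<le> (N1 * K)\<^sup>2 * T * a" and c2: "c\<^sup>2 \<le> (N2 * K)\<^sup>2 * T * a"
    and d: "\<bar>d\<bar> \<le> N1 * N2 * K * T"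
    and l: "\<bar>l\<bar> \<le> 1" "\<bar>l1\<bar> \<le> N1 * 2" "\<bar>l2\<bar> \<le> N2 * 2" "\<bar>l12\<bar> \<le> N1 * N2 * 6"
  shows "\<bar>density2 p a b c d l l1 l2 l12\<bar> \<le> (p\<^sup>2 + 5 * p + 6) * K powr (p + 1) * N1 * N2 * T powr p"
proof -
  define S where "S = K powr p * T powr p"
  have S0: "0 \<le> S" unfolding S_def by simp
  have pp: "pow0 (p - 1) (K * T) * (K * T) = S"
    unfolding S_def using pow0_mult_self[of "p - 1" "K * T"] p K by (simp add: powr_mult)
  have pw: "pow0 (p - 1) a \<le> pow0 (p - 1) (K * T)" using p a by (intro pow0_mono) auto
  have t1: "\<bar>p * ((p - 1) * (a powr (p - 2) * b * c)) * l\<bar> \<le> p * (p - 1) * K * N1 * N2 * S"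
  proof (cases "p = 1")
    case False
    have "\<bar>a powr (p - 2) * b * c\<bar> \<le> (N1 * K * sqrt T) * (N2 * K * sqrt T) * a powr (p - 1)"
      using b2 c2 K a by (intro powr_minus2_bound) (auto simp: power_mult_distrib)
    also have "\<dots> = N1 * N2 * K\<^sup>2 * T * pow0 (p - 1) a"
      using K False by (simp add: power2_eq_square pow0_def algebra_simps)
    also have "\<dots> \<le> N1 * N2 * K\<^sup>2 * T * pow0 (p - 1) (K * T)"
      using pw K by (intro mult_left_mono) auto
    also have "\<dots> = N1 * N2 * K * (pow0 (p - 1) (K * T) * (K * T))"
      by (simp add: power2_eq_square)
    finally have "\<bar>a powr (p - 2) * b * c\<bar> \<le> N1 * N2 * K * S" by (simp only: pp)
    then have "\<bar>p * ((p - 1) * (a powr (p - 2) * b * c)) * l\<bar> \<le> p * ((p - 1) * (N1 * N2 * K * S)) * 1"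
      unfolding abs_mult[of p] abs_mult[of "p - 1"] abs_mult[of _ l] using p l by (intro mult_mono) auto
    then show ?thesis by (simp add: algebra_simps)
  qed simp
  have "\<bar>d * l + b * l2 + c * l1\<bar> \<le> \<bar>d\<bar> * \<bar>l\<bar> + \<bar>b\<bar> * \<bar>l2\<bar> + \<bar>c\<bar> * \<bar>l1\<bar>"
    unfolding abs_mult[symmetric] by linarith
  also have "\<dots> \<le> (N1 * N2 * K * T) * 1 + (N1 * K * T) * (N2 * 2) + (N2 * K * T) * (N1 * 2)"
    using b c d l K by (intro add_mono mult_mono) auto
  finally have "\<bar>d * l + b * l2 + c * l1\<bar> \<le> 5 * N1 * N2 * (K * T)" by (simp add: algebra_simps)
  then have "\<bar>p * pow0 (p - 1) a * (d * l + b * l2 + c * l1)\<bar> \<le> p * pow0 (p - 1) (K * T) * (5 * N1 * N2 * (K * T))"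
    unfolding abs_mult[of "p * _"] abs_mult[of p] using p pw by (intro mult_mono) auto
  also have "\<dots> = 5 * p * N1 * N2 * (pow0 (p - 1) (K * T) * (K * T))" by (simp add: algebra_simps)
  finally have t2: "\<bar>p * pow0 (p - 1) a * (d * l + b * l2 + c * l1)\<bar> \<le> 5 * p * N1 * N2 * S" by (simp only: pp)
  have "\<bar>a powr p * l12\<bar> \<le> (K * T) powr p * (N1 * N2 * 6)"
    unfolding abs_mult using p K a l by (intro mult_mono) (auto intro: powr_mono2)
  then have t3: "\<bar>a powr p * l12\<bar> \<le> 6 * N1 * N2 * S" by (simp add: S_def powr_mult algebra_simps)
  have KS: "N1 * N2 * S \<le> K * N1 * N2 * S"
    using mult_right_mono[OF K(1), of "N1 * N2 * S"] K S0 by simp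
  have "\<bar>density2 p a b c d l l1 l2 l12\<bar> \<le> p * (p - 1) * (K * N1 * N2 * S) + (5 * p) * (N1 * N2 * S) + 6 * (N1 * N2 * S)"
    unfolding density2_def using t1 t2 t3 by (simp add: mult.assoc)
  also have "\<dots> \<le> p * (p - 1) * (K * N1 * N2 * S) + (5 * p) * (K * N1 * N2 * S) + 6 * (K * N1 * N2 * S)"
    using KS p by (intro add_mono mult_left_mono order_refl) simp_all
  also have "\<dots> \<le> (p\<^sup>2 + 5 * p + 6) * (K * N1 * N2 * S)"
    using mult_nonneg_nonneg[of p "K * N1 * N2 * S"] p K S0 by (simp add: algebra_simps power2_eq_square)
  also have "\<dots> = (p\<^sup>2 + 5 * p + 6) * K powr (p + 1) * N1 * N2 * T powr p"
    unfolding S_def powr_add using K by simp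
  finally show ?thesis .
qed

lemma tendsto_density1:
  assumes p: "1 \<le> p"
    and "(a \<longlongrightarrow> a0) F" "(b \<longlongrightarrow> b0) F" "(l \<longlongrightarrow> l0) F" "(l1 \<longlongrightarrow> l10) F" "\<forall>\<^sub>F x in F. 0 \<le> a x"
  shows "((\<lambda>x. density1 p (a x) (b x) (l x) (l1 x)) \<longlongrightarrow> density1 p a0 b0 l0 l10) F"
  unfolding density1_def using assms
  by (intro tendsto_intros tendsto_pow0 tendsto_powr2) auto

text \<open>Only the singular term is delicate, and only where the limit of \<open>a\<close> is 0.
  There the squared bounds squeeze it below a multiple of \<open>a powr (p - 1)\<close>, so it tends
  to 0, in agreement with the convention for \<open>0 powr (p - 2)\<close>.\<close>

lemma tendsto_density2:
  fixes a :: "'b \<Rightarrow> real"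
  assumes p: "1 \<le> p"
    and a: "(a \<longlongrightarrow> a0) F" and b: "(b \<longlongrightarrow> b0) F" and c: "(c \<longlongrightarrow> c0) F" and d: "(d \<longlongrightarrow> d0) F"
    and l: "(l \<longlongrightarrow> l0) F" "(l1 \<longlongrightarrow> l10) F" "(l2 \<longlongrightarrow> l20) F" "(l12 \<longlongrightarrow> l120) F"
    and nn: "\<forall>\<^sub>F x in F. 0 \<le> a x"
    and q: "\<forall>\<^sub>F x in F. (b x)\<^sup>2 \<le> q\<^sup>2 * a x" "\<forall>\<^sub>F x in F. (c x)\<^sup>2 \<le> q\<^sup>2 * a x" "0 \<le> q"
  shows "((\<lambda>x. density2 p (a x) (b x) (c x) (d x) (l x) (l1 x) (l2 x) (l12 x)) \<longlongrightarrow>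
           density2 p a0 b0 c0 d0 l0 l10 l20 l120) F"
proof -
  have *: "((\<lambda>x. (p - 1) * (a x powr (p - 2) * b x * c x)) \<longlongrightarrow> (p - 1) * (a0 powr (p - 2) * b0 * c0)) F"
  proof (cases "p = 1 \<or> F = bot")
    case False
    then have p1: "p > 1" using p by auto
    have a0: "0 \<le> a0" using tendsto_lowerbound[OF a nn] False by simp
    show ?thesis
    proof (cases "a0 = 0")
      case False
      then show ?thesis using a0 by (intro tendsto_intros a b c) auto
    next
      case True
      have "((\<lambda>x. q * q * a x powr (p - 1)) \<longlongrightarrow> q * q * a0 powr (p - 1)) F"
        using p1 by (intro tendsto_intros tendsto_powr2 a nn) auto
      then have l0: "((\<lambda>x. q * q * a x powr (p - 1)) \<longlongrightarrow> 0) F" using True p1 by simp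
      have "\<forall>\<^sub>F x in F. norm (a x powr (p - 2) * b x * c x) \<le> q * q * a x powr (p - 1)"
        using nn q(1) q(2)
        by eventually_elim (auto intro!: powr_minus2_bound simp: q(3))
      then have "((\<lambda>x. a x powr (p - 2) * b x * c x) \<longlongrightarrow> 0) F"
        by (rule Lim_null_comparison[OF _ l0])
      from tendsto_mult_left[OF this, of "p - 1"] True show ?thesis by simp
    qed
  qed auto
  show ?thesis
    unfolding density2_def using p
    by (intro tendsto_intros tendsto_pow0 tendsto_powr2 * a b c d l nn) auto
qed

text \<open>Homogeneity of degree p in the gap and its derivatives with the end factors fixed. It
  serves to pull a common power of the arc length out of the density.\<close>

lemma density1_scale:
  assumes "1 \<le> p" "0 < k"
  shows "density1 p (k * a) (k * b) l l1 = k powr p * density1 p a b l l1"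
proof -
  have 1: "k powr p = pow0 (p - 1) k * k" using pow0_mult_self[of "p - 1" k] assms by simp
  show ?thesis unfolding density1_def pow0_mult powr_mult 1 by algebra
qed

lemma density2_scale:
  assumes "1 \<le> p" "0 < k"
  shows "density2 p (k * a) (k * b) (k * c) (k * d) l l1 l2 l12 = k powr p * density2 p a b c d l l1 l2 l12"
proof -
  have 1: "k powr p = pow0 (p - 1) k * k" using pow0_mult_self[of "p - 1" k] assms by simp
  have 2: "k powr p = k powr (p - 2) * k * k"
    using assms by (simp add: powr_diff power2_eq_square)
  have "density2 p (k * a) (k * b) (k * c) (k * d) l l1 l2 l12 =
     (k powr (p - 2) * k * k) * (p * ((p - 1) * (a powr (p - 2) * b * c)) * l)
     + (pow0 (p - 1) k * k) * (p * pow0 (p - 1) a * (d * l + b * l2 + c * l1)) + k powr p * (a powr p * l12)"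
    unfolding density2_def pow0_mult powr_mult by algebra
  then show ?thesis unfolding 1[symmetric] 2[symmetric] density2_def by (simp only: distrib_left)
qed

section \<open>Differences of negative powers\<close>

text \<open>Applied with q = \<alpha> / 2 to squared lengths, because the squared chord is a
  quadratic polynomial in the perturbation parameter and, for unit tangents, 1 minus a
  variance.\<close>

definition gap :: "real \<Rightarrow> real \<Rightarrow> real \<Rightarrow> real" where
  "gap q m n = m powr (-q) - n powr (-q)"

definition gap1 :: "real \<Rightarrow> real \<Rightarrow> real \<Rightarrow> real \<Rightarrow> real \<Rightarrow> real" where
  "gap1 q m n m1 n1 = - q * (m powr (-q - 1) * m1 - n powr (-q - 1) * n1)"

definition gap2 ::
    "real \<Rightarrow> real \<Rightarrow> real \<Rightarrow> real \<Rightarrow> real \<Rightarrow> real \<Rightarrow> real \<Rightarrow> real \<Rightarrow> real \<Rightarrow> real" where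
  "gap2 q m n m1 n1 m2 n2 m12 n12 =
     q * (q + 1) * (m powr (-q - 2) * m1 * m2 - n powr (-q - 2) * n1 * n2)
     - q * (m powr (-q - 1) * m12 - n powr (-q - 1) * n12)"

lemma DERIV_gap:
  assumes "(m has_real_derivative m1) (at x)" "(n has_real_derivative n1) (at x)" "0 < m x" "0 < n x"
  shows "((\<lambda>e. gap q (m e) (n e)) has_real_derivative gap1 q (m x) (n x) m1 n1) (at x)"
  unfolding gap_def by (rule derivative_eq_intros assms refl)+ (simp add: gap1_def algebra_simps)

lemma DERIV_gap1:
  assumes "(m has_real_derivative m1) (at x)" "(n has_real_derivative n1) (at x)" "0 < m x" "0 < n x"
    and "(m2 has_real_derivative m12) (at x)" "(n2 has_real_derivative n12) (at x)"
  shows "((\<lambda>e. gap1 q (m e) (n e) (m2 e) (n2 e)) has_real_derivative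
           gap2 q (m x) (n x) m1 n1 (m2 x) (n2 x) m12 n12) (at x)"
proof -
  have e: "-q - 1 - 1 = -q - (2::real)" by simp
  have "((\<lambda>e. - q * (m e powr (-q - 1) * m2 e - n e powr (-q - 1) * n2 e)) has_real_derivative
     - q * ((-q - 1) * m x powr (-q - 2) * m1 * m2 x + m x powr (-q - 1) * m12
       - ((-q - 1) * n x powr (-q - 2) * n1 * n2 x + n x powr (-q - 1) * n12))) (at x)"
    unfolding e[symmetric] by (rule derivative_eq_intros assms refl)+ (simp add: algebra_simps)
  moreover have "- q * ((-q - 1) * m x powr (-q - 2) * m1 * m2 x + m x powr (-q - 1) * m12
       - ((-q - 1) * n x powr (-q - 2) * n1 * n2 x + n x powr (-q - 1) * n12))
     = gap2 q (m x) (n x) m1 n1 (m2 x) (n2 x) m12 n12"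
    unfolding gap2_def by algebra
  ultimately show ?thesis unfolding gap1_def by simp
qed

text \<open>Mean value theorem between \<open>1 - R\<close> and 1, where the derivative of the power
  has modulus at least q and, because of \<open>1 / B \<le> 1 - R\<close>, at most
  \<open>q * B powr (q + 1)\<close>. The lower bound is what later allows the gap to dominate the
  variance of the tangent.\<close>

lemma powr_neg_minus_one_bounds:
  fixes q R B :: real
  assumes "0 \<le> q" "0 \<le> R" "1 / B \<le> 1 - R" "0 < B"
  shows "q * R \<le> (1 - R) powr (-q) - 1" "(1 - R) powr (-q) - 1 \<le> q * B powr (q + 1) * R"
    "0 \<le> (1 - R) powr (-q) - 1"
proof -
  have pos: "0 < 1 / B" using assms by simp
  have "q * R \<le> (1 - R) powr (-q) - 1 \<and> (1 - R) powr (-q) - 1 \<le> q * B powr (q + 1) * R"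
  proof (cases "R = 0")
    case False
    then have "1 - R < 1" using assms by simp
    moreover have "\<And>x. 1 - R \<le> x \<Longrightarrow> x \<le> 1 \<Longrightarrow> ((\<lambda>z. z powr (-q)) has_real_derivative (-q) * x powr (-q - 1)) (at x)"
      using assms pos by (intro has_real_derivative_powr) linarith
    ultimately obtain z where z: "1 - R < z" "z < 1"
      and "1 powr (-q) - (1 - R) powr (-q) = (1 - (1 - R)) * ((-q) * z powr (-q - 1))"
      using MVT2[of "1 - R" 1 "\<lambda>z. z powr (-q)" "\<lambda>x. (-q) * x powr (-q - 1)"] by blast
    moreover have "-q - 1 = -(q + 1)" by simp
    ultimately have eq: "(1 - R) powr (-q) - 1 = (q * R) * z powr (-(q + 1))"
      by (simp only:) (simp add: algebra_simps)
    have z0: "1 / B \<le> z" "0 < z" using z assms pos by linarith+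
    have "1 \<le> z powr (-(q + 1))"
      using powr_mono2'[of "-(q + 1)" z 1] z z0 assms by simp
    moreover have "z powr (-(q + 1)) \<le> (1 / B) powr (-(q + 1))"
      using powr_mono2'[of "-(q + 1)" "1 / B" z] z0 pos assms by simp
    moreover have "(1 / B) powr (-(q + 1)) = B powr (q + 1)"
      using assms by (simp only: powr_minus_divide powr_divide powr_one_eq_one) simp
    moreover have "0 \<le> q * R" using assms by simp
    ultimately have "q * R * 1 \<le> (q * R) * z powr (-(q + 1))" "(q * R) * z powr (-(q + 1)) \<le> (q * R) * B powr (q + 1)"
      by (intro mult_left_mono; simp)+
    then show ?thesis using eq by (simp add: algebra_simps)
  qed auto
  moreover have "0 \<le> q * R" using assms by simp
  ultimately show "q * R \<le> (1 - R) powr (-q) - 1" "(1 - R) powr (-q) - 1 \<le> q * B powr (q + 1) * R"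
    "0 \<le> (1 - R) powr (-q) - 1" by linarith+
qed

text \<open>The three summands in the bracket belong to the gap, its first derivatives and its mixed
  derivative. The factor \<open>1 + 1 / q\<close> pays for replacing a variance R by the gap divided
  by q, and the leading 1 makes the constant at least 1.\<close>

definition gap_const :: "real \<Rightarrow> real \<Rightarrow> real" where
  "gap_const q B = 1 + (1 + 1 / q) * (q * B powr (q + 1) + (2 * q * (q + 1) * B powr (q + 2) + 2 * q)
      + (q * (q + 1) * ((q + 2) * B powr (q + 3) * 4 + 8) + q * ((q + 1) * B powr (q + 2) * 2 + 10)))"

lemma gap_const_ge:
  assumes "0 < q"
  shows "1 \<le> gap_const q B" "q * B powr (q + 1) \<le> gap_const q B"
    "(1 + 1 / q) * (2 * q * (q + 1) * B powr (q + 2) + 2 * q) \<le> gap_const q B"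
    "q * (q + 1) * ((q + 2) * B powr (q + 3) * 4 + 8) + q * ((q + 1) * B powr (q + 2) * 2 + 10) \<le> gap_const q B"
proof -
  define x y z where "x = q * B powr (q + 1)" and "y = 2 * q * (q + 1) * B powr (q + 2) + 2 * q"
    and "z = q * (q + 1) * ((q + 2) * B powr (q + 3) * 4 + 8) + q * ((q + 1) * B powr (q + 2) * 2 + 10)"
  have nn: "0 \<le> x" "0 \<le> y" "0 \<le> z" unfolding x_def y_def z_def using assms by auto
  have K: "gap_const q B = 1 + (x + y + z) + 1 / q * x + 1 / q * y + 1 / q * z"
    unfolding gap_const_def x_def[symmetric] y_def[symmetric] z_def[symmetric] by algebra
  have "0 \<le> 1 / q * x" "0 \<le> 1 / q * y" "0 \<le> 1 / q * z" using nn assms by simp_all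
  moreover have "(1 + 1 / q) * y = y + 1 / q * y" by algebra
  ultimately show "1 \<le> gap_const q B" "q * B powr (q + 1) \<le> gap_const q B"
    "(1 + 1 / q) * (2 * q * (q + 1) * B powr (q + 2) + 2 * q) \<le> gap_const q B"
    "q * (q + 1) * ((q + 2) * B powr (q + 3) * 4 + 8) + q * ((q + 1) * B powr (q + 2) * 2 + 10) \<le> gap_const q B"
    unfolding x_def[symmetric] y_def[symmetric] z_def[symmetric] K using nn by linarith+
qed

lemma abs_mult_le:
  fixes a b x y :: real
  assumes "\<bar>a\<bar> \<le> x" "\<bar>b\<bar> \<le> y" shows "\<bar>a * b\<bar> \<le> x * y"
  unfolding abs_mult using assms by (intro mult_mono) auto

lemma gap_bounds:
  fixes q R B T :: real
  assumes q: "0 < q" and R: "0 \<le> R" "1 / B \<le> 1 - R" "0 < B" and T: "R \<le> T"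
  shows "q * R \<le> gap q (1 - R) 1" "0 \<le> gap q (1 - R) 1" "gap q (1 - R) 1 \<le> gap_const q B * T"
proof -
  note K = gap_const_ge[OF q, of B]
  show 1: "q * R \<le> gap q (1 - R) 1"
    using powr_neg_minus_one_bounds[of q R B] R q by (simp add: gap_def)
  then show "0 \<le> gap q (1 - R) 1" using q R by (meson dual_order.trans less_imp_le mult_nonneg_nonneg)
  have "gap q (1 - R) 1 \<le> q * B powr (q + 1) * R"
    using powr_neg_minus_one_bounds[of q R B] R q by (simp add: gap_def)
  also have "\<dots> \<le> gap_const q B * T" using K R T q by (intro mult_mono) auto
  finally show "gap q (1 - R) 1 \<le> gap_const q B * T" .
qed

text \<open>The hypothesis on \<open>m1 - n1\<close> keeps the geometric mean
  \<open>sqrt (R * T)\<close> that Cauchy-Schwarz provides. Bounding it by T gives the first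
  estimate; squaring it leaves a factor R, which the gap dominates, and gives the second.\<close>

lemma gap1_bounds:
  fixes q R B T :: real
  assumes q: "0 < q" and R: "0 \<le> R" "1 / B \<le> 1 - R" "0 < B" and T: "R \<le> T" and N: "0 \<le> N"
    and m1: "\<bar>m1\<bar> \<le> 2 * N" and mn: "\<bar>m1 - n1\<bar> \<le> 2 * N * sqrt (R * T)"
  shows "\<bar>gap1 q (1 - R) 1 m1 n1\<bar> \<le> N * gap_const q B * T"
    "(gap1 q (1 - R) 1 m1 n1)\<^sup>2 \<le> (N * gap_const q B)\<^sup>2 * T * gap q (1 - R) 1"
proof -
  note K = gap_const_ge[OF q, of B]
  define C where "C = 2 * q * (q + 1) * B powr (q + 2) + 2 * q"
  have C0: "0 \<le> C" unfolding C_def using q by simp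
  have RT: "R \<le> sqrt (R * T)" using R T by (intro real_le_rsqrt) (simp add: power2_eq_square mult_left_mono)
  have w0: "0 \<le> (1 - R) powr (-(q + 1)) - 1" "(1 - R) powr (-(q + 1)) - 1 \<le> (q + 1) * B powr (q + 2) * R"
    using powr_neg_minus_one_bounds[of "q + 1" R B] R q
    by (simp_all add: add.assoc)
  have "(q + 1) * B powr (q + 2) * R \<le> (q + 1) * B powr (q + 2) * sqrt (R * T)"
    using RT q by (intro mult_left_mono) auto
  then have w: "\<bar>(1 - R) powr (-(q + 1)) - 1\<bar> \<le> (q + 1) * B powr (q + 2) * sqrt (R * T)"
    using w0 by linarith
  have e: "-q - 1 = -(q + 1)" by simp
  have "gap1 q (1 - R) 1 m1 n1 = - q * (((1 - R) powr (-(q + 1)) - 1) * m1 + (m1 - n1))"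
    unfolding gap1_def e by (simp add: algebra_simps)
  also have "\<bar>\<dots>\<bar> \<le> q * ((q + 1) * B powr (q + 2) * sqrt (R * T) * (2 * N) + 2 * N * sqrt (R * T))"
    using q by (intro abs_mult_le order_trans[OF abs_triangle_ineq] add_mono w m1 mn) auto
  also have "\<dots> = N * C * sqrt (R * T)" unfolding C_def by algebra
  finally have b: "\<bar>gap1 q (1 - R) 1 m1 n1\<bar> \<le> N * C * sqrt (R * T)" .
  have CK2: "(1 + 1 / q) * C \<le> gap_const q B" using K(3) unfolding C_def .
  have "(1 + 1 / q) * C = C + C / q" by (simp add: algebra_simps)
  moreover have "0 \<le> C / q" using C0 q by simp
  ultimately have CK1: "C \<le> gap_const q B" using CK2 by linarith
  note CK = CK1 CK2
  have "sqrt (R * T) \<le> T" using R T by (intro real_le_lsqrt) (auto simp: power2_eq_square mult_right_mono)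
  then have "N * C * sqrt (R * T) \<le> N * gap_const q B * T"
    using CK C0 N R T by (intro mult_mono) auto
  then show "\<bar>gap1 q (1 - R) 1 m1 n1\<bar> \<le> N * gap_const q B * T" using b by linarith
  have "(gap1 q (1 - R) 1 m1 n1)\<^sup>2 \<le> (N * C * sqrt (R * T))\<^sup>2"
    using b by (metis abs_ge_zero power2_abs power_mono)
  also have "\<dots> = N\<^sup>2 * T * (C\<^sup>2 * R)" using R T by (simp add: power_mult_distrib)
  also have "\<dots> \<le> N\<^sup>2 * T * ((gap_const q B)\<^sup>2 * gap q (1 - R) 1)"
  proof (intro mult_left_mono)
    \<comment> \<open>The gap dominates \<open>q * R\<close>, not R; the resulting factor
      \<open>1 / q\<close> is absorbed by the square of \<open>1 + 1 / q\<close> in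
      \<open>gap_const\<close>.\<close>
    have "1 / q * 1 \<le> (1 + 1 / q) * (1 + 1 / q)" using q by (simp add: field_simps)
    then have "C\<^sup>2 * (1 / q) \<le> C\<^sup>2 * ((1 + 1 / q) * (1 + 1 / q))"
      by (intro mult_left_mono) auto
    also have "\<dots> = ((1 + 1 / q) * C)\<^sup>2" by (simp only: power2_eq_square ac_simps)
    also have "\<dots> \<le> (gap_const q B)\<^sup>2" using CK C0 q by (intro power_mono) auto
    finally have "C\<^sup>2 * (1 / q) * (q * R) \<le> (gap_const q B)\<^sup>2 * gap q (1 - R) 1"
      using gap_bounds(1)[OF q R T] q R by (intro mult_mono) auto
    then show "C\<^sup>2 * R \<le> (gap_const q B)\<^sup>2 * gap q (1 - R) 1" using q by simp
  qed (use R T in auto)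
  finally show "(gap1 q (1 - R) 1 m1 n1)\<^sup>2 \<le> (N * gap_const q B)\<^sup>2 * T * gap q (1 - R) 1"
    by (simp only: power_mult_distrib ac_simps)
qed

text \<open>Both differences are telescoped, changing first the power of \<open>1 - R\<close> and
  then one derivative at a time, so that every summand contains exactly one quantity of order T. The
  powers come with the factors 4 and 2, the changed derivatives with 8 and 10.\<close>

lemma gap2_bound:
  fixes q R B T :: real
  assumes q: "0 < q" and R: "0 \<le> R" "1 / B \<le> 1 - R" "0 < B" and T: "R \<le> T" and N: "0 \<le> N1" "0 \<le> N2"
    and m1: "\<bar>m1\<bar> \<le> 2 * N1" and n1: "\<bar>n1\<bar> \<le> 2 * N1" and m2: "\<bar>m2\<bar> \<le> 2 * N2"
    and m12: "\<bar>m12\<bar> \<le> 2 * (N1 * N2)"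
    and d1: "\<bar>m1 - n1\<bar> \<le> 2 * N1 * T" and d2: "\<bar>m2 - n2\<bar> \<le> 2 * N2 * T"
    and d12: "\<bar>m12 - n12\<bar> \<le> 10 * (N1 * N2) * T"
  shows "\<bar>gap2 q (1 - R) 1 m1 n1 m2 n2 m12 n12\<bar> \<le> N1 * N2 * gap_const q B * T"
proof -
  note K = gap_const_ge[OF q, of B]
  have T0: "0 \<le> T" using R T by simp
  have w: "\<bar>(1 - R) powr (-r) - 1\<bar> \<le> r * B powr (r + 1) * T" if "0 \<le> r" for r
  proof -
    have "r * B powr (r + 1) * R \<le> r * B powr (r + 1) * T" using T that by (intro mult_left_mono) auto
    then show ?thesis
      using powr_neg_minus_one_bounds[of r R B] R that by linarith
  qed
  have "\<bar>((1 - R) powr (-(q + 2)) - 1) * (m1 * m2) + ((m1 - n1) * m2 + n1 * (m2 - n2))\<bar>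
      \<le> (q + 2) * B powr (q + 2 + 1) * T * ((2 * N1) * (2 * N2)) + ((2 * N1 * T) * (2 * N2) + (2 * N1) * (2 * N2 * T))"
    using q by (intro abs_mult_le order_trans[OF abs_triangle_ineq] add_mono w m1 m2 n1 d1 d2) auto
  also have "\<dots> = N1 * N2 * T * ((q + 2) * B powr (q + 3) * 4 + 8)" by (simp add: algebra_simps)
  finally have 1: "\<bar>((1 - R) powr (-(q + 2)) - 1) * (m1 * m2) + ((m1 - n1) * m2 + n1 * (m2 - n2))\<bar>
     \<le> N1 * N2 * T * ((q + 2) * B powr (q + 3) * 4 + 8)" .
  have "\<bar>((1 - R) powr (-(q + 1)) - 1) * m12 + (m12 - n12)\<bar> \<le> (q + 1) * B powr (q + 1 + 1) * T * (2 * (N1 * N2)) + 10 * (N1 * N2) * T"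
    using q by (intro abs_mult_le order_trans[OF abs_triangle_ineq] add_mono w m12 d12) auto
  also have "\<dots> = N1 * N2 * T * ((q + 1) * B powr (q + 2) * 2 + 10)" by (simp add: algebra_simps)
  finally have 2: "\<bar>((1 - R) powr (-(q + 1)) - 1) * m12 + (m12 - n12)\<bar> \<le> N1 * N2 * T * ((q + 1) * B powr (q + 2) * 2 + 10)" .
  have e: "-q - 2 = -(q + 2)" "-q - 1 = -(q + 1)" by auto
  have "gap2 q (1 - R) 1 m1 n1 m2 n2 m12 n12 =
      (q * (q + 1)) * (((1 - R) powr (-(q + 2)) - 1) * (m1 * m2) + ((m1 - n1) * m2 + n1 * (m2 - n2)))
      + (-q) * (((1 - R) powr (-(q + 1)) - 1) * m12 + (m12 - n12))"
    unfolding gap2_def e by (simp add: algebra_simps)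
  also have "\<bar>\<dots>\<bar> \<le> (q * (q + 1)) * (N1 * N2 * T * ((q + 2) * B powr (q + 3) * 4 + 8))
      + q * (N1 * N2 * T * ((q + 1) * B powr (q + 2) * 2 + 10))"
    using q by (intro abs_mult_le order_trans[OF abs_triangle_ineq] add_mono 1 2) auto
  also have "\<dots> = N1 * N2 * T * (q * (q + 1) * ((q + 2) * B powr (q + 3) * 4 + 8) + q * ((q + 1) * B powr (q + 2) * 2 + 10))"
    by algebra
  also have "\<dots> \<le> N1 * N2 * T * gap_const q B" using K(4) N T0 by (intro mult_left_mono) auto
  finally show ?thesis by (simp only: ac_simps)
qed

section \<open>Covariances\<close>

text \<open>The lower bound is Cauchy-Schwarz for v and v + w, the upper one the inequality between
  arithmetic and geometric mean for their norms. The remainder is explicit and quadratic in w, hence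
  uniform for vectors bounded away from 0.\<close>

lemma norm_add_first_order:
  fixes v w :: "'a::real_inner"
  assumes "v \<noteq> 0"
  shows "0 \<le> norm (v + w) - norm v - (v \<bullet> w) / norm v"
    "norm (v + w) - norm v - (v \<bullet> w) / norm v \<le> (norm w)\<^sup>2 / (2 * norm v)"
proof -
  have v: "0 < norm v" using assms by simp
  have "v \<bullet> (v + w) \<le> norm v * norm (v + w)" by (rule norm_cauchy_schwarz)
  then have "(norm v)\<^sup>2 + v \<bullet> w \<le> norm v * norm (v + w)"
    by (simp add: inner_add_right power2_norm_eq_inner)
  then show "0 \<le> norm (v + w) - norm v - (v \<bullet> w) / norm v"
    using v by (simp add: field_simps power2_eq_square)
  have "2 * norm v * norm (v + w) \<le> (norm v)\<^sup>2 + (norm (v + w))\<^sup>2"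
    using sum_squares_bound[of "norm v" "norm (v + w)"] by simp
  also have "(norm (v + w))\<^sup>2 = (norm v)\<^sup>2 + 2 * (v \<bullet> w) + (norm w)\<^sup>2"
    by (simp add: power2_norm_eq_inner inner_add_left inner_add_right inner_commute)
  finally have "2 * norm v * norm (v + w) \<le> 2 * (norm v)\<^sup>2 + 2 * (v \<bullet> w) + (norm w)\<^sup>2" by simp
  then have "norm (v + w) \<le> (2 * (norm v)\<^sup>2 + 2 * (v \<bullet> w) + (norm w)\<^sup>2) / (2 * norm v)"
    using v by (simp add: pos_le_divide_eq mult.commute)
  also have "\<dots> = norm v + (v \<bullet> w) / norm v + (norm w)\<^sup>2 / (2 * norm v)"
    using v by (simp add: add_divide_distrib power2_eq_square)
  finally show "norm (v + w) - norm v - (v \<bullet> w) / norm v \<le> (norm w)\<^sup>2 / (2 * norm v)" by simp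
qed

text \<open>To first order the unit direction moves by the component of w orthogonal to v. The
  remainder is quadratic once \<open>w\<close> is so short that v + w stays away from 0.\<close>

lemma unit_direction_first_order:
  fixes v w z :: "'a::real_inner"
  assumes v: "norm v = 1" and w: "norm w \<le> 1 / 2"
  shows "\<bar>((v + w) \<bullet> z) / norm (v + w) - v \<bullet> z - (w \<bullet> z - (v \<bullet> w) * (v \<bullet> z))\<bar> \<le> 7 * (norm w)\<^sup>2 * norm z"
proof -
  define c r \<theta> where "c = v \<bullet> w" and "r = norm (v + w)" and "\<theta> = r - 1 - c"
  have v0: "v \<noteq> 0" using v by auto
  have \<theta>: "0 \<le> \<theta>" "\<theta> \<le> (norm w)\<^sup>2 / 2"
    using norm_add_first_order[OF v0, of w] v by (simp_all add: \<theta>_def r_def c_def)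
  have c: "\<bar>c\<bar> \<le> norm w" using Cauchy_Schwarz_ineq2[of v w] v by (simp add: c_def)
  have r: "1 / 2 \<le> r" using norm_triangle_ineq2[of v "-w"] v w by (simp add: r_def)
  \<comment> \<open>Remainder of \<open>1 / r\<close> after its linear part \<open>1 - c\<close>.
    Multiplication by r turns it into a polynomial in c and \<theta> in which each term is of second
    order.\<close>
  define \<rho> where "\<rho> = 1 / r - 1 + c"
  have "\<rho> * r = c\<^sup>2 - \<theta> + c * \<theta>"
    using r by (simp add: \<rho>_def \<theta>_def field_simps power2_eq_square)
  moreover have "\<bar>c\<^sup>2 - \<theta> + c * \<theta>\<bar> \<le> (norm w)\<^sup>2 + (norm w)\<^sup>2 / 2 + 1 / 2 * ((norm w)\<^sup>2 / 2)"
  proof -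
    have "c\<^sup>2 \<le> (norm w)\<^sup>2" using c abs_le_square_iff by fastforce
    moreover have "\<bar>c * \<theta>\<bar> \<le> 1 / 2 * ((norm w)\<^sup>2 / 2)" using c w \<theta> by (intro abs_mult_le) auto
    ultimately show ?thesis using \<theta> zero_le_power2[of c] by linarith
  qed
  ultimately have "\<bar>\<rho> * r\<bar> \<le> 7 / 4 * (norm w)\<^sup>2" by linarith
  then have "\<bar>\<rho>\<bar> * r \<le> 7 / 4 * (norm w)\<^sup>2" using r by (simp add: abs_mult)
  moreover have "\<bar>\<rho>\<bar> * (1 / 2) \<le> \<bar>\<rho>\<bar> * r" using r by (intro mult_left_mono) auto
  ultimately have \<rho>: "\<bar>\<rho>\<bar> \<le> 7 / 2 * (norm w)\<^sup>2" by simp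
  have wz: "\<bar>w \<bullet> z\<bar> \<le> norm w * norm z" "\<bar>v \<bullet> z\<bar> \<le> norm z" "norm w * norm z \<le> 1 / 2 * norm z"
    using Cauchy_Schwarz_ineq2[of w z] Cauchy_Schwarz_ineq2[of v z] v mult_right_mono[OF w, of "norm z"] by auto
  have "((v + w) \<bullet> z) / r - v \<bullet> z - (w \<bullet> z - c * (v \<bullet> z)) = - (w \<bullet> z) * c + (v \<bullet> z + w \<bullet> z) * \<rho>"
    by (simp add: \<rho>_def algebra_simps inner_add_left add_divide_distrib)
  also have "\<bar>\<dots>\<bar> \<le> (norm w * norm z) * norm w + (3 / 2 * norm z) * (7 / 2 * (norm w)\<^sup>2)"
    using wz c \<rho> by (intro order_trans[OF abs_triangle_ineq] add_mono abs_mult_le) auto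
  also have "\<dots> = 25 / 4 * ((norm w)\<^sup>2 * norm z)" by (simp add: power2_eq_square)
  also have "\<dots> \<le> 7 * (norm w)\<^sup>2 * norm z"
    using zero_le_mult_iff[of "(norm w)\<^sup>2" "norm z"] by simp
  finally show ?thesis unfolding r_def c_def .
qed

text \<open>A quadratic remainder that is uniform in the integration variable survives taking
  expectations, so this criterion replaces a theorem on differentiation under the integral
  sign.\<close>

lemma DERIV_quadratic_remainder:
  fixes g :: "real \<Rightarrow> real"
  assumes "\<forall>\<^sub>F e in nhds 0. \<bar>g e - g 0 - e * D\<bar> \<le> C * e\<^sup>2"
  shows "(g has_real_derivative D) (at 0)"
proof -
  have "\<forall>\<^sub>F e in at 0. norm ((g e - g 0) / (e - 0) - D) \<le> \<bar>C\<bar> * \<bar>e\<bar>"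
    using assms unfolding eventually_at_filter
  proof eventually_elim
    case (elim e)
    show ?case
    proof (intro impI)
      assume e: "e \<noteq> 0"
      have "(g e - g 0) / (e - 0) - D = (g e - g 0 - e * D) / e" using e by (simp add: field_simps)
      then have "norm ((g e - g 0) / (e - 0) - D) \<le> C * e\<^sup>2 / \<bar>e\<bar>"
        using elim e by (simp add: abs_divide divide_right_mono)
      also have "\<dots> = C * \<bar>e\<bar>" 
        using e by (simp add: power2_eq_square abs_if)
      also have "\<dots> \<le> \<bar>C\<bar> * \<bar>e\<bar>" by (intro mult_right_mono) auto
      finally show "norm ((g e - g 0) / (e - 0) - D) \<le> \<bar>C\<bar> * \<bar>e\<bar>" .
    qed
  qed
  moreover have "((\<lambda>e::real. \<bar>C\<bar> * \<bar>e\<bar>) \<longlongrightarrow> 0) (at 0)"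
    by (rule tendsto_eq_intros refl)+ simp
  ultimately have "((\<lambda>e. (g e - g 0) / (e - 0) - D) \<longlongrightarrow> 0) (at 0)"
    by (rule Lim_null_comparison)
  then show ?thesis unfolding has_field_derivative_iff using LIM_zero_iff by blast
qed

lemma eventually_small_mult:
  fixes W c :: real
  assumes "0 < c"
  shows "\<forall>\<^sub>F e in nhds (0::real). \<bar>e\<bar> * W \<le> c"
proof -
  have "((\<lambda>e::real. \<bar>e\<bar> * W) \<longlongrightarrow> 0) (nhds 0)"
    by (rule tendsto_eq_intros filterlim_ident refl)+ simp
  then have "\<forall>\<^sub>F e in nhds (0::real). \<bar>e\<bar> * W < c" using assms by (rule order_tendstoD)
  then show ?thesis by eventually_elim simp
qed

section \<open>Covariance inequalities and derivatives of expectations on a probability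
  space\<close>

definition covar :: "'b measure \<Rightarrow> ('b \<Rightarrow> 'a::euclidean_space) \<Rightarrow> ('b \<Rightarrow> 'a) \<Rightarrow> real" where
  "covar M u v = (\<integral>x. u x \<bullet> v x \<partial>M) - (\<integral>x. u x \<partial>M) \<bullet> (\<integral>x. v x \<partial>M)"

context prob_space
begin

lemma integrable_bounded:
  fixes u :: "'a \<Rightarrow> 'b::{banach, second_countable_topology}"
  assumes "u \<in> borel_measurable M" "\<And>x. norm (u x) \<le> B"
  shows "integrable M u"
  by (rule integrable_const_bound[of _ B]) (use assms in auto)

lemma norm_expectation_le:
  fixes u :: "'a \<Rightarrow> 'b::{banach, second_countable_topology}"
  assumes "u \<in> borel_measurable M" "\<And>x. norm (u x) \<le> B"
  shows "norm (\<integral>x. u x \<partial>M) \<le> B"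
proof -
  have "0 \<le> B" by (rule order_trans[OF norm_ge_zero assms(2)])
  have "norm (\<integral>x. u x \<partial>M) \<le> (\<integral>x. norm (u x) \<partial>M)" by (rule integral_norm_bound)
  also have "\<dots> \<le> (\<integral>x. B \<partial>M)" using assms \<open>0 \<le> B\<close> by (intro integral_mono integrable_bounded[of _ B]) auto
  finally show ?thesis by (simp add: prob_space)
qed

context
  fixes u v :: "'a \<Rightarrow> 'b::euclidean_space" and U V :: real
  assumes u: "u \<in> borel_measurable M" "\<And>x. norm (u x) \<le> U"
    and v: "v \<in> borel_measurable M" "\<And>x. norm (v x) \<le> V"
begin

lemma inner_bounded: "\<bar>u x \<bullet> v x\<bar> \<le> U * V"
  by (meson Cauchy_Schwarz_ineq2 mult_mono norm_ge_zero order_trans u(2) v(2))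

lemma integrable_inner_bounded: "integrable M (\<lambda>x. u x \<bullet> v x)"
  using u v inner_bounded by (intro integrable_bounded[of _ "U * V"]) auto

text \<open>Shifting both functions by constants does not change their covariance. The means as
  constants give the formula for the variance; values at the start of an arc express it through
  jumps along the arc.\<close>

lemma covar_centered:
  "covar M u v = (\<integral>x. (u x - c) \<bullet> (v x - d) \<partial>M) - ((\<integral>x. u x \<partial>M) - c) \<bullet> ((\<integral>x. v x \<partial>M) - d)"
proof -
  note iu = integrable_bounded[OF u] and iv = integrable_bounded[OF v]
  have "(\<integral>x. (u x - c) \<bullet> (v x - d) \<partial>M) = (\<integral>x. u x \<bullet> v x - u x \<bullet> d - c \<bullet> v x + c \<bullet> d \<partial>M)"
    by (simp add: inner_diff_left inner_diff_right algebra_simps)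
  also have "\<dots> = (\<integral>x. u x \<bullet> v x \<partial>M) - (\<integral>x. u x \<partial>M) \<bullet> d - c \<bullet> (\<integral>x. v x \<partial>M) + c \<bullet> d"
    using iu iv integrable_inner_bounded by (simp add: prob_space)
  finally show ?thesis unfolding covar_def by (simp add: inner_diff_left inner_diff_right algebra_simps)
qed

end

lemma covar_self_le:
  fixes u :: "'a \<Rightarrow> 'b::euclidean_space"
  assumes "u \<in> borel_measurable M" "\<And>x. norm (u x) \<le> U"
  shows "covar M u u \<le> (\<integral>x. (norm (u x - c))\<^sup>2 \<partial>M)"
  using covar_centered[OF assms assms, of c c] by (simp add: power2_norm_eq_inner)

lemma covar_self_eq:
  fixes u :: "'a \<Rightarrow> 'b::euclidean_space"
  assumes "u \<in> borel_measurable M" "\<And>x. norm (u x) \<le> U"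
  shows "covar M u u = (\<integral>x. (norm (u x - (\<integral>x. u x \<partial>M)))\<^sup>2 \<partial>M)"
  using covar_centered[OF assms assms, of "\<integral>x. u x \<partial>M" "\<integral>x. u x \<partial>M"] by (simp add: power2_norm_eq_inner)

lemma covar_self_nonneg:
  fixes u :: "'a \<Rightarrow> 'b::euclidean_space"
  assumes "u \<in> borel_measurable M" "\<And>x. norm (u x) \<le> U"
  shows "0 \<le> covar M u u"
  unfolding covar_self_eq[OF assms] by simp

text \<open>The variance of u + t v is a nonnegative quadratic polynomial in t, and its minimal
  value gives the inequality.\<close>

lemma covar_Cauchy_Schwarz:
  fixes u v :: "'a \<Rightarrow> 'b::euclidean_space"
  assumes u: "u \<in> borel_measurable M" "\<And>x. norm (u x) \<le> U"
    and v: "v \<in> borel_measurable M" "\<And>x. norm (v x) \<le> V"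
  shows "\<bar>covar M u v\<bar> \<le> sqrt (covar M u u * covar M v v)"
proof -
  define a b c where "a = covar M u u" and "b = covar M u v" and "c = covar M v v"
  have q: "0 \<le> a + 2 * t * b + t\<^sup>2 * c" for t
  proof -
    have "norm (u x + t *\<^sub>R v x) \<le> U + \<bar>t\<bar> * V" for x
      by (intro norm_triangle_le add_mono u) (simp add: mult_left_mono v)
    then have "0 \<le> covar M (\<lambda>x. u x + t *\<^sub>R v x) (\<lambda>x. u x + t *\<^sub>R v x)"
      using u v by (intro covar_self_nonneg) auto
    also have "covar M (\<lambda>x. u x + t *\<^sub>R v x) (\<lambda>x. u x + t *\<^sub>R v x) = a + 2 * t * b + t\<^sup>2 * c"
      using integrable_inner_bounded[OF u u] integrable_inner_bounded[OF u v] integrable_inner_bounded[OF v v]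
        integrable_inner_bounded[OF v u] integrable_bounded[OF u] integrable_bounded[OF v]
      by (simp add: covar_def a_def b_def c_def inner_add_left inner_add_right inner_commute
          algebra_simps power2_eq_square)
    finally show ?thesis .
  qed
  have c0: "0 \<le> c" unfolding c_def using covar_self_nonneg[OF v] .
  have "b\<^sup>2 \<le> a * c"
  proof (cases "c = 0")
    case True
    have "b = 0"
    proof (rule ccontr)
      assume "b \<noteq> 0"
      \<comment> \<open>With \<open>c = 0\<close> the polynomial is affine in t, and at this
        argument it takes the value -1.\<close>
      then show False using q[of "- (a + 1) / (2 * b)"] True by (simp add: field_simps)
    qed
    then show ?thesis using True by simp
  next
    case False
    have "0 \<le> (a + 2 * (- b / c) * b + (- b / c)\<^sup>2 * c) * c" by (rule mult_nonneg_nonneg[OF q c0])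
    also have "\<dots> = a * c - b\<^sup>2" using False by (simp add: field_simps power2_eq_square)
    finally show ?thesis by simp
  qed
  then show ?thesis unfolding a_def b_def c_def by (metis real_sqrt_abs real_sqrt_le_mono)
qed

text \<open>A variance is at most the mean square distance to any constant. The constant here is the
  inner product of the two means, because the difference then splits into one deviation for each
  factor. These inner products occur in the second variation of the arc length.\<close>

lemma covar_inner_self_le:
  fixes t u :: "'a \<Rightarrow> 'b::euclidean_space"
  assumes t: "t \<in> borel_measurable M" "\<And>x. norm (t x) \<le> 1"
    and u: "u \<in> borel_measurable M" "\<And>x. norm (u x) \<le> U"
  shows "covar M (\<lambda>x. t x \<bullet> u x) (\<lambda>x. t x \<bullet> u x) \<le> 2 * (U\<^sup>2 * covar M t t + covar M u u)"
proof -
  define m k where "m = (\<integral>x. t x \<partial>M)" and "k = (\<integral>x. u x \<partial>M)"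
  have mk: "norm m \<le> 1" "norm k \<le> U" unfolding m_def k_def using norm_expectation_le t u by auto
  have tu: "\<bar>t x \<bullet> u x\<bar> \<le> 1 * U" for x using inner_bounded[OF t u] .
  have bt: "norm ((norm (t x - m))\<^sup>2) \<le> 4" for x
  proof -
    have "norm (t x - m) \<le> 2" using norm_triangle_ineq4[of "t x" m] t(2)[of x] mk by linarith
    then have "(norm (t x - m))\<^sup>2 \<le> 2\<^sup>2" by (intro power_mono) auto
    then show ?thesis by simp
  qed
  have bu: "norm ((norm (u x - k))\<^sup>2) \<le> (2 * U)\<^sup>2" for x
  proof -
    have "norm (u x - k) \<le> 2 * U" using norm_triangle_ineq4[of "u x" k] u(2)[of x] mk by linarith
    then have "(norm (u x - k))\<^sup>2 \<le> (2 * U)\<^sup>2" by (intro power_mono) auto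
    then show ?thesis by simp
  qed
  have it: "integrable M (\<lambda>x. (norm (t x - m))\<^sup>2)" by (rule integrable_bounded[OF _ bt]) (use t in measurable)
  have iu: "integrable M (\<lambda>x. (norm (u x - k))\<^sup>2)" by (rule integrable_bounded[OF _ bu]) (use u in measurable)
  have pt: "(norm (t x \<bullet> u x - m \<bullet> k))\<^sup>2 \<le> 2 * U\<^sup>2 * (norm (t x - m))\<^sup>2 + 2 * (norm (u x - k))\<^sup>2" for x
  proof -
    define y z where "y = (t x - m) \<bullet> u x" and "z = m \<bullet> (u x - k)"
    have "\<bar>y\<bar> \<le> norm (t x - m) * U" unfolding y_def
      by (meson Cauchy_Schwarz_ineq2 mult_left_mono norm_ge_zero order_trans u(2))
    then have y: "y\<^sup>2 \<le> U\<^sup>2 * (norm (t x - m))\<^sup>2"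
      by (metis abs_ge_zero mult.commute power2_abs power_mono power_mult_distrib)
    have "\<bar>z\<bar> \<le> 1 * norm (u x - k)" unfolding z_def
      by (meson Cauchy_Schwarz_ineq2 mult_right_mono norm_ge_zero order_trans mk)
    then have z: "z\<^sup>2 \<le> (norm (u x - k))\<^sup>2"
      by (metis abs_ge_zero mult_1 power2_abs power_mono)
    have "t x \<bullet> u x - m \<bullet> k = y + z" by (simp add: y_def z_def inner_diff_left inner_diff_right)
    then have "(norm (t x \<bullet> u x - m \<bullet> k))\<^sup>2 = (y + z)\<^sup>2" by simp
    also have "\<dots> \<le> 2 * y\<^sup>2 + 2 * z\<^sup>2" using sum_squares_bound[of y z] by (simp add: power2_sum)
    finally show ?thesis using y z by linarith
  qed
  have "covar M (\<lambda>x. t x \<bullet> u x) (\<lambda>x. t x \<bullet> u x) \<le> (\<integral>x. (norm (t x \<bullet> u x - m \<bullet> k))\<^sup>2 \<partial>M)"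
    using t u tu by (intro covar_self_le[of _ "1 * U"]) auto
  also have "\<dots> \<le> (\<integral>x. 2 * U\<^sup>2 * (norm (t x - m))\<^sup>2 + 2 * (norm (u x - k))\<^sup>2 \<partial>M)"
    using it iu by (intro integral_mono' pt) auto
  also have "\<dots> = 2 * (U\<^sup>2 * covar M t t + covar M u u)"
    using it iu covar_self_eq[OF t] covar_self_eq[OF u] by (simp add: m_def k_def)
  finally show ?thesis .
qed

text \<open>The lower bound c on the norm of u makes the quadratic remainder uniform, so that it may
  be integrated.\<close>

lemma DERIV_expectation_norm:
  fixes u w :: "'a \<Rightarrow> 'b::euclidean_space"
  assumes u: "u \<in> borel_measurable M" "\<And>x. norm (u x) \<le> U" "\<And>x. c \<le> norm (u x)" "0 < c"
    and w: "w \<in> borel_measurable M" "\<And>x. norm (w x) \<le> W"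
  shows "((\<lambda>e. \<integral>x. norm (u x + e *\<^sub>R w x) \<partial>M) has_real_derivative (\<integral>x. (u x \<bullet> w x) / norm (u x) \<partial>M)) (at 0)"
proof (rule DERIV_quadratic_remainder[where C = "W\<^sup>2 / (2 * c)"], intro always_eventually allI)
  fix e :: real
  have u0: "u x \<noteq> 0" "0 < norm (u x)" for x using u(3)[of x] u(4) by auto
  have pt: "\<bar>norm (u x + e *\<^sub>R w x) - norm (u x) - e * ((u x \<bullet> w x) / norm (u x))\<bar> \<le> W\<^sup>2 / (2 * c) * e\<^sup>2" for x
  proof -
    have "(norm (e *\<^sub>R w x))\<^sup>2 / (2 * norm (u x)) \<le> (\<bar>e\<bar> * W)\<^sup>2 / (2 * c)"
      using w(2)[of x] u(3)[of x] u(4) by (intro frac_le power_mono) (auto intro: mult_left_mono)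
    then show ?thesis
      using norm_add_first_order[OF u0(1), of x "e *\<^sub>R w x"] by (simp add: power_mult_distrib mult.commute)
  qed
  have i1: "integrable M (\<lambda>x. norm (u x + e *\<^sub>R w x))"
  proof (rule integrable_bounded[of _ "U + \<bar>e\<bar> * W"])
    fix x show "norm (norm (u x + e *\<^sub>R w x)) \<le> U + \<bar>e\<bar> * W"
      using norm_triangle_ineq[of "u x" "e *\<^sub>R w x"] u(2)[of x] mult_left_mono[OF w(2)[of x], of "\<bar>e\<bar>"] by simp
  qed (use u w in measurable)
  have i2: "integrable M (\<lambda>x. norm (u x))" using integrable_bounded[OF u(1,2)] by simp
  have i3: "integrable M (\<lambda>x. (u x \<bullet> w x) / norm (u x))"
  proof (rule integrable_bounded[of _ W])
    fix x
    have "\<bar>u x \<bullet> w x\<bar> \<le> norm (u x) * W"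
      by (meson Cauchy_Schwarz_ineq2 mult_left_mono norm_ge_zero order_trans w(2))
    then show "norm (u x \<bullet> w x / norm (u x)) \<le> W" using u0(2)[of x] by (simp add: divide_simps mult.commute)
  qed (use u w in measurable)
  have "(\<integral>x. norm (u x + e *\<^sub>R w x) \<partial>M) - (\<integral>x. norm (u x + 0 *\<^sub>R w x) \<partial>M) - e * (\<integral>x. (u x \<bullet> w x) / norm (u x) \<partial>M)
     = (\<integral>x. norm (u x + e *\<^sub>R w x) - norm (u x) - e * ((u x \<bullet> w x) / norm (u x)) \<partial>M)"
    using i1 i2 i3 by (simp del: times_divide_eq_right)
  also have "norm \<dots> \<le> W\<^sup>2 / (2 * c) * e\<^sup>2"
    using u w pt by (intro norm_expectation_le) auto
  finally show "\<bar>(\<integral>x. norm (u x + e *\<^sub>R w x) \<partial>M) - (\<integral>x. norm (u x + 0 *\<^sub>R w x) \<partial>M)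
     - e * (\<integral>x. (u x \<bullet> w x) / norm (u x) \<partial>M)\<bar> \<le> W\<^sup>2 / (2 * c) * e\<^sup>2" by simp
qed

text \<open>Only the part of u orthogonal to the unit vector t turns the direction; this is the
  origin of the subtracted product. The remainder estimate requires a perturbation of size at most
  1/2, so it is asserted for e near 0 only.\<close>

lemma DERIV_expectation_direction:
  fixes t u v :: "'a \<Rightarrow> 'b::euclidean_space"
  assumes t: "t \<in> borel_measurable M" "\<And>x. norm (t x) = 1"
    and u: "u \<in> borel_measurable M" "\<And>x. norm (u x) \<le> U"
    and v: "v \<in> borel_measurable M" "\<And>x. norm (v x) \<le> V"
  shows "((\<lambda>e. \<integral>x. ((t x + e *\<^sub>R u x) \<bullet> v x) / norm (t x + e *\<^sub>R u x) \<partial>M) has_real_derivative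
      (\<integral>x. u x \<bullet> v x \<partial>M) - (\<integral>x. (t x \<bullet> u x) * (t x \<bullet> v x) \<partial>M)) (at 0)"
proof (rule DERIV_quadratic_remainder[where C = "7 * U\<^sup>2 * V"])
  have t': "norm (t x) \<le> 1" for x using t(2)[of x] by simp
  show "\<forall>\<^sub>F e in nhds 0. \<bar>(\<integral>x. ((t x + e *\<^sub>R u x) \<bullet> v x) / norm (t x + e *\<^sub>R u x) \<partial>M)
     - (\<integral>x. ((t x + 0 *\<^sub>R u x) \<bullet> v x) / norm (t x + 0 *\<^sub>R u x) \<partial>M)
     - e * ((\<integral>x. u x \<bullet> v x \<partial>M) - (\<integral>x. (t x \<bullet> u x) * (t x \<bullet> v x) \<partial>M))\<bar> \<le> 7 * U\<^sup>2 * V * e\<^sup>2"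
    using eventually_small_mult[of "1/2" U, OF half_gt_zero[OF zero_less_one]]
  proof eventually_elim
    case (elim e)
    have e: "norm (e *\<^sub>R u x) \<le> 1 / 2" for x
      using mult_left_mono[OF u(2)[of x], of "\<bar>e\<bar>"] elim by simp
    have pt: "\<bar>((t x + e *\<^sub>R u x) \<bullet> v x) / norm (t x + e *\<^sub>R u x) - t x \<bullet> v x
         - e * (u x \<bullet> v x - (t x \<bullet> u x) * (t x \<bullet> v x))\<bar> \<le> 7 * U\<^sup>2 * V * e\<^sup>2" for x
    proof -
      have "7 * (norm (e *\<^sub>R u x))\<^sup>2 * norm (v x) \<le> 7 * (\<bar>e\<bar> * U)\<^sup>2 * V"
        using u(2)[of x] v(2)[of x] by (intro mult_mono power_mono) (auto intro: mult_left_mono)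
      also have "\<dots> = 7 * U\<^sup>2 * V * e\<^sup>2" by (simp add: power_mult_distrib)
      finally show ?thesis
        using unit_direction_first_order[OF t(2) e, of x x "v x"] by (simp add: algebra_simps)
    qed
    have i1: "integrable M (\<lambda>x. ((t x + e *\<^sub>R u x) \<bullet> v x) / norm (t x + e *\<^sub>R u x))"
    proof (rule integrable_bounded[of _ V])
      fix x
      have "\<bar>(t x + e *\<^sub>R u x) \<bullet> v x\<bar> \<le> norm (t x + e *\<^sub>R u x) * V"
        by (meson Cauchy_Schwarz_ineq2 mult_left_mono norm_ge_zero order_trans v(2))
      moreover have "0 < norm (t x + e *\<^sub>R u x)"
        using norm_triangle_ineq2[of "t x" "- (e *\<^sub>R u x)"] t(2)[of x] e[of x]
        unfolding norm_minus_cancel diff_minus_eq_add by linarith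
      ultimately show "norm ((t x + e *\<^sub>R u x) \<bullet> v x / norm (t x + e *\<^sub>R u x)) \<le> V"
        by (simp add: divide_simps mult.commute)
    qed (use t u v in measurable)
    have i4: "integrable M (\<lambda>x. (t x \<bullet> u x) * (t x \<bullet> v x))"
    proof (rule integrable_bounded[of _ "(1 * U) * (1 * V)"])
      fix x show "norm ((t x \<bullet> u x) * (t x \<bullet> v x)) \<le> (1 * U) * (1 * V)"
        unfolding real_norm_def by (intro abs_mult_le inner_bounded[OF t(1) t' u] inner_bounded[OF t(1) t' v])
    qed (use t u v in measurable)
    note i = i1 i4 integrable_inner_bounded[OF t(1) t' v] integrable_inner_bounded[OF u v]
    have "(\<integral>x. ((t x + e *\<^sub>R u x) \<bullet> v x) / norm (t x + e *\<^sub>R u x) \<partial>M)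
     - (\<integral>x. ((t x + 0 *\<^sub>R u x) \<bullet> v x) / norm (t x + 0 *\<^sub>R u x) \<partial>M)
     - e * ((\<integral>x. u x \<bullet> v x \<partial>M) - (\<integral>x. (t x \<bullet> u x) * (t x \<bullet> v x) \<partial>M))
      = (\<integral>x. ((t x + e *\<^sub>R u x) \<bullet> v x) / norm (t x + e *\<^sub>R u x) - t x \<bullet> v x
         - e * (u x \<bullet> v x - (t x \<bullet> u x) * (t x \<bullet> v x)) \<partial>M)"
      using i t(2) by simp
    also have "norm \<dots> \<le> 7 * U\<^sup>2 * V * e\<^sup>2"
      using t u v pt by (intro norm_expectation_le) auto
    finally show ?case by simp
  qed
qed

end

section \<open>Variation of the density of a single arc\<close>

text \<open>For an arc of parameter length s, the chord is s times the norm of the expectation of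
  the tangent and the length is s times the expectation of its norm. This is the density with these
  factors s removed.\<close>

definition pair_density ::
    "'b measure \<Rightarrow> real \<Rightarrow> real \<Rightarrow> ('b \<Rightarrow> 'a::euclidean_space) \<Rightarrow> 'a \<Rightarrow> 'a \<Rightarrow> real" where
  "pair_density M \<alpha> p g v1 v2 =
     (1 / norm (\<integral>x. g x \<partial>M) powr \<alpha> - 1 / (\<integral>x. norm (g x) \<partial>M) powr \<alpha>) powr p * norm v1 * norm v2"

lemma inverse_powr_square:
  fixes x \<alpha> :: real
  assumes "0 \<le> x"
  shows "1 / x powr \<alpha> = (x\<^sup>2) powr (- (\<alpha> / 2))"
proof (cases "x = 0")
  case False
  then have "x\<^sup>2 = x powr 2" using assms by (simp add: powr_numeral)
  then show ?thesis by (simp only: powr_powr) (simp add: powr_minus_divide)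
qed simp

lemma pair_density_gap:
  "pair_density M \<alpha> p g v1 v2 =
     gap (\<alpha> / 2) ((norm (\<integral>x. g x \<partial>M))\<^sup>2) ((\<integral>x. norm (g x) \<partial>M)\<^sup>2) powr p * (norm v1 * norm v2)"
  by (simp add: pair_density_def gap_def inverse_powr_square[symmetric])

lemma gap_nonneg:
  assumes "0 \<le> q" "0 < m" "m \<le> n" shows "0 \<le> gap q m n"
  using assms powr_mono2'[of "-q" m n] by (simp add: gap_def)

lemma DERIV_norm_line:
  fixes v w :: "'a::euclidean_space"
  assumes "v \<noteq> 0"
  shows "((\<lambda>e. norm (v + e *\<^sub>R w)) has_real_derivative (v \<bullet> w) / norm v) (at 0)"
proof (rule DERIV_quadratic_remainder[where C = "(norm w)\<^sup>2 / (2 * norm v)"], intro always_eventually allI)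
  fix e :: real
  show "\<bar>norm (v + e *\<^sub>R w) - norm (v + 0 *\<^sub>R w) - e * ((v \<bullet> w) / norm v)\<bar> \<le> (norm w)\<^sup>2 / (2 * norm v) * e\<^sup>2"
    using norm_add_first_order[OF assms, of "e *\<^sub>R w"] by (simp add: power_mult_distrib mult.commute)
qed

lemma DERIV_direction_line:
  fixes v w z :: "'a::euclidean_space"
  assumes "norm v = 1"
  shows "((\<lambda>e. ((v + e *\<^sub>R w) \<bullet> z) / norm (v + e *\<^sub>R w)) has_real_derivative w \<bullet> z - (v \<bullet> w) * (v \<bullet> z)) (at 0)"
proof (rule DERIV_quadratic_remainder[where C = "7 * (norm w)\<^sup>2 * norm z"])
  show "\<forall>\<^sub>F e in nhds 0. \<bar>((v + e *\<^sub>R w) \<bullet> z) / norm (v + e *\<^sub>R w) - ((v + 0 *\<^sub>R w) \<bullet> z) / norm (v + 0 *\<^sub>R w)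
     - e * (w \<bullet> z - (v \<bullet> w) * (v \<bullet> z))\<bar> \<le> 7 * (norm w)\<^sup>2 * norm z * e\<^sup>2"
    using eventually_small_mult[of "1/2" "norm w", OF half_gt_zero[OF zero_less_one]]
  proof eventually_elim
    case (elim e)
    then show ?case
      using unit_direction_first_order[OF assms, of "e *\<^sub>R w" z] assms
      by (simp add: algebra_simps power_mult_distrib)
  qed
qed

definition arc_gap :: "'b measure \<Rightarrow> real \<Rightarrow> ('b \<Rightarrow> 'a::euclidean_space) \<Rightarrow> real" where
  "arc_gap M \<alpha> t = gap (\<alpha> / 2) ((norm (\<integral>x. t x \<partial>M))\<^sup>2) 1"

definition arc_gap1 :: "'b measure \<Rightarrow> real \<Rightarrow> ('b \<Rightarrow> 'a::euclidean_space) \<Rightarrow> ('b \<Rightarrow> 'a) \<Rightarrow> real" where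
  "arc_gap1 M \<alpha> t u = gap1 (\<alpha> / 2) ((norm (\<integral>x. t x \<partial>M))\<^sup>2) 1
     (2 * ((\<integral>x. t x \<partial>M) \<bullet> (\<integral>x. u x \<partial>M))) (2 * (\<integral>x. t x \<bullet> u x \<partial>M))"

text \<open>The last argument is the mixed derivative of the squared arc length at a unit tangent:
  twice the product of the two first derivatives of the length plus twice its mixed derivative,
  since the length itself is 1.\<close>

definition arc_gap2 ::
    "'b measure \<Rightarrow> real \<Rightarrow> ('b \<Rightarrow> 'a::euclidean_space) \<Rightarrow> ('b \<Rightarrow> 'a) \<Rightarrow> ('b \<Rightarrow> 'a) \<Rightarrow> real" where
  "arc_gap2 M \<alpha> t u v = gap2 (\<alpha> / 2) ((norm (\<integral>x. t x \<partial>M))\<^sup>2) 1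
     (2 * ((\<integral>x. t x \<partial>M) \<bullet> (\<integral>x. u x \<partial>M))) (2 * (\<integral>x. t x \<bullet> u x \<partial>M))
     (2 * ((\<integral>x. t x \<partial>M) \<bullet> (\<integral>x. v x \<partial>M))) (2 * (\<integral>x. t x \<bullet> v x \<partial>M))
     (2 * ((\<integral>x. u x \<partial>M) \<bullet> (\<integral>x. v x \<partial>M)))
     (2 * (\<integral>x. t x \<bullet> u x \<partial>M) * (\<integral>x. t x \<bullet> v x \<partial>M)
       + 2 * ((\<integral>x. u x \<bullet> v x \<partial>M) - (\<integral>x. (t x \<bullet> u x) * (t x \<bullet> v x) \<partial>M)))"

definition ends1 :: "'a::euclidean_space \<Rightarrow> 'a \<Rightarrow> 'a \<Rightarrow> 'a \<Rightarrow> real" where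
  "ends1 v1 v2 w1 w2 = v1 \<bullet> w1 + v2 \<bullet> w2"

text \<open>Mixed second derivative of the product of the two end norms at unit vectors. The
  expressions \<open>w1 \<bullet> z1 - (v1 \<bullet> w1) * (v1 \<bullet> z1)\<close> and its
  analogue are the mixed derivatives of a single norm.\<close>

definition ends2 :: "'a::euclidean_space \<Rightarrow> 'a \<Rightarrow> 'a \<Rightarrow> 'a \<Rightarrow> 'a \<Rightarrow> 'a \<Rightarrow> real" where
  "ends2 v1 v2 w1 w2 z1 z2 =
     (w1 \<bullet> z1 - (v1 \<bullet> w1) * (v1 \<bullet> z1)) + (v1 \<bullet> z1) * (v2 \<bullet> w2)
     + ((v1 \<bullet> w1) * (v2 \<bullet> z2) + (w2 \<bullet> z2 - (v2 \<bullet> w2) * (v2 \<bullet> z2)))"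

definition density_variation1 ::
    "'b measure \<Rightarrow> real \<Rightarrow> real \<Rightarrow> ('b \<Rightarrow> 'a::euclidean_space) \<Rightarrow> ('b \<Rightarrow> 'a) \<Rightarrow> 'a \<Rightarrow> 'a \<Rightarrow> 'a \<Rightarrow> 'a \<Rightarrow> real" where
  "density_variation1 M \<alpha> p t u v1 v2 w1 w2 =
     density1 p (arc_gap M \<alpha> t) (arc_gap1 M \<alpha> t u) 1 (ends1 v1 v2 w1 w2)"

definition density_variation2 ::
    "'b measure \<Rightarrow> real \<Rightarrow> real \<Rightarrow> ('b \<Rightarrow> 'a::euclidean_space) \<Rightarrow> ('b \<Rightarrow> 'a) \<Rightarrow> ('b \<Rightarrow> 'a)
      \<Rightarrow> 'a \<Rightarrow> 'a \<Rightarrow> 'a \<Rightarrow> 'a \<Rightarrow> 'a \<Rightarrow> 'a \<Rightarrow> real" where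
  "density_variation2 M \<alpha> p t u v v1 v2 w1 w2 z1 z2 =
     density2 p (arc_gap M \<alpha> t) (arc_gap1 M \<alpha> t u) (arc_gap1 M \<alpha> t v) (arc_gap2 M \<alpha> t u v)
       1 (ends1 v1 v2 w1 w2) (ends1 v1 v2 z1 z2) (ends2 v1 v2 w1 w2 z1 z2)"

context prob_space
begin

lemma chord_le_arc:
  fixes g :: "'a \<Rightarrow> 'b::euclidean_space"
  shows "(norm (\<integral>x. g x \<partial>M))\<^sup>2 \<le> (\<integral>x. norm (g x) \<partial>M)\<^sup>2"
  by (intro power_mono integral_norm_bound) simp

lemma DERIV_chord:
  fixes u w :: "'a \<Rightarrow> 'b::euclidean_space"
  assumes "integrable M u" "integrable M w"
  shows "((\<lambda>e. (norm (\<integral>x. u x + e *\<^sub>R w x \<partial>M))\<^sup>2) has_real_derivative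
      2 * ((\<integral>x. u x \<partial>M) \<bullet> (\<integral>x. w x \<partial>M))) (at 0)"
proof -
  have "(\<lambda>e. (norm (\<integral>x. u x + e *\<^sub>R w x \<partial>M))\<^sup>2) =
    (\<lambda>e. (\<integral>x. u x \<partial>M) \<bullet> (\<integral>x. u x \<partial>M) + 2 * e * ((\<integral>x. u x \<partial>M) \<bullet> (\<integral>x. w x \<partial>M)) + e\<^sup>2 * ((\<integral>x. w x \<partial>M) \<bullet> (\<integral>x. w x \<partial>M)))"
    unfolding power2_norm_eq_inner
    using assms by (simp add: fun_eq_iff inner_add_left inner_add_right inner_commute algebra_simps power2_eq_square)
  moreover have "((\<lambda>e. (\<integral>x. u x \<partial>M) \<bullet> (\<integral>x. u x \<partial>M) + 2 * e * ((\<integral>x. u x \<partial>M) \<bullet> (\<integral>x. w x \<partial>M)) + e\<^sup>2 * ((\<integral>x. w x \<partial>M) \<bullet> (\<integral>x. w x \<partial>M)))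
     has_real_derivative 2 * ((\<integral>x. u x \<partial>M) \<bullet> (\<integral>x. w x \<partial>M))) (at 0)"
    by (rule derivative_eq_intros refl)+ simp
  ultimately show ?thesis by simp
qed

text \<open>The base function is merely bounded away from 0 and not a unit field, because a mixed
  variation differentiates in the second direction at a tangent that is already perturbed in the
  first one.\<close>

lemma DERIV_pair_density:
  fixes u w :: "'a \<Rightarrow> 'b::euclidean_space" and v1 v2 w1 w2 :: 'b
  assumes p: "1 \<le> p" and \<alpha>: "0 < \<alpha>"
    and u: "u \<in> borel_measurable M" "\<And>x. norm (u x) \<le> U" "\<And>x. c \<le> norm (u x)" "0 < c"
    and w: "w \<in> borel_measurable M" "\<And>x. norm (w x) \<le> W"
    and Eu: "(\<integral>x. u x \<partial>M) \<noteq> 0" and v: "v1 \<noteq> 0" "v2 \<noteq> 0"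
  defines "m \<equiv> (norm (\<integral>x. u x \<partial>M))\<^sup>2" and "n \<equiv> (\<integral>x. norm (u x) \<partial>M)\<^sup>2"
  shows "((\<lambda>e. pair_density M \<alpha> p (\<lambda>x. u x + e *\<^sub>R w x) (v1 + e *\<^sub>R w1) (v2 + e *\<^sub>R w2)) has_real_derivative
      density1 p (gap (\<alpha> / 2) m n)
        (gap1 (\<alpha> / 2) m n (2 * ((\<integral>x. u x \<partial>M) \<bullet> (\<integral>x. w x \<partial>M)))
          (2 * (\<integral>x. norm (u x) \<partial>M) * (\<integral>x. (u x \<bullet> w x) / norm (u x) \<partial>M)))
        (norm v1 * norm v2) ((v1 \<bullet> w1) / norm v1 * norm v2 + norm v1 * ((v2 \<bullet> w2) / norm v2))) (at 0)"
proof -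
  have iu: "integrable M u" and iw: "integrable M w" using integrable_bounded u w by blast+
  define mm where "mm = (\<lambda>e. (norm (\<integral>x. u x + e *\<^sub>R w x \<partial>M))\<^sup>2)"
  define nn where "nn = (\<lambda>e. (\<integral>x. norm (u x + e *\<^sub>R w x) \<partial>M)\<^sup>2)"
  have dm: "(mm has_real_derivative 2 * ((\<integral>x. u x \<partial>M) \<bullet> (\<integral>x. w x \<partial>M))) (at 0)"
    unfolding mm_def by (rule DERIV_chord[OF iu iw])
  have dn: "(nn has_real_derivative 2 * (\<integral>x. norm (u x) \<partial>M) * (\<integral>x. (u x \<bullet> w x) / norm (u x) \<partial>M)) (at 0)"
    unfolding nn_def by (rule derivative_eq_intros DERIV_expectation_norm[OF u w] refl)+ simp
  have m0: "mm 0 = m" "nn 0 = n" by (simp_all add: mm_def m_def nn_def n_def)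
  have mpos: "0 < m" using Eu by (simp add: m_def)
  have npos: "0 < n" using chord_le_arc[of u] mpos unfolding m_def n_def by linarith
  have "mm \<midarrow>0\<rightarrow> m" using DERIV_isCont[OF dm] m0 by (simp add: isCont_def)
  then have "(mm \<longlongrightarrow> m) (nhds 0)" using m0 tendsto_at_iff_tendsto_nhds[of mm 0] by simp
  then have "\<forall>\<^sub>F e in nhds 0. 0 < mm e" using mpos by (rule order_tendstoD)
  then have pos: "\<forall>\<^sub>F e in nhds 0. 0 \<le> gap (\<alpha> / 2) (mm e) (nn e)"
    by eventually_elim (use \<alpha> in \<open>auto intro!: gap_nonneg chord_le_arc simp: mm_def nn_def\<close>)
  have dg: "((\<lambda>e. gap (\<alpha> / 2) (mm e) (nn e)) has_real_derivative gap1 (\<alpha> / 2) m n (2 * ((\<integral>x. u x \<partial>M) \<bullet> (\<integral>x. w x \<partial>M)))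
      (2 * (\<integral>x. norm (u x) \<partial>M) * (\<integral>x. (u x \<bullet> w x) / norm (u x) \<partial>M))) (at 0)"
    using DERIV_gap[OF dm dn, of "\<alpha> / 2"] m0 mpos npos by simp
  have dl: "((\<lambda>e. norm (v1 + e *\<^sub>R w1) * norm (v2 + e *\<^sub>R w2)) has_real_derivative
      (v1 \<bullet> w1) / norm v1 * norm v2 + norm v1 * ((v2 \<bullet> w2) / norm v2)) (at 0)"
    by (rule derivative_eq_intros DERIV_norm_line[OF v(1)] DERIV_norm_line[OF v(2)] refl)+ simp
  show ?thesis
    unfolding pair_density_gap using DERIV_density1[OF p dg pos dl] m0
    by (simp add: mm_def nn_def)
qed

context
  fixes t :: "'a \<Rightarrow> 'b::euclidean_space" and v1 v2 :: 'b and \<alpha> p :: real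
  assumes p: "1 \<le> p" and \<alpha>: "0 < \<alpha>"
    and t: "t \<in> borel_measurable M" "\<And>x. norm (t x) = 1" and Et: "(\<integral>x. t x \<partial>M) \<noteq> 0"
    and v: "norm v1 = 1" "norm v2 = 1"
begin

lemma pair_density_variation1:
  assumes u: "u \<in> borel_measurable M" "\<And>x. norm (u x) \<le> U"
  shows "((\<lambda>e. pair_density M \<alpha> p (\<lambda>x. t x + e *\<^sub>R u x) (v1 + e *\<^sub>R w1) (v2 + e *\<^sub>R w2)) has_real_derivative
      density_variation1 M \<alpha> p t u v1 v2 w1 w2) (at 0)"
proof -
  have t': "norm (t x) \<le> 1" "1 \<le> norm (t x)" for x using t(2)[of x] by auto
  have v0: "v1 \<noteq> 0" "v2 \<noteq> 0" using v by auto
  show ?thesis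
    using DERIV_pair_density[OF p \<alpha> t(1) t' zero_less_one u Et v0, of w1 w2]
    by (simp add: density_variation1_def arc_gap_def arc_gap1_def ends1_def t v prob_space)
qed

text \<open>\<open>K\<close> is the derivative in the second direction as a function of the first
  parameter. Its differentiability rests on the fact that the derivative of the gap vanishes where
  the gap does.\<close>

lemma pair_density_variation2:
  fixes u w :: "'a \<Rightarrow> 'b" and w1 w2 z1 z2 :: 'b
  assumes u: "u \<in> borel_measurable M" "\<And>x. norm (u x) \<le> U"
    and w: "w \<in> borel_measurable M" "\<And>x. norm (w x) \<le> W"
  defines "F \<equiv> \<lambda>e1 e2. pair_density M \<alpha> p (\<lambda>x. t x + e1 *\<^sub>R u x + e2 *\<^sub>R w x)
      (v1 + e1 *\<^sub>R w1 + e2 *\<^sub>R z1) (v2 + e1 *\<^sub>R w2 + e2 *\<^sub>R z2)"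
  shows "\<exists>K. (\<forall>\<^sub>F e1 in nhds 0. (F e1 has_real_derivative K e1) (at 0)) \<and>
      (K has_real_derivative density_variation2 M \<alpha> p t u w v1 v2 w1 w2 z1 z2) (at 0)"
proof -
  have t': "norm (t x) \<le> 1" "1 \<le> norm (t x)" for x using t(2)[of x] by auto
  have it: "integrable M t" and iu: "integrable M u" and iw: "integrable M w"
    using integrable_bounded t t' u w by blast+
  define g where "g = (\<lambda>e x. t x + e *\<^sub>R u x)"
  define mm where "mm = (\<lambda>e. (norm (\<integral>x. g e x \<partial>M))\<^sup>2)"
  define N where "N = (\<lambda>e. \<integral>x. norm (g e x) \<partial>M)"
  define nn where "nn = (\<lambda>e. (N e)\<^sup>2)"
  define N2 where "N2 = (\<lambda>e. \<integral>x. (g e x \<bullet> w x) / norm (g e x) \<partial>M)"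
  define m2 where "m2 = (\<lambda>e. 2 * ((\<integral>x. g e x \<partial>M) \<bullet> (\<integral>x. w x \<partial>M)))"
  define n2 where "n2 = (\<lambda>e. 2 * N e * N2 e)"
  define l where "l = (\<lambda>e. norm (v1 + e *\<^sub>R w1) * norm (v2 + e *\<^sub>R w2))"
  define l2 where "l2 = (\<lambda>e. ((v1 + e *\<^sub>R w1) \<bullet> z1) / norm (v1 + e *\<^sub>R w1) * norm (v2 + e *\<^sub>R w2)
      + norm (v1 + e *\<^sub>R w1) * (((v2 + e *\<^sub>R w2) \<bullet> z2) / norm (v2 + e *\<^sub>R w2)))"
  define K where "K = (\<lambda>e. density1 p (gap (\<alpha> / 2) (mm e) (nn e)) (gap1 (\<alpha> / 2) (mm e) (nn e) (m2 e) (n2 e)) (l e) (l2 e))"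
  have g0: "g 0 = t" by (simp add: g_def)
  have at0: "mm 0 = (norm (\<integral>x. t x \<partial>M))\<^sup>2" "N 0 = 1" "nn 0 = 1" "N2 0 = (\<integral>x. t x \<bullet> w x \<partial>M)"
    "m2 0 = 2 * ((\<integral>x. t x \<partial>M) \<bullet> (\<integral>x. w x \<partial>M))" "n2 0 = 2 * (\<integral>x. t x \<bullet> w x \<partial>M)"
    "l 0 = 1" "l2 0 = ends1 v1 v2 z1 z2"
    by (simp_all add: mm_def N_def nn_def N2_def m2_def n2_def l_def l2_def g0 t v prob_space ends1_def)
  have dm: "(mm has_real_derivative 2 * ((\<integral>x. t x \<partial>M) \<bullet> (\<integral>x. u x \<partial>M))) (at 0)"
    unfolding mm_def g_def by (rule DERIV_chord[OF it iu])
  have dN: "(N has_real_derivative (\<integral>x. t x \<bullet> u x \<partial>M)) (at 0)"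
    using DERIV_expectation_norm[OF t(1) t' zero_less_one u] unfolding N_def g_def by (simp add: t)
  have dn: "(nn has_real_derivative 2 * (\<integral>x. t x \<bullet> u x \<partial>M)) (at 0)"
    unfolding nn_def by (rule derivative_eq_intros dN refl)+ (simp add: at0)
  have dN2: "(N2 has_real_derivative (\<integral>x. u x \<bullet> w x \<partial>M) - (\<integral>x. (t x \<bullet> u x) * (t x \<bullet> w x) \<partial>M)) (at 0)"
    unfolding N2_def g_def by (rule DERIV_expectation_direction[OF t u w])
  have "m2 = (\<lambda>e. 2 * ((\<integral>x. t x \<partial>M) \<bullet> (\<integral>x. w x \<partial>M)) + e * (2 * ((\<integral>x. u x \<partial>M) \<bullet> (\<integral>x. w x \<partial>M))))"
    unfolding m2_def g_def using it iu by (simp add: fun_eq_iff inner_add_left algebra_simps)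
  then have dm2: "(m2 has_real_derivative 2 * ((\<integral>x. u x \<partial>M) \<bullet> (\<integral>x. w x \<partial>M))) (at 0)"
    by (auto intro!: derivative_eq_intros)
  have dn2: "(n2 has_real_derivative 2 * (\<integral>x. t x \<bullet> u x \<partial>M) * (\<integral>x. t x \<bullet> w x \<partial>M)
       + 2 * ((\<integral>x. u x \<bullet> w x \<partial>M) - (\<integral>x. (t x \<bullet> u x) * (t x \<bullet> w x) \<partial>M))) (at 0)"
    unfolding n2_def by (rule derivative_eq_intros dN dN2 refl)+ (simp add: at0)
  have v0: "v1 \<noteq> 0" "v2 \<noteq> 0" using v by auto
  have dl: "(l has_real_derivative ends1 v1 v2 w1 w2) (at 0)"
    unfolding l_def by (rule derivative_eq_intros DERIV_norm_line v0 refl)+ (simp add: v ends1_def)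
  have dl2: "(l2 has_real_derivative ends2 v1 v2 w1 w2 z1 z2) (at 0)"
    unfolding l2_def
    by (rule DERIV_cong, rule DERIV_add[OF
          DERIV_mult[OF DERIV_direction_line[OF v(1)] DERIV_norm_line[OF v0(2)]]
          DERIV_mult[OF DERIV_norm_line[OF v0(1)] DERIV_direction_line[OF v(2)]]])
       (simp add: v ends2_def algebra_simps)
  have mpos: "0 < mm 0" using Et by (simp add: at0)
  have "mm \<midarrow>0\<rightarrow> mm 0" using DERIV_isCont[OF dm] by (simp add: isCont_def)
  then have "(mm \<longlongrightarrow> mm 0) (nhds 0)" using tendsto_at_iff_tendsto_nhds[of mm 0] by simp
  then have mpos_ev: "\<forall>\<^sub>F e in nhds 0. 0 < mm e" using mpos by (rule order_tendstoD)
  then have pos: "\<forall>\<^sub>F e in nhds 0. 0 \<le> gap (\<alpha> / 2) (mm e) (nn e)"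
    by eventually_elim (use \<alpha> in \<open>auto intro!: gap_nonneg chord_le_arc simp: mm_def nn_def N_def\<close>)
  have dg: "((\<lambda>e. gap (\<alpha> / 2) (mm e) (nn e)) has_real_derivative arc_gap1 M \<alpha> t u) (at 0)"
    using DERIV_gap[OF dm dn, of "\<alpha> / 2"] mpos by (simp add: at0 arc_gap1_def)
  have dg1: "((\<lambda>e. gap1 (\<alpha> / 2) (mm e) (nn e) (m2 e) (n2 e)) has_real_derivative arc_gap2 M \<alpha> t u w) (at 0)"
    using DERIV_gap1[OF dm dn _ _ dm2 dn2, of "\<alpha> / 2"] mpos by (simp add: at0 arc_gap2_def)
  \<comment> \<open>A zero gap means that chord and length agree, so the tangent has variance 0. By
    Cauchy-Schwarz its covariance with the perturbation is 0 too, and this covariance is half the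
    difference of the derivatives of squared length and squared chord.\<close>
  have z: "gap1 (\<alpha> / 2) (mm 0) (nn 0) (m2 0) (n2 0) = 0" if "gap (\<alpha> / 2) (mm 0) (nn 0) = 0"
  proof -
    have "m2 0 = n2 0" if "mm 0 = 1"
    proof -
      have "\<bar>covar M t w\<bar> \<le> sqrt (covar M t t * covar M w w)"
        by (rule covar_Cauchy_Schwarz[OF t(1) t'(1) w])
      moreover have "covar M t t = 0"
        using that t(2) by (simp add: covar_def at0 power2_norm_eq_inner[symmetric] prob_space)
      ultimately show ?thesis by (simp add: at0 covar_def)
    qed
    moreover have "mm 0 = 1"
    proof (rule ccontr)
      assume "mm 0 \<noteq> 1"
      moreover have "(\<integral>x. norm (t x) \<partial>M) = 1" by (simp add: t prob_space)
      then have "mm 0 \<le> 1" using chord_le_arc[of t] unfolding at0(1) by simp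
      ultimately have "mm 0 < 1" by simp
      then have "1 powr (- (\<alpha> / 2)) < mm 0 powr (- (\<alpha> / 2))"
        using \<alpha> mpos by (intro powr_less_mono2_neg) auto
      then show False using that by (simp add: gap_def at0)
    qed
    ultimately show ?thesis by (simp add: gap1_def at0)
  qed
  have "(K has_real_derivative density_variation2 M \<alpha> p t u w v1 v2 w1 w2 z1 z2) (at 0)"
    using DERIV_density2[OF p dg pos dg1 z dl dl2] unfolding K_def
    by (simp add: density_variation2_def at0 arc_gap_def arc_gap1_def)
  \<comment> \<open>For small parameters the chord is nonzero by continuity, while perturbations of
    size at most 1/2 keep the tangent and both end vectors away from 0.\<close>
  moreover have "\<forall>\<^sub>F e1 in nhds 0. (F e1 has_real_derivative K e1) (at 0)"
    using mpos_ev
      eventually_small_mult[of "1/2" U, OF half_gt_zero[OF zero_less_one]]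
      eventually_small_mult[of "1/2" "norm w1", OF half_gt_zero[OF zero_less_one]]
      eventually_small_mult[of "1/2" "norm w2", OF half_gt_zero[OF zero_less_one]]
  proof eventually_elim
    case (elim e)
    have lower: "1 / 2 \<le> norm (y + e *\<^sub>R z)" if "norm y = 1" "\<bar>e\<bar> * norm z \<le> 1 / 2" for y z :: 'b
      using norm_triangle_ineq2[of y "- (e *\<^sub>R z)"] that by simp
    have eu: "\<bar>e\<bar> * norm (u x) \<le> 1 / 2" for x
      using mult_left_mono[OF u(2)[of x], of "\<bar>e\<bar>"] elim by simp
    have g1: "1 / 2 \<le> norm (g e x)" for x unfolding g_def by (rule lower[OF t(2) eu])
    have g2: "norm (g e x) \<le> 2" for x
      using norm_triangle_ineq[of "t x" "e *\<^sub>R u x"] t(2)[of x] eu[of x] by (simp add: g_def)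
    have gm: "g e \<in> borel_measurable M" unfolding g_def using t u by measurable
    have v0: "v1 + e *\<^sub>R w1 \<noteq> 0" "v2 + e *\<^sub>R w2 \<noteq> 0"
      using lower[OF v(1) elim(3)] lower[OF v(2) elim(4)] by auto
    have Eg: "(\<integral>x. g e x \<partial>M) \<noteq> 0" using elim(1) by (auto simp: mm_def)
    show ?case
      using DERIV_pair_density[OF p \<alpha> gm g2 g1 _ w Eg v0, of z1 z2]
      unfolding F_def K_def mm_def nn_def m2_def n2_def N_def N2_def l_def l2_def g_def by simp
  qed
  ultimately show ?thesis by blast
qed

end

section \<open>Gap derivatives estimated by variances\<close>

context
  fixes t :: "'a \<Rightarrow> 'b::euclidean_space" and \<alpha> B T :: real
  assumes \<alpha>: "0 < \<alpha>" and B: "0 < B"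
    and t: "t \<in> borel_measurable M" "\<And>x. norm (t x) = 1" and Et: "1 / B \<le> (norm (\<integral>x. t x \<partial>M))\<^sup>2"
    and T: "covar M t t \<le> T"
begin

lemma chord_square: "(norm (\<integral>x. t x \<partial>M))\<^sup>2 = 1 - covar M t t"
  by (simp add: covar_def t prob_space power2_norm_eq_inner[symmetric])

lemma arc_gap_estimates:
  "0 \<le> arc_gap M \<alpha> t" "arc_gap M \<alpha> t \<le> gap_const (\<alpha> / 2) B * T"
proof -
  have t': "norm (t x) \<le> 1" for x using t(2)[of x] by simp
  note R = covar_self_nonneg[OF t(1) t'] Et[unfolded chord_square] B
  show "0 \<le> arc_gap M \<alpha> t" "arc_gap M \<alpha> t \<le> gap_const (\<alpha> / 2) B * T"
    unfolding arc_gap_def chord_square using gap_bounds(2,3)[OF _ R T] \<alpha> by auto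
qed

lemma covar_t_le:
  assumes u: "u \<in> borel_measurable M" "\<And>x. norm (u x) \<le> N" "covar M u u \<le> N\<^sup>2 * T"
  shows "\<bar>covar M t u\<bar> \<le> N * sqrt (covar M t t * T)" "N * sqrt (covar M t t * T) \<le> N * T"
proof -
  have t': "norm (t x) \<le> 1" for x using t(2)[of x] by simp
  have N: "0 \<le> N" by (rule order_trans[OF norm_ge_zero u(2)])
  have R: "0 \<le> covar M t t" by (rule covar_self_nonneg[OF t(1) t'])
  have "\<bar>covar M t u\<bar> \<le> sqrt (covar M t t * covar M u u)"
    by (rule covar_Cauchy_Schwarz[OF t(1) t' u(1,2)])
  also have "\<dots> \<le> sqrt (covar M t t * (N\<^sup>2 * T))" using u(3) R by (intro real_sqrt_le_mono mult_left_mono)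
  also have "\<dots> = N * sqrt (covar M t t * T)" using N by (simp add: real_sqrt_mult)
  finally show "\<bar>covar M t u\<bar> \<le> N * sqrt (covar M t t * T)" .
  have "sqrt (covar M t t * T) \<le> T" using R T by (intro real_le_lsqrt) (auto simp: power2_eq_square mult_right_mono)
  then show "N * sqrt (covar M t t * T) \<le> N * T" using N by (rule mult_left_mono)
qed

lemma inner_expectation_le:
  fixes u w :: "'a \<Rightarrow> 'b"
  assumes "u \<in> borel_measurable M" "\<And>x. norm (u x) \<le> N1" "w \<in> borel_measurable M" "\<And>x. norm (w x) \<le> N2"
  shows "\<bar>(\<integral>x. u x \<partial>M) \<bullet> (\<integral>x. w x \<partial>M)\<bar> \<le> N1 * N2" "\<bar>\<integral>x. u x \<bullet> w x \<partial>M\<bar> \<le> N1 * N2"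
proof -
  have "0 \<le> N1" by (rule order_trans[OF norm_ge_zero assms(2)])
  then have "norm (\<integral>x. u x \<partial>M) * norm (\<integral>x. w x \<partial>M) \<le> N1 * N2"
    by (intro mult_mono norm_expectation_le assms) auto
  then show "\<bar>(\<integral>x. u x \<partial>M) \<bullet> (\<integral>x. w x \<partial>M)\<bar> \<le> N1 * N2"
    using Cauchy_Schwarz_ineq2 order_trans by blast
  show "\<bar>\<integral>x. u x \<bullet> w x \<partial>M\<bar> \<le> N1 * N2"
    using norm_expectation_le[of "\<lambda>x. u x \<bullet> w x" "N1 * N2"] inner_bounded[OF assms] assms by simp
qed

lemma arc_gap1_estimates:
  assumes u: "u \<in> borel_measurable M" "\<And>x. norm (u x) \<le> N" "covar M u u \<le> N\<^sup>2 * T"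
  shows "\<bar>arc_gap1 M \<alpha> t u\<bar> \<le> N * gap_const (\<alpha> / 2) B * T"
    "(arc_gap1 M \<alpha> t u)\<^sup>2 \<le> (N * gap_const (\<alpha> / 2) B)\<^sup>2 * T * arc_gap M \<alpha> t"
proof -
  have t': "norm (t x) \<le> 1" for x using t(2)[of x] by simp
  have N: "0 \<le> N" by (rule order_trans[OF norm_ge_zero u(2)])
  note R = covar_self_nonneg[OF t(1) t'] Et[unfolded chord_square] B
  have m1: "\<bar>2 * ((\<integral>x. t x \<partial>M) \<bullet> (\<integral>x. u x \<partial>M))\<bar> \<le> 2 * N"
    using inner_expectation_le(1)[OF t(1) t' u(1,2)] by simp
  have mn: "\<bar>2 * ((\<integral>x. t x \<partial>M) \<bullet> (\<integral>x. u x \<partial>M)) - 2 * (\<integral>x. t x \<bullet> u x \<partial>M)\<bar> \<le> 2 * N * sqrt (covar M t t * T)"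
    using covar_t_le(1)[OF u] unfolding covar_def[of M t u] by linarith
  show "\<bar>arc_gap1 M \<alpha> t u\<bar> \<le> N * gap_const (\<alpha> / 2) B * T"
    "(arc_gap1 M \<alpha> t u)\<^sup>2 \<le> (N * gap_const (\<alpha> / 2) B)\<^sup>2 * T * arc_gap M \<alpha> t"
    unfolding arc_gap_def arc_gap1_def chord_square
    using gap1_bounds[OF _ R T N m1 mn, of "\<alpha> / 2"] \<alpha> by auto
qed

lemma arc_gap2_estimate:
  assumes u: "u \<in> borel_measurable M" "\<And>x. norm (u x) \<le> N1" "covar M u u \<le> N1\<^sup>2 * T"
    and w: "w \<in> borel_measurable M" "\<And>x. norm (w x) \<le> N2" "covar M w w \<le> N2\<^sup>2 * T"
  shows "\<bar>arc_gap2 M \<alpha> t u w\<bar> \<le> N1 * N2 * gap_const (\<alpha> / 2) B * T"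
proof -
  have t': "norm (t x) \<le> 1" for x using t(2)[of x] by simp
  have N: "0 \<le> N1" "0 \<le> N2"
    by (rule order_trans[OF norm_ge_zero u(2)], rule order_trans[OF norm_ge_zero w(2)])
  note R = covar_self_nonneg[OF t(1) t'] Et[unfolded chord_square] B
  have T0: "0 \<le> T" using R(1) T by linarith
  have m: "\<bar>2 * ((\<integral>x. t x \<partial>M) \<bullet> (\<integral>x. u x \<partial>M))\<bar> \<le> 2 * N1" "\<bar>2 * (\<integral>x. t x \<bullet> u x \<partial>M)\<bar> \<le> 2 * N1"
    "\<bar>2 * ((\<integral>x. t x \<partial>M) \<bullet> (\<integral>x. w x \<partial>M))\<bar> \<le> 2 * N2" "\<bar>2 * ((\<integral>x. u x \<partial>M) \<bullet> (\<integral>x. w x \<partial>M))\<bar> \<le> 2 * (N1 * N2)"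
    using inner_expectation_le[OF t(1) t' u(1,2)] inner_expectation_le[OF t(1) t' w(1,2)]
      inner_expectation_le[OF u(1,2) w(1,2)] by simp_all
  have mn: "\<bar>2 * ((\<integral>x. t x \<partial>M) \<bullet> (\<integral>x. u x \<partial>M)) - 2 * (\<integral>x. t x \<bullet> u x \<partial>M)\<bar> \<le> 2 * N1 * T"
    "\<bar>2 * ((\<integral>x. t x \<partial>M) \<bullet> (\<integral>x. w x \<partial>M)) - 2 * (\<integral>x. t x \<bullet> w x \<partial>M)\<bar> \<le> 2 * N2 * T"
    using covar_t_le[OF u] covar_t_le[OF w] unfolding covar_def[of M t u] covar_def[of M t w] by linarith+
  \<comment> \<open>The factor \<open>(2 * N)\<^sup>2\<close> arises as twice the sum of two
    contributions \<open>N\<^sup>2 * T\<close>, one from t and one from z.\<close>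
  have self: "covar M (\<lambda>x. t x \<bullet> z x) (\<lambda>x. t x \<bullet> z x) \<le> (2 * N)\<^sup>2 * T"
    if z: "z \<in> borel_measurable M" "\<And>x. norm (z x) \<le> N" "covar M z z \<le> N\<^sup>2 * T" for z :: "'a \<Rightarrow> 'b" and N
  proof -
    have "N\<^sup>2 * covar M t t \<le> N\<^sup>2 * T" using T by (intro mult_left_mono) auto
    then show ?thesis using covar_inner_self_le[OF t(1) t' z(1,2)] z(3) by (simp add: power_mult_distrib)
  qed
  have cs: "\<bar>covar M y z\<bar> \<le> k * l * T"
    if "y \<in> borel_measurable M" "\<And>x. norm (y x) \<le> Y" "z \<in> borel_measurable M" "\<And>x. norm (z x) \<le> Z"
      "covar M y y \<le> k\<^sup>2 * T" "covar M z z \<le> l\<^sup>2 * T" "0 \<le> k" "0 \<le> l"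
    for y z :: "'a \<Rightarrow> 'c::euclidean_space" and k l Y Z
  proof -
    have "\<bar>covar M y z\<bar> \<le> sqrt (covar M y y * covar M z z)" by (rule covar_Cauchy_Schwarz[OF that(1-4)])
    also have "\<dots> \<le> sqrt ((k\<^sup>2 * T) * (l\<^sup>2 * T))"
      using that T0 by (intro real_sqrt_le_mono mult_mono covar_self_nonneg[OF that(3,4)]) auto
    also have "\<dots> = k * l * T" using that T0 by (simp add: real_sqrt_mult)
    finally show ?thesis .
  qed
  have c1: "\<bar>covar M u w\<bar> \<le> N1 * N2 * T" by (rule cs[OF u(1,2) w(1,2) u(3) w(3) N])
  have mt: "(\<lambda>x. t x \<bullet> u x) \<in> borel_measurable M" "(\<lambda>x. t x \<bullet> w x) \<in> borel_measurable M"
    using t u w by auto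
  have c2: "\<bar>covar M (\<lambda>x. t x \<bullet> u x) (\<lambda>x. t x \<bullet> w x)\<bar> \<le> (2 * N1) * (2 * N2) * T"
    using inner_bounded[OF t(1) t' u(1,2)] inner_bounded[OF t(1) t' w(1,2)] N
    by (intro cs[OF mt(1) _ mt(2) _ self[OF u] self[OF w], of "1 * N1" "1 * N2"]) auto
  \<comment> \<open>The mixed derivatives of squared chord and squared length also differ by
    covariances only, now those of u with w and of their tangential components. With the bounds for
    these the total is 2 + 8 = 10.\<close>
  have "2 * ((\<integral>x. u x \<partial>M) \<bullet> (\<integral>x. w x \<partial>M)) - (2 * (\<integral>x. t x \<bullet> u x \<partial>M) * (\<integral>x. t x \<bullet> w x \<partial>M)
       + 2 * ((\<integral>x. u x \<bullet> w x \<partial>M) - (\<integral>x. (t x \<bullet> u x) * (t x \<bullet> w x) \<partial>M)))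
     = 2 * covar M (\<lambda>x. t x \<bullet> u x) (\<lambda>x. t x \<bullet> w x) - 2 * covar M u w"
    by (simp add: covar_def)
  then have m12: "\<bar>2 * ((\<integral>x. u x \<partial>M) \<bullet> (\<integral>x. w x \<partial>M)) - (2 * (\<integral>x. t x \<bullet> u x \<partial>M) * (\<integral>x. t x \<bullet> w x \<partial>M)
       + 2 * ((\<integral>x. u x \<bullet> w x \<partial>M) - (\<integral>x. (t x \<bullet> u x) * (t x \<bullet> w x) \<partial>M)))\<bar> \<le> 10 * (N1 * N2) * T"
    using c1 c2 by linarith
  show ?thesis
    unfolding arc_gap2_def chord_square
    using gap2_bound[OF _ R T N m mn m12, of "\<alpha> / 2"] \<alpha> by simp
qed

end

end

lemma ends1_bound:
  assumes "norm v1 = 1" "norm v2 = 1" "norm w1 \<le> N" "norm w2 \<le> N"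
  shows "\<bar>ends1 v1 v2 w1 w2\<bar> \<le> N * 2"
  using Cauchy_Schwarz_ineq2[of v1 w1] Cauchy_Schwarz_ineq2[of v2 w2] assms
  by (simp add: ends1_def)

lemma ends2_bound:
  assumes "norm v1 = 1" "norm v2 = 1" "norm w1 \<le> N1" "norm w2 \<le> N1" "norm z1 \<le> N2" "norm z2 \<le> N2"
  shows "\<bar>ends2 v1 v2 w1 w2 z1 z2\<bar> \<le> N1 * N2 * 6"
proof -
  have b: "\<bar>v1 \<bullet> w1\<bar> \<le> N1" "\<bar>v2 \<bullet> w2\<bar> \<le> N1" "\<bar>v1 \<bullet> z1\<bar> \<le> N2" "\<bar>v2 \<bullet> z2\<bar> \<le> N2"
    using assms Cauchy_Schwarz_ineq2[of v1 w1] Cauchy_Schwarz_ineq2[of v2 w2]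
      Cauchy_Schwarz_ineq2[of v1 z1] Cauchy_Schwarz_ineq2[of v2 z2] by auto
  have "\<bar>w1 \<bullet> z1\<bar> \<le> N1 * N2" "\<bar>w2 \<bullet> z2\<bar> \<le> N1 * N2"
    using assms by (meson Cauchy_Schwarz_ineq2 mult_mono norm_ge_zero order_trans)+
  moreover have "\<bar>(v1 \<bullet> w1) * (v1 \<bullet> z1)\<bar> \<le> N1 * N2" "\<bar>(v1 \<bullet> z1) * (v2 \<bullet> w2)\<bar> \<le> N2 * N1"
    "\<bar>(v1 \<bullet> w1) * (v2 \<bullet> z2)\<bar> \<le> N1 * N2" "\<bar>(v2 \<bullet> w2) * (v2 \<bullet> z2)\<bar> \<le> N1 * N2"
    using b by (auto intro!: abs_mult_le)
  ultimately show ?thesis unfolding ends2_def mult.commute[of N2 N1] by linarith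
qed

section \<open>Arcs of a closed curve\<close>

definition unit_interval :: "real measure" where
  "unit_interval = restrict_space lborel {0..1}"

lemma prob_space_unit_interval: "prob_space unit_interval"
  unfolding unit_interval_def by (rule prob_spaceI) (simp add: space_restrict_space emeasure_restrict_space)

interpretation unit: prob_space unit_interval
  by (rule prob_space_unit_interval)

lemma borel_measurable_unit_interval [measurable (raw)]:
  "w \<in> borel_measurable borel \<Longrightarrow> w \<in> borel_measurable unit_interval"
  unfolding unit_interval_def by (intro measurable_restrict_space1) simp

lemma borel_measurable_arc [measurable]:
  fixes w :: "real \<Rightarrow> 'b::topological_space"
  assumes "w \<in> borel_measurable borel"
  shows "(\<lambda>x. w (a + s * x)) \<in> borel_measurable unit_interval"
  by (rule borel_measurable_unit_interval) (use assms in measurable)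

lemma integral_arc:
  fixes w :: "real \<Rightarrow> 'b::euclidean_space"
  assumes w: "w \<in> borel_measurable borel" and s: "0 < s"
  shows "(\<integral>x. w x \<partial>lebesgue_on {a..a + s}) = s *\<^sub>R (\<integral>x. w (a + s * x) \<partial>unit_interval)"
proof -
  have ind: "indicator {a..a + s} (a + s * x) = (indicator {0..1} x :: real)" for x
    using s by (auto simp: indicator_def mult_le_cancel_left1 zero_le_mult_iff)
  have "(\<integral>x. w x \<partial>lebesgue_on {a..a + s}) = (\<integral>x. indicator {a..a + s} x *\<^sub>R w x \<partial>lebesgue)"
    by (rule integral_restrict_space) simp
  also have "\<dots> = (\<integral>x. indicator {a..a + s} x *\<^sub>R w x \<partial>lborel)"
    using w by (intro integral_completion) measurable
  also have "\<dots> = s *\<^sub>R (\<integral>x. indicator {0..1} x *\<^sub>R w (a + s * x) \<partial>lborel)"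
    using lborel_integral_real_affine[of s "\<lambda>x. indicator {a..a + s} x *\<^sub>R w x" a] s by (simp add: ind)
  also have "(\<integral>x. indicator {0..1} x *\<^sub>R w (a + s * x) \<partial>lborel) = (\<integral>x. w (a + s * x) \<partial>unit_interval)"
    unfolding unit_interval_def by (rule integral_restrict_space[symmetric]) simp
  finally show ?thesis .
qed

lemma periodic_add_int:
  fixes g :: "real \<Rightarrow> 'b"
  assumes "periodic_fun_simple g L"
  shows "g (x + of_int n * L) = g x" "g (x + L * of_int n) = g x"
proof -
  interpret periodic_fun_simple g L by fact
  show "g (x + of_int n * L) = g x" "g (x + L * of_int n) = g x"
    using plus_of_int[of x n] by (simp_all add: mult.commute)
qed

lemma periodic_add:
  fixes g :: "real \<Rightarrow> 'b"
  assumes "periodic_fun_simple g L"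
  shows "g (x + L) = g x"
  using assms by (simp add: periodic_fun_simple_def)

lemma rmod_decomp: "0 < L \<Longrightarrow> x = x rmod L + L * of_int \<lfloor>x / L\<rfloor>"
  by (simp add: rmod_def)

text \<open>Start of the shorter arc, traversed in the positive direction; the order of the two
  points is forgotten. For antipodal points the tie is decided in favour of the arc starting at
  \<open>s2\<close>.\<close>

definition arc_start :: "real \<Rightarrow> real \<Rightarrow> real \<Rightarrow> real" where
  "arc_start L s1 s2 = (if (s1 - s2) rmod L \<le> L / 2 then s2 else s2 + (s1 - s2) rmod L)"

lemma circle_dist_bounds:
  assumes "0 < L" shows "0 \<le> circle_dist L s1 s2" "circle_dist L s1 s2 \<le> L / 2"
  using rmod_nonneg[of L "s1 - s2"] rmod_less[OF assms, of "s1 - s2"] assms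
  by (auto simp: circle_dist_def min_def)

text \<open>Up to whole periods the shorter arc runs either from s2 to s1 or from s1 to s2. The
  quantities in the density are symmetric in the two points, so both cases lead to the same
  formulas.\<close>

lemma arc_cases:
  assumes "0 < L"
  obtains n where "arc_start L s1 s2 = s2" "arc_start L s1 s2 + circle_dist L s1 s2 = s1 + of_int n * L"
      "circle_dist L s1 s2 = (s1 - s2) rmod L"
    | n where "arc_start L s1 s2 = s1 + of_int n * L" "arc_start L s1 s2 + circle_dist L s1 s2 = s2 + L"
      "circle_dist L s1 s2 = L - (s1 - s2) rmod L" "arc_start L s1 s2 = s2 + (s1 - s2) rmod L"
proof -
  define r where "r = (s1 - s2) rmod L"
  obtain n :: int where n: "s1 - s2 = r + L * of_int n" using rmod_decomp[OF assms, of "s1 - s2"] r_def by blast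
  show thesis
  proof (cases "r \<le> L / 2")
    case True
    then have "arc_start L s1 s2 = s2" "circle_dist L s1 s2 = r"
      by (auto simp: arc_start_def circle_dist_def r_def)
    moreover have "s2 + r = s1 + of_int (- n) * L" using n by (simp add: algebra_simps)
    ultimately show thesis using that(1)[of "- n"] r_def by simp
  next
    case False
    then have "arc_start L s1 s2 = s2 + r" "circle_dist L s1 s2 = L - r"
      by (auto simp: arc_start_def circle_dist_def r_def)
    moreover have "s2 + r = s1 + of_int (- n) * L" using n by (simp add: algebra_simps)
    ultimately show thesis using that(2)[of "- n"] r_def by simp
  qed
qed

lemma norm_diff_arc:
  fixes g :: "real \<Rightarrow> 'b::real_normed_vector"
  assumes L: "0 < L" and g: "periodic_fun_simple g L"
  shows "norm (g s1 - g s2) = norm (g (arc_start L s1 s2 + circle_dist L s1 s2) - g (arc_start L s1 s2))"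
  using arc_cases[OF L, of s1 s2]
proof cases
  case (1 n)
  then show ?thesis using periodic_add_int[OF g] by simp
next
  case (2 n)
  then show ?thesis unfolding 2(2) unfolding 2(1) periodic_add_int[OF g] periodic_add[OF g]
    using norm_minus_commute[of "g s1" "g s2"] by simp
qed

lemma norm_mult_arc:
  fixes g :: "real \<Rightarrow> 'b::real_normed_vector"
  assumes L: "0 < L" and g: "periodic_fun_simple g L"
  shows "norm (g s1) * norm (g s2) = norm (g (arc_start L s1 s2)) * norm (g (arc_start L s1 s2 + circle_dist L s1 s2))"
  using arc_cases[OF L, of s1 s2]
proof cases
  case (1 n)
  then show ?thesis using periodic_add_int[OF g] by simp
next
  case (2 n)
  then show ?thesis unfolding 2(2) unfolding 2(1) periodic_add_int[OF g] periodic_add[OF g] by simp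
qed

lemma arc_in_periodic_set:
  assumes L: "0 < L" and S: "periodic_fun_simple (\<lambda>x. x \<in> S) L" and s: "s1 \<in> S" "s2 \<in> S"
  shows "arc_start L s1 s2 \<in> S" "arc_start L s1 s2 + circle_dist L s1 s2 \<in> S"
  using arc_cases[OF L, of s1 s2] periodic_add_int[OF S] periodic_add[OF S] s
  by (metis (no_types, lifting))+

lemma integral_cong_AE_lebesgue_on:
  fixes g h :: "real \<Rightarrow> 'b::euclidean_space"
  assumes "AE x in lebesgue. g x = h x" "h \<in> borel_measurable borel" "S \<in> sets lebesgue"
  shows "(\<integral>x. g x \<partial>lebesgue_on S) = (\<integral>x. h x \<partial>lebesgue_on S)"
proof (rule integral_cong_AE)
  have hm: "h \<in> borel_measurable lebesgue" using assms(2) by (simp add: measurable_completion)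
  have "AE x in lebesgue. h x = g x" using assms(1) by eventually_elim simp
  then have "g \<in> borel_measurable lebesgue" by (rule borel_measurable_AE[OF hm])
  then show "g \<in> borel_measurable (lebesgue_on S)" by (rule measurable_restrict_space1)
  show "h \<in> borel_measurable (lebesgue_on S)" using hm by (rule measurable_restrict_space1)
  show "AE x in lebesgue_on S. g x = h x"
    using assms by (subst AE_restrict_space_iff) (auto elim: AE_mp)
qed

lemma intrinsic_dist_arc:
  fixes g' :: "real \<Rightarrow> 'b::euclidean_space" and h :: "real \<Rightarrow> 'b"
  assumes L: "0 < L" and g: "AE x in lebesgue. g' x = h x" and h: "h \<in> borel_measurable borel"
    and per: "periodic_fun_simple h L" and s0: "circle_dist L s1 s2 \<noteq> 0"
  defines "a \<equiv> arc_start L s1 s2" and "s \<equiv> circle_dist L s1 s2"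
  shows "intrinsic_dist L g' s1 s2 = min (s * (\<integral>x. norm (h (a + s * x)) \<partial>unit_interval))
     ((L - s) * (\<integral>x. norm (h (a + s + (L - s) * x)) \<partial>unit_interval))"
proof -
  have s: "0 < s" "s < L" using circle_dist_bounds[OF L, of s1 s2] s0 L by (auto simp: s_def)
  have hm: "(\<lambda>x. norm (h x)) \<in> borel_measurable borel" using h by measurable
  have AEn: "AE x in lebesgue. norm (g' x) = norm (h x)" using g by eventually_elim simp
  define I where "I x y = (\<integral>z. norm (h z) \<partial>lebesgue_on {x..y})" for x y
  have I: "I x (x + r) = r * (\<integral>z. norm (h (x + r * z)) \<partial>unit_interval)" if "0 < r" for x r
    unfolding I_def using integral_arc[OF hm that, of x] by simp
  have D: "intrinsic_dist L g' s1 s2 = (let r = (s1 - s2) rmod L in min (I s2 (s2 + r)) (I (s2 + r) (s2 + L)))"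
    unfolding intrinsic_dist_def I_def using integral_cong_AE_lebesgue_on[OF AEn hm] by (simp add: Let_def)
  have "intrinsic_dist L g' s1 s2 = min (I a (a + s)) (I (a + s) (a + s + (L - s)))"
    using arc_cases[OF L, of s1 s2]
  proof cases
    case (1 n)
    then have "(s1 - s2) rmod L = s" "a = s2" by (auto simp: s_def a_def)
    then show ?thesis unfolding D Let_def by simp
  next
    case (2 n)
    then have r: "(s1 - s2) rmod L = L - s" and a: "a = s2 + (L - s)" "a + s = s2 + L" by (auto simp: s_def a_def)
    \<comment> \<open>Here the first arc in the definition of the intrinsic distance is the longer
      one. It begins at \<open>s2\<close>, and periodicity moves it by L so that it begins at the
      end of the shorter arc.\<close>
    have "I s2 (s2 + (L - s)) = (L - s) * (\<integral>z. norm (h (s2 + (L - s) * z)) \<partial>unit_interval)"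
      using s by (intro I) simp
    also have "\<dots> = (L - s) * (\<integral>z. norm (h (s2 + L + (L - s) * z)) \<partial>unit_interval)"
      using periodic_add[OF per] by (metis (no_types, opaque_lifting) add.commute add.left_commute)
    also have "\<dots> = I (s2 + L) (s2 + L + (L - s))" using s by (intro I[symmetric]) simp
    finally have "I s2 (s2 + (L - s)) = I (a + s) (a + s + (L - s))" unfolding a(2) .
    then show ?thesis unfolding D Let_def r using a by (metis min.commute)
  qed
  also have "\<dots> = min (s * (\<integral>x. norm (h (a + s * x)) \<partial>unit_interval))
     ((L - s) * (\<integral>x. norm (h (a + s + (L - s) * x)) \<partial>unit_interval))"
    using I[of s a] I[of "L - s" "a + s"] s by simp
  finally show ?thesis .
qed

lemma energy_density_arc:
  fixes g g' h :: "real \<Rightarrow> 'b::euclidean_space"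
  assumes L: "0 < L" and g: "AE x in lebesgue. g' x = h x" and h: "h \<in> borel_measurable borel"
    and per: "periodic_fun_simple h L" "periodic_fun_simple g L" and s0: "circle_dist L s1 s2 \<noteq> 0"
  defines "a \<equiv> arc_start L s1 s2" and "s \<equiv> circle_dist L s1 s2"
  assumes ftc: "g (a + s) - g a = (\<integral>x. h x \<partial>lebesgue_on {a..a + s})"
    and short: "s * (\<integral>x. norm (h (a + s * x)) \<partial>unit_interval) \<le> (L - s) * (\<integral>x. norm (h (a + s + (L - s) * x)) \<partial>unit_interval)"
  shows "energy_density \<alpha> p L g g' (s1, s2) = s powr (- \<alpha> * p) *
    (1 / norm (\<integral>x. h (a + s * x) \<partial>unit_interval) powr \<alpha> - 1 / (\<integral>x. norm (h (a + s * x)) \<partial>unit_interval) powr \<alpha>) powr p"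
proof -
  have s: "0 < s" using circle_dist_bounds[OF L, of s1 s2] s0 by (auto simp: s_def)
  have "norm (g s1 - g s2) = norm (g (a + s) - g a)"
    unfolding a_def s_def by (rule norm_diff_arc[OF L per(2)])
  also have "\<dots> = s * norm (\<integral>x. h (a + s * x) \<partial>unit_interval)"
    unfolding ftc integral_arc[OF h s] using s by simp
  finally have n: "norm (g s1 - g s2) = s * norm (\<integral>x. h (a + s * x) \<partial>unit_interval)" .
  have d: "intrinsic_dist L g' s1 s2 = s * (\<integral>x. norm (h (a + s * x)) \<partial>unit_interval)"
    using intrinsic_dist_arc[OF L g h per(1) s0] short unfolding a_def s_def by simp
  have sp: "1 / (s * x) powr \<alpha> = s powr (-\<alpha>) * (1 / x powr \<alpha>)" for x
    using s by (simp add: powr_mult powr_minus_divide)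
  show ?thesis
    unfolding energy_density_def prod.case n d sp right_diff_distrib[symmetric] powr_mult[of "s powr (- \<alpha>)"] powr_powr ..
qed

definition arc_energy :: "real \<Rightarrow> real \<Rightarrow> (real \<Rightarrow> 'a::euclidean_space) \<Rightarrow> real \<Rightarrow> real \<Rightarrow> real" where
  "arc_energy \<alpha> p t a s = s powr (- \<alpha> * p) * arc_gap unit_interval \<alpha> (\<lambda>x. t (a + s * x)) powr p"

definition arc_variation1 ::
    "real \<Rightarrow> real \<Rightarrow> (real \<Rightarrow> 'a::euclidean_space) \<Rightarrow> (real \<Rightarrow> 'a) \<Rightarrow> real \<Rightarrow> real \<Rightarrow> real" where
  "arc_variation1 \<alpha> p t u a s = s powr (- \<alpha> * p) *
     density_variation1 unit_interval \<alpha> p (\<lambda>x. t (a + s * x)) (\<lambda>x. u (a + s * x)) (t a) (t (a + s)) (u a) (u (a + s))"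

definition arc_variation2 ::
    "real \<Rightarrow> real \<Rightarrow> (real \<Rightarrow> 'a::euclidean_space) \<Rightarrow> (real \<Rightarrow> 'a) \<Rightarrow> (real \<Rightarrow> 'a) \<Rightarrow> real \<Rightarrow> real \<Rightarrow> real" where
  "arc_variation2 \<alpha> p t u v a s = s powr (- \<alpha> * p) *
     density_variation2 unit_interval \<alpha> p (\<lambda>x. t (a + s * x)) (\<lambda>x. u (a + s * x)) (\<lambda>x. v (a + s * x))
       (t a) (t (a + s)) (u a) (u (a + s)) (v a) (v (a + s))"

text \<open>\<open>t\<close>, \<open>u\<close>, \<open>v\<close> are bounded Borel representatives of the derivatives \<open>\<tau>\<close>, \<open>\<phi>'\<close>, \<open>\<psi>'\<close>; the set \<open>S\<close> of full
  measure consists of the parameters where the pointwise values are the good ones.\<close>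

locale curve_variation =
  fixes L \<alpha> p N1 N2 Cb :: real and f \<phi> \<psi> \<tau> \<phi>' \<psi>' t u v :: "real \<Rightarrow> 'a::euclidean_space" and S :: "real set"
  assumes L: "0 < L" and \<alpha>: "0 < \<alpha>" and p: "1 \<le> p"
    and periodic: "periodic_fun_simple f L" "periodic_fun_simple \<phi> L" "periodic_fun_simple \<psi> L"
      "periodic_fun_simple \<tau> L" "periodic_fun_simple \<phi>' L" "periodic_fun_simple \<psi>' L"
      "periodic_fun_simple t L" "periodic_fun_simple u L" "periodic_fun_simple v L"
      "periodic_fun_simple (\<lambda>x. x \<in> S) L"
    and borel: "t \<in> borel_measurable borel" "u \<in> borel_measurable borel" "v \<in> borel_measurable borel"
    and norms: "\<And>x. norm (t x) = 1" "\<And>x. norm (u x) \<le> N1" "\<And>x. norm (v x) \<le> N2"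
    and AE_S: "AE x in lebesgue. x \<in> S"
    and on_S: "\<And>x. x \<in> S \<Longrightarrow> \<tau> x = t x" "\<And>x. x \<in> S \<Longrightarrow> \<phi>' x = u x" "\<And>x. x \<in> S \<Longrightarrow> \<psi>' x = v x"
    and ftc: "\<And>a b. a \<in> S \<Longrightarrow> b \<in> S \<Longrightarrow> a \<le> b \<Longrightarrow> b \<le> a + L \<Longrightarrow> f b - f a = (\<integral>x. t x \<partial>lebesgue_on {a..b})"
      "\<And>a b. a \<in> S \<Longrightarrow> b \<in> S \<Longrightarrow> a \<le> b \<Longrightarrow> b \<le> a + L \<Longrightarrow> \<phi> b - \<phi> a = (\<integral>x. u x \<partial>lebesgue_on {a..b})"
      "\<And>a b. a \<in> S \<Longrightarrow> b \<in> S \<Longrightarrow> a \<le> b \<Longrightarrow> b \<le> a + L \<Longrightarrow> \<psi> b - \<psi> a = (\<integral>x. v x \<partial>lebesgue_on {a..b})"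
    and bi_lip: "0 < Cb" "\<And>s1 s2. circle_dist L s1 s2 \<le> Cb * norm (f s1 - f s2)"
begin

context
  fixes s1 s2 a s :: real
  assumes s1: "s1 \<in> S" and s2: "s2 \<in> S" and s_pos: "circle_dist L s1 s2 \<noteq> 0"
    and a_def: "a = arc_start L s1 s2" and s_def: "s = circle_dist L s1 s2"
begin

lemma s_bounds: "0 < s" "s \<le> L / 2" "s < L"
  using circle_dist_bounds[OF L, of s1 s2] s_pos L by (auto simp: s_def)

lemma ends_in_S: "a \<in> S" "a + s \<in> S"
  using arc_in_periodic_set[OF L periodic(10) s1 s2] by (simp_all add: a_def s_def)

lemma integrable_arc:
  "integrable unit_interval (\<lambda>x. t (b + r * x))" "integrable unit_interval (\<lambda>x. u (b + r * x))"
  "integrable unit_interval (\<lambda>x. v (b + r * x))"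
proof -
  show "integrable unit_interval (\<lambda>x. t (b + r * x))"
    by (rule unit.integrable_bounded[where B = 1, OF borel_measurable_arc[OF borel(1)]]) (simp add: norms)
  show "integrable unit_interval (\<lambda>x. u (b + r * x))"
    by (rule unit.integrable_bounded[OF borel_measurable_arc[OF borel(2)] norms(2)])
  show "integrable unit_interval (\<lambda>x. v (b + r * x))"
    by (rule unit.integrable_bounded[OF borel_measurable_arc[OF borel(3)] norms(3)])
qed

lemma expectation_t:
  "1 / Cb\<^sup>2 \<le> (norm (\<integral>x. t (a + s * x) \<partial>unit_interval))\<^sup>2" "(\<integral>x. t (a + s * x) \<partial>unit_interval) \<noteq> 0"
proof -
  have "norm (f s1 - f s2) = norm (f (a + s) - f a)"
    unfolding a_def s_def by (rule norm_diff_arc[OF L periodic(1)])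
  also have "\<dots> = s * norm (\<integral>x. t (a + s * x) \<partial>unit_interval)"
    using ftc(1)[OF ends_in_S] integral_arc[OF borel(1), of s a] s_bounds by simp
  finally have "s \<le> s * (Cb * norm (\<integral>x. t (a + s * x) \<partial>unit_interval))"
    using bi_lip(2)[of s1 s2] by (simp add: s_def[symmetric] algebra_simps)
  then have "1 \<le> Cb * norm (\<integral>x. t (a + s * x) \<partial>unit_interval)" using s_bounds by simp
  then have *: "1 / Cb \<le> norm (\<integral>x. t (a + s * x) \<partial>unit_interval)"
    using bi_lip(1) by (simp add: field_simps)
  then have "(1 / Cb)\<^sup>2 \<le> (norm (\<integral>x. t (a + s * x) \<partial>unit_interval))\<^sup>2"
    using bi_lip(1) by (intro power_mono) auto
  then show "1 / Cb\<^sup>2 \<le> (norm (\<integral>x. t (a + s * x) \<partial>unit_interval))\<^sup>2" by (simp add: power_divide)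
  have "0 < 1 / Cb" using bi_lip(1) by simp
  then show "(\<integral>x. t (a + s * x) \<partial>unit_interval) \<noteq> 0" using * by auto
qed

text \<open>The smallness condition guarantees that the perturbed shorter arc is still the minimum.
  With zero perturbation and \<open>\<delta> = 0\<close> it reduces to \<open>s \<le> L / 2\<close>,
  so that the formula for the unperturbed density covers antipodal pairs as well.\<close>

lemma energy_density_perturbed:
  fixes e1 e2 :: real
  assumes e: "\<bar>e1\<bar> * N1 + \<bar>e2\<bar> * N2 \<le> \<delta>" "0 \<le> \<delta>" "(1 + \<delta>) * s \<le> (1 - \<delta>) * (L - s)"
  defines "g \<equiv> \<lambda>x. f x + e1 *\<^sub>R \<phi> x + e2 *\<^sub>R \<psi> x" and "g' \<equiv> \<lambda>x. \<tau> x + e1 *\<^sub>R \<phi>' x + e2 *\<^sub>R \<psi>' x"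
    and "h \<equiv> \<lambda>x. t x + e1 *\<^sub>R u x + e2 *\<^sub>R v x"
  shows "energy_density \<alpha> p L g g' (s1, s2) = s powr (- \<alpha> * p) *
    (1 / norm (\<integral>x. h (a + s * x) \<partial>unit_interval) powr \<alpha> - 1 / (\<integral>x. norm (h (a + s * x)) \<partial>unit_interval) powr \<alpha>) powr p"
    "energy_form \<alpha> p L g g' (s1, s2) = s powr (- \<alpha> * p) *
       pair_density unit_interval \<alpha> p (\<lambda>x. h (a + s * x)) (h a) (h (a + s))"
proof -
  have hm: "h \<in> borel_measurable borel" unfolding h_def using borel by measurable
  have AEh: "AE x in lebesgue. g' x = h x"
    using AE_S by eventually_elim (simp add: g'_def h_def on_S)
  have per: "periodic_fun_simple h L" "periodic_fun_simple g L" "periodic_fun_simple g' L"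
    using periodic by (simp_all add: h_def g_def g'_def periodic_fun_simple_def)
  have h1: "norm (h x) \<le> 1 + \<delta>" "1 - \<delta> \<le> norm (h x)" for x
  proof -
    have "norm (e1 *\<^sub>R u x + e2 *\<^sub>R v x) \<le> \<bar>e1\<bar> * N1 + \<bar>e2\<bar> * N2"
      by (intro norm_triangle_le add_mono) (auto intro: mult_left_mono norms)
    then have "norm (e1 *\<^sub>R u x + e2 *\<^sub>R v x) \<le> \<delta>" using e by linarith
    then show "norm (h x) \<le> 1 + \<delta>" "1 - \<delta> \<le> norm (h x)"
      using norm_triangle_ineq[of "t x" "e1 *\<^sub>R u x + e2 *\<^sub>R v x"] norm_triangle_ineq2[of "t x" "- (e1 *\<^sub>R u x + e2 *\<^sub>R v x)"] norms(1)[of x]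
      unfolding h_def add.assoc norm_minus_cancel diff_minus_eq_add by linarith+
  qed
  have ih: "integrable unit_interval (\<lambda>x. norm (h (b + r * x)))" for b r
    by (rule unit.integrable_bounded[of _ "1 + \<delta>"]) (use hm h1 in \<open>auto intro!: borel_measurable_arc borel_measurable_norm\<close>)
  have up: "(\<integral>x. norm (h (b + r * x)) \<partial>unit_interval) \<le> 1 + \<delta>" for b r
    using integral_mono[OF ih[of b r], of "\<lambda>_. 1 + \<delta>"] h1 by (simp add: unit.prob_space)
  have low: "1 - \<delta> \<le> (\<integral>x. norm (h (b + r * x)) \<partial>unit_interval)" for b r
    using integral_mono[OF _ ih[of b r], of "\<lambda>_. 1 - \<delta>"] h1 by (simp add: unit.prob_space)
  \<comment> \<open>The speed stays between \<open>1 - \<delta>\<close> and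
    \<open>1 + \<delta>\<close>, which bounds the shorter arc from above and the longer one from
    below.\<close>
  have "s * (\<integral>x. norm (h (a + s * x)) \<partial>unit_interval) \<le> s * (1 + \<delta>)"
    using up s_bounds by (intro mult_left_mono) auto
  also have "\<dots> \<le> (L - s) * (1 - \<delta>)" using e by (simp add: mult.commute)
  also have "\<dots> \<le> (L - s) * (\<integral>x. norm (h (a + s + (L - s) * x)) \<partial>unit_interval)"
    using low s_bounds by (intro mult_left_mono) auto
  finally have short: "s * (\<integral>x. norm (h (a + s * x)) \<partial>unit_interval) \<le> (L - s) * (\<integral>x. norm (h (a + s + (L - s) * x)) \<partial>unit_interval)" .
  have "g (a + s) - g a = (f (a + s) - f a) + e1 *\<^sub>R (\<phi> (a + s) - \<phi> a) + e2 *\<^sub>R (\<psi> (a + s) - \<psi> a)"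
    by (simp add: g_def algebra_simps)
  also have "\<dots> = s *\<^sub>R (\<integral>x. t (a + s * x) \<partial>unit_interval) + e1 *\<^sub>R s *\<^sub>R (\<integral>x. u (a + s * x) \<partial>unit_interval)
      + e2 *\<^sub>R s *\<^sub>R (\<integral>x. v (a + s * x) \<partial>unit_interval)"
    using ftc[OF ends_in_S] s_bounds by (simp add: integral_arc[OF borel(1)] integral_arc[OF borel(2)] integral_arc[OF borel(3)])
  also have "\<dots> = s *\<^sub>R (\<integral>x. h (a + s * x) \<partial>unit_interval)"
    using integrable_arc by (simp add: h_def scaleR_add_right scaleR_left_commute del: scaleR_scaleR)
  also have "\<dots> = (\<integral>x. h x \<partial>lebesgue_on {a..a + s})" using integral_arc[OF hm, of s a] s_bounds by simp
  finally have gftc: "g (a + s) - g a = (\<integral>x. h x \<partial>lebesgue_on {a..a + s})" .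
  show d: "energy_density \<alpha> p L g g' (s1, s2) = s powr (- \<alpha> * p) *
    (1 / norm (\<integral>x. h (a + s * x) \<partial>unit_interval) powr \<alpha> - 1 / (\<integral>x. norm (h (a + s * x)) \<partial>unit_interval) powr \<alpha>) powr p"
    using energy_density_arc[OF L AEh hm per(1,2) s_pos] gftc short unfolding a_def s_def by blast
  have "norm (g' s1) * norm (g' s2) = norm (g' a) * norm (g' (a + s))"
    unfolding a_def s_def by (rule norm_mult_arc[OF L per(3)])
  also have "\<dots> = norm (h a) * norm (h (a + s))" using ends_in_S by (simp add: g'_def h_def on_S)
  finally show "energy_form \<alpha> p L g g' (s1, s2) = s powr (- \<alpha> * p) *
       pair_density unit_interval \<alpha> p (\<lambda>x. h (a + s * x)) (h a) (h (a + s))"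
    unfolding energy_form_def prod.case d pair_density_def by (simp add: mult.assoc)
qed

lemma energy_density_eq: "energy_density \<alpha> p L f \<tau> (s1, s2) = arc_energy \<alpha> p t a s"
  using energy_density_perturbed(1)[of 0 0 0] s_bounds
  by (simp add: arc_energy_def arc_gap_def gap_def norms unit.prob_space inverse_powr_square[symmetric])

context
  fixes \<delta> :: real
  assumes antipodal: "circle_dist L s1 s2 \<noteq> L / 2" and \<delta>_def: "\<delta> = (L - 2 * s) / L"
begin

text \<open>If the velocity is perturbed by at most \<open>\<delta>\<close>, the shorter arc remains the shorter one.\<close>

lemma perturbation_size: "0 < \<delta>" "(1 + \<delta>) * s \<le> (1 - \<delta>) * (L - s)"
proof -
  have "s < L / 2" using s_bounds antipodal by (simp add: s_def)
  then show "0 < \<delta>" using L by (simp add: \<delta>_def)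
  \<comment> \<open>The claim is equivalent to \<open>\<delta> * L \<le> L - 2 * s\<close>, so
    \<delta> is the largest admissible size.\<close>
  have "\<delta> * L = L - 2 * s" using L by (simp add: \<delta>_def)
  then show "(1 + \<delta>) * s \<le> (1 - \<delta>) * (L - s)" by (simp add: algebra_simps)
qed

text \<open>Each of the two perturbations is allotted half of the admissible size.\<close>

lemma form2_eq:
  assumes "\<bar>e1\<bar> * N1 \<le> \<delta> / 2" "\<bar>e2\<bar> * N2 \<le> \<delta> / 2"
  shows "form2 \<alpha> p L f \<tau> \<phi> \<phi>' \<psi> \<psi>' (s1, s2) e1 e2 = s powr (- \<alpha> * p) *
     pair_density unit_interval \<alpha> p (\<lambda>x. t (a + s * x) + e1 *\<^sub>R u (a + s * x) + e2 *\<^sub>R v (a + s * x))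
       (t a + e1 *\<^sub>R u a + e2 *\<^sub>R v a) (t (a + s) + e1 *\<^sub>R u (a + s) + e2 *\<^sub>R v (a + s))"
  unfolding form2_def using energy_density_perturbed(2)[of e1 e2 \<delta>] perturbation_size assms by simp

lemma variation1_eq:
  "variation1_exists \<alpha> p L f \<tau> \<phi> \<phi>' (s1, s2)"
  "variation1 \<alpha> p L f \<tau> \<phi> \<phi>' (s1, s2) = arc_variation1 \<alpha> p t u a s"
proof -
  have "((\<lambda>e. s powr (- \<alpha> * p) * pair_density unit_interval \<alpha> p (\<lambda>x. t (a + s * x) + e *\<^sub>R u (a + s * x))
       (t a + e *\<^sub>R u a) (t (a + s) + e *\<^sub>R u (a + s))) has_real_derivative arc_variation1 \<alpha> p t u a s) (at 0)"
    unfolding arc_variation1_def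
    by (intro DERIV_cmult unit.pair_density_variation1[OF p \<alpha> borel_measurable_arc[OF borel(1)] norms(1)
        expectation_t(2) norms(1) norms(1) borel_measurable_arc[OF borel(2)] norms(2)])
  moreover have ev: "\<forall>\<^sub>F e in nhds 0. form1 \<alpha> p L f \<tau> \<phi> \<phi>' (s1, s2) e =
     s powr (- \<alpha> * p) * pair_density unit_interval \<alpha> p (\<lambda>x. t (a + s * x) + e *\<^sub>R u (a + s * x))
       (t a + e *\<^sub>R u a) (t (a + s) + e *\<^sub>R u (a + s))"
    using eventually_small_mult[of "\<delta> / 2" N1, OF half_gt_zero[OF perturbation_size(1)]]
  proof eventually_elim
    case (elim e)
    have "form1 \<alpha> p L f \<tau> \<phi> \<phi>' (s1, s2) e = form2 \<alpha> p L f \<tau> \<phi> \<phi>' \<psi> \<psi>' (s1, s2) e 0"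
      by (simp add: form1_def form2_def)
    then show ?case using form2_eq[OF elim, of 0] perturbation_size by simp
  qed
  ultimately have "(form1 \<alpha> p L f \<tau> \<phi> \<phi>' (s1, s2) has_real_derivative arc_variation1 \<alpha> p t u a s) (at 0)"
    using DERIV_cong_ev[OF refl ev refl] by simp
  then show "variation1_exists \<alpha> p L f \<tau> \<phi> \<phi>' (s1, s2)"
    "variation1 \<alpha> p L f \<tau> \<phi> \<phi>' (s1, s2) = arc_variation1 \<alpha> p t u a s"
    by (auto simp: variation1_exists_def variation1_def field_differentiable_def intro: DERIV_imp_deriv)
qed

lemma variation2_eq:
  "variation2_exists \<alpha> p L f \<tau> \<phi> \<phi>' \<psi> \<psi>' (s1, s2)"
  "variation2 \<alpha> p L f \<tau> \<phi> \<phi>' \<psi> \<psi>' (s1, s2) = arc_variation2 \<alpha> p t u v a s"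
proof -
  define c where "c = s powr (- \<alpha> * p)"
  define P where "P = (\<lambda>e1 e2. pair_density unit_interval \<alpha> p (\<lambda>x. t (a + s * x) + e1 *\<^sub>R u (a + s * x) + e2 *\<^sub>R v (a + s * x))
       (t a + e1 *\<^sub>R u a + e2 *\<^sub>R v a) (t (a + s) + e1 *\<^sub>R u (a + s) + e2 *\<^sub>R v (a + s)))"
  define F where "F = form2 \<alpha> p L f \<tau> \<phi> \<phi>' \<psi> \<psi>' (s1, s2)"
  obtain K where K: "\<forall>\<^sub>F e1 in nhds 0. (P e1 has_real_derivative K e1) (at 0)"
    and dK: "(K has_real_derivative density_variation2 unit_interval \<alpha> p (\<lambda>x. t (a + s * x)) (\<lambda>x. u (a + s * x))
       (\<lambda>x. v (a + s * x)) (t a) (t (a + s)) (u a) (u (a + s)) (v a) (v (a + s))) (at 0)"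
    using unit.pair_density_variation2[OF p \<alpha> borel_measurable_arc[OF borel(1)] norms(1) expectation_t(2) norms(1) norms(1)
        borel_measurable_arc[OF borel(2)] norms(2) borel_measurable_arc[OF borel(3)] norms(3)]
    unfolding P_def by blast
  have F: "\<forall>\<^sub>F e1 in nhds 0. (F e1 has_real_derivative c * K e1) (at 0)"
    using K eventually_small_mult[of "\<delta> / 2" N1, OF half_gt_zero[OF perturbation_size(1)]]
  proof eventually_elim
    case (elim e1)
    \<comment> \<open>The first parameter is fixed here; agreement with the arc formula for all
      small second parameters suffices for the inner derivative.\<close>
    have "\<forall>\<^sub>F e2 in nhds 0. F e1 e2 = c * P e1 e2"
      using eventually_small_mult[of "\<delta> / 2" N2, OF half_gt_zero[OF perturbation_size(1)]]
      by eventually_elim (use form2_eq[OF elim(2)] in \<open>simp add: F_def P_def c_def\<close>)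
    from DERIV_cong_ev[OF refl this refl] show ?case using DERIV_cmult[OF elim(1), of c] by simp
  qed
  then have ev: "\<forall>\<^sub>F e1 in nhds 0. deriv (F e1) 0 = c * K e1"
    by eventually_elim (rule DERIV_imp_deriv)
  moreover have "((\<lambda>e. c * K e) has_real_derivative arc_variation2 \<alpha> p t u v a s) (at 0)"
    using DERIV_cmult[OF dK, of c] by (simp add: c_def arc_variation2_def)
  ultimately have "((\<lambda>e1. deriv (F e1) 0) has_real_derivative arc_variation2 \<alpha> p t u v a s) (at 0)"
    using DERIV_cong_ev[OF refl ev refl] by simp
  moreover have "\<forall>\<^sub>F e1 in nhds 0. F e1 field_differentiable (at 0)"
    using F by eventually_elim (auto simp: field_differentiable_def)
  ultimately show "variation2_exists \<alpha> p L f \<tau> \<phi> \<phi>' \<psi> \<psi>' (s1, s2)"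
    "variation2 \<alpha> p L f \<tau> \<phi> \<phi>' \<psi> \<psi>' (s1, s2) = arc_variation2 \<alpha> p t u v a s"
    by (auto simp: variation2_exists_def variation2_def field_differentiable_def F_def intro: DERIV_imp_deriv)
qed

end

end

end

section \<open>Bounds for the three densities of an arc\<close>

definition arc_var :: "(real \<Rightarrow> 'a::euclidean_space) \<Rightarrow> real \<Rightarrow> real \<Rightarrow> real" where
  "arc_var w a s = covar unit_interval (\<lambda>x. w (a + s * x)) (\<lambda>x. w (a + s * x))"

text \<open>Coefficient and exponent are those of the second variation. They dominate the
  coefficients 1 and p + 2 and the exponent p of the other two densities, because
  \<open>gap_const\<close> is at least 1.\<close>

definition variation_const :: "real \<Rightarrow> real \<Rightarrow> real \<Rightarrow> real" where
  "variation_const \<alpha> p Cb = (p\<^sup>2 + 5 * p + 6) * gap_const (\<alpha> / 2) (Cb\<^sup>2) powr (p + 1)"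

lemma variation_const_pos:
  assumes "0 < \<alpha>" "1 \<le> p" shows "0 < variation_const \<alpha> p Cb"
proof -
  have "1 \<le> gap_const (\<alpha> / 2) (Cb\<^sup>2)" using assms by (intro gap_const_ge) simp
  moreover have "0 < p\<^sup>2 + 5 * p + 6" using assms by (simp add: add_nonneg_pos)
  ultimately show ?thesis unfolding variation_const_def by (simp add: powr_gt_zero)
qed

lemma arc_bounds:
  fixes t u v :: "real \<Rightarrow> 'a::euclidean_space"
  assumes \<alpha>: "0 < \<alpha>" and p: "1 \<le> p" and Cb: "0 < Cb"
    and borel: "t \<in> borel_measurable borel" "u \<in> borel_measurable borel" "v \<in> borel_measurable borel"
    and norms: "\<And>x. norm (t x) = 1" "\<And>x. norm (u x) \<le> N1" "\<And>x. norm (v x) \<le> N2"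
    and Et: "1 / Cb\<^sup>2 \<le> (norm (\<integral>x. t (a + s * x) \<partial>unit_interval))\<^sup>2"
    and T: "arc_var t a s \<le> T" "arc_var u a s \<le> N1\<^sup>2 * T" "arc_var v a s \<le> N2\<^sup>2 * T"
  shows "\<bar>arc_energy \<alpha> p t a s\<bar> \<le> variation_const \<alpha> p Cb * (s powr (- \<alpha> * p) * T powr p)"
    "\<bar>arc_variation1 \<alpha> p t u a s\<bar> \<le> variation_const \<alpha> p Cb * N1 * (s powr (- \<alpha> * p) * T powr p)"
    "\<bar>arc_variation2 \<alpha> p t u v a s\<bar> \<le> variation_const \<alpha> p Cb * N1 * N2 * (s powr (- \<alpha> * p) * T powr p)"
proof -
  define K where "K = gap_const (\<alpha> / 2) (Cb\<^sup>2)"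
  have K1: "1 \<le> K" unfolding K_def using \<alpha> by (intro gap_const_ge) simp
  have Kp: "K powr p \<le> K powr (p + 1)" using K1 by (intro powr_mono) auto
  have N: "0 \<le> N1" "0 \<le> N2"
    by (rule order_trans[OF norm_ge_zero norms(2)], rule order_trans[OF norm_ge_zero norms(3)])
  note mt = borel_measurable_arc[OF borel(1), of a s] and mu = borel_measurable_arc[OF borel(2), of a s]
    and mv = borel_measurable_arc[OF borel(3), of a s]
  have Cb2: "0 < Cb\<^sup>2" using Cb by simp
  note T' = T[unfolded arc_var_def]
  note est = \<alpha> Cb2 mt norms(1) Et T'(1)
  have "0 \<le> covar unit_interval (\<lambda>x. t (a + s * x)) (\<lambda>x. t (a + s * x))"
    by (rule unit.covar_self_nonneg[OF mt, of 1]) (simp add: norms)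
  then have T0: "0 \<le> T" using T'(1) by linarith
  have pc: "0 \<le> p\<^sup>2" "0 \<le> T powr p" "0 \<le> K powr (p + 1)" by simp_all
  have vc: "variation_const \<alpha> p Cb = (p\<^sup>2 + 5 * p + 6) * K powr (p + 1)" by (simp add: variation_const_def K_def)
  have mono: "c * K powr p \<le> variation_const \<alpha> p Cb" if "0 \<le> c" "c \<le> p\<^sup>2 + 5 * p + 6" for c
    unfolding vc using that Kp by (intro mult_mono) auto
  note g = unit.arc_gap_estimates[OF est, folded K_def]
  have "arc_gap unit_interval \<alpha> (\<lambda>x. t (a + s * x)) powr p \<le> (K * T) powr p"
    using g p by (intro powr_mono2) auto
  also have "\<dots> = 1 * K powr p * T powr p" by (simp add: powr_mult)
  also have "\<dots> \<le> variation_const \<alpha> p Cb * T powr p" using p pc by (intro mult_right_mono mono) auto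
  finally have e: "arc_gap unit_interval \<alpha> (\<lambda>x. t (a + s * x)) powr p \<le> variation_const \<alpha> p Cb * T powr p" .
  show "\<bar>arc_energy \<alpha> p t a s\<bar> \<le> variation_const \<alpha> p Cb * (s powr (- \<alpha> * p) * T powr p)"
    using mult_left_mono[OF e, of "s powr (- \<alpha> * p)"] unfolding arc_energy_def abs_mult
    by (simp add: ac_simps)
  have b: "\<bar>density_variation1 unit_interval \<alpha> p (\<lambda>x. t (a + s * x)) (\<lambda>x. u (a + s * x)) (t a) (t (a + s)) (u a) (u (a + s))\<bar>
     \<le> variation_const \<alpha> p Cb * (N1 * T powr p)"
  proof -
    have "\<bar>density_variation1 unit_interval \<alpha> p (\<lambda>x. t (a + s * x)) (\<lambda>x. u (a + s * x)) (t a) (t (a + s)) (u a) (u (a + s))\<bar>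
      \<le> (p + 2) * K powr p * N1 * T powr p"
      unfolding density_variation1_def
      using K1 T0 N by (intro density1_bound p g ends1_bound norms
        unit.arc_gap1_estimates(1)[OF est mu norms(2) T'(2), folded K_def]) auto
    also have "\<dots> = ((p + 2) * K powr p) * (N1 * T powr p)" by simp
    also have "\<dots> \<le> variation_const \<alpha> p Cb * (N1 * T powr p)"
      using p N pc by (intro mult_right_mono mono) auto
    finally show ?thesis .
  qed
  show "\<bar>arc_variation1 \<alpha> p t u a s\<bar> \<le> variation_const \<alpha> p Cb * N1 * (s powr (- \<alpha> * p) * T powr p)"
    using mult_left_mono[OF b, of "s powr (- \<alpha> * p)"] unfolding arc_variation1_def abs_mult
    by (simp add: ac_simps)
  have b: "\<bar>density_variation2 unit_interval \<alpha> p (\<lambda>x. t (a + s * x)) (\<lambda>x. u (a + s * x)) (\<lambda>x. v (a + s * x))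
       (t a) (t (a + s)) (u a) (u (a + s)) (v a) (v (a + s))\<bar>
      \<le> (p\<^sup>2 + 5 * p + 6) * K powr (p + 1) * N1 * N2 * T powr p"
    unfolding density_variation2_def
    using K1 T0 N by (intro density2_bound p g ends1_bound ends2_bound norms
        unit.arc_gap1_estimates[OF est mu norms(2) T'(2), folded K_def]
        unit.arc_gap1_estimates[OF est mv norms(3) T'(3), folded K_def]
        unit.arc_gap2_estimate[OF est mu norms(2) T'(2) mv norms(3) T'(3), folded K_def]) auto
  show "\<bar>arc_variation2 \<alpha> p t u v a s\<bar> \<le> variation_const \<alpha> p Cb * N1 * N2 * (s powr (- \<alpha> * p) * T powr p)"
    using mult_left_mono[OF b, of "s powr (- \<alpha> * p)"] unfolding arc_variation2_def abs_mult vc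
    by (simp add: ac_simps)
qed

section \<open>Measurability of the densities in start and length of the arc\<close>

lemma borel_measurable_gap [measurable (raw)]:
  fixes m n :: "'b \<Rightarrow> real"
  assumes [measurable]: "m \<in> borel_measurable M" "n \<in> borel_measurable M"
  shows "(\<lambda>x. gap q (m x) (n x)) \<in> borel_measurable M"
  unfolding gap_def by measurable

lemma borel_measurable_gap1 [measurable (raw)]:
  fixes m n m1 n1 :: "'b \<Rightarrow> real"
  assumes [measurable]: "m \<in> borel_measurable M" "n \<in> borel_measurable M" "m1 \<in> borel_measurable M" "n1 \<in> borel_measurable M"
  shows "(\<lambda>x. gap1 q (m x) (n x) (m1 x) (n1 x)) \<in> borel_measurable M"
  unfolding gap1_def by measurable

lemma borel_measurable_gap2 [measurable (raw)]:
  fixes m n m1 n1 m2 n2 m12 n12 :: "'b \<Rightarrow> real"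
  assumes [measurable]: "m \<in> borel_measurable M" "n \<in> borel_measurable M" "m1 \<in> borel_measurable M" "n1 \<in> borel_measurable M" "m2 \<in> borel_measurable M" "n2 \<in> borel_measurable M" "m12 \<in> borel_measurable M" "n12 \<in> borel_measurable M"
  shows "(\<lambda>x. gap2 q (m x) (n x) (m1 x) (n1 x) (m2 x) (n2 x) (m12 x) (n12 x)) \<in> borel_measurable M"
  unfolding gap2_def by measurable

lemma borel_measurable_pow0 [measurable (raw)]:
  "f \<in> borel_measurable M \<Longrightarrow> (\<lambda>x. pow0 q (f x)) \<in> borel_measurable M"
  unfolding pow0_def by (cases "q = 0") simp_all

lemma borel_measurable_density1 [measurable (raw)]:
  fixes a b l l1 :: "'b \<Rightarrow> real"
  assumes [measurable]: "a \<in> borel_measurable M" "b \<in> borel_measurable M" "l \<in> borel_measurable M" "l1 \<in> borel_measurable M"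
  shows "(\<lambda>x. density1 p (a x) (b x) (l x) (l1 x)) \<in> borel_measurable M"
  unfolding density1_def by measurable

lemma borel_measurable_density2 [measurable (raw)]:
  fixes a b c d l l1 l2 l12 :: "'b \<Rightarrow> real"
  assumes [measurable]: "a \<in> borel_measurable M" "b \<in> borel_measurable M" "c \<in> borel_measurable M" "d \<in> borel_measurable M" "l \<in> borel_measurable M" "l1 \<in> borel_measurable M" "l2 \<in> borel_measurable M" "l12 \<in> borel_measurable M"
  shows "(\<lambda>x. density2 p (a x) (b x) (c x) (d x) (l x) (l1 x) (l2 x) (l12 x)) \<in> borel_measurable M"
  unfolding density2_def by measurable

lemma borel_measurable_expectation_arc [measurable]:
  fixes w :: "real \<Rightarrow> 'b::euclidean_space"
  assumes [measurable]: "w \<in> borel_measurable borel" "A \<in> borel_measurable M" "B \<in> borel_measurable M"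
  shows "(\<lambda>q. \<integral>x. w (A q + B q * x) \<partial>unit_interval) \<in> borel_measurable M"
proof -
  have [measurable]: "(\<lambda>x. x) \<in> borel_measurable unit_interval" by (rule borel_measurable_unit_interval) simp
  have "(\<lambda>(q, x). w (A q + B q * x)) \<in> borel_measurable (M \<Otimes>\<^sub>M unit_interval)" by measurable
  then show ?thesis by (rule unit.borel_measurable_lebesgue_integral)
qed

context
  fixes A B :: "'b \<Rightarrow> real" and M :: "'b measure" and t u v :: "real \<Rightarrow> 'a::euclidean_space"
  assumes meas [measurable]: "A \<in> borel_measurable M" "B \<in> borel_measurable M"
    "t \<in> borel_measurable borel" "u \<in> borel_measurable borel" "v \<in> borel_measurable borel"
begin

lemma borel_measurable_arc_inner:
  "(\<lambda>q. \<integral>x. t (A q + B q * x) \<bullet> u (A q + B q * x) \<partial>unit_interval) \<in> borel_measurable M"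
  "(\<lambda>q. \<integral>x. t (A q + B q * x) \<bullet> v (A q + B q * x) \<partial>unit_interval) \<in> borel_measurable M"
  "(\<lambda>q. \<integral>x. u (A q + B q * x) \<bullet> v (A q + B q * x) \<partial>unit_interval) \<in> borel_measurable M"
  "(\<lambda>q. \<integral>x. (t (A q + B q * x) \<bullet> u (A q + B q * x)) * (t (A q + B q * x) \<bullet> v (A q + B q * x)) \<partial>unit_interval) \<in> borel_measurable M"
proof -
  show "(\<lambda>q. \<integral>x. t (A q + B q * x) \<bullet> u (A q + B q * x) \<partial>unit_interval) \<in> borel_measurable M"
    by (rule borel_measurable_expectation_arc[where w = "\<lambda>y. t y \<bullet> u y"]) measurable
  show "(\<lambda>q. \<integral>x. t (A q + B q * x) \<bullet> v (A q + B q * x) \<partial>unit_interval) \<in> borel_measurable M"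
    by (rule borel_measurable_expectation_arc[where w = "\<lambda>y. t y \<bullet> v y"]) measurable
  show "(\<lambda>q. \<integral>x. u (A q + B q * x) \<bullet> v (A q + B q * x) \<partial>unit_interval) \<in> borel_measurable M"
    by (rule borel_measurable_expectation_arc[where w = "\<lambda>y. u y \<bullet> v y"]) measurable
  show "(\<lambda>q. \<integral>x. (t (A q + B q * x) \<bullet> u (A q + B q * x)) * (t (A q + B q * x) \<bullet> v (A q + B q * x)) \<partial>unit_interval) \<in> borel_measurable M"
    by (rule borel_measurable_expectation_arc[where w = "\<lambda>y. (t y \<bullet> u y) * (t y \<bullet> v y)"]) measurable
qed

lemma borel_measurable_arc_functions:
  "(\<lambda>q. arc_energy \<alpha> p t (A q) (B q)) \<in> borel_measurable M"
  "(\<lambda>q. arc_variation1 \<alpha> p t u (A q) (B q)) \<in> borel_measurable M"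
  "(\<lambda>q. arc_variation2 \<alpha> p t u v (A q) (B q)) \<in> borel_measurable M"
proof -
  note i [measurable] = borel_measurable_arc_inner
  note e [measurable] = borel_measurable_expectation_arc[OF meas(3) meas(1,2)]
    borel_measurable_expectation_arc[OF meas(4) meas(1,2)] borel_measurable_expectation_arc[OF meas(5) meas(1,2)]
  have g: "(\<lambda>q. arc_gap unit_interval \<alpha> (\<lambda>x. t (A q + B q * x))) \<in> borel_measurable M"
    unfolding arc_gap_def by measurable
  have g1: "(\<lambda>q. arc_gap1 unit_interval \<alpha> (\<lambda>x. t (A q + B q * x)) (\<lambda>x. u (A q + B q * x))) \<in> borel_measurable M"
    "(\<lambda>q. arc_gap1 unit_interval \<alpha> (\<lambda>x. t (A q + B q * x)) (\<lambda>x. v (A q + B q * x))) \<in> borel_measurable M"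
    unfolding arc_gap1_def
    by measurable
  have g2: "(\<lambda>q. arc_gap2 unit_interval \<alpha> (\<lambda>x. t (A q + B q * x)) (\<lambda>x. u (A q + B q * x)) (\<lambda>x. v (A q + B q * x))) \<in> borel_measurable M"
    unfolding arc_gap2_def
    by measurable
  have n: "(\<lambda>q. ends1 (t (A q)) (t (A q + B q)) (u (A q)) (u (A q + B q))) \<in> borel_measurable M"
    "(\<lambda>q. ends1 (t (A q)) (t (A q + B q)) (v (A q)) (v (A q + B q))) \<in> borel_measurable M"
    "(\<lambda>q. ends2 (t (A q)) (t (A q + B q)) (u (A q)) (u (A q + B q)) (v (A q)) (v (A q + B q))) \<in> borel_measurable M"
    unfolding ends1_def ends2_def by measurable
  have s: "(\<lambda>q. B q powr (- \<alpha> * p)) \<in> borel_measurable M" by measurable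
  show "(\<lambda>q. arc_energy \<alpha> p t (A q) (B q)) \<in> borel_measurable M"
    unfolding arc_energy_def using g by measurable
  show "(\<lambda>q. arc_variation1 \<alpha> p t u (A q) (B q)) \<in> borel_measurable M"
    unfolding arc_variation1_def density_variation1_def
    by (intro borel_measurable_times borel_measurable_density1 borel_measurable_const s g g1 n)
  show "(\<lambda>q. arc_variation2 \<alpha> p t u v (A q) (B q)) \<in> borel_measurable M"
    unfolding arc_variation2_def density_variation2_def
    by (intro borel_measurable_times borel_measurable_density2 borel_measurable_const s g g1 g2 n)
qed

end

lemma borel_measurable_arc_var [measurable]:
  fixes w :: "real \<Rightarrow> 'a::euclidean_space"
  assumes [measurable]: "w \<in> borel_measurable borel" "A \<in> borel_measurable M" "B \<in> borel_measurable M"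
  shows "(\<lambda>q. arc_var w (A q) (B q)) \<in> borel_measurable M"
  unfolding arc_var_def covar_def using borel_measurable_arc_inner(1)[OF assms(2,3,1,1,1)] by measurable

lemma borel_measurable_rmod [measurable]:
  "(\<lambda>q. A q rmod L) \<in> borel_measurable M" if [measurable]: "A \<in> borel_measurable M"
  unfolding rmod_def by measurable

lemma borel_measurable_arc_start [measurable]:
  assumes [measurable]: "A \<in> borel_measurable M" "B \<in> borel_measurable M"
  shows "(\<lambda>q. arc_start L (A q) (B q)) \<in> borel_measurable M" "(\<lambda>q. circle_dist L (A q) (B q)) \<in> borel_measurable M"
  unfolding arc_start_def circle_dist_def by measurable

section \<open>Weak derivatives of periodic functions\<close>

definition circle_point :: "real \<Rightarrow> real \<Rightarrow> real \<times> real" where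
  "circle_point L s = (cos (2 * pi * s / L), sin (2 * pi * s / L))"

text \<open>\<open>smooth\<close> asks for a whole sequence of successive derivatives. On a class
  closed under differentiation it is obtained by iterating a chosen derivative.\<close>

lemma smooth_if_derivative_closed:
  assumes "\<And>u. u \<in> A \<Longrightarrow> \<exists>v\<in>A. \<forall>s. (u has_vector_derivative v s) (at s)" and "u \<in> A"
  shows "smooth u"
proof -
  obtain d where d: "\<And>u. u \<in> A \<Longrightarrow> d u \<in> A \<and> (\<forall>s. (u has_vector_derivative d u s) (at s))"
    using assms(1) by metis
  define D where "D k = (d ^^ k) u" for k
  have "D k \<in> A" for k by (induction k) (auto simp: D_def assms(2) d)
  then have "D 0 = u \<and> (\<forall>k s. (D k has_vector_derivative D (Suc k) s) (at s))"
    using d by (auto simp: D_def)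
  then show ?thesis unfolding smooth_def by blast
qed

lemma circle_point_altdef: "circle_point L s = (cos (2 * pi / L * s), sin (2 * pi / L * s))"
  by (simp add: circle_point_def)

lemma has_vector_derivative_circle_point:
  "(circle_point L has_vector_derivative (2 * pi / L) *\<^sub>R (- snd (circle_point L s), fst (circle_point L s))) (at s)"
proof -
  define c where "c = 2 * pi / L"
  have "((\<lambda>s. cos (c * s)) has_real_derivative - c * sin (c * s)) (at s)"
    "((\<lambda>s. sin (c * s)) has_real_derivative c * cos (c * s)) (at s)"
    by (auto intro!: derivative_eq_intros)
  then have "((\<lambda>s. (cos (c * s), sin (c * s))) has_vector_derivative (- c * sin (c * s), c * cos (c * s))) (at s)"
    by (intro has_vector_derivative_Pair) (simp_all add: has_real_derivative_iff_has_vector_derivative)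
  moreover have "circle_point L = (\<lambda>s. (cos (c * s), sin (c * s)))" by (simp add: fun_eq_iff circle_point_altdef c_def)
  ultimately show ?thesis by (simp add: c_def[symmetric])
qed

text \<open>The derivative of \<open>circle_point\<close> is a linear map applied to it, a quarter
  turn with a factor. Hence differentiation maps polynomials in cosine and sine to polynomials in
  cosine and sine.\<close>

lemma trig_polynomial_derivative:
  fixes P :: "real \<times> real \<Rightarrow> real"
  assumes "L \<noteq> 0" "real_polynomial_function P"
  shows "\<exists>Q. real_polynomial_function Q \<and> (\<forall>s. ((\<lambda>s. P (circle_point L s)) has_real_derivative Q (circle_point L s)) (at s))"
  using assms(2)
proof induction
  case (linear f)
  define J :: "real \<times> real \<Rightarrow> real \<times> real" where "J = (\<lambda>z. (2 * pi / L) *\<^sub>R (- snd z, fst z))"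
  have "bounded_linear J" unfolding J_def
    by (intro bounded_linear_intros bounded_linear_Pair bounded_linear_minus bounded_linear_snd bounded_linear_fst)
  then have "real_polynomial_function (\<lambda>z. f (J z))"
    using bounded_linear_compose[OF linear] by blast
  moreover have "((\<lambda>s. f (circle_point L s)) has_real_derivative f (J (circle_point L s))) (at s)" for s
    using bounded_linear.has_vector_derivative[OF linear has_vector_derivative_circle_point]
    by (simp add: J_def has_real_derivative_iff_has_vector_derivative)
  ultimately show ?case by blast
next
  case (const c)
  show ?case by (intro exI[of _ "\<lambda>_. 0"]) auto
next
  case (add f g)
  then obtain F G where "real_polynomial_function F" "real_polynomial_function G"
    "\<And>s. ((\<lambda>s. f (circle_point L s)) has_real_derivative F (circle_point L s)) (at s)"
    "\<And>s. ((\<lambda>s. g (circle_point L s)) has_real_derivative G (circle_point L s)) (at s)" by blast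
  then show ?case by (intro exI[of _ "\<lambda>z. F z + G z"]) (auto intro!: derivative_eq_intros)
next
  case (mult f g)
  then obtain F G where "real_polynomial_function F" "real_polynomial_function G"
    "\<And>s. ((\<lambda>s. f (circle_point L s)) has_real_derivative F (circle_point L s)) (at s)"
    "\<And>s. ((\<lambda>s. g (circle_point L s)) has_real_derivative G (circle_point L s)) (at s)" by blast
  with mult.hyps show ?case
    by (intro exI[of _ "\<lambda>z. F z * g z + f z * G z"]) (auto intro!: derivative_eq_intros simp: algebra_simps)
qed

lemma smooth_trig_polynomial:
  fixes P :: "real \<times> real \<Rightarrow> real"
  assumes "L \<noteq> 0" "real_polynomial_function P"
  shows "smooth (\<lambda>s. P (circle_point L s))" "periodic_fun_simple (\<lambda>s. P (circle_point L s)) L"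
proof -
  show "smooth (\<lambda>s. P (circle_point L s))"
    by (rule smooth_if_derivative_closed[of "(\<lambda>P s. P (circle_point L s)) ` Collect real_polynomial_function"])
       (use trig_polynomial_derivative[OF assms(1)] assms(2) in
         \<open>fastforce simp: has_real_derivative_iff_has_vector_derivative[symmetric]\<close>)+
  have "circle_point L (x + L) = circle_point L x" for x
    using assms(1) by (simp add: circle_point_def distrib_left add_divide_distrib)
  then show "periodic_fun_simple (\<lambda>s. P (circle_point L s)) L"
    by (simp add: periodic_fun_simple_def)
qed

lemma continuous_on_circle_point: "continuous_on S (circle_point L)"
  unfolding circle_point_altdef by (intro continuous_intros)

lemma inj_on_circle_point:
  assumes "0 < L" shows "inj_on (circle_point L) {0..<L}"
proof (rule inj_onI)
  fix x y assume x: "x \<in> {0..<L}" and y: "y \<in> {0..<L}" and eq: "circle_point L x = circle_point L y"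
  then obtain n :: int where "2 * pi * x / L = 2 * pi * y / L + 2 * pi * n"
    using sin_cos_eq_iff[of "2 * pi * x / L" "2 * pi * y / L"] by (auto simp: circle_point_def)
  then have "(2 * pi) * (x / L) = (2 * pi) * (y / L + n)" by (simp add: algebra_simps)
  then have "x / L = y / L + n" by (simp only: mult_cancel_left) simp
  then have n: "x - y = n * L" using assms by (simp add: field_simps)
  have "\<bar>x - y\<bar> < L" using x y by auto
  then have "\<bar>real_of_int n\<bar> * L < 1 * L" using assms unfolding n by (simp add: abs_mult)
  then have "n = 0" using assms by simp
  then show "x = y" using n by simp
qed

lemma circle_measure_simps:
  "space (circle_measure L) = {0..L}" "A \<in> sets borel \<Longrightarrow> A \<subseteq> {0..L} \<Longrightarrow> A \<in> sets (circle_measure L)"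
  "f \<in> borel_measurable borel \<Longrightarrow> f \<in> borel_measurable (circle_measure L)"
  by (auto simp: circle_measure_def sets_restrict_space_iff measurable_completion intro!: measurable_restrict_space1)

lemma finite_measure_circle: "finite_measure (circle_measure L)"
  unfolding circle_measure_def by (rule finite_measure_lebesgue_on) simp

lemma integrable_bounded_scaleR:
  fixes w :: "'b \<Rightarrow> 'a::euclidean_space"
  assumes "integrable M w" "\<eta> \<in> borel_measurable M" "\<And>x. x \<in> space M \<Longrightarrow> \<bar>\<eta> x\<bar> \<le> B"
  shows "integrable M (\<lambda>x. \<eta> x *\<^sub>R w x)"
proof (rule Bochner_Integration.integrable_bound[of M "\<lambda>x. B *\<^sub>R w x"])
  show "AE x in M. norm (\<eta> x *\<^sub>R w x) \<le> norm (B *\<^sub>R w x)"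
    using assms(3) by (intro AE_I2) (auto intro!: mult_right_mono order_trans[OF _ abs_ge_self])
qed (use assms in \<open>auto intro: borel_measurable_scaleR\<close>)

text \<open>The functions \<open>P \<circ> circle_point L\<close> with \<open>P\<close> a polynomial are the trigonometric polynomials; by
  Stone-Weierstrass they are dense in the continuous functions on the circle.\<close>

lemma weak_zero_AE:
  fixes w :: "real \<Rightarrow> 'a::euclidean_space"
  assumes L: "0 < L" and w: "integrable (circle_measure L) w"
    and z: "\<And>\<eta>::real \<Rightarrow> real. smooth \<eta> \<Longrightarrow> periodic_fun_simple \<eta> L \<Longrightarrow> (\<integral>s. \<eta> s *\<^sub>R w s \<partial>circle_measure L) = 0"
  shows "AE s in circle_measure L. w s = 0"
proof -
  let ?M = "circle_measure L" and ?e = "circle_point L"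
  interpret finite_measure ?M by (rule finite_measure_circle)
  have em: "(\<lambda>s. h (?e s)) \<in> borel_measurable ?M" if "continuous_on UNIV h" for h :: "real \<times> real \<Rightarrow> real"
    by (intro circle_measure_simps(3) borel_measurable_continuous_onI continuous_on_compose2[OF that continuous_on_circle_point]) simp
  have cont: "(\<integral>s. h (?e s) *\<^sub>R w s \<partial>?M) = 0" if h: "continuous_on UNIV h" for h :: "real \<times> real \<Rightarrow> real"
  proof -
    have comp: "compact (?e ` {0..L})" by (intro compact_continuous_image continuous_on_circle_point) simp
    have hc: "continuous_on (?e ` {0..L}) h" using h continuous_on_subset by blast
    obtain B where B: "\<forall>s\<in>{0..L}. \<bar>h (?e s)\<bar> \<le> B"
      using compact_imp_bounded[OF compact_continuous_image[OF hc comp]] by (auto simp: bounded_iff)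
    have "norm (\<integral>s. h (?e s) *\<^sub>R w s \<partial>?M) \<le> \<epsilon> * (1 + (\<integral>s. norm (w s) \<partial>?M))" if \<epsilon>: "0 < \<epsilon>" for \<epsilon>
    proof -
      obtain P where P: "real_polynomial_function P" and Ph: "\<And>x. x \<in> ?e ` {0..L} \<Longrightarrow> \<bar>h x - P x\<bar> < \<epsilon>"
        using Stone_Weierstrass_real_polynomial_function[OF comp hc \<epsilon>] by blast
      have Pc: "continuous_on UNIV P"
        using continuous_real_polymonial_function[OF P] by (simp add: continuous_at_imp_continuous_on)
      have hP: "\<bar>h (?e s) - P (?e s)\<bar> \<le> \<epsilon>" if "s \<in> space ?M" for s
        using Ph[of "?e s"] that by (simp add: circle_measure_simps less_imp_le)
      have i1: "integrable ?M (\<lambda>s. h (?e s) *\<^sub>R w s)"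
        using B by (intro integrable_bounded_scaleR[OF w em[OF h], of B]) (simp add: circle_measure_simps)
      have i2: "integrable ?M (\<lambda>s. (h (?e s) - P (?e s)) *\<^sub>R w s)"
        using hP by (intro integrable_bounded_scaleR[OF w _, of _ \<epsilon>] borel_measurable_diff em h Pc) auto
      have i3: "integrable ?M (\<lambda>s. P (?e s) *\<^sub>R w s)"
        using Bochner_Integration.integrable_diff[OF i1 i2] by (simp add: algebra_simps)
      have "(\<integral>s. P (?e s) *\<^sub>R w s \<partial>?M) = 0"
        using smooth_trig_polynomial[OF _ P, of L] L by (intro z) auto
      then have "(\<integral>s. h (?e s) *\<^sub>R w s \<partial>?M) = (\<integral>s. (h (?e s) - P (?e s)) *\<^sub>R w s \<partial>?M)"
        using i1 i3 by (simp add: scaleR_diff_left)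
      also have "norm \<dots> \<le> (\<integral>s. norm ((h (?e s) - P (?e s)) *\<^sub>R w s) \<partial>?M)" by (rule integral_norm_bound)
      also have "\<dots> \<le> (\<integral>s. \<epsilon> * norm (w s) \<partial>?M)"
        using i2 w hP by (intro integral_mono integrable_norm) (auto intro: mult_right_mono)
      also have "\<dots> = \<epsilon> * (\<integral>s. norm (w s) \<partial>?M)" using w by simp
      also have "\<dots> \<le> \<epsilon> * (1 + (\<integral>s. norm (w s) \<partial>?M))" using \<epsilon> by simp
      finally show ?thesis .
    qed
    note bound = this
    have "norm (\<integral>s. h (?e s) *\<^sub>R w s \<partial>?M) \<le> 0"
    proof (rule field_le_epsilon)
      fix e :: real assume "0 < e"
      have "0 < 1 + (\<integral>s. norm (w s) \<partial>?M)" by (simp add: add_pos_nonneg)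
      then show "norm (\<integral>s. h (?e s) *\<^sub>R w s \<partial>?M) \<le> 0 + e"
        using bound[of "e / (1 + (\<integral>s. norm (w s) \<partial>?M))"] \<open>0 < e\<close> by simp
    qed
    then show ?thesis by simp
  qed
  \<comment> \<open>On the half-open interval \<open>circle_point\<close> is injective, so
    membership in the compact set C can be read off from the image point.\<close>
  have closed_zero: "(\<integral>s. indicator C s *\<^sub>R w s \<partial>?M) = 0" if C: "closed C" "C \<subseteq> {0..<L}" for C :: "real set"
  proof (cases "C = {}")
    case False
    define K where "K = ?e ` C"
    have "compact C" using C by (meson atLeastLessThan_subseteq_atLeastAtMost_iff bounded_closed_interval bounded_subset compact_eq_bounded_closed order_refl order_trans)
    then have K: "closed K" "K \<noteq> {}"
      using False unfolding K_def by (auto intro!: compact_imp_closed compact_continuous_image continuous_on_circle_point)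
    \<comment> \<open>Continuous cutoffs with value 1 on K that decrease pointwise to the indicator
      of K.\<close>
    define h where "h n z = max 0 (1 - real n * infdist z K)" for n z
    have hc: "continuous_on UNIV (h n)" for n unfolding h_def by (intro continuous_intros)
    have "(\<lambda>n. \<integral>s. h n (?e s) *\<^sub>R w s \<partial>?M) \<longlonglongrightarrow> (\<integral>s. indicator C s *\<^sub>R w s \<partial>?M)"
    proof (rule integral_dominated_convergence[where w = "\<lambda>s. norm (w s)"])
      show "(\<lambda>s. indicator C s *\<^sub>R w s) \<in> borel_measurable ?M"
        using C by (intro borel_measurable_scaleR circle_measure_simps(3)[OF borel_measurable_indicator] borel_measurable_integrable[OF w]) auto
      show "(\<lambda>s. h n (?e s) *\<^sub>R w s) \<in> borel_measurable ?M" for n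
        using w by (intro borel_measurable_scaleR em hc) auto
      show "integrable ?M (\<lambda>s. norm (w s))" using w by simp
      show "AE s in ?M. norm (h n (?e s) *\<^sub>R w s) \<le> norm (w s)" for n
      proof (rule AE_I2)
        fix s
        have "\<bar>h n (?e s)\<bar> \<le> 1" by (auto simp: h_def infdist_nonneg)
        then show "norm (h n (?e s) *\<^sub>R w s) \<le> norm (w s)" by (simp add: mult_left_le_one_le)
      qed
      \<comment> \<open>L has the same image as 0, which may belong to C; as a single point it is
        negligible.\<close>
      have "AE s in ?M. s \<noteq> L"
        unfolding circle_measure_def using AE_lborel_singleton[of L]
        by (subst AE_restrict_space_iff) (auto intro: AE_completion elim: AE_mp)
      then show "AE s in ?M. (\<lambda>n. h n (?e s) *\<^sub>R w s) \<longlonglongrightarrow> indicator C s *\<^sub>R w s"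
      proof (rule AE_mp, intro AE_I2 impI)
        fix s assume s: "s \<in> space ?M" "s \<noteq> L"
        have "(\<lambda>n. h n (?e s)) \<longlonglongrightarrow> indicator C s"
        proof (cases "s \<in> C")
          case True
          then have "infdist (?e s) K = 0" unfolding K_def by (intro infdist_zero) auto
          then show ?thesis using True by (simp add: h_def)
        next
          case False
          have "?e s \<notin> K"
          proof
            assume "?e s \<in> K"
            then obtain c where "c \<in> C" "?e s = ?e c" unfolding K_def by auto
            then show False
              using inj_onD[OF inj_on_circle_point[OF L], of s c] s C False by (auto simp: circle_measure_simps subset_iff)
          qed
          then have pos: "0 < infdist (?e s) K" using K by (metis in_closed_iff_infdist_zero infdist_pos_not_in_closed)
          have "\<forall>\<^sub>F n in sequentially. h n (?e s) = 0"
            using eventually_ge_at_top[of "nat \<lceil>1 / infdist (?e s) K\<rceil>"]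
          proof eventually_elim
            case (elim n)
            then have "1 / infdist (?e s) K \<le> real n" by linarith
            then show ?case using pos by (simp add: h_def field_simps)
          qed
          then show ?thesis using False by (simp add: tendsto_eventually)
        qed
        then show "(\<lambda>n. h n (?e s) *\<^sub>R w s) \<longlonglongrightarrow> indicator C s *\<^sub>R w s" by (intro tendsto_scaleR tendsto_const)
      qed
    qed
    then show ?thesis using cont[OF hc] by (simp add: LIMSEQ_const_iff)
  qed simp
  have "set_lebesgue_integral ?M A w = 0" if A: "A \<in> sets ?M" for A
  proof -
    have AL: "A \<in> sets lebesgue" "A \<subseteq> {0..L}"
      using A by (auto simp: circle_measure_def sets_restrict_space_iff)
    then have "A \<inter> {0..<L} \<in> sets lebesgue" by auto
    \<comment> \<open>Up to a null set a measurable set is a countable union of closed sets. Finite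
      unions of these are closed and increase to it, so dominated convergence applies.\<close>
    then obtain C T where C: "fsigma C" "T \<in> null_sets lebesgue" "C \<union> T = A \<inter> {0..<L}" "disjnt C T"
      by (rule lebesgue_set_almost_fsigma)
    obtain F :: "nat \<Rightarrow> real set" where F: "\<And>n. closed (F n)" "C = (\<Union>n. F n)"
      using C(1) by (auto elim!: fsigma.cases)
    define G where "G n = (\<Union>k\<le>n. F k)" for n
    have G: "closed (G n)" "G n \<subseteq> {0..<L}" for n
      using F C(3) by (auto simp: G_def)
    have ind: "(\<lambda>n. indicator (G n) s :: real) \<longlonglongrightarrow> indicator C s" for s
    proof (cases "s \<in> C")
      case True
      then obtain k where "s \<in> F k" using F by auto
      have "\<forall>\<^sub>F n in sequentially. indicator (G n) s = (1::real)"
        using eventually_ge_at_top[of k] by eventually_elim (use \<open>s \<in> F k\<close> in \<open>auto simp: G_def indicator_def\<close>)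
      then show ?thesis using True by (simp add: tendsto_eventually)
    next
      case False
      then have "\<And>n. s \<notin> G n" using F by (auto simp: G_def)
      then show ?thesis using False by simp
    qed
    have Cm: "C \<in> sets borel" using F by auto
    have "(\<lambda>n. \<integral>s. indicator (G n) s *\<^sub>R w s \<partial>?M) \<longlonglongrightarrow> (\<integral>s. indicator C s *\<^sub>R w s \<partial>?M)"
    proof (rule integral_dominated_convergence[where w = "\<lambda>s. norm (w s)"])
      show "(\<lambda>s. indicator C s *\<^sub>R w s) \<in> borel_measurable ?M"
        using Cm by (intro borel_measurable_scaleR circle_measure_simps(3)[OF borel_measurable_indicator] borel_measurable_integrable[OF w]) auto
      show "(\<lambda>s. indicator (G n) s *\<^sub>R w s) \<in> borel_measurable ?M" for n
        using G(1)[of n] by (intro borel_measurable_scaleR circle_measure_simps(3)[OF borel_measurable_indicator] borel_measurable_integrable[OF w]) auto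
      show "AE s in ?M. (\<lambda>n. indicator (G n) s *\<^sub>R w s) \<longlonglongrightarrow> indicator C s *\<^sub>R w s"
        by (intro AE_I2 tendsto_scaleR tendsto_const ind)
    qed (use w in \<open>auto simp: indicator_def\<close>)
    then have "(\<integral>s. indicator C s *\<^sub>R w s \<partial>?M) = 0" using closed_zero[OF G] by (simp add: LIMSEQ_const_iff)
    moreover have "(\<integral>s. indicator A s *\<^sub>R w s \<partial>?M) = (\<integral>s. indicator C s *\<^sub>R w s \<partial>?M)"
    proof (rule integral_cong_AE)
      show "(\<lambda>s. indicator A s *\<^sub>R w s) \<in> borel_measurable ?M" using A w by auto
      show "(\<lambda>s. indicator C s *\<^sub>R w s) \<in> borel_measurable ?M"
        using Cm by (intro borel_measurable_scaleR circle_measure_simps(3)[OF borel_measurable_indicator] borel_measurable_integrable[OF w]) auto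
      have "negligible (insert L T)" using C(2) by (simp add: negligible_iff_null_sets)
      then have "AE s in lebesgue. s \<notin> insert L T"
        unfolding eventually_ae_filter_negligible by (intro exI[of _ "insert L T"]) auto
      then have "AE s in lebesgue. s \<in> {0..L} \<longrightarrow> indicator A s *\<^sub>R w s = indicator C s *\<^sub>R w s"
      proof eventually_elim
        case (elim s)
        have "s \<in> A \<longleftrightarrow> s \<in> C" if "s \<in> {0..L}"
          using elim that set_eq_iff[THEN iffD1, OF C(3), rule_format, of s] by auto
        then show ?case by (simp add: indicator_def)
      qed
      then show "AE s in ?M. indicator A s *\<^sub>R w s = indicator C s *\<^sub>R w s"
        unfolding circle_measure_def by (subst AE_restrict_space_iff) simp_all
    qed
    ultimately show ?thesis by (simp add: set_lebesgue_integral_def)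
  qed
  then show ?thesis using density_zero[OF w] by blast
qed

section \<open>Periodic statements almost everywhere and Borel representatives\<close>

lemma AE_lebesgue_translation:
  assumes "AE x in lebesgue. P (x::real)"
  shows "AE x in lebesgue. P (x + c)"
proof -
  obtain N where N: "negligible N" "{x. \<not> P x} \<subseteq> N"
    using assms unfolding eventually_ae_filter_negligible by blast
  have "{x. \<not> P (x + c)} \<subseteq> (+) (- c) ` N"
  proof
    fix x assume "x \<in> {x. \<not> P (x + c)}"
    then have "x + c \<in> N" using N by auto
    then have "- c + (x + c) \<in> (+) (- c) ` N" by blast
    then show "x \<in> (+) (- c) ` N" by simp
  qed
  then show ?thesis
    unfolding eventually_ae_filter_negligible using negligible_translation[OF N(1)] by blast
qed

lemma AE_circle_iff: "(AE s in circle_measure L. P s) \<longleftrightarrow> (AE s in lebesgue. s \<in> {0..L} \<longrightarrow> P s)"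
  unfolding circle_measure_def by (subst AE_restrict_space_iff) simp_all

text \<open>The translates of a null set by multiples of L are countably many, so their union is
  still null, and every point has a translate in one period.\<close>

lemma AE_periodic:
  assumes L: "0 < L" and P: "periodic_fun_simple P L" and AE: "AE s in circle_measure L. P s"
  shows "AE s in lebesgue. P s"
proof -
  have "AE s in lebesgue. s + of_int k * L \<in> {0..L} \<longrightarrow> P (s + of_int k * L)" for k :: int
    using AE_lebesgue_translation[OF AE[unfolded AE_circle_iff], of "of_int k * L"] .
  then have "AE s in lebesgue. \<forall>k::int. s + of_int k * L \<in> {0..L} \<longrightarrow> P (s + of_int k * L)"
    unfolding AE_all_countable by blast
  then show ?thesis
  proof eventually_elim
    case (elim s)
    have "s + of_int (- \<lfloor>s / L\<rfloor>) * L = s rmod L" using rmod_decomp[OF L, of s] by (simp add: mult.commute)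
    then have "s + of_int (- \<lfloor>s / L\<rfloor>) * L \<in> {0..L}" using rmod_nonneg[of L s] rmod_less[OF L, of s] L by simp
    with elim have "P (s + of_int (- \<lfloor>s / L\<rfloor>) * L)" by blast
    then show ?case unfolding periodic_add_int(1)[OF P] .
  qed
qed

lemma periodic_rmod:
  assumes "0 < L" "periodic_fun_simple g L" shows "g (x rmod L) = g x"
  using periodic_add_int(2)[OF assms(2), of "x rmod L" "\<lfloor>x / L\<rfloor>"] rmod_decomp[OF assms(1), of x] by simp

lemma rmod_add_period: "0 < L \<Longrightarrow> (x + L) rmod L = x rmod L"
  by (simp add: rmod_def add_divide_distrib distrib_left)

text \<open>Real representatives of the finitely many coordinates are recombined along the
  basis.\<close>

lemma completion_ex_borel_measurable_euclidean:
  fixes g :: "'b \<Rightarrow> 'a::euclidean_space"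
  assumes g: "g \<in> borel_measurable (completion M)"
  shows "\<exists>g'\<in>borel_measurable M. AE x in M. g x = g' x"
proof -
  have "\<forall>b. \<exists>h. h \<in> borel_measurable M \<and> (AE x in M. g x \<bullet> b = h x)"
  proof
    fix b
    have "(\<lambda>x. g x \<bullet> b) \<in> borel_measurable (completion M)" using g by simp
    from completion_ex_borel_measurable_real[OF this]
    show "\<exists>h. h \<in> borel_measurable M \<and> (AE x in M. g x \<bullet> b = h x)" unfolding Bex_def .
  qed
  from choice[OF this] obtain h where H: "\<forall>b. h b \<in> borel_measurable M \<and> (AE x in M. g x \<bullet> b = h b x)" ..
  have h: "h b \<in> borel_measurable M" "AE x in M. g x \<bullet> b = h b x" for b
    by (rule conjunct1[OF spec[OF H]], rule conjunct2[OF spec[OF H]])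
  have "AE x in M. \<forall>b\<in>Basis. g x \<bullet> b = h b x" by (rule AE_finite_allI[OF finite_Basis h(2)])
  then have "AE x in M. g x = (\<Sum>b\<in>Basis. h b x *\<^sub>R b)"
  proof eventually_elim
    case (elim x)
    have "g x = (\<Sum>b\<in>Basis. (g x \<bullet> b) *\<^sub>R b)" by (rule euclidean_representation[symmetric])
    also have "\<dots> = (\<Sum>b\<in>Basis. h b x *\<^sub>R b)" using elim by (intro sum.cong refl) (simp only:)
    finally show ?case .
  qed
  moreover have "(\<lambda>x. \<Sum>b\<in>Basis. h b x *\<^sub>R b) \<in> borel_measurable M"
    by (intro borel_measurable_sum borel_measurable_scaleR h(1) borel_measurable_const)
  ultimately show ?thesis by (intro bexI)
qed

text \<open>Replacing bad values by a point of the closed set \<open>Q\<close> makes a bound that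
  holds almost everywhere hold everywhere. \<open>Q\<close> is the unit sphere for the tangent and a
  ball for the perturbations.\<close>

lemma borel_representative:
  fixes v :: "real \<Rightarrow> 'a::euclidean_space"
  assumes L: "0 < L" and per: "periodic_fun_simple v L" and v: "v \<in> borel_measurable (circle_measure L)"
    and Q: "closed Q" "z \<in> Q" "AE s in circle_measure L. v s \<in> Q"
  obtains w where "w \<in> borel_measurable borel" "periodic_fun_simple w L" "\<And>x. w x \<in> Q" "AE x in lebesgue. v x = w x"
proof -
  have "(\<lambda>x. indicator {0..L} x *\<^sub>R v x) \<in> borel_measurable lebesgue"
    using v unfolding circle_measure_def by (subst (asm) borel_measurable_restrict_space_iff) (auto simp: mult.commute)
  then obtain w0 where w0: "w0 \<in> borel_measurable lborel" "AE x in lborel. indicator {0..L} x *\<^sub>R v x = w0 x"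
    using completion_ex_borel_measurable_euclidean by blast
  \<comment> \<open>Evaluation modulo L makes the modified function periodic; the value z replaces
    all values outside Q.\<close>
  define w where "w x = (if w0 (x rmod L) \<in> Q then w0 (x rmod L) else z)" for x
  have [measurable]: "w0 \<in> borel_measurable borel" using w0(1) by simp
  have [measurable]: "Q \<in> sets borel" using Q(1) by simp
  have wb: "w \<in> borel_measurable borel" unfolding w_def by measurable
  have wp: "periodic_fun_simple w L" unfolding periodic_fun_simple_def w_def rmod_add_period[OF L] by simp
  have wQ: "w x \<in> Q" for x using Q(2) by (simp add: w_def)
  have "AE x in lebesgue. x \<noteq> L" using AE_completion[OF AE_lborel_singleton[of L]] .
  moreover have "AE x in lebesgue. indicator {0..L} x *\<^sub>R v x = w0 x" by (rule AE_completion[OF w0(2)])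
  moreover have "AE s in lebesgue. s \<in> {0..L} \<longrightarrow> v s \<in> Q" using Q(3) unfolding AE_circle_iff .
  ultimately have "AE x in lebesgue. x \<in> {0..L} \<longrightarrow> v x = w x"
  proof eventually_elim
    case (elim x)
    show ?case
    proof
      assume x: "x \<in> {0..L}"
      then have "x rmod L = x" using elim(1) L by (intro rmod_unique[of _ _ _ 0]) auto
      then show "v x = w x" using elim x by (simp add: w_def)
    qed
  qed
  moreover have "periodic_fun_simple (\<lambda>x. v x = w x) L" using per wp by (simp add: periodic_fun_simple_def)
  ultimately have "AE x in lebesgue. v x = w x"
    unfolding AE_circle_iff[symmetric] by (intro AE_periodic[OF L])
  then show thesis by (rule that[OF wb wp wQ])
qed

section \<open>Periodic primitives and integration by parts\<close>

lemma integral_lebesgue_on_lborel: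
  fixes g :: "real \<Rightarrow> 'a::euclidean_space"
  assumes "g \<in> borel_measurable borel" "S \<in> sets borel"
  shows "(\<integral>x. g x \<partial>lebesgue_on S) = (\<integral>x. indicator S x *\<^sub>R g x \<partial>lborel)"
proof -
  have "(\<integral>x. g x \<partial>lebesgue_on S) = (\<integral>x. indicator S x *\<^sub>R g x \<partial>lebesgue)"
    using assms(2) by (intro integral_restrict_space) simp
  also have "\<dots> = (\<integral>x. indicator S x *\<^sub>R g x \<partial>lborel)"
    using assms by (intro integral_completion) auto
  finally show ?thesis .
qed

lemma integral_derivative:
  fixes F f :: "real \<Rightarrow> 'a::euclidean_space"
  assumes "a \<le> b" "\<And>x. (F has_vector_derivative f x) (at x)" "continuous_on UNIV f"
  shows "(\<integral>x. f x \<partial>lebesgue_on {a..b}) = F b - F a"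
proof -
  have "(\<integral>x. f x \<partial>lebesgue_on {a..b}) = (\<integral>x. indicator {a..b} x *\<^sub>R f x \<partial>lborel)"
    using assms(3) by (intro integral_lebesgue_on_lborel borel_measurable_continuous_onI) auto
  also have "\<dots> = F b - F a"
  proof (rule integral_FTC_atLeastAtMost[of a b F f])
    show "(F has_vector_derivative f x) (at x within {a..b})" for x
      using has_vector_derivative_at_within[OF assms(2)] .
  qed (use assms(1) continuous_on_subset[OF assms(3)] in auto)
  finally show ?thesis .
qed

context
  fixes u :: "real \<Rightarrow> 'a::euclidean_space" and N :: real
  assumes u: "u \<in> borel_measurable borel" "\<And>x. norm (u x) \<le> N"
begin

lemma integrable_lebesgue_on_bounded: "integrable (lebesgue_on {a..b}) u"
proof -
  interpret finite_measure "lebesgue_on {a..b}" by (rule finite_measure_lebesgue_on) simp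
  show ?thesis
    using u by (intro integrable_const_bound[of _ N] measurable_restrict_space1 measurable_completion) auto
qed

lemma integral_lebesgue_on_combine:
  assumes "a \<le> b" "b \<le> c"
  shows "(\<integral>x. u x \<partial>lebesgue_on {a..b}) + (\<integral>x. u x \<partial>lebesgue_on {b..c}) = (\<integral>x. u x \<partial>lebesgue_on {a..c})"
proof -
  have "u integrable_on {a..c}"
    using integrable_lebesgue_on_bounded by (rule integrable_on_lebesgue_on) simp
  note * = Henstock_Kurzweil_Integration.integral_combine[OF assms this]
  have e: "(\<integral>x. u x \<partial>lebesgue_on {x..y}) = integral {x..y} u" for x y
    by (rule lebesgue_integral_eq_integral[OF integrable_lebesgue_on_bounded]) simp
  show ?thesis unfolding e by (rule *)
qed

lemma integral_lebesgue_on_shift: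
  assumes "periodic_fun_simple u L" "a < b"
  shows "(\<integral>x. u x \<partial>lebesgue_on {a + of_int k * L..b + of_int k * L}) = (\<integral>x. u x \<partial>lebesgue_on {a..b})"
proof -
  have b: "a + of_int k * L + (b - a) = b + of_int k * L" by simp
  have "u (a + of_int k * L + (b - a) * x) = u (a + (b - a) * x)" for x
    using periodic_add_int(1)[OF assms(1), of "a + (b - a) * x" k] by (simp add: algebra_simps)
  then show ?thesis
    using assms(2) integral_arc[OF u(1), of "b - a" "a + of_int k * L"] integral_arc[OF u(1), of "b - a" a] unfolding b by simp
qed

lemma integral_point_zero: "(\<integral>x. u x \<partial>lebesgue_on {a..a}) = 0"
  using integral_lebesgue_on_combine[OF order_refl order_refl, of a] by (simp only: add_cancel_left_right)

text \<open>As u has zero mean, the primitive from 0 returns to 0 after a full period. It may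
  therefore be evaluated modulo L, also when the arc crosses a multiple of L.\<close>

lemma integral_arc_primitive:
  assumes L: "0 < L" and per: "periodic_fun_simple u L" and z: "(\<integral>x. u x \<partial>lebesgue_on {0..L}) = 0"
    and ab: "a \<le> b" "b \<le> a + L"
  shows "(\<integral>x. u x \<partial>lebesgue_on {0..b rmod L}) - (\<integral>x. u x \<partial>lebesgue_on {0..a rmod L}) = (\<integral>x. u x \<partial>lebesgue_on {a..b})"
proof -
  define I where "I x y = (\<integral>z. u z \<partial>lebesgue_on {x..y})" for x y
  have comb: "I x y + I y w = I x w" if "x \<le> y" "y \<le> w" for x y w
    unfolding I_def by (rule integral_lebesgue_on_combine[OF that])
  have shift: "I (x + of_int k * L) (y + of_int k * L) = I x y" if "x \<le> y" for x y k
  proof (cases "x = y")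
    case True
    then show ?thesis unfolding I_def by (simp only: integral_point_zero)
  next
    case False
    then show ?thesis unfolding I_def using that by (intro integral_lebesgue_on_shift[OF per]) simp
  qed
  define k where "k = \<lfloor>a / L\<rfloor>"
  define a0 b0 where "a0 = a rmod L" and "b0 = b - of_int k * L"
  have a: "a = a0 + of_int k * L" using rmod_decomp[OF L, of a] by (simp add: a0_def k_def mult.commute)
  have a0: "0 \<le> a0" "a0 < L" using rmod_nonneg[of L a] rmod_less[OF L, of a] L by (simp_all add: a0_def)
  have b: "b = b0 + of_int k * L" by (simp add: b0_def)
  have b0: "a0 \<le> b0" "b0 \<le> a0 + L" using ab a b by linarith+
  have "I a b = I a0 b0" using shift[OF b0(1), of k] a b by simp
  moreover have "I 0 (b rmod L) - I 0 a0 = I a0 b0"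
  proof (cases "b0 < L")
    case True
    then have "b rmod L = b0" using a0 b0 b by (intro rmod_unique[of _ _ _ k]) auto
    then show ?thesis using comb[of 0 a0 b0] a0 b0 by (simp add: algebra_simps)
  next
    case False
    then have r: "b rmod L = b0 - L" using a0 b0 b by (intro rmod_unique[of _ _ _ "k + 1"]) (auto simp: algebra_simps)
    have "I 0 a0 + I a0 L = 0" using comb[of 0 a0 L] a0 z by (simp add: I_def)
    then have "I a0 L = - I 0 a0" by (simp add: eq_neg_iff_add_eq_0 add.commute)
    moreover have "I a0 L + I L b0 = I a0 b0" using comb[of a0 L b0] a0 False by simp
    moreover have "I L b0 = I 0 (b0 - L)" using shift[of 0 "b0 - L" 1] False by simp
    ultimately show ?thesis using r by simp
  qed
  ultimately show ?thesis by (simp add: I_def a0_def)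
qed

text \<open>Integration by parts for a function u that is merely bounded and measurable: the order
  of integration over the triangle \<open>r \<le> s\<close> is exchanged, the inner integral of the
  derivative is explicit, and the boundary term at L vanishes because u has zero mean.\<close>

lemma Fubini_primitive:
  assumes L: "0 < L" and z: "(\<integral>x. u x \<partial>lebesgue_on {0..L}) = 0"
    and \<eta>: "\<And>x. (\<eta> has_real_derivative \<eta>' x) (at x)" "continuous_on UNIV \<eta>'"
  shows "(\<integral>s. \<eta>' s *\<^sub>R (\<integral>x. u x \<partial>lebesgue_on {0..s}) \<partial>lebesgue_on {0..L}) = - (\<integral>s. \<eta> s *\<^sub>R u s \<partial>lebesgue_on {0..L})"
proof -
  define P where "P = restrict_space lborel {0..L}"
  interpret P: finite_measure P unfolding P_def
    using L by (intro finite_measureI) (simp add: space_restrict_space emeasure_restrict_space)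
  interpret PP: pair_sigma_finite P P ..
  have Pm: "g \<in> borel_measurable P" if "g \<in> borel_measurable borel" for g :: "real \<Rightarrow> 'c::topological_space"
    unfolding P_def by (intro measurable_restrict_space1) (use that in simp)
  have Pid [measurable]: "(\<lambda>x. x) \<in> borel_measurable P" by (rule Pm) simp
  have Pint: "(\<integral>x. g x \<partial>P) = (\<integral>x. g x \<partial>lebesgue_on {0..L})" if "g \<in> borel_measurable borel" for g :: "real \<Rightarrow> 'a"
    unfolding P_def using that by (subst integral_restrict_space) (auto simp: integral_lebesgue_on_lborel)
  have \<eta>c: "continuous_on UNIV \<eta>"
    using DERIV_isCont[OF \<eta>(1)] by (simp add: continuous_on_eq_continuous_at)
  have \<eta>b [measurable]: "\<eta>' \<in> borel_measurable borel" "\<eta> \<in> borel_measurable borel"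
    by (intro borel_measurable_continuous_onI \<eta>c \<eta>(2))+
  note [measurable] = u(1)
  define f where "f r s = (if r \<le> s then \<eta>' s else 0) *\<^sub>R u r" for r s
  obtain B where B: "\<forall>s\<in>{0..L}. \<bar>\<eta>' s\<bar> \<le> B"
    using compact_imp_bounded[OF compact_continuous_image[OF continuous_on_subset[OF \<eta>(2)] compact_Icc[of 0 L]]]
    by (auto simp: bounded_iff)
  have [measurable]: "fst \<in> borel_measurable (P \<Otimes>\<^sub>M P)" "snd \<in> borel_measurable (P \<Otimes>\<^sub>M P)"
    using measurable_compose[OF measurable_fst Pid] measurable_compose[OF measurable_snd Pid] by simp_all
  have "(\<lambda>q. f (fst q) (snd q)) \<in> borel_measurable (P \<Otimes>\<^sub>M P)" unfolding f_def by measurable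
  then have fm: "case_prod f \<in> borel_measurable (P \<Otimes>\<^sub>M P)" by (simp add: case_prod_beta')
  interpret fin: finite_measure "P \<Otimes>\<^sub>M P"
    by (rule finite_measure_pair_measure) unfold_locales
  have fi: "integrable (P \<Otimes>\<^sub>M P) (case_prod f)"
  proof (rule fin.integrable_const_bound[of _ "B * N"])
    show "AE x in P \<Otimes>\<^sub>M P. norm (case_prod f x) \<le> B * N"
    proof (intro AE_I2)
      fix x assume "x \<in> space (P \<Otimes>\<^sub>M P)"
      then have s: "snd x \<in> {0..L}" by (auto simp: space_pair_measure P_def space_restrict_space)
      have "\<bar>if fst x \<le> snd x then \<eta>' (snd x) else 0\<bar> \<le> B"
        using bspec[OF B s] abs_ge_zero[of "\<eta>' (snd x)"] by auto
      then have "\<bar>if fst x \<le> snd x then \<eta>' (snd x) else 0\<bar> * norm (u (fst x)) \<le> B * N"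
        using u(2) by (intro mult_mono) (auto intro: order_trans[OF abs_ge_zero])
      then show "norm (case_prod f x) \<le> B * N" by (simp add: f_def case_prod_beta')
    qed
  qed (rule fm)
  have inner1: "(\<integral>r. f r s \<partial>P) = \<eta>' s *\<^sub>R (\<integral>x. u x \<partial>lebesgue_on {0..s})" if "s \<in> {0..L}" for s
  proof -
    have eq: "indicator {0..L} r *\<^sub>R f r s = \<eta>' s *\<^sub>R (indicator {0..s} r *\<^sub>R u r)" for r
      using that by (simp add: f_def indicator_def)
    have "(\<integral>r. f r s \<partial>P) = (\<integral>r. \<eta>' s *\<^sub>R (indicator {0..s} r *\<^sub>R u r) \<partial>lborel)"
      unfolding P_def eq[symmetric] by (rule integral_restrict_space) simp
    also have "\<dots> = \<eta>' s *\<^sub>R (\<integral>r. indicator {0..s} r *\<^sub>R u r \<partial>lborel)"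
      using integrable_lebesgue_on_bounded[of 0 s]
      by (simp add: integrable_restrict_space integrable_completion del: scaleR_scaleR)
    finally show ?thesis by (simp add: integral_lebesgue_on_lborel[OF u(1)])
  qed
  have inner2: "(\<integral>s. f r s \<partial>P) = (\<eta> L - \<eta> r) *\<^sub>R u r" if r: "r \<in> {0..L}" for r
  proof -
    have ftc: "(\<integral>s. indicator {r..L} s *\<^sub>R \<eta>' s \<partial>lborel) = \<eta> L - \<eta> r"
    proof (rule integral_FTC_atLeastAtMost[of r L \<eta> \<eta>'])
      show "(\<eta> has_vector_derivative \<eta>' x) (at x within {r..L})" for x
        using has_vector_derivative_at_within[OF \<eta>(1)[unfolded has_real_derivative_iff_has_vector_derivative]] .
    qed (use r continuous_on_subset[OF \<eta>(2)] in auto)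
    have eq: "indicator {0..L} s *\<^sub>R f r s = (indicator {r..L} s *\<^sub>R \<eta>' s) *\<^sub>R u r" for s
      using r by (simp add: f_def indicator_def)
    have "(\<integral>s. f r s \<partial>P) = (\<integral>s. (indicator {r..L} s *\<^sub>R \<eta>' s) *\<^sub>R u r \<partial>lborel)"
      unfolding P_def eq[symmetric] by (rule integral_restrict_space) simp
    also have "\<dots> = (\<integral>s. indicator {r..L} s *\<^sub>R \<eta>' s \<partial>lborel) *\<^sub>R u r"
      by (rule integral_scaleR_left, rule borel_integrable_atLeastAtMost'[unfolded set_integrable_def],
          rule continuous_on_subset[OF \<eta>(2)]) simp
    finally show ?thesis unfolding ftc .
  qed
  have sP: "space P = {0..L}" by (simp add: P_def space_restrict_space)
  have "(\<integral>s. (\<integral>r. f r s \<partial>P) \<partial>P) = (\<integral>r. (\<integral>s. f r s \<partial>P) \<partial>P)"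
    by (rule PP.Fubini_integral[OF fi])
  moreover have "(\<integral>s. (\<integral>r. f r s \<partial>P) \<partial>P) = (\<integral>s. \<eta>' s *\<^sub>R (\<integral>x. u x \<partial>lebesgue_on {0..s}) \<partial>lebesgue_on {0..L})"
  proof -
    have "(\<integral>s. (\<integral>r. f r s \<partial>P) \<partial>P) = (\<integral>s. (\<integral>r. f r s \<partial>P) \<partial>lebesgue_on {0..L})"
    proof (rule Pint)
      show "(\<lambda>s. \<integral>r. f r s \<partial>P) \<in> borel_measurable borel"
        unfolding f_def by measurable
    qed
    also have "\<dots> = (\<integral>s. \<eta>' s *\<^sub>R (\<integral>x. u x \<partial>lebesgue_on {0..s}) \<partial>lebesgue_on {0..L})"
      by (intro Bochner_Integration.integral_cong) (auto simp: inner1)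
    finally show ?thesis .
  qed
  moreover have "(\<integral>r. (\<integral>s. f r s \<partial>P) \<partial>P) = - (\<integral>s. \<eta> s *\<^sub>R u s \<partial>lebesgue_on {0..L})"
  proof -
    have iu: "integrable (lebesgue_on {0..L}) u" by (rule integrable_lebesgue_on_bounded)
    have i\<eta>: "integrable (lebesgue_on {0..L}) (\<lambda>r. \<eta> r *\<^sub>R u r)"
    proof -
      obtain C where "\<forall>s\<in>{0..L}. \<bar>\<eta> s\<bar> \<le> C"
        using compact_imp_bounded[OF compact_continuous_image[OF continuous_on_subset[OF \<eta>c] compact_Icc[of 0 L]]]
        by (auto simp: bounded_iff)
      then show ?thesis
        by (intro integrable_bounded_scaleR[OF iu, of _ C] measurable_restrict_space1 measurable_completion) auto
    qed
    have "(\<integral>r. (\<integral>s. f r s \<partial>P) \<partial>P) = (\<integral>r. (\<eta> L - \<eta> r) *\<^sub>R u r \<partial>P)"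
      by (intro Bochner_Integration.integral_cong) (auto simp: inner2 sP)
    also have "\<dots> = (\<integral>r. \<eta> L *\<^sub>R u r - \<eta> r *\<^sub>R u r \<partial>lebesgue_on {0..L})"
      by (subst Pint) (auto simp: scaleR_diff_left)
    also have "\<dots> = - (\<integral>s. \<eta> s *\<^sub>R u s \<partial>lebesgue_on {0..L})"
      using iu i\<eta> z by simp
    finally show ?thesis .
  qed
  ultimately show ?thesis by simp
qed

end

lemma smooth_continuous:
  fixes h :: "real \<Rightarrow> real"
  assumes "smooth h" shows "continuous_on UNIV h"
  using assms unfolding smooth_def
  by (metis continuous_at_imp_continuous_on has_vector_derivative_continuous)

lemma continuous_bounded_Icc:
  fixes h :: "real \<Rightarrow> real"
  assumes "continuous_on UNIV h"
  shows "\<exists>B. \<forall>s\<in>{a..b}. \<bar>h s\<bar> \<le> B"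
proof -
  have "bounded (h ` {a..b})"
    by (intro compact_imp_bounded compact_continuous_image continuous_on_subset[OF assms]) auto
  then show ?thesis by (auto simp: bounded_iff)
qed

lemma borel_measurable_continuous_lebesgue_on:
  fixes h :: "real \<Rightarrow> real"
  assumes "continuous_on UNIV h"
  shows "h \<in> borel_measurable (lebesgue_on {a..b})"
  using borel_measurable_continuous_onI[OF assms] by (intro measurable_restrict_space1 measurable_completion) simp

lemma integrable_continuous_lebesgue_on:
  fixes h :: "real \<Rightarrow> real"
  assumes "continuous_on UNIV h"
  shows "integrable (lebesgue_on {a..b}) h"
proof -
  interpret finite_measure "lebesgue_on {a..b}" by (rule finite_measure_lebesgue_on) simp
  obtain B where "\<forall>s\<in>{a..b}. \<bar>h s\<bar> \<le> B" using continuous_bounded_Icc[OF assms] by blast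
  then show ?thesis
    by (intro integrable_const_bound[of _ B] AE_I2 borel_measurable_continuous_lebesgue_on assms)
       (simp add: space_restrict_space)
qed

text \<open>After subtraction of the mean the increment of the antiderivative over one period does
  not depend on the starting point, its derivative being 0, and equals the zero integral over
  \<open>[0, L]\<close>.\<close>

lemma smooth_periodic_antiderivative:
  fixes h :: "real \<Rightarrow> real"
  assumes L: "0 < L" and h: "smooth h" "periodic_fun_simple h L"
  defines "m \<equiv> (\<integral>s. h s \<partial>lebesgue_on {0..L}) / L"
  obtains \<eta> where "smooth \<eta>" "periodic_fun_simple \<eta> L" "\<And>s. (\<eta> has_real_derivative h s - m) (at s)"
proof -
  have c: "continuous_on UNIV h" by (rule smooth_continuous[OF h(1)])
  then have "\<And>x. isCont (\<lambda>s. h s - m) x" by (auto simp: continuous_on_eq_continuous_at)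
  then obtain \<eta> where \<eta>: "(\<eta> has_vector_derivative h s - m) (at s)" for s
    using einterval_antiderivative[of "-\<infinity>" "\<infinity>" "\<lambda>s. h s - m"] by auto
  obtain D where D: "D 0 = h" "\<And>k s. (D k has_vector_derivative D (Suc k) s) (at s)"
    using h(1) unfolding smooth_def by blast
  \<comment> \<open>The derivatives of h shifted by one place; the mean m shows up in the first
    derivative of the antiderivative only.\<close>
  define D' where "D' k = (case k of 0 \<Rightarrow> \<eta> | Suc 0 \<Rightarrow> (\<lambda>s. h s - m) | Suc (Suc j) \<Rightarrow> D (Suc j))" for k
  have "(D' k has_vector_derivative D' (Suc k) s) (at s)" for k s
  proof -
    have "((\<lambda>s. h s - m) has_vector_derivative D (Suc 0) s) (at s)"
      using has_vector_derivative_diff[OF D(2)[of 0 s] has_vector_derivative_const[of m]] by (simp add: D(1))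
    then show ?thesis using \<eta> D by (auto simp: D'_def split: nat.splits)
  qed
  moreover have "D' 0 = \<eta>" by (simp add: D'_def)
  ultimately have s: "smooth \<eta>" unfolding smooth_def by blast
  have dr: "(\<eta> has_real_derivative h s - m) (at s)" for s
    using \<eta> by (simp add: has_real_derivative_iff_has_vector_derivative)
  have "((\<lambda>s. \<eta> (s + L) - \<eta> s) has_real_derivative 0) (at s)" for s
  proof -
    have "((\<lambda>s. \<eta> (s + L)) has_real_derivative h (s + L) - m) (at s)"
      using DERIV_shift[of \<eta> "h (s + L) - m" s L] dr by blast
    from DERIV_diff[OF this dr[of s]] show ?thesis using periodic_add[OF h(2)] by simp
  qed
  then have const: "\<eta> (s + L) - \<eta> s = \<eta> (0 + L) - \<eta> 0" for s
    using DERIV_isconst_all[of "\<lambda>s. \<eta> (s + L) - \<eta> s" s 0] by blast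
  have ih: "integrable (lebesgue_on {0..L}) h"
    by (rule integrable_continuous_lebesgue_on[OF c])
  have "\<eta> L - \<eta> 0 = (\<integral>s. h s - m \<partial>lebesgue_on {0..L})"
    using L c by (intro integral_derivative[symmetric] \<eta> continuous_intros) auto
  also have "\<dots> = 0" using L ih by (simp add: m_def measure_restrict_space)
  finally have "periodic_fun_simple \<eta> L" using const by (simp add: periodic_fun_simple_def)
  with s show thesis using dr by (rule that)
qed

text \<open>The argument of du Bois-Reymond. The constant test function gives u zero mean. Testing
  with periodic antiderivatives then shows that \<phi> minus the primitive of u is orthogonal to
  every smooth function of mean zero, hence constant almost everywhere.\<close>

lemma weak_derivative_primitive:
  fixes \<phi> \<phi>' u :: "real \<Rightarrow> 'a::euclidean_space"
  assumes L: "0 < L" and wd: "has_weak_deriv L \<phi> \<phi>'"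
    and u: "u \<in> borel_measurable borel" "\<And>x. norm (u x) \<le> N" and AEu: "AE x in lebesgue. \<phi>' x = u x"
  shows "(\<integral>x. u x \<partial>lebesgue_on {0..L}) = 0"
    "\<exists>c. AE s in circle_measure L. \<phi> s = c + (\<integral>x. u x \<partial>lebesgue_on {0..s})"
proof -
  let ?M = "lebesgue_on {0..L}"
  have N0: "0 \<le> N" by (rule order_trans[OF norm_ge_zero u(2)])
  have cm: "circle_measure L = ?M" by (simp add: circle_measure_def)
  interpret M: finite_measure ?M by (rule finite_measure_lebesgue_on) simp
  have i\<phi>: "integrable ?M \<phi>" using wd by (simp add: has_weak_deriv_def cm)
  have iu: "integrable ?M u" by (rule integrable_lebesgue_on_bounded[OF u])
  have mc: "h \<in> borel_measurable ?M" if "continuous_on UNIV h" for h :: "real \<Rightarrow> real"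
    by (rule borel_measurable_continuous_lebesgue_on[OF that])
  have isc: "integrable ?M (\<lambda>s. h s *\<^sub>R w s)" if hc: "continuous_on UNIV h" and hw: "integrable ?M w"
    for h :: "real \<Rightarrow> real" and w :: "real \<Rightarrow> 'a"
  proof -
    obtain B where "\<forall>s\<in>{0..L}. \<bar>h s\<bar> \<le> B" using continuous_bounded_Icc[OF hc] by blast
    then show ?thesis
      by (intro integrable_bounded_scaleR[OF hw mc[OF hc], of B]) (simp add: space_restrict_space)
  qed
  have weak: "(\<integral>s. deriv \<eta> s *\<^sub>R \<phi> s \<partial>?M) = - (\<integral>s. \<eta> s *\<^sub>R u s \<partial>?M)"
    if \<eta>: "smooth \<eta>" "periodic_fun_simple \<eta> L" for \<eta>
  proof -
    have "(\<integral>s. \<eta> s *\<^sub>R \<phi>' s \<partial>?M) = (\<integral>s. \<eta> s *\<^sub>R u s \<partial>?M)"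
    proof (rule integral_cong_AE_lebesgue_on)
      show "AE x in lebesgue. \<eta> x *\<^sub>R \<phi>' x = \<eta> x *\<^sub>R u x" using AEu by eventually_elim simp
      show "(\<lambda>x. \<eta> x *\<^sub>R u x) \<in> borel_measurable borel"
        using u(1) borel_measurable_continuous_onI[OF smooth_continuous[OF \<eta>(1)]] by measurable
    qed simp
    moreover have "(\<integral>s. deriv \<eta> s *\<^sub>R \<phi> s \<partial>?M) = - (\<integral>s. \<eta> s *\<^sub>R \<phi>' s \<partial>?M)"
      using wd \<eta> by (simp add: has_weak_deriv_def cm)
    ultimately show ?thesis by simp
  qed
  have s1: "smooth (\<lambda>s. 1 :: real)" unfolding smooth_def
    by (intro exI[of _ "\<lambda>k s. if k = 0 then 1 else 0"]) auto
  show z: "(\<integral>x. u x \<partial>?M) = 0" using weak[OF s1] by (simp add: periodic_fun_simple_def)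
  \<comment> \<open>The primitive of u, written as an expectation over the unit interval, for which
    measurability in s is known.\<close>
  define U where "U s = s *\<^sub>R (\<integral>x. u (0 + s * x) \<partial>unit_interval)" for s
  have U: "(\<integral>x. u x \<partial>lebesgue_on {0..s}) = U s" if "0 \<le> s" for s
  proof (cases "s = 0")
    case True
    show ?thesis unfolding True integral_point_zero[OF u] U_def by simp
  next
    case False
    then show ?thesis using integral_arc[OF u(1), of s 0] that by (simp add: U_def)
  qed
  have Um: "U \<in> borel_measurable borel" unfolding U_def
    by (intro borel_measurable_scaleR borel_measurable_expectation_arc[where A = "\<lambda>_. 0" and B = "\<lambda>s. s", OF u(1)]) auto
  have iU: "integrable ?M U"
  proof (rule M.integrable_const_bound[of _ "L * N"])
    show "AE x in ?M. norm (U x) \<le> L * N"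
    proof (rule AE_I2)
      fix s assume "s \<in> space ?M"
      then have s: "0 \<le> s" "s \<le> L" by (auto simp: space_restrict_space)
      have "norm (\<integral>x. u (0 + s * x) \<partial>unit_interval) \<le> N"
        by (rule unit.norm_expectation_le[OF borel_measurable_arc[OF u(1)] u(2)])
      then show "norm (U s) \<le> L * N" unfolding U_def using s L by (simp add: mult_mono)
    qed
    show "U \<in> borel_measurable ?M"
      using Um by (intro measurable_restrict_space1 measurable_completion) simp
  qed
  define w where "w s = \<phi> s - U s" for s
  have iw: "integrable ?M w" unfolding w_def using i\<phi> iU by simp
  define c where "c = (1 / L) *\<^sub>R (\<integral>s. w s \<partial>?M)"
  have "AE s in circle_measure L. w s - c = 0"
  proof (rule weak_zero_AE[OF L])
    show "integrable (circle_measure L) (\<lambda>s. w s - c)" unfolding cm using iw by simp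
    fix h :: "real \<Rightarrow> real" assume h: "smooth h" "periodic_fun_simple h L"
    define m where "m = (\<integral>s. h s \<partial>?M) / L"
    obtain \<eta> where \<eta>: "smooth \<eta>" "periodic_fun_simple \<eta> L" "\<And>s. (\<eta> has_real_derivative h s - m) (at s)"
      using smooth_periodic_antiderivative[OF L h] unfolding m_def by blast
    have cc: "continuous_on UNIV (\<lambda>s. h s - m)" "continuous_on UNIV h"
      using smooth_continuous[OF h(1)] by (auto intro: continuous_intros)
    have ih: "integrable ?M h" by (rule integrable_continuous_lebesgue_on[OF cc(2)])
    have d: "deriv \<eta> = (\<lambda>s. h s - m)" using \<eta>(3) DERIV_imp_deriv by blast
    have f1: "(\<integral>s. (h s - m) *\<^sub>R \<phi> s \<partial>?M) = - (\<integral>s. \<eta> s *\<^sub>R u s \<partial>?M)" using weak[OF \<eta>(1,2)] by (simp add: d)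
    have "(\<integral>s. (h s - m) *\<^sub>R U s \<partial>?M) = (\<integral>s. (h s - m) *\<^sub>R (\<integral>x. u x \<partial>lebesgue_on {0..s}) \<partial>?M)"
      by (intro Bochner_Integration.integral_cong) (auto simp: U space_restrict_space)
    then have f2: "(\<integral>s. (h s - m) *\<^sub>R U s \<partial>?M) = - (\<integral>s. \<eta> s *\<^sub>R u s \<partial>?M)"
      using Fubini_primitive[OF u L z \<eta>(3) cc(1)] by simp
    have "(\<integral>s. (h s - m) *\<^sub>R w s \<partial>?M) = 0"
      unfolding w_def scaleR_diff_right using f1 f2 isc[OF cc(1) i\<phi>] isc[OF cc(1) iU] by simp
    then have f3: "(\<integral>s. h s *\<^sub>R w s \<partial>?M) = m *\<^sub>R (\<integral>s. w s \<partial>?M)"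
      using isc[OF cc(2) iw] iw by (simp add: scaleR_diff_left)
    have "(\<integral>s. h s *\<^sub>R (w s - c) \<partial>?M) = (\<integral>s. h s *\<^sub>R w s \<partial>?M) - (\<integral>s. h s \<partial>?M) *\<^sub>R c"
      using isc[OF cc(2) iw] ih by (simp add: scaleR_diff_right)
    also have "\<dots> = 0" unfolding f3 c_def m_def by simp
    finally show "(\<integral>s. h s *\<^sub>R (w s - c) \<partial>circle_measure L) = 0" unfolding cm .
  qed
  then have "AE s in circle_measure L. \<phi> s = c + (\<integral>x. u x \<partial>lebesgue_on {0..s})"
    unfolding AE_circle_iff
  proof eventually_elim
    case (elim s)
    show ?case using elim U[of s] by (auto simp: w_def)
  qed
  then show "\<exists>c. AE s in circle_measure L. \<phi> s = c + (\<integral>x. u x \<partial>lebesgue_on {0..s})" by blast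
qed

text \<open>A function with a weak derivative agrees with a primitive only almost everywhere, so the
  fundamental theorem is stated between points of agreement. The primitive is evaluated modulo L to
  make this set of points periodic.\<close>

lemma weak_derivative_ftc:
  fixes \<phi> \<phi>' u :: "real \<Rightarrow> 'a::euclidean_space"
  assumes L: "0 < L" and wd: "has_weak_deriv L \<phi> \<phi>'" and per: "periodic_fun_simple u L"
    and u: "u \<in> borel_measurable borel" "\<And>x. norm (u x) \<le> N" and AEu: "AE x in lebesgue. \<phi>' x = u x"
  shows "\<exists>S. periodic_fun_simple (\<lambda>x. x \<in> S) L \<and> (AE x in lebesgue. x \<in> S) \<and>
    (\<forall>a\<in>S. \<forall>b\<in>S. a \<le> b \<longrightarrow> b \<le> a + L \<longrightarrow> \<phi> b - \<phi> a = (\<integral>x. u x \<partial>lebesgue_on {a..b}))"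
proof -
  note prim = weak_derivative_primitive[OF L wd u AEu]
  obtain c where c: "AE s in circle_measure L. \<phi> s = c + (\<integral>x. u x \<partial>lebesgue_on {0..s})"
    using prim(2) by blast
  define S where "S = {x. \<phi> x = c + (\<integral>y. u y \<partial>lebesgue_on {0..x rmod L})}"
  have \<phi>: "periodic_fun_simple \<phi> L" using wd by (simp add: has_weak_deriv_def)
  have pS: "periodic_fun_simple (\<lambda>x. x \<in> S) L"
    unfolding periodic_fun_simple_def S_def mem_Collect_eq rmod_add_period[OF L] periodic_add[OF \<phi>] by simp
  have "AE s in lebesgue. s \<noteq> L" using AE_completion[OF AE_lborel_singleton[of L]] .
  with c[unfolded AE_circle_iff] have "AE s in lebesgue. s \<in> {0..L} \<longrightarrow> s \<in> S"
  proof eventually_elim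
    case (elim s)
    show ?case
    proof
      assume s: "s \<in> {0..L}"
      then have "s rmod L = s" using elim(2) L by (intro rmod_unique[of _ _ _ 0]) auto
      then show "s \<in> S" using elim s by (simp add: S_def)
    qed
  qed
  then have "AE s in lebesgue. s \<in> S" unfolding AE_circle_iff[symmetric] by (rule AE_periodic[OF L pS])
  moreover have "\<phi> b - \<phi> a = (\<integral>x. u x \<partial>lebesgue_on {a..b})"
    if "a \<in> S" "b \<in> S" "a \<le> b" "b \<le> a + L" for a b
    using that(1,2) integral_arc_primitive[OF u L per prim(1) that(3,4)] by (simp add: S_def)
  ultimately show ?thesis using pS by (intro exI[of _ S]) simp
qed

lemma weak_derivative_unique:
  assumes L: "0 < L" and "has_weak_deriv L f v" "has_weak_deriv L f w"
  shows "AE s in circle_measure L. v s = w s"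
proof -
  have iv: "integrable (circle_measure L) v" and iw: "integrable (circle_measure L) w"
    using assms by (auto simp: has_weak_deriv_def)
  have "AE s in circle_measure L. v s - w s = 0"
  proof (rule weak_zero_AE[OF L])
    show "integrable (circle_measure L) (\<lambda>s. v s - w s)" using iv iw by simp
    fix \<eta> :: "real \<Rightarrow> real" assume \<eta>: "smooth \<eta>" "periodic_fun_simple \<eta> L"
    have c: "continuous_on UNIV \<eta>" by (rule smooth_continuous[OF \<eta>(1)])
    obtain B where B: "\<forall>s\<in>{0..L}. \<bar>\<eta> s\<bar> \<le> B" using continuous_bounded_Icc[OF c] by blast
    have i: "integrable (circle_measure L) (\<lambda>s. \<eta> s *\<^sub>R z s)" if "integrable (circle_measure L) z" for z :: "real \<Rightarrow> 'a"
      using B by (intro integrable_bounded_scaleR[OF that, of _ B] circle_measure_simps(3) borel_measurable_continuous_onI c)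
        (simp add: circle_measure_simps)
    have "(\<integral>s. deriv \<eta> s *\<^sub>R f s \<partial>circle_measure L) = - (\<integral>s. \<eta> s *\<^sub>R v s \<partial>circle_measure L)"
      "(\<integral>s. deriv \<eta> s *\<^sub>R f s \<partial>circle_measure L) = - (\<integral>s. \<eta> s *\<^sub>R w s \<partial>circle_measure L)"
      using assms(2,3) \<eta> by (simp_all add: has_weak_deriv_def)
    then have "(\<integral>s. \<eta> s *\<^sub>R v s \<partial>circle_measure L) = (\<integral>s. \<eta> s *\<^sub>R w s \<partial>circle_measure L)" by simp
    then show "(\<integral>s. \<eta> s *\<^sub>R (v s - w s) \<partial>circle_measure L) = 0"
      using i[OF iv] i[OF iw] by (simp add: scaleR_diff_right)
  qed
  then show ?thesis by eventually_elim simp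
qed

section \<open>Integration over the torus\<close>

lemma nn_integral_periodic_shift_aux:
  fixes G :: "real \<Rightarrow> ennreal"
  assumes G: "G \<in> borel_measurable borel" "\<And>x. G (x + L) = G x" and c: "0 \<le> c" "c \<le> L"
  shows "(\<integral>\<^sup>+x. G (c + x) * indicator {0..L} x \<partial>lborel) = (\<integral>\<^sup>+x. G x * indicator {0..L} x \<partial>lborel)"
proof -
  note [measurable] = G(1)
  have ind: "indicator {c..c + L} (c + x) = (indicator {0..L} x :: ennreal)" for x
    by (auto simp: indicator_def)
  have ind2: "indicator {L..c + L} (L + x) = (indicator {0..c} x :: ennreal)" for x
    by (auto simp: indicator_def)
  have GL: "G (L + x) = G x" for x using G(2)[of x] by (simp add: add.commute)
  have shift: "(\<integral>\<^sup>+x. G x * indicator {L..c + L} x \<partial>lborel) = (\<integral>\<^sup>+x. G x * indicator {0..c} x \<partial>lborel)"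
    using nn_integral_real_affine[of "\<lambda>x. G x * indicator {L..c + L} x" 1 L] by (simp add: ind2 GL)
  have split: "AE x in lborel. G x * indicator {c..c + L} x = G x * indicator {c..L} x + G x * indicator {L..c + L} x"
    using AE_lborel_singleton[of L] by eventually_elim (use c in \<open>auto simp: indicator_def\<close>)
  have split2: "AE x in lborel. G x * indicator {c..L} x + G x * indicator {0..c} x = G x * indicator {0..L} x"
    using AE_lborel_singleton[of c] by eventually_elim (use c in \<open>auto simp: indicator_def\<close>)
  have "(\<integral>\<^sup>+x. G (c + x) * indicator {0..L} x \<partial>lborel) = (\<integral>\<^sup>+x. G x * indicator {c..c + L} x \<partial>lborel)"
    using nn_integral_real_affine[of "\<lambda>x. G x * indicator {c..c + L} x" 1 c] by (simp add: ind)
  also have "\<dots> = (\<integral>\<^sup>+x. G x * indicator {c..L} x + G x * indicator {L..c + L} x \<partial>lborel)"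
    by (rule nn_integral_cong_AE[OF split])
  also have "\<dots> = (\<integral>\<^sup>+x. G x * indicator {c..L} x \<partial>lborel) + (\<integral>\<^sup>+x. G x * indicator {0..c} x \<partial>lborel)"
    unfolding shift[symmetric] by (rule nn_integral_add) measurable
  also have "\<dots> = (\<integral>\<^sup>+x. G x * indicator {c..L} x + G x * indicator {0..c} x \<partial>lborel)"
    by (rule nn_integral_add[symmetric]) measurable
  also have "\<dots> = (\<integral>\<^sup>+x. G x * indicator {0..L} x \<partial>lborel)"
    by (rule nn_integral_cong_AE[OF split2])
  finally show ?thesis .
qed

lemma nn_integral_periodic_shift:
  fixes G :: "real \<Rightarrow> ennreal"
  assumes L: "0 < L" and G: "G \<in> borel_measurable borel" "periodic_fun_simple G L"
  shows "(\<integral>\<^sup>+x. G (c + x) * indicator {0..L} x \<partial>lborel) = (\<integral>\<^sup>+x. G x * indicator {0..L} x \<partial>lborel)"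
proof -
  have "G (c + x) = G (c rmod L + x)" for x
    using periodic_add_int(2)[OF G(2), of "c rmod L + x" "\<lfloor>c / L\<rfloor>"] rmod_decomp[OF L, of c]
    by (simp add: algebra_simps)
  then show ?thesis
    using nn_integral_periodic_shift_aux[OF G(1) periodic_add[OF G(2)], of "c rmod L"]
      rmod_nonneg[of L c] rmod_less[OF L, of c] L by simp
qed

lemma nn_integral_torus:
  assumes "H \<in> borel_measurable borel"
  shows "(\<integral>\<^sup>+q. H q \<partial>torus_measure L) =
    (\<integral>\<^sup>+s2. (\<integral>\<^sup>+s1. H (s1, s2) * indicator {0..L} s1 \<partial>lborel) * indicator {0..L} s2 \<partial>lborel)"
proof -
  have H [measurable]: "H \<in> borel_measurable (lborel \<Otimes>\<^sub>M lborel)" using assms by (simp add: lborel_prod)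
  have "(\<integral>\<^sup>+q. H q \<partial>torus_measure L) = (\<integral>\<^sup>+q. H q * indicator ({0..L} \<times> {0..L}) q \<partial>lebesgue)"
    unfolding torus_measure_def by (intro nn_integral_restrict_space) (auto intro: lmeasurable_interval simp: closed_Times)
  also have "\<dots> = (\<integral>\<^sup>+q. H q * indicator ({0..L} \<times> {0..L}) q \<partial>(lborel \<Otimes>\<^sub>M lborel))"
    by (simp add: nn_integral_completion lborel_prod)
  also have "\<dots> = (\<integral>\<^sup>+s2. (\<integral>\<^sup>+s1. H (s1, s2) * indicator ({0..L} \<times> {0..L}) (s1, s2) \<partial>lborel) \<partial>lborel)"
    by (subst lborel_pair.nn_integral_snd[symmetric]) auto
  also have "\<dots> = (\<integral>\<^sup>+s2. (\<integral>\<^sup>+s1. (H (s1, s2) * indicator {0..L} s1) * indicator {0..L} s2 \<partial>lborel) \<partial>lborel)"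
    by (simp add: indicator_times mult.assoc)
  also have "\<dots> = (\<integral>\<^sup>+s2. (\<integral>\<^sup>+s1. H (s1, s2) * indicator {0..L} s1 \<partial>lborel) * indicator {0..L} s2 \<partial>lborel)"
    by (subst nn_integral_multc) auto
  finally show ?thesis .
qed

text \<open>Each unordered pair of points is described once by the starting point and the length of its shorter arc.\<close>

lemma nn_integral_torus_arc:
  fixes h :: "real \<times> real \<Rightarrow> ennreal"
  assumes L: "0 < L" and h: "h \<in> borel_measurable borel" and per: "\<And>a s. h (a + L, s) = h (a, s)"
  shows "(\<integral>\<^sup>+q. h (arc_start L (fst q) (snd q), circle_dist L (fst q) (snd q)) \<partial>torus_measure L) =
    2 * (\<integral>\<^sup>+a. (\<integral>\<^sup>+s. h (a, s) * indicator {0..L / 2} s \<partial>lborel) * indicator {0..L} a \<partial>lborel)"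
proof -
  have hm [measurable]: "(\<lambda>x. h (A x, B x)) \<in> borel_measurable M"
    if [measurable]: "A \<in> borel_measurable M" "B \<in> borel_measurable M" for A B :: "'c \<Rightarrow> real" and M
    using measurable_compose[OF _ h, of "\<lambda>x. (A x, B x)" M] by simp
  have [measurable]: "(fst :: real \<times> real \<Rightarrow> real) \<in> borel_measurable borel" "(snd :: real \<times> real \<Rightarrow> real) \<in> borel_measurable borel"
    by (intro borel_measurable_continuous_onI continuous_intros)+
  define H where "H q = h (arc_start L (fst q) (snd q), circle_dist L (fst q) (snd q))" for q
  have Hm: "H \<in> borel_measurable borel" unfolding H_def by measurable
  have perh: "periodic_fun_simple (\<lambda>a. h (a, s)) L" for s using per by (simp add: periodic_fun_simple_def)
  have rm: "(x + L - y) rmod L = (x - y) rmod L" for x y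
    using rmod_add_period[OF L, of "x - y"] by (simp add: algebra_simps)
  have perH: "periodic_fun_simple (\<lambda>s1. H (s1, s2)) L" for s2
    unfolding periodic_fun_simple_def H_def by (simp add: arc_start_def circle_dist_def rm)
  have Hm1 [measurable]: "(\<lambda>x. H (A x, B x)) \<in> borel_measurable M"
    if [measurable]: "A \<in> borel_measurable M" "B \<in> borel_measurable M" for A B :: "'c \<Rightarrow> real" and M
    using measurable_compose[OF _ Hm, of "\<lambda>x. (A x, B x)" M] by simp
  have inner: "(\<integral>\<^sup>+s1. H (s1, s2) * indicator {0..L} s1 \<partial>lborel) =
      (\<integral>\<^sup>+s. h (s2, s) * indicator {0..L / 2} s \<partial>lborel) + (\<integral>\<^sup>+s. h (s2 - s, s) * indicator {0..L / 2} s \<partial>lborel)" for s2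
  proof -
    \<comment> \<open>These are the pairs whose shorter arc ends at \<open>s2\<close>; in terms of
      its length s the start is \<open>s2 - s\<close> up to a period.\<close>
    have refl: "(\<integral>\<^sup>+r. h (s2 + r, L - r) * indicator {L / 2..L} r \<partial>lborel) = (\<integral>\<^sup>+s. h (s2 - s, s) * indicator {0..L / 2} s \<partial>lborel)"
    proof -
      have ind: "indicator {L / 2..L} (L - s) = (indicator {0..L / 2} s :: ennreal)" for s by (auto simp: indicator_def)
      have "h (s2 + (L - s), s) = h (s2 - s, s)" for s using per[of "s2 - s" s] by (simp add: algebra_simps)
      moreover have "(\<lambda>r. h (s2 + r, L - r) * indicator {L / 2..L} r) \<in> borel_measurable borel" by measurable
      ultimately show ?thesis
        using nn_integral_real_affine[of "\<lambda>r. h (s2 + r, L - r) * indicator {L / 2..L} r" "-1" L] by (simp add: ind)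
    qed
    have ae: "AE r in lborel. H (s2 + r, s2) * indicator {0..L} r =
          h (s2, r) * indicator {0..L / 2} r + h (s2 + r, L - r) * indicator {L / 2..L} r"
      using AE_lborel_singleton[of L] AE_lborel_singleton[of "L / 2"]
    proof eventually_elim
      case (elim r)
      have "(s2 + r - s2) rmod L = r" if "0 \<le> r" "r < L"
        using that by (intro rmod_unique[of _ _ _ 0]) auto
      then show ?case using elim L by (auto simp: H_def arc_start_def circle_dist_def indicator_def)
    qed
    have "(\<integral>\<^sup>+s1. H (s1, s2) * indicator {0..L} s1 \<partial>lborel) = (\<integral>\<^sup>+r. H (s2 + r, s2) * indicator {0..L} r \<partial>lborel)"
      by (rule nn_integral_periodic_shift[OF L _ perH, symmetric]) measurable
    also have "\<dots> = (\<integral>\<^sup>+r. h (s2, r) * indicator {0..L / 2} r + h (s2 + r, L - r) * indicator {L / 2..L} r \<partial>lborel)"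
      by (rule nn_integral_cong_AE[OF ae])
    also have "\<dots> = (\<integral>\<^sup>+r. h (s2, r) * indicator {0..L / 2} r \<partial>lborel) + (\<integral>\<^sup>+s. h (s2 - s, s) * indicator {0..L / 2} s \<partial>lborel)"
      unfolding refl[symmetric] by (rule nn_integral_add) measurable
    finally show ?thesis .
  qed
  \<comment> \<open>Describing arcs by their end instead of their start gives the same integral, by
    translation in \<open>a\<close> for each fixed length. The two kinds of pairs thus contribute
    equally, which is the factor 2.\<close>
  have swap: "(\<integral>\<^sup>+a. (\<integral>\<^sup>+s. h (a - s, s) * indicator {0..L / 2} s \<partial>lborel) * indicator {0..L} a \<partial>lborel)
     = (\<integral>\<^sup>+a. (\<integral>\<^sup>+s. h (a, s) * indicator {0..L / 2} s \<partial>lborel) * indicator {0..L} a \<partial>lborel)"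
  proof -
    have tonelli: "(\<integral>\<^sup>+a. (\<integral>\<^sup>+s. g (a, s) * indicator {0..L / 2} s \<partial>lborel) * indicator {0..L} a \<partial>lborel)
       = (\<integral>\<^sup>+s. (\<integral>\<^sup>+a. g (a, s) * indicator {0..L} a \<partial>lborel) * indicator {0..L / 2} s \<partial>lborel)"
      if g: "g \<in> borel_measurable (lborel \<Otimes>\<^sub>M lborel)" for g :: "real \<times> real \<Rightarrow> ennreal"
    proof -
      note [measurable] = g
      have "(\<integral>\<^sup>+a. (\<integral>\<^sup>+s. g (a, s) * indicator {0..L / 2} s \<partial>lborel) * indicator {0..L} a \<partial>lborel)
         = (\<integral>\<^sup>+a. (\<integral>\<^sup>+s. g (a, s) * indicator {0..L / 2} s * indicator {0..L} a \<partial>lborel) \<partial>lborel)"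
        by (subst nn_integral_multc) auto
      also have "\<dots> = (\<integral>\<^sup>+s. (\<integral>\<^sup>+a. g (a, s) * indicator {0..L / 2} s * indicator {0..L} a \<partial>lborel) \<partial>lborel)"
        by (rule lborel_pair.Fubini'[symmetric]) measurable
      also have "\<dots> = (\<integral>\<^sup>+s. (\<integral>\<^sup>+a. (g (a, s) * indicator {0..L} a) * indicator {0..L / 2} s \<partial>lborel) \<partial>lborel)"
        by (simp add: ac_simps)
      also have "\<dots> = (\<integral>\<^sup>+s. (\<integral>\<^sup>+a. g (a, s) * indicator {0..L} a \<partial>lborel) * indicator {0..L / 2} s \<partial>lborel)"
        by (subst nn_integral_multc) auto
      finally show ?thesis .
    qed
    have "(\<lambda>q. h (fst q - snd q, snd q)) \<in> borel_measurable (lborel \<Otimes>\<^sub>M lborel)" by measurable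
    from tonelli[OF this]
    have "(\<integral>\<^sup>+a. (\<integral>\<^sup>+s. h (a - s, s) * indicator {0..L / 2} s \<partial>lborel) * indicator {0..L} a \<partial>lborel)
       = (\<integral>\<^sup>+s. (\<integral>\<^sup>+a. h (a - s, s) * indicator {0..L} a \<partial>lborel) * indicator {0..L / 2} s \<partial>lborel)" by simp
    also have "\<dots> = (\<integral>\<^sup>+s. (\<integral>\<^sup>+a. h (a, s) * indicator {0..L} a \<partial>lborel) * indicator {0..L / 2} s \<partial>lborel)"
    proof -
      have "(\<integral>\<^sup>+a. h (a - s, s) * indicator {0..L} a \<partial>lborel) = (\<integral>\<^sup>+a. h (a, s) * indicator {0..L} a \<partial>lborel)" for s
        using nn_integral_periodic_shift[OF L _ perh, of s "-s"] by (simp add: add.commute)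
      then show ?thesis by simp
    qed
    also have "\<dots> = (\<integral>\<^sup>+a. (\<integral>\<^sup>+s. h (a, s) * indicator {0..L / 2} s \<partial>lborel) * indicator {0..L} a \<partial>lborel)"
      by (rule tonelli[symmetric]) (use h in \<open>simp add: lborel_prod\<close>)
    finally show ?thesis .
  qed
  have "(\<integral>\<^sup>+q. H q \<partial>torus_measure L) =
      (\<integral>\<^sup>+a. (\<integral>\<^sup>+s. h (a, s) * indicator {0..L / 2} s \<partial>lborel) * indicator {0..L} a
         + (\<integral>\<^sup>+s. h (a - s, s) * indicator {0..L / 2} s \<partial>lborel) * indicator {0..L} a \<partial>lborel)"
    unfolding nn_integral_torus[OF Hm] inner by (simp add: distrib_right)
  also have "\<dots> = (\<integral>\<^sup>+a. (\<integral>\<^sup>+s. h (a, s) * indicator {0..L / 2} s \<partial>lborel) * indicator {0..L} a \<partial>lborel)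
     + (\<integral>\<^sup>+a. (\<integral>\<^sup>+s. h (a - s, s) * indicator {0..L / 2} s \<partial>lborel) * indicator {0..L} a \<partial>lborel)"
    by (intro nn_integral_add) measurable
  finally show ?thesis unfolding swap H_def by (simp add: mult_2)
qed

section \<open>Jensen's inequality and variances along arcs\<close>

lemma powr_expectation_le:
  fixes g :: "'b \<Rightarrow> real" and p :: real
  assumes M: "prob_space M" and g: "integrable M g" "\<And>x. 0 \<le> g x" and gp: "integrable M (\<lambda>x. g x powr p)" and p: "1 \<le> p"
  shows "(\<integral>x. g x \<partial>M) powr p \<le> (\<integral>x. g x powr p \<partial>M)"
proof -
  interpret prob_space M by fact
  define c where "c = (\<integral>x. g x \<partial>M)"
  have c0: "0 \<le> c" unfolding c_def by (rule integral_nonneg_AE) (simp add: g(2))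
  define K where "K = p * pow0 (p - 1) c"
  \<comment> \<open>The power lies above its tangent at the mean c; integrating this inequality
    gives the claim. For c = 0 the slope supplied by \<open>pow0\<close> is 1 if p = 1 and 0
    otherwise.\<close>
  have pt: "c powr p + K * (y - c) \<le> y powr p" if y: "0 \<le> y" for y
  proof -
    have e: "pow0 (p - 1) c * c = c powr p" using pow0_mult_self[of "p - 1" c] p c0 by simp
    consider "c = 0" "p = 1" | "c = 0" "p \<noteq> 1" | "c > 0" "y = 0" | "c > 0" "y > 0" using c0 y by fastforce
    then show ?thesis
    proof cases
      case 1
      then show ?thesis using y by (simp add: K_def pow0_def)
    next
      case 2
      then show ?thesis by (simp add: K_def pow0_def)
    next
      case 3
      have "c powr p + K * (y - c) = c powr p - p * (pow0 (p - 1) c * c)" using 3 by (simp add: K_def)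
      also have "\<dots> \<le> 0" unfolding e using mult_right_mono[OF p, of "c powr p"] by simp
      finally show ?thesis using 3 by simp
    next
      case 4
      have d: "((\<lambda>x. x powr p) has_real_derivative p * c powr (p - 1)) (at c within {0<..})"
        using has_real_derivative_powr[OF 4(1), of p] by (rule has_field_derivative_at_within)
      have "p * c powr (p - 1) * (y - c) \<le> y powr p - c powr p"
        using convex_on_imp_above_tangent[OF powr_convex[OF p] _ _ _ d, of y] 4
        by (simp add: interior_open)
      moreover have "pow0 (p - 1) c = c powr (p - 1)" using 4 by (simp add: pow0_def)
      ultimately show ?thesis by (simp add: K_def)
    qed
  qed
  have i: "integrable M (\<lambda>x. c powr p + K * (g x - c))" using g(1) by simp
  have "(\<integral>x. c powr p + K * (g x - c) \<partial>M) \<le> (\<integral>x. g x powr p \<partial>M)"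
    by (rule integral_mono[OF i gp]) (rule pt[OF g(2)])
  moreover have "(\<integral>x. c powr p + K * (g x - c) \<partial>M) = c powr p"
    using g(1) by (simp add: prob_space c_def[symmetric])
  ultimately have "c powr p \<le> (\<integral>x. g x powr p \<partial>M)" by (simp only:)
  then show ?thesis unfolding c_def .
qed

text \<open>The variance is at most the mean square deviation from the starting value, and Jensen
  moves the power inside. This centre is taken instead of the mean in order that the integrand
  becomes a jump between two points, as in the fractional seminorm.\<close>

lemma arc_var_powr_le:
  fixes u :: "real \<Rightarrow> 'a::euclidean_space"
  assumes u: "u \<in> borel_measurable borel" "\<And>x. norm (u x) \<le> N" and p: "1 \<le> p"
  shows "arc_var u a s powr p \<le> (\<integral>x. norm (u (a + s * x) - u a) powr (2 * p) \<partial>unit_interval)"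
proof -
  have N0: "0 \<le> N" by (rule order_trans[OF norm_ge_zero u(2)])
  have um: "(\<lambda>x. u (a + s * x) - u a) \<in> borel_measurable unit_interval"
    using borel_measurable_arc[OF u(1), of a s] by simp
  have b: "norm (u (a + s * x) - u a) \<le> 2 * N" for x
    using norm_triangle_ineq4[of "u (a + s * x)" "u a"] u(2)[of "a + s * x"] u(2)[of a] by linarith
  have b2: "norm ((norm (u (a + s * x) - u a))\<^sup>2) \<le> (2 * N)\<^sup>2" for x using power_mono[OF b norm_ge_zero, of x 2] by simp
  have i2: "integrable unit_interval (\<lambda>x. (norm (u (a + s * x) - u a))\<^sup>2)"
    by (rule unit.integrable_bounded[OF _ b2]) (use um in measurable)
  have e: "((norm (u (a + s * x) - u a))\<^sup>2) powr p = norm (u (a + s * x) - u a) powr (2 * p)" for x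
    using powr_powr[of "norm (u (a + s * x) - u a)" 2 p] by (simp add: powr_numeral)
  have ip: "integrable unit_interval (\<lambda>x. ((norm (u (a + s * x) - u a))\<^sup>2) powr p)"
  proof (rule unit.integrable_bounded[of _ "((2 * N)\<^sup>2) powr p"])
    show "norm ((norm (u (a + s * x) - u a))\<^sup>2 powr p) \<le> ((2 * N)\<^sup>2) powr p" for x
      using b2[of x] p by (simp add: powr_mono2)
  qed (use um in measurable)
  have "arc_var u a s powr p \<le> (\<integral>x. (norm (u (a + s * x) - u a))\<^sup>2 \<partial>unit_interval) powr p"
    unfolding arc_var_def using p
    by (intro powr_mono2 unit.covar_self_le[OF borel_measurable_arc[OF u(1)] u(2)]
        unit.covar_self_nonneg[OF borel_measurable_arc[OF u(1)] u(2)]) auto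
  also have "\<dots> \<le> (\<integral>x. ((norm (u (a + s * x) - u a))\<^sup>2) powr p \<partial>unit_interval)"
    by (rule powr_expectation_le[OF prob_space_unit_interval i2 _ ip p]) simp
  finally show ?thesis unfolding e .
qed

text \<open>After Jensen the left side is an average over x in [0, 1] of integrals with the jump at
  distance \<open>s * x\<close>. The substitution of s for \<open>s * x\<close> produces the factor
  \<open>x powr (q - 1)\<close>, which is at most 1 because q is at least 1, and shortens the range
  of integration.\<close>

lemma nn_integral_arc_var_le:
  fixes u :: "real \<Rightarrow> 'a::euclidean_space"
  assumes u: "u \<in> borel_measurable borel" "\<And>x. norm (u x) \<le> N" and p: "1 \<le> p" and q: "1 \<le> q" and D: "0 < D"
  shows "(\<integral>\<^sup>+s. ennreal (s powr (- q) * arc_var u a s powr p) * indicator {0..D} s \<partial>lborel)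
     \<le> (\<integral>\<^sup>+s. ennreal (s powr (- q) * norm (u (a + s) - u a) powr (2 * p)) * indicator {0..D} s \<partial>lborel)"
proof -
  note [measurable] = u(1)
  have [measurable]: "(\<lambda>x. x) \<in> borel_measurable unit_interval" by (rule borel_measurable_unit_interval) simp
  have N0: "0 \<le> N" by (rule order_trans[OF norm_ge_zero u(2)])
  define g where "g d = norm (u (a + d) - u a) powr (2 * p)" for d
  have gm [measurable]: "g \<in> borel_measurable borel" unfolding g_def by measurable
  have g0: "0 \<le> g d" "g d \<le> (2 * N) powr (2 * p)" for d
  proof -
    have "norm (u (a + d) - u a) \<le> 2 * N"
      using norm_triangle_ineq4[of "u (a + d)" "u a"] u(2)[of "a + d"] u(2)[of a] by linarith
    then show "0 \<le> g d" "g d \<le> (2 * N) powr (2 * p)" unfolding g_def using p by (auto intro: powr_mono2)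
  qed
  have gi: "integrable unit_interval (\<lambda>x. g (s * x))" for s
    by (rule unit.integrable_bounded[of _ "(2 * N) powr (2 * p)"]) (use g0 in auto)
  define k where "k s = ennreal (s powr (- q) * g s) * indicator {0..D} s" for s
  have km: "k \<in> borel_measurable borel" unfolding k_def by measurable
  define J where "J = (\<integral>\<^sup>+s. k s \<partial>lborel)"
  have sub: "(\<integral>\<^sup>+s. ennreal (s powr (- q) * g (s * x)) * indicator {0..D} s \<partial>lborel) \<le> J" if x: "0 < x" "x \<le> 1" for x
  proof -
    have "(\<integral>\<^sup>+s. ennreal (s powr (- q) * g (s * x)) * indicator {0..D} s \<partial>lborel)
      \<le> (\<integral>\<^sup>+s. ennreal x * k (x * s) \<partial>lborel)"
      unfolding k_def
    proof (rule nn_integral_mono)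
      fix s
      show "ennreal (s powr (- q) * g (s * x)) * indicator {0..D} s
         \<le> ennreal x * (ennreal ((x * s) powr (- q) * g (x * s)) * indicator {0..D} (x * s))"
      proof (cases "s \<in> {0..D}")
        case True
        have xs: "x * s \<in> {0..D}" using True x mult_left_le_one_le[of s x] by auto
        have "1 \<le> x * x powr (- q)"
        proof -
          have "x * x powr (- q) = x powr (1 - q)" using powr_mult_base[of x "- q"] x by simp
          moreover have "1 \<le> x powr (1 - q)" using powr_mono2'[of "1 - q" x 1] x q by simp
          ultimately show ?thesis by simp
        qed
        then have "1 * (s powr (- q) * g (s * x)) \<le> (x * x powr (- q)) * (s powr (- q) * g (s * x))"
          using g0 by (intro mult_right_mono) auto
        then have "s powr (- q) * g (s * x) \<le> x * ((x * s) powr (- q) * g (x * s))"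
          by (simp add: powr_mult ac_simps)
        then have "ennreal (s powr (- q) * g (s * x)) \<le> ennreal (x * ((x * s) powr (- q) * g (x * s)))"
          by (rule ennreal_leI)
        moreover have "ennreal (x * ((x * s) powr (- q) * g (x * s))) = ennreal x * ennreal ((x * s) powr (- q) * g (x * s))"
          using x g0 by (intro ennreal_mult) auto
        ultimately show ?thesis using True xs by (simp only: indicator_simps mult_1_right)
      next
        case False
        then have z: "indicator {0..D} s = (0 :: ennreal)" by (simp add: indicator_def)
        show ?thesis unfolding z mult_zero_right by (rule zero_le)
      qed
    qed
    moreover have "(\<integral>\<^sup>+s. ennreal x * k (x * s) \<partial>lborel) = ennreal x * (\<integral>\<^sup>+s. k (x * s) \<partial>lborel)"
      by (rule nn_integral_cmult, rule measurable_compose[OF _ km]) simp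
    moreover have "J = ennreal \<bar>x\<bar> * (\<integral>\<^sup>+s. k (0 + x * s) \<partial>lborel)"
      unfolding J_def by (rule nn_integral_real_affine[OF km]) (use x in simp)
    ultimately show ?thesis using x by simp
  qed
  have A: "(\<integral>\<^sup>+s. ennreal (s powr (- q) * arc_var u a s powr p) * indicator {0..D} s \<partial>lborel)
     \<le> (\<integral>\<^sup>+s. (\<integral>\<^sup>+x. ennreal (s powr (- q) * g (s * x)) * indicator {0..D} s \<partial>unit_interval) \<partial>lborel)"
  proof (rule nn_integral_mono)
    fix s
    have "ennreal (s powr (- q) * arc_var u a s powr p) \<le> ennreal (s powr (- q) * (\<integral>x. g (s * x) \<partial>unit_interval))"
      unfolding g_def by (intro ennreal_leI mult_left_mono arc_var_powr_le[OF u p]) auto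
    also have "\<dots> = ennreal (\<integral>x. s powr (- q) * g (s * x) \<partial>unit_interval)" by simp
    also have "\<dots> = (\<integral>\<^sup>+x. ennreal (s powr (- q) * g (s * x)) \<partial>unit_interval)"
      using gi g0 by (intro nn_integral_eq_integral[symmetric]) auto
    finally have "ennreal (s powr (- q) * arc_var u a s powr p) \<le> (\<integral>\<^sup>+x. ennreal (s powr (- q) * g (s * x)) \<partial>unit_interval)" .
    then show "ennreal (s powr (- q) * arc_var u a s powr p) * indicator {0..D} s
       \<le> (\<integral>\<^sup>+x. ennreal (s powr (- q) * g (s * x)) * indicator {0..D} s \<partial>unit_interval)"
      by (cases "s \<in> {0..D}") auto
  qed
  have B: "(\<integral>\<^sup>+s. (\<integral>\<^sup>+x. ennreal (s powr (- q) * g (s * x)) * indicator {0..D} s \<partial>unit_interval) \<partial>lborel)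
     = (\<integral>\<^sup>+x. (\<integral>\<^sup>+s. ennreal (s powr (- q) * g (s * x)) * indicator {0..D} s \<partial>lborel) \<partial>unit_interval)"
  proof -
    interpret P: pair_sigma_finite unit_interval lborel ..
    show ?thesis by (rule P.Fubini') measurable
  qed
  have C: "(\<integral>\<^sup>+x. (\<integral>\<^sup>+s. ennreal (s powr (- q) * g (s * x)) * indicator {0..D} s \<partial>lborel) \<partial>unit_interval)
     \<le> (\<integral>\<^sup>+x. J \<partial>unit_interval)"
  proof (rule nn_integral_mono_AE)
    \<comment> \<open>The substitution degenerates at x = 0, a single point.\<close>
    have "AE x in unit_interval. x \<noteq> 0"
      unfolding unit_interval_def using AE_lborel_singleton[of 0]
      by (subst AE_restrict_space_iff) (auto elim: AE_mp)
    moreover have "AE x in unit_interval. x \<in> {0..1}"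
      by (rule AE_I2) (simp add: unit_interval_def space_restrict_space)
    ultimately show "AE x in unit_interval. (\<integral>\<^sup>+s. ennreal (s powr (- q) * g (s * x)) * indicator {0..D} s \<partial>lborel) \<le> J"
      by eventually_elim (auto intro: sub)
  qed
  have D: "(\<integral>\<^sup>+x. J \<partial>unit_interval) = J" by (simp add: unit.emeasure_space_1)
  show ?thesis using order_trans[OF A C[folded B]] unfolding D by (simp only: J_def k_def g_def)
qed

section \<open>Null sets and measurability on the torus\<close>

lemma borel_measurable_torus: "f \<in> borel_measurable borel \<Longrightarrow> f \<in> borel_measurable (torus_measure L)"
  unfolding torus_measure_def by (intro measurable_restrict_space1 measurable_completion) simp

lemma AE_torus_iff: "(AE q in torus_measure L. P q) \<longleftrightarrow> (AE q in lebesgue. q \<in> {0..L} \<times> {0..L} \<longrightarrow> P q)"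
  unfolding torus_measure_def by (subst AE_restrict_space_iff) (auto simp: closed_Times)

lemma AE_torus_coordinates:
  assumes "AE x in lebesgue. P x"
  shows "AE q in torus_measure L. P (fst q) \<and> P (snd q)"
proof -
  have "AE x in lborel. P x" using assms by (simp add: AE_completion_iff)
  then obtain N where N: "{x. \<not> P x} \<subseteq> N" "N \<in> null_sets lborel"
    unfolding eventually_ae_filter by auto
  have "N \<times> UNIV \<in> null_sets (lborel \<Otimes>\<^sub>M lborel)" "UNIV \<times> N \<in> null_sets (lborel \<Otimes>\<^sub>M lborel)"
    using N(2) by (auto simp: null_sets_def lborel.emeasure_pair_measure_Times)
  then have "N \<times> UNIV \<union> UNIV \<times> N \<in> null_sets (lborel :: (real \<times> real) measure)"
    unfolding lborel_prod by (rule null_sets.Un)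
  moreover have "{q. \<not> (P (fst q) \<and> P (snd q))} \<subseteq> N \<times> UNIV \<union> UNIV \<times> N" using N(1) by auto
  ultimately have "AE q in lborel. P (fst q) \<and> P (snd q)" unfolding eventually_ae_filter by auto
  then have "AE q in lebesgue. P (fst q) \<and> P (snd q)" by (rule AE_completion)
  then show ?thesis unfolding AE_torus_iff by eventually_elim simp
qed

text \<open>The integral formula over arcs is applied to the indicator of the two lengths 0 and
  \<open>L / 2\<close>; its inner integrals over the length vanish.\<close>

lemma AE_torus_circle_dist:
  assumes L: "0 < L"
  shows "AE q in torus_measure L. circle_dist L (fst q) (snd q) \<noteq> 0 \<and> circle_dist L (fst q) (snd q) \<noteq> L / 2"
proof -
  have [measurable]: "(fst :: real \<times> real \<Rightarrow> real) \<in> borel_measurable borel" "(snd :: real \<times> real \<Rightarrow> real) \<in> borel_measurable borel"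
    by (intro borel_measurable_continuous_onI continuous_intros)+
  define h where "h q = (indicator {0, L / 2} (snd q) :: ennreal)" for q :: "real \<times> real"
  have hm: "h \<in> borel_measurable borel" unfolding h_def by measurable
  have z: "(\<integral>\<^sup>+s. h (a, s) * indicator {0..L / 2} s \<partial>lborel) = 0" for a
  proof -
    have ae: "AE s in lborel. h (a, s) * indicator {0..L / 2} s = 0"
      using AE_lborel_singleton[of 0] AE_lborel_singleton[of "L / 2"]
      by eventually_elim (simp add: h_def)
    show ?thesis unfolding nn_integral_cong_AE[OF ae] by simp
  qed
  have "(\<integral>\<^sup>+q. h (arc_start L (fst q) (snd q), circle_dist L (fst q) (snd q)) \<partial>torus_measure L) = 0"
    by (subst nn_integral_torus_arc[OF L hm]) (simp_all add: z, simp add: h_def)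
  moreover have "(\<lambda>q. h (arc_start L (fst q) (snd q), circle_dist L (fst q) (snd q))) \<in> borel_measurable (torus_measure L)"
    unfolding h_def by (intro borel_measurable_torus) measurable
  ultimately have "AE q in torus_measure L. h (arc_start L (fst q) (snd q), circle_dist L (fst q) (snd q)) = 0"
    by (simp add: nn_integral_0_iff_AE)
  then show ?thesis by eventually_elim (auto simp: h_def indicator_def)
qed

lemma nn_integral_torus_arc_var_le:
  fixes w :: "real \<Rightarrow> 'a::euclidean_space"
  assumes L: "0 < L" and w: "w \<in> borel_measurable borel" "\<And>x. norm (w x) \<le> N" "periodic_fun_simple w L"
    and p: "1 \<le> p" and r: "1 \<le> r"
  shows "(\<integral>\<^sup>+q. ennreal (circle_dist L (fst q) (snd q) powr (- r) * arc_var w (arc_start L (fst q) (snd q)) (circle_dist L (fst q) (snd q)) powr p) \<partial>torus_measure L)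
    \<le> (\<integral>\<^sup>+q. ennreal (circle_dist L (fst q) (snd q) powr (- r) *
        norm (w (arc_start L (fst q) (snd q) + circle_dist L (fst q) (snd q)) - w (arc_start L (fst q) (snd q))) powr (2 * p)) \<partial>torus_measure L)"
proof -
  note [measurable] = w(1)
  have [measurable]: "(fst :: real \<times> real \<Rightarrow> real) \<in> borel_measurable borel" "(snd :: real \<times> real \<Rightarrow> real) \<in> borel_measurable borel"
    by (intro borel_measurable_continuous_onI continuous_intros)+
  define h1 where "h1 q = ennreal (snd q powr (- r) * arc_var w (fst q) (snd q) powr p)" for q
  define h2 where "h2 q = ennreal (snd q powr (- r) * norm (w (fst q + snd q) - w (fst q)) powr (2 * p))" for q
  have m: "h1 \<in> borel_measurable borel" "h2 \<in> borel_measurable borel" unfolding h1_def h2_def by measurable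
  have pa: "w (a + L + x) = w (a + x)" "w (a + L) = w a" for a x
    using periodic_add[OF w(3), of "a + x"] periodic_add[OF w(3), of a] by (simp_all add: algebra_simps)
  have per: "h1 (a + L, s) = h1 (a, s)" "h2 (a + L, s) = h2 (a, s)" for a s
    unfolding h1_def h2_def arc_var_def by (simp_all add: pa)
  have le: "(\<integral>\<^sup>+s. h1 (a, s) * indicator {0..L / 2} s \<partial>lborel) \<le> (\<integral>\<^sup>+s. h2 (a, s) * indicator {0..L / 2} s \<partial>lborel)" for a
    unfolding h1_def h2_def fst_conv snd_conv using L by (intro nn_integral_arc_var_le[OF w(1,2) p r]) simp
  have "2 * (\<integral>\<^sup>+a. (\<integral>\<^sup>+s. h1 (a, s) * indicator {0..L / 2} s \<partial>lborel) * indicator {0..L} a \<partial>lborel)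
     \<le> 2 * (\<integral>\<^sup>+a. (\<integral>\<^sup>+s. h2 (a, s) * indicator {0..L / 2} s \<partial>lborel) * indicator {0..L} a \<partial>lborel)"
    by (intro mult_left_mono nn_integral_mono mult_right_mono le) auto
  then show ?thesis
    unfolding nn_integral_torus_arc[OF L m(1) per(1), symmetric] nn_integral_torus_arc[OF L m(2) per(2), symmetric]
    by (simp add: h1_def h2_def)
qed

lemma sum3_powr_le:
  fixes x y z p :: real
  assumes "0 \<le> x" "0 \<le> y" "0 \<le> z" "0 \<le> p"
  shows "(x + y + z) powr p \<le> 3 powr p * (x powr p + y powr p + z powr p)"
proof -
  define m where "m = max x (max y z)"
  have m: "m powr p \<le> x powr p + y powr p + z powr p"
    by (auto simp: m_def max_def)
  have "(x + y + z) powr p \<le> (3 * m) powr p" using assms by (intro powr_mono2) (auto simp: m_def)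
  also have "\<dots> = 3 powr p * m powr p" by (simp add: powr_mult)
  also have "\<dots> \<le> 3 powr p * (x powr p + y powr p + z powr p)" using m by (intro mult_left_mono) auto
  finally show ?thesis .
qed

lemma integrable_bound_nn:
  fixes f E :: "'b \<Rightarrow> real"
  assumes f: "f \<in> borel_measurable M" and E: "E \<in> borel_measurable M" and le: "AE x in M. \<bar>f x\<bar> \<le> c * E x" and c: "0 \<le> c"
    and B: "(\<integral>\<^sup>+x. ennreal (E x) \<partial>M) \<le> ennreal B" "0 \<le> B"
  shows "integrable M f" "(\<integral>x. \<bar>f x\<bar> \<partial>M) \<le> c * B"
proof -
  have "(\<integral>\<^sup>+x. ennreal \<bar>f x\<bar> \<partial>M) \<le> (\<integral>\<^sup>+x. ennreal c * ennreal (E x) \<partial>M)"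
  proof (rule nn_integral_mono_AE)
    show "AE x in M. ennreal \<bar>f x\<bar> \<le> ennreal c * ennreal (E x)"
      using le
    proof eventually_elim
      case (elim x)
      then have "ennreal \<bar>f x\<bar> \<le> ennreal (c * E x)" by (rule ennreal_leI)
      then show ?case using c by (simp add: ennreal_mult')
    qed
  qed
  moreover have "(\<integral>\<^sup>+x. ennreal c * ennreal (E x) \<partial>M) = ennreal c * (\<integral>\<^sup>+x. ennreal (E x) \<partial>M)"
    using E by (intro nn_integral_cmult) auto
  moreover have "ennreal c * (\<integral>\<^sup>+x. ennreal (E x) \<partial>M) \<le> ennreal c * ennreal B"
    by (intro mult_left_mono B) simp
  ultimately have b: "(\<integral>\<^sup>+x. ennreal \<bar>f x\<bar> \<partial>M) \<le> ennreal (c * B)" using c B(2) by (simp add: ennreal_mult)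
  then show "integrable M f" using f by (intro integrableI_bounded) (auto intro: le_less_trans)
  have "(\<integral>x. \<bar>f x\<bar> \<partial>M) = enn2real (\<integral>\<^sup>+x. ennreal \<bar>f x\<bar> \<partial>M)"
    using f by (intro integral_eq_nn_integral) auto
  also have "\<dots> \<le> enn2real (ennreal (c * B))" using b by (intro enn2real_mono) auto
  finally show "(\<integral>x. \<bar>f x\<bar> \<partial>M) \<le> c * B" using c B(2) by simp
qed

text \<open>At exceptional pairs \<open>deriv\<close> has an uncontrolled value. Completeness of
  Lebesgue measure still yields measurability from agreement almost everywhere with a measurable
  function.\<close>

lemma borel_measurable_torus_AE:
  assumes g: "g \<in> borel_measurable (torus_measure L)" and eq: "AE q in torus_measure L. f q = (g q :: real)"
  shows "f \<in> borel_measurable (torus_measure L)"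
proof -
  let ?S = "{0..L} \<times> {0..L}"
  have S: "?S \<in> sets lebesgue" by (simp add: closed_Times)
  have "(\<lambda>q. indicator ?S q *\<^sub>R g q) \<in> borel_measurable lebesgue"
    using g unfolding torus_measure_def
    by (subst (asm) borel_measurable_restrict_space_iff) (auto simp: mult.commute S)
  moreover have "AE q in lebesgue. indicator ?S q *\<^sub>R g q = indicator ?S q *\<^sub>R f q"
    using eq unfolding AE_torus_iff by eventually_elim (auto simp: indicator_def)
  ultimately have "(\<lambda>q. indicator ?S q *\<^sub>R f q) \<in> borel_measurable lebesgue" by (rule borel_measurable_AE)
  then show ?thesis
    unfolding torus_measure_def by (subst borel_measurable_restrict_space_iff) (auto simp: mult.commute S)
qed

context curve_variation
begin

lemma AE_torus_good:
  "AE q in torus_measure L. fst q \<in> S \<and> snd q \<in> S \<and> circle_dist L (fst q) (snd q) \<noteq> 0 \<and> circle_dist L (fst q) (snd q) \<noteq> L / 2"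
  using AE_torus_coordinates[OF AE_S] AE_torus_circle_dist[OF L] by eventually_elim simp

lemma AE_torus_variations:
  "AE q in torus_measure L. energy_density \<alpha> p L f \<tau> q = arc_energy \<alpha> p t (arc_start L (fst q) (snd q)) (circle_dist L (fst q) (snd q))"
  "AE q in torus_measure L. variation1_exists \<alpha> p L f \<tau> \<phi> \<phi>' q"
  "AE q in torus_measure L. variation1 \<alpha> p L f \<tau> \<phi> \<phi>' q = arc_variation1 \<alpha> p t u (arc_start L (fst q) (snd q)) (circle_dist L (fst q) (snd q))"
  "AE q in torus_measure L. variation2_exists \<alpha> p L f \<tau> \<phi> \<phi>' \<psi> \<psi>' q"
  "AE q in torus_measure L. variation2 \<alpha> p L f \<tau> \<phi> \<phi>' \<psi> \<psi>' q = arc_variation2 \<alpha> p t u v (arc_start L (fst q) (snd q)) (circle_dist L (fst q) (snd q))"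
proof -
  show "AE q in torus_measure L. energy_density \<alpha> p L f \<tau> q = arc_energy \<alpha> p t (arc_start L (fst q) (snd q)) (circle_dist L (fst q) (snd q))"
    using AE_torus_good by eventually_elim (use energy_density_eq in force)
  show "AE q in torus_measure L. variation1_exists \<alpha> p L f \<tau> \<phi> \<phi>' q"
    using AE_torus_good by eventually_elim (use variation1_eq(1) in force)
  show "AE q in torus_measure L. variation1 \<alpha> p L f \<tau> \<phi> \<phi>' q = arc_variation1 \<alpha> p t u (arc_start L (fst q) (snd q)) (circle_dist L (fst q) (snd q))"
    using AE_torus_good by eventually_elim (use variation1_eq(2) in force)
  show "AE q in torus_measure L. variation2_exists \<alpha> p L f \<tau> \<phi> \<phi>' \<psi> \<psi>' q"
    using AE_torus_good by eventually_elim (use variation2_eq(1) in force)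
  show "AE q in torus_measure L. variation2 \<alpha> p L f \<tau> \<phi> \<phi>' \<psi> \<psi>' q = arc_variation2 \<alpha> p t u v (arc_start L (fst q) (snd q)) (circle_dist L (fst q) (snd q))"
    using AE_torus_good by eventually_elim (use variation2_eq(2) in force)
qed

lemma borel_measurable_torus_variations:
  "energy_density \<alpha> p L f \<tau> \<in> borel_measurable (torus_measure L)"
  "variation1 \<alpha> p L f \<tau> \<phi> \<phi>' \<in> borel_measurable (torus_measure L)"
  "variation2 \<alpha> p L f \<tau> \<phi> \<phi>' \<psi> \<psi>' \<in> borel_measurable (torus_measure L)"
proof -
  have fs [measurable]: "(fst :: real \<times> real \<Rightarrow> real) \<in> borel_measurable borel" "(snd :: real \<times> real \<Rightarrow> real) \<in> borel_measurable borel"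
    by (intro borel_measurable_continuous_onI continuous_intros)+
  have as: "(\<lambda>q. arc_start L (fst q) (snd q)) \<in> borel_measurable borel" "(\<lambda>q. circle_dist L (fst q) (snd q)) \<in> borel_measurable borel"
    by measurable
  show "energy_density \<alpha> p L f \<tau> \<in> borel_measurable (torus_measure L)"
    by (rule borel_measurable_torus_AE[OF borel_measurable_torus[OF borel_measurable_arc_functions(1)[OF as borel]] AE_torus_variations(1)])
  show "variation1 \<alpha> p L f \<tau> \<phi> \<phi>' \<in> borel_measurable (torus_measure L)"
    by (rule borel_measurable_torus_AE[OF borel_measurable_torus[OF borel_measurable_arc_functions(2)[OF as borel]] AE_torus_variations(3)])
  show "variation2 \<alpha> p L f \<tau> \<phi> \<phi>' \<psi> \<psi>' \<in> borel_measurable (torus_measure L)"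
    by (rule borel_measurable_torus_AE[OF borel_measurable_torus[OF borel_measurable_arc_functions(3)[OF as borel]] AE_torus_variations(5)])
qed

lemma AE_torus_bounds:
  assumes T: "AE q in torus_measure L. arc_var t (arc_start L (fst q) (snd q)) (circle_dist L (fst q) (snd q)) \<le> T q"
    "AE q in torus_measure L. arc_var u (arc_start L (fst q) (snd q)) (circle_dist L (fst q) (snd q)) \<le> N1\<^sup>2 * T q"
    "AE q in torus_measure L. arc_var v (arc_start L (fst q) (snd q)) (circle_dist L (fst q) (snd q)) \<le> N2\<^sup>2 * T q"
  shows "AE q in torus_measure L. \<bar>energy_density \<alpha> p L f \<tau> q\<bar> \<le>
      variation_const \<alpha> p Cb * (circle_dist L (fst q) (snd q) powr (- \<alpha> * p) * T q powr p)"
    "AE q in torus_measure L. \<bar>variation1 \<alpha> p L f \<tau> \<phi> \<phi>' q\<bar> \<le>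
      variation_const \<alpha> p Cb * N1 * (circle_dist L (fst q) (snd q) powr (- \<alpha> * p) * T q powr p)"
    "AE q in torus_measure L. \<bar>variation2 \<alpha> p L f \<tau> \<phi> \<phi>' \<psi> \<psi>' q\<bar> \<le>
      variation_const \<alpha> p Cb * N1 * N2 * (circle_dist L (fst q) (snd q) powr (- \<alpha> * p) * T q powr p)"
proof -
  note b = arc_bounds[OF \<alpha> p bi_lip(1) borel norms expectation_t(1)[OF _ _ _ refl refl]]
  show "AE q in torus_measure L. \<bar>energy_density \<alpha> p L f \<tau> q\<bar> \<le>
      variation_const \<alpha> p Cb * (circle_dist L (fst q) (snd q) powr (- \<alpha> * p) * T q powr p)"
    using AE_torus_good AE_torus_variations(1) T
  proof eventually_elim
    case (elim q)
    show ?case unfolding elim(2) by (rule b(1)) (use elim in auto)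
  qed
  show "AE q in torus_measure L. \<bar>variation1 \<alpha> p L f \<tau> \<phi> \<phi>' q\<bar> \<le>
      variation_const \<alpha> p Cb * N1 * (circle_dist L (fst q) (snd q) powr (- \<alpha> * p) * T q powr p)"
    using AE_torus_good AE_torus_variations(3) T
  proof eventually_elim
    case (elim q)
    show ?case unfolding elim(2) by (rule b(2)) (use elim in auto)
  qed
  show "AE q in torus_measure L. \<bar>variation2 \<alpha> p L f \<tau> \<phi> \<phi>' \<psi> \<psi>' q\<bar> \<le>
      variation_const \<alpha> p Cb * N1 * N2 * (circle_dist L (fst q) (snd q) powr (- \<alpha> * p) * T q powr p)"
    using AE_torus_good AE_torus_variations(5) T
  proof eventually_elim
    case (elim q)
    show ?case unfolding elim(2) by (rule b(3)) (use elim in auto)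
  qed
qed

end

lemma arc_var_nonneg:
  assumes "w \<in> borel_measurable borel" "\<And>x. norm (w x) \<le> N"
  shows "0 \<le> arc_var w a s"
  unfolding arc_var_def by (rule unit.covar_self_nonneg[OF borel_measurable_arc[OF assms(1)] assms(2)])

context curve_variation
begin

lemma integrable_torus_variations:
  assumes N: "0 < N1" "0 < N2" and r: "1 \<le> \<alpha> * p"
  defines "J w \<equiv> (\<integral>\<^sup>+q. ennreal (circle_dist L (fst q) (snd q) powr (- (\<alpha> * p)) *
        norm (w (arc_start L (fst q) (snd q) + circle_dist L (fst q) (snd q)) - w (arc_start L (fst q) (snd q))) powr (2 * p)) \<partial>torus_measure L)"
  assumes J: "J t \<le> ennreal (K powr (2 * p))" "J u \<le> ennreal (N1 powr (2 * p))" "J v \<le> ennreal (N2 powr (2 * p))"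
  defines "B \<equiv> variation_const \<alpha> p Cb * (3 powr p * (K powr (2 * p) + 2))"
  shows "integrable (torus_measure L) (energy_density \<alpha> p L f \<tau>)"
    "integrable (torus_measure L) (variation1 \<alpha> p L f \<tau> \<phi> \<phi>')"
    "integrable (torus_measure L) (variation2 \<alpha> p L f \<tau> \<phi> \<phi>' \<psi> \<psi>')"
    "(\<integral>q. \<bar>energy_density \<alpha> p L f \<tau> q\<bar> \<partial>torus_measure L) \<le> B"
    "(\<integral>q. \<bar>variation1 \<alpha> p L f \<tau> \<phi> \<phi>' q\<bar> \<partial>torus_measure L) \<le> B * N1"
    "(\<integral>q. \<bar>variation2 \<alpha> p L f \<tau> \<phi> \<phi>' \<psi> \<psi>' q\<bar> \<partial>torus_measure L) \<le> B * N1 * N2"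
proof -
  have fs [measurable]: "(fst :: real \<times> real \<Rightarrow> real) \<in> borel_measurable borel" "(snd :: real \<times> real \<Rightarrow> real) \<in> borel_measurable borel"
    by (intro borel_measurable_continuous_onI continuous_intros)+
  define V where "V w q = arc_var w (arc_start L (fst q) (snd q)) (circle_dist L (fst q) (snd q))"
    for w :: "real \<Rightarrow> 'a" and q :: "real \<times> real"
  define D where "D q = circle_dist L (fst q) (snd q) powr (- (\<alpha> * p))" for q :: "real \<times> real"
  \<comment> \<open>A sum instead of a maximum: it dominates all three normalized variances, and its
    p-th power can be estimated and integrated term by term.\<close>
  define T where "T q = V t q + V u q / N1\<^sup>2 + V v q / N2\<^sup>2" for q
  define A where "A w q = D q * V w q powr p" for w q
  have Vm: "V w \<in> borel_measurable borel" if "w \<in> borel_measurable borel" for w :: "real \<Rightarrow> 'a"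
    unfolding V_def using that by measurable
  have Dm: "D \<in> borel_measurable borel" unfolding D_def by measurable
  have Am: "A w \<in> borel_measurable (torus_measure L)" if "w \<in> borel_measurable borel" for w :: "real \<Rightarrow> 'a"
  proof (rule borel_measurable_torus)
    note [measurable] = Vm[OF that] Dm
    show "A w \<in> borel_measurable borel" unfolding A_def by measurable
  qed
  have t1: "norm (t x) \<le> 1" for x using norms(1)[of x] by simp
  have V0: "0 \<le> V t q" "0 \<le> V u q" "0 \<le> V v q" for q
    unfolding V_def by (rule arc_var_nonneg[OF borel(1) t1], rule arc_var_nonneg[OF borel(2) norms(2)],
        rule arc_var_nonneg[OF borel(3) norms(3)])
  have T: "V t q \<le> T q" "V u q \<le> N1\<^sup>2 * T q" "V v q \<le> N2\<^sup>2 * T q" for q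
  proof -
    have "0 \<le> V u q / N1\<^sup>2" "0 \<le> V v q / N2\<^sup>2" using V0 by simp_all
    then have "V t q \<le> T q" "V u q / N1\<^sup>2 \<le> T q" "V v q / N2\<^sup>2 \<le> T q" using V0(1)[of q] by (simp_all add: T_def)
    then show "V t q \<le> T q" "V u q \<le> N1\<^sup>2 * T q" "V v q \<le> N2\<^sup>2 * T q"
      using N by (simp_all add: divide_le_eq mult.commute)
  qed
  define c1 c2 where "c1 = 1 / N1 powr (2 * p)" and "c2 = 1 / N2 powr (2 * p)"
  have c0: "0 \<le> c1" "0 \<le> c2" by (simp_all add: c1_def c2_def)
  have A0: "0 \<le> A w q" for w q by (simp add: A_def D_def)
  have sq: "(x\<^sup>2) powr p = x powr (2 * p)" if "0 < x" for x :: real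
    using powr_powr[of x 2 p] that by (simp add: powr_numeral)
  have ET: "D q * T q powr p \<le> 3 powr p * (A t q + c1 * A u q + c2 * A v q)" for q
  proof -
    have "T q powr p \<le> 3 powr p * (V t q powr p + (V u q / N1\<^sup>2) powr p + (V v q / N2\<^sup>2) powr p)"
      unfolding T_def using V0[of q] p by (intro sum3_powr_le) auto
    then have "D q * T q powr p \<le> D q * (3 powr p * (V t q powr p + (V u q / N1\<^sup>2) powr p + (V v q / N2\<^sup>2) powr p))"
      by (intro mult_left_mono) (simp_all add: D_def)
    also have "\<dots> = 3 powr p * (A t q + c1 * A u q + c2 * A v q)"
      using N by (simp add: A_def c1_def c2_def powr_divide sq algebra_simps)
    finally show ?thesis .
  qed
  have JA: "(\<integral>\<^sup>+q. ennreal (A t q) \<partial>torus_measure L) \<le> ennreal (K powr (2 * p))"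
    "(\<integral>\<^sup>+q. ennreal (A u q) \<partial>torus_measure L) \<le> ennreal (N1 powr (2 * p))"
    "(\<integral>\<^sup>+q. ennreal (A v q) \<partial>torus_measure L) \<le> ennreal (N2 powr (2 * p))"
    unfolding A_def D_def V_def
    by (rule order_trans[OF nn_integral_torus_arc_var_le[OF L borel(1) t1 periodic(7) p r] J(1)[unfolded J_def]],
        rule order_trans[OF nn_integral_torus_arc_var_le[OF L borel(2) norms(2) periodic(8) p r] J(2)[unfolded J_def]],
        rule order_trans[OF nn_integral_torus_arc_var_le[OF L borel(3) norms(3) periodic(9) p r] J(3)[unfolded J_def]])
  \<comment> \<open>After normalization u and v contribute 1 each, which makes the 2;
    \<open>3 powr p\<close> comes from splitting the p-th power of a sum of three terms.\<close>
  define B0 where "B0 = 3 powr p * (K powr (2 * p) + 2)"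
  have B0: "0 \<le> B0" by (simp add: B0_def)
  have nn: "(\<integral>\<^sup>+q. ennreal (D q * T q powr p) \<partial>torus_measure L) \<le> ennreal B0"
  proof -
    note Am' = Am[OF borel(1)] Am[OF borel(2)] Am[OF borel(3)]
    have e: "ennreal (3 powr p * (A t q + c1 * A u q + c2 * A v q)) =
        ennreal (3 powr p) * (ennreal (A t q) + ennreal c1 * ennreal (A u q) + ennreal c2 * ennreal (A v q))" for q
      using A0 c0 by (simp add: ennreal_mult ennreal_plus)
    have c: "ennreal c1 * ennreal (N1 powr (2 * p)) = 1" "ennreal c2 * ennreal (N2 powr (2 * p)) = 1"
      using N by (simp_all add: c1_def c2_def ennreal_mult[symmetric])
    have "(\<integral>\<^sup>+q. ennreal (D q * T q powr p) \<partial>torus_measure L)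
      \<le> (\<integral>\<^sup>+q. ennreal (3 powr p) * (ennreal (A t q) + ennreal c1 * ennreal (A u q) + ennreal c2 * ennreal (A v q)) \<partial>torus_measure L)"
      unfolding e[symmetric] by (intro nn_integral_mono ennreal_leI ET)
    moreover have "(\<integral>\<^sup>+q. ennreal (3 powr p) * (ennreal (A t q) + ennreal c1 * ennreal (A u q) + ennreal c2 * ennreal (A v q)) \<partial>torus_measure L)
      = ennreal (3 powr p) * ((\<integral>\<^sup>+q. ennreal (A t q) \<partial>torus_measure L) + ennreal c1 * (\<integral>\<^sup>+q. ennreal (A u q) \<partial>torus_measure L)
          + ennreal c2 * (\<integral>\<^sup>+q. ennreal (A v q) \<partial>torus_measure L))"
      using Am' by (simp add: nn_integral_cmult nn_integral_add)
    moreover have "\<dots> \<le> ennreal (3 powr p) * (ennreal (K powr (2 * p)) + ennreal c1 * ennreal (N1 powr (2 * p))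
          + ennreal c2 * ennreal (N2 powr (2 * p)))"
      by (intro mult_left_mono add_mono JA) auto
    moreover have "\<dots> = ennreal B0"
      unfolding c B0_def by (simp add: ennreal_mult ennreal_plus add.assoc one_add_one)
    ultimately show ?thesis by simp
  qed
  have Em: "(\<lambda>q. D q * T q powr p) \<in> borel_measurable (torus_measure L)"
  proof (rule borel_measurable_torus)
    note [measurable] = Vm[OF borel(1)] Vm[OF borel(2)] Vm[OF borel(3)] Dm
    show "(\<lambda>q. D q * T q powr p) \<in> borel_measurable borel" unfolding T_def by measurable
  qed
  have vc: "0 \<le> variation_const \<alpha> p Cb" using variation_const_pos[OF \<alpha> p, of Cb] by simp
  have b: "AE q in torus_measure L. \<bar>energy_density \<alpha> p L f \<tau> q\<bar> \<le> variation_const \<alpha> p Cb * (D q * T q powr p)"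
    "AE q in torus_measure L. \<bar>variation1 \<alpha> p L f \<tau> \<phi> \<phi>' q\<bar> \<le> variation_const \<alpha> p Cb * N1 * (D q * T q powr p)"
    "AE q in torus_measure L. \<bar>variation2 \<alpha> p L f \<tau> \<phi> \<phi>' \<psi> \<psi>' q\<bar> \<le> variation_const \<alpha> p Cb * N1 * N2 * (D q * T q powr p)"
    using AE_torus_bounds[of T] T unfolding V_def D_def by auto
  have "integrable (torus_measure L) (energy_density \<alpha> p L f \<tau>) \<and>
      (\<integral>q. \<bar>energy_density \<alpha> p L f \<tau> q\<bar> \<partial>torus_measure L) \<le> variation_const \<alpha> p Cb * B0"
    using integrable_bound_nn[OF borel_measurable_torus_variations(1) Em b(1) _ nn B0] vc by simp
  moreover have "integrable (torus_measure L) (variation1 \<alpha> p L f \<tau> \<phi> \<phi>') \<and>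
      (\<integral>q. \<bar>variation1 \<alpha> p L f \<tau> \<phi> \<phi>' q\<bar> \<partial>torus_measure L) \<le> variation_const \<alpha> p Cb * N1 * B0"
    using integrable_bound_nn[OF borel_measurable_torus_variations(2) Em b(2) _ nn B0] vc N by simp
  moreover have "integrable (torus_measure L) (variation2 \<alpha> p L f \<tau> \<phi> \<phi>' \<psi> \<psi>') \<and>
      (\<integral>q. \<bar>variation2 \<alpha> p L f \<tau> \<phi> \<phi>' \<psi> \<psi>' q\<bar> \<partial>torus_measure L) \<le> variation_const \<alpha> p Cb * N1 * N2 * B0"
    using integrable_bound_nn[OF borel_measurable_torus_variations(3) Em b(3) _ nn B0] vc N by simp
  ultimately show "integrable (torus_measure L) (energy_density \<alpha> p L f \<tau>)"
    "integrable (torus_measure L) (variation1 \<alpha> p L f \<tau> \<phi> \<phi>')"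
    "integrable (torus_measure L) (variation2 \<alpha> p L f \<tau> \<phi> \<phi>' \<psi> \<psi>')"
    "(\<integral>q. \<bar>energy_density \<alpha> p L f \<tau> q\<bar> \<partial>torus_measure L) \<le> B"
    "(\<integral>q. \<bar>variation1 \<alpha> p L f \<tau> \<phi> \<phi>' q\<bar> \<partial>torus_measure L) \<le> B * N1"
    "(\<integral>q. \<bar>variation2 \<alpha> p L f \<tau> \<phi> \<phi>' \<psi> \<psi>' q\<bar> \<partial>torus_measure L) \<le> B * N1 * N2"
    by (simp_all add: B_def B0_def ac_simps)
qed

end

section \<open>Arclength, essential suprema and fractional norms\<close>

lemma circle_dist_eq_intrinsic_dist:
  fixes \<tau> t :: "real \<Rightarrow> 'a::euclidean_space"
  assumes L: "0 < L" and t: "AE x in lebesgue. \<tau> x = t x" "t \<in> borel_measurable borel" "periodic_fun_simple t L" "\<And>x. norm (t x) = 1"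
    and s: "circle_dist L s1 s2 \<noteq> 0"
  shows "intrinsic_dist L \<tau> s1 s2 = circle_dist L s1 s2"
  using intrinsic_dist_arc[OF L t(1,2,3) s] circle_dist_bounds[OF L, of s1 s2]
  by (simp add: t(4) unit.prob_space)

lemma bi_lipschitz_circle_dist:
  fixes f \<tau> t :: "real \<Rightarrow> 'a::euclidean_space"
  assumes bl: "bi_lipschitz_curve L f \<tau> Cb"
    and t: "0 < L" "AE x in lebesgue. \<tau> x = t x" "t \<in> borel_measurable borel" "periodic_fun_simple t L" "\<And>x. norm (t x) = 1"
  shows "0 < Cb" "circle_dist L s1 s2 \<le> Cb * norm (f s1 - f s2)"
proof -
  show C: "0 < Cb" using bl by (simp add: bi_lipschitz_curve_def)
  show "circle_dist L s1 s2 \<le> Cb * norm (f s1 - f s2)"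
  proof (cases "circle_dist L s1 s2 = 0")
    case False
    have "intrinsic_dist L \<tau> s1 s2 \<le> Cb * norm (f s1 - f s2)" using bl by (simp add: bi_lipschitz_curve_def)
    then show ?thesis unfolding circle_dist_eq_intrinsic_dist[OF t False] .
  qed (use C in simp)
qed

lemma Linf_norm_AE:
  fixes v :: "real \<Rightarrow> 'a::euclidean_space"
  assumes L: "0 < L" and v: "in_Linf (circle_measure L) v"
  shows "AE s in circle_measure L. norm (v s) \<le> Linf_norm (circle_measure L) v" "0 \<le> Linf_norm (circle_measure L) v"
proof -
  let ?e = "esssup (circle_measure L) (\<lambda>x. ereal (norm (v x)))"
  have fin: "?e < \<infinity>" using v by (simp add: in_Linf_def)
  have "AE s in circle_measure L. ereal (norm (v s)) \<le> ?e" by (rule esssup_AE)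
  then show ae: "AE s in circle_measure L. norm (v s) \<le> Linf_norm (circle_measure L) v"
    unfolding Linf_norm_def
  proof eventually_elim
    case (elim s)
    then show ?case using fin by (cases ?e) auto
  qed
  show "0 \<le> Linf_norm (circle_measure L) v"
  proof (rule ccontr)
    assume neg: "\<not> 0 \<le> Linf_norm (circle_measure L) v"
    \<comment> \<open>A negative essential supremum would bound a norm almost everywhere, which is
      impossible on a circle of positive measure.\<close>
    have "AE s in circle_measure L. False"
      using ae by eventually_elim (use neg norm_ge_zero order_trans in blast)
    then have "emeasure (circle_measure L) (space (circle_measure L)) = 0" by (simp add: AE_iff_measurable[OF _ refl])
    then show False using L by (simp add: circle_measure_def emeasure_restrict_space space_restrict_space)
  qed
qed

text \<open>The jump along the shorter arc is the jump between the two points of the pair, and a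
  change of representative affects a null set of pairs only; what remains is the integral in the
  seminorm.\<close>

lemma nn_integral_arc_jump:
  fixes v w :: "real \<Rightarrow> 'a::euclidean_space"
  assumes L: "0 < L" and per: "periodic_fun_simple v L" "periodic_fun_simple w L"
    and AE: "AE x in lebesgue. v x = w x" and q: "0 < q"
    and int: "integrable (torus_measure L) (frac_quotient L \<sigma> q v)"
  shows "(\<integral>\<^sup>+x. ennreal (circle_dist L (fst x) (snd x) powr (- (1 + \<sigma> * q)) *
        norm (w (arc_start L (fst x) (snd x) + circle_dist L (fst x) (snd x)) - w (arc_start L (fst x) (snd x))) powr q) \<partial>torus_measure L)
    = ennreal (frac_seminorm L \<sigma> q v powr q)"
proof -
  have nonneg: "0 \<le> frac_quotient L \<sigma> q v x" for x by (simp add: frac_quotient_def case_prod_beta)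
  have "AE x in torus_measure L. circle_dist L (fst x) (snd x) powr (- (1 + \<sigma> * q)) *
        norm (w (arc_start L (fst x) (snd x) + circle_dist L (fst x) (snd x)) - w (arc_start L (fst x) (snd x))) powr q
      = frac_quotient L \<sigma> q v x"
    using AE_torus_coordinates[OF AE]
  proof eventually_elim
    case (elim x)
    have "norm (v (fst x) - v (snd x)) = norm (w (fst x) - w (snd x))" using elim by simp
    also have "\<dots> = norm (w (arc_start L (fst x) (snd x) + circle_dist L (fst x) (snd x)) - w (arc_start L (fst x) (snd x)))"
      by (rule norm_diff_arc[OF L per(2)])
    finally show ?case unfolding powr_minus_divide by (simp add: frac_quotient_def case_prod_beta)
  qed
  then have "(\<integral>\<^sup>+x. ennreal (circle_dist L (fst x) (snd x) powr (- (1 + \<sigma> * q)) *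
        norm (w (arc_start L (fst x) (snd x) + circle_dist L (fst x) (snd x)) - w (arc_start L (fst x) (snd x))) powr q) \<partial>torus_measure L)
     = (\<integral>\<^sup>+x. ennreal (frac_quotient L \<sigma> q v x) \<partial>torus_measure L)"
    by (intro nn_integral_cong_AE) (auto elim!: AE_mp)
  also have "\<dots> = ennreal (\<integral>x. frac_quotient L \<sigma> q v x \<partial>torus_measure L)"
    using int nonneg by (intro nn_integral_eq_integral) auto
  also have "(\<integral>x. frac_quotient L \<sigma> q v x \<partial>torus_measure L) = frac_seminorm L \<sigma> q v powr q"
    unfolding frac_seminorm_def using q by (simp add: powr_powr nonneg)
  finally show ?thesis .
qed

lemma frac_seminorm_le:
  assumes "0 < q" "0 \<le> Linf_norm (circle_measure L) v"
  shows "0 \<le> frac_seminorm L \<sigma> q v" "frac_seminorm L \<sigma> q v \<le> frac_Linf_norm L \<sigma> q v" "0 \<le> frac_Linf_norm L \<sigma> q v"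
    "Linf_norm (circle_measure L) v \<le> frac_Linf_norm L \<sigma> q v"
proof -
  show s0: "0 \<le> frac_seminorm L \<sigma> q v" by (simp add: frac_seminorm_def)
  have "frac_seminorm L \<sigma> q v = (frac_seminorm L \<sigma> q v powr q) powr (1 / q)"
    using assms s0 by (simp add: powr_powr)
  also have "\<dots> \<le> frac_norm L \<sigma> q v"
    unfolding frac_norm_def using assms by (intro powr_mono2) auto
  finally have "frac_seminorm L \<sigma> q v \<le> frac_norm L \<sigma> q v" .
  then show "frac_seminorm L \<sigma> q v \<le> frac_Linf_norm L \<sigma> q v" "0 \<le> frac_Linf_norm L \<sigma> q v"
    "Linf_norm (circle_measure L) v \<le> frac_Linf_norm L \<sigma> q v"
    using assms(2) s0 by (simp_all add: frac_Linf_norm_def)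
qed

text \<open>Membership in the two spaces provides some weak derivatives, possibly two different
  ones. By uniqueness almost everywhere their regularity passes to the given derivative.\<close>

lemma W1_representative:
  fixes \<phi> \<phi>' :: "real \<Rightarrow> 'a::euclidean_space"
  assumes L: "0 < L" and W: "\<phi> \<in> W1_frac L \<sigma> q" "\<phi> \<in> W1_inf L" and wd: "has_weak_deriv L \<phi> \<phi>'"
  shows "integrable (torus_measure L) (frac_quotient L \<sigma> q \<phi>')" "in_Linf (circle_measure L) \<phi>'"
proof -
  have \<phi>'m: "\<phi>' \<in> borel_measurable (circle_measure L)" and per: "periodic_fun_simple \<phi>' L"
    using wd by (auto simp: has_weak_deriv_def)
  obtain v where v: "has_weak_deriv L \<phi> v" "integrable (torus_measure L) (frac_quotient L \<sigma> q v)"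
    using W(1) by (auto simp: W1_frac_def)
  have "periodic_fun_simple (\<lambda>x. v x = \<phi>' x) L"
    using per v(1) by (simp add: has_weak_deriv_def periodic_fun_simple_def)
  then have "AE x in lebesgue. v x = \<phi>' x" using weak_derivative_unique[OF L v(1) wd] by (rule AE_periodic[OF L])
  then have "AE x in torus_measure L. v (fst x) = \<phi>' (fst x) \<and> v (snd x) = \<phi>' (snd x)" by (rule AE_torus_coordinates)
  then have eq: "AE x in torus_measure L. frac_quotient L \<sigma> q \<phi>' x = frac_quotient L \<sigma> q v x"
    by eventually_elim (simp add: frac_quotient_def case_prod_beta)
  then have "frac_quotient L \<sigma> q \<phi>' \<in> borel_measurable (torus_measure L)"
    by (rule borel_measurable_torus_AE[OF borel_measurable_integrable[OF v(2)]])
  then show "integrable (torus_measure L) (frac_quotient L \<sigma> q \<phi>')"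
    using v(2) eq by (subst integrable_cong_AE[of _ _ "frac_quotient L \<sigma> q v"]) auto
  obtain w where w: "has_weak_deriv L \<phi> w" "in_Linf (circle_measure L) w"
    using W(2) by (auto simp: W1_inf_def)
  have "AE s in circle_measure L. ereal (norm (\<phi>' s)) \<le> ereal (norm (w s))"
    using weak_derivative_unique[OF L w(1) wd] by eventually_elim simp
  then have "esssup (circle_measure L) (\<lambda>s. ereal (norm (\<phi>' s))) \<le> esssup (circle_measure L) (\<lambda>s. ereal (norm (w s)))"
    using \<phi>'m by (intro esssup_AE_mono) auto
  then show "in_Linf (circle_measure L) \<phi>'" using w(2) \<phi>'m by (auto simp: in_Linf_def)
qed

section \<open>Fractional Sobolev regularity\<close>

lemma curve_variation_weak:
  fixes f \<phi> \<psi> \<tau> \<phi>' \<psi>' :: "real \<Rightarrow> 'a::euclidean_space"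
  assumes \<alpha>: "0 < \<alpha>" and p: "1 \<le> p"
    and arc: "arclength_curve L f \<tau>" and bl: "bi_lipschitz_curve L f \<tau> Cb"
    and wd: "has_weak_deriv L \<phi> \<phi>'" "has_weak_deriv L \<psi> \<psi>'"
    and inf: "in_Linf (circle_measure L) \<phi>'" "in_Linf (circle_measure L) \<psi>'"
    and N: "Linf_norm (circle_measure L) \<phi>' \<le> N1" "Linf_norm (circle_measure L) \<psi>' \<le> N2"
  obtains t u v S where "curve_variation L \<alpha> p N1 N2 Cb f \<phi> \<psi> \<tau> \<phi>' \<psi>' t u v S"
proof -
  have L: "0 < L" and wf: "has_weak_deriv L f \<tau>" and unit: "AE s in lebesgue. norm (\<tau> s) = 1"
    using arc by (auto simp: arclength_curve_def)
  have N0: "0 \<le> N1" "0 \<le> N2" using Linf_norm_AE(2)[OF L inf(1)] Linf_norm_AE(2)[OF L inf(2)] N by auto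
  have per: "periodic_fun_simple f L" "periodic_fun_simple \<phi> L" "periodic_fun_simple \<psi> L"
      "periodic_fun_simple \<tau> L" "periodic_fun_simple \<phi>' L" "periodic_fun_simple \<psi>' L"
    and meas: "\<tau> \<in> borel_measurable (circle_measure L)" "\<phi>' \<in> borel_measurable (circle_measure L)"
      "\<psi>' \<in> borel_measurable (circle_measure L)"
    using wf wd by (auto simp: has_weak_deriv_def)
  \<comment> \<open>Any unit vector serves as replacement value for the tangent on the null set
    where its length is not 1.\<close>
  obtain e :: 'a where e: "e \<in> Basis" using nonempty_Basis by blast
  have z: "e \<in> sphere 0 1" using e by simp
  have "AE s in circle_measure L. \<tau> s \<in> sphere 0 1"
    unfolding AE_circle_iff using unit by eventually_elim simp
  then obtain t where t: "t \<in> borel_measurable borel" "periodic_fun_simple t L" "\<And>x. t x \<in> sphere 0 1" "AE x in lebesgue. \<tau> x = t x"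
    using borel_representative[OF L per(4) meas(1) closed_sphere z] by blast
  have "AE s in circle_measure L. \<phi>' s \<in> cball 0 N1"
    using Linf_norm_AE(1)[OF L inf(1)] by eventually_elim (use N in simp)
  then obtain u where u: "u \<in> borel_measurable borel" "periodic_fun_simple u L" "\<And>x. u x \<in> cball 0 N1" "AE x in lebesgue. \<phi>' x = u x"
    using borel_representative[OF L per(5) meas(2) closed_cball, of 0 0 N1] N0 by auto
  have "AE s in circle_measure L. \<psi>' s \<in> cball 0 N2"
    using Linf_norm_AE(1)[OF L inf(2)] by eventually_elim (use N in simp)
  then obtain v where v: "v \<in> borel_measurable borel" "periodic_fun_simple v L" "\<And>x. v x \<in> cball 0 N2" "AE x in lebesgue. \<psi>' x = v x"
    using borel_representative[OF L per(6) meas(3) closed_cball, of 0 0 N2] N0 by auto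
  have n: "norm (t x) = 1" "norm (u x) \<le> N1" "norm (v x) \<le> N2" for x
    using t(3)[of x] u(3)[of x] v(3)[of x] by simp_all
  have t1: "norm (t x) \<le> 1" for x using n(1)[of x] by simp
  obtain S1 where S1: "periodic_fun_simple (\<lambda>x. x \<in> S1) L" "AE x in lebesgue. x \<in> S1"
    "\<forall>a\<in>S1. \<forall>b\<in>S1. a \<le> b \<longrightarrow> b \<le> a + L \<longrightarrow> f b - f a = (\<integral>x. t x \<partial>lebesgue_on {a..b})"
    using weak_derivative_ftc[OF L wf t(2,1) t1 t(4)] by (elim exE conjE)
  obtain S2 where S2: "periodic_fun_simple (\<lambda>x. x \<in> S2) L" "AE x in lebesgue. x \<in> S2"
    "\<forall>a\<in>S2. \<forall>b\<in>S2. a \<le> b \<longrightarrow> b \<le> a + L \<longrightarrow> \<phi> b - \<phi> a = (\<integral>x. u x \<partial>lebesgue_on {a..b})"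
    using weak_derivative_ftc[OF L wd(1) u(2,1) n(2) u(4)] by (elim exE conjE)
  obtain S3 where S3: "periodic_fun_simple (\<lambda>x. x \<in> S3) L" "AE x in lebesgue. x \<in> S3"
    "\<forall>a\<in>S3. \<forall>b\<in>S3. a \<le> b \<longrightarrow> b \<le> a + L \<longrightarrow> \<psi> b - \<psi> a = (\<integral>x. v x \<partial>lebesgue_on {a..b})"
    using weak_derivative_ftc[OF L wd(2) v(2,1) n(3) v(4)] by (elim exE conjE)
  \<comment> \<open>At these points all three primitive formulas hold, and the given derivatives
    coincide with their representatives.\<close>
  define S where "S = S1 \<inter> S2 \<inter> S3 \<inter> {x. \<tau> x = t x \<and> \<phi>' x = u x \<and> \<psi>' x = v x}"
  note bl' = bi_lipschitz_circle_dist[OF bl L t(4,1,2) n(1)]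
  have "curve_variation L \<alpha> p N1 N2 Cb f \<phi> \<psi> \<tau> \<phi>' \<psi>' t u v S"
  proof (rule curve_variation.intro)
    show "periodic_fun_simple (\<lambda>x. x \<in> S) L"
      using S1(1) S2(1) S3(1) per t(2) u(2) v(2) by (simp add: S_def periodic_fun_simple_def)
    show "AE x in lebesgue. x \<in> S"
      using S1(2) S2(2) S3(2) t(4) u(4) v(4) by eventually_elim (simp add: S_def)
    show "f b - f a = (\<integral>x. t x \<partial>lebesgue_on {a..b})" if "a \<in> S" "b \<in> S" "a \<le> b" "b \<le> a + L" for a b
      using that S1(3) unfolding S_def by blast
    show "\<phi> b - \<phi> a = (\<integral>x. u x \<partial>lebesgue_on {a..b})" if "a \<in> S" "b \<in> S" "a \<le> b" "b \<le> a + L" for a b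
      using that S2(3) unfolding S_def by blast
    show "\<psi> b - \<psi> a = (\<integral>x. v x \<partial>lebesgue_on {a..b})" if "a \<in> S" "b \<in> S" "a \<le> b" "b \<le> a + L" for a b
      using that S3(3) unfolding S_def by blast
  qed (use L \<alpha> p per t(1,2) u(1,2) v(1,2) n bl' in \<open>auto simp: S_def\<close>)
  then show thesis by (rule that)
qed

lemma le_of_le_mult_add_eps:
  fixes B a b x :: real
  assumes "\<And>\<epsilon>. 0 < \<epsilon> \<Longrightarrow> x \<le> B * (a + \<epsilon>) * (b + \<epsilon>)"
  shows "x \<le> B * a * b"
proof (rule tendsto_lowerbound)
  show "((\<lambda>\<epsilon>. B * (a + \<epsilon>) * (b + \<epsilon>)) \<longlongrightarrow> B * a * b) (at_right 0)"
    by (rule tendsto_eq_intros refl tendsto_ident_at)+ simp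
  show "\<forall>\<^sub>F \<epsilon> in at_right 0. x \<le> B * (a + \<epsilon>) * (b + \<epsilon>)"
    using eventually_at_right_less[of "0 :: real"] by eventually_elim (rule assms)
qed simp

theorem fractional_Sobolev_bounds:
  fixes f \<phi> \<psi> \<tau> \<phi>' \<psi>' :: "real \<Rightarrow> 'a::euclidean_space"
  assumes \<alpha>: "0 < \<alpha>" and p: "1 \<le> p" and r: "1 \<le> \<alpha> * p" and \<sigma>: "\<sigma> = (\<alpha> * p - 1) / (2 * p)"
    and arc: "arclength_curve L f \<tau>" and bl: "bi_lipschitz_curve L f \<tau> Cb"
    and W: "{f, \<phi>, \<psi>} \<subseteq> W1_frac L \<sigma> (2 * p) \<inter> W1_inf L"
    and wd: "has_weak_deriv L \<phi> \<phi>'" "has_weak_deriv L \<psi> \<psi>'"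
  defines "T \<equiv> torus_measure L"
    and "B \<equiv> variation_const \<alpha> p Cb * (3 powr p * (frac_Linf_norm L \<sigma> (2 * p) \<tau> powr (2 * p) + 2))"
  shows "AE x in T. variation1_exists \<alpha> p L f \<tau> \<phi> \<phi>' x"
    "AE x in T. variation2_exists \<alpha> p L f \<tau> \<phi> \<phi>' \<psi> \<psi>' x"
    "integrable T (energy_density \<alpha> p L f \<tau>)" "integrable T (variation1 \<alpha> p L f \<tau> \<phi> \<phi>')"
    "integrable T (variation2 \<alpha> p L f \<tau> \<phi> \<phi>' \<psi> \<psi>')"
    "(\<integral>x. \<bar>energy_density \<alpha> p L f \<tau> x\<bar> \<partial>T) \<le> B"
    "(\<integral>x. \<bar>variation1 \<alpha> p L f \<tau> \<phi> \<phi>' x\<bar> \<partial>T) \<le> B * frac_Linf_norm L \<sigma> (2 * p) \<phi>'"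
    "(\<integral>x. \<bar>variation2 \<alpha> p L f \<tau> \<phi> \<phi>' \<psi> \<psi>' x\<bar> \<partial>T)
       \<le> B * frac_Linf_norm L \<sigma> (2 * p) \<phi>' * frac_Linf_norm L \<sigma> (2 * p) \<psi>'"
proof -
  let ?N = "frac_Linf_norm L \<sigma> (2 * p)" and ?S = "frac_seminorm L \<sigma> (2 * p)"
  have L: "0 < L" and wf: "has_weak_deriv L f \<tau>"
    using arc by (auto simp: arclength_curve_def)
  have q: "0 < 2 * p" using p by simp
  \<comment> \<open>The choice of \<sigma> makes the exponent in the kernel of the seminorm equal to
    that in the densities.\<close>
  have e: "1 + \<sigma> * (2 * p) = \<alpha> * p" using p \<sigma> by simp
  have W': "f \<in> W1_frac L \<sigma> (2 * p)" "f \<in> W1_inf L" "\<phi> \<in> W1_frac L \<sigma> (2 * p)" "\<phi> \<in> W1_inf L"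
    "\<psi> \<in> W1_frac L \<sigma> (2 * p)" "\<psi> \<in> W1_inf L" using W by auto
  note rf = W1_representative[OF L W'(1,2) wf] and r\<phi> = W1_representative[OF L W'(3,4) wd(1)]
    and r\<psi> = W1_representative[OF L W'(5,6) wd(2)]
  note nf = frac_seminorm_le[OF q Linf_norm_AE(2)[OF L rf(2)], of \<sigma>]
    and n\<phi> = frac_seminorm_le[OF q Linf_norm_AE(2)[OF L r\<phi>(2)], of \<sigma>]
    and n\<psi> = frac_seminorm_le[OF q Linf_norm_AE(2)[OF L r\<psi>(2)], of \<sigma>]
  \<comment> \<open>The variances of the perturbations are divided by \<open>N1\<^sup>2\<close> and
    \<open>N2\<^sup>2\<close>, but the norms of the perturbations may be 0. Both are therefore
    enlarged by \<epsilon>, which tends to 0 at the end.\<close>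
  have main: "(AE x in T. variation1_exists \<alpha> p L f \<tau> \<phi> \<phi>' x) \<and>
    (AE x in T. variation2_exists \<alpha> p L f \<tau> \<phi> \<phi>' \<psi> \<psi>' x) \<and>
    integrable T (energy_density \<alpha> p L f \<tau>) \<and> integrable T (variation1 \<alpha> p L f \<tau> \<phi> \<phi>') \<and>
    integrable T (variation2 \<alpha> p L f \<tau> \<phi> \<phi>' \<psi> \<psi>') \<and>
    (\<integral>x. \<bar>energy_density \<alpha> p L f \<tau> x\<bar> \<partial>T) \<le> B \<and>
    (\<integral>x. \<bar>variation1 \<alpha> p L f \<tau> \<phi> \<phi>' x\<bar> \<partial>T) \<le> B * (?N \<phi>' + \<epsilon>) \<and>
    (\<integral>x. \<bar>variation2 \<alpha> p L f \<tau> \<phi> \<phi>' \<psi> \<psi>' x\<bar> \<partial>T) \<le> B * (?N \<phi>' + \<epsilon>) * (?N \<psi>' + \<epsilon>)" if \<epsilon>: "0 < \<epsilon>" for \<epsilon>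
  proof -
    have N: "Linf_norm (circle_measure L) \<phi>' \<le> ?N \<phi>' + \<epsilon>" "Linf_norm (circle_measure L) \<psi>' \<le> ?N \<psi>' + \<epsilon>"
      "0 < ?N \<phi>' + \<epsilon>" "0 < ?N \<psi>' + \<epsilon>" using n\<phi> n\<psi> \<epsilon> by linarith+
    obtain t u v S where cv: "curve_variation L \<alpha> p (?N \<phi>' + \<epsilon>) (?N \<psi>' + \<epsilon>) Cb f \<phi> \<psi> \<tau> \<phi>' \<psi>' t u v S"
      by (rule curve_variation_weak[OF \<alpha> p arc bl wd r\<phi>(2) r\<psi>(2) N(1,2)])
    interpret curve_variation L \<alpha> p "?N \<phi>' + \<epsilon>" "?N \<psi>' + \<epsilon>" Cb f \<phi> \<psi> \<tau> \<phi>' \<psi>' t u v S by (rule cv)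
    have ae: "AE x in lebesgue. \<tau> x = t x" "AE x in lebesgue. \<phi>' x = u x" "AE x in lebesgue. \<psi>' x = v x"
      using AE_S by (eventually_elim, simp add: on_S)+
    have J: "(\<integral>\<^sup>+q. ennreal (circle_dist L (fst q) (snd q) powr (- (\<alpha> * p)) *
        norm (w (arc_start L (fst q) (snd q) + circle_dist L (fst q) (snd q)) - w (arc_start L (fst q) (snd q))) powr (2 * p)) \<partial>torus_measure L)
        \<le> ennreal (b powr (2 * p))"
      if "periodic_fun_simple z L" "periodic_fun_simple w L" "AE x in lebesgue. z x = w x"
        "integrable (torus_measure L) (frac_quotient L \<sigma> (2 * p) z)" "0 \<le> ?S z" "?S z \<le> b" for z w b
      using nn_integral_arc_jump[OF L that(1-3) q that(4)] that(5,6) q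
      unfolding e by (simp add: ennreal_leI powr_mono2)
    have b: "?S \<phi>' \<le> ?N \<phi>' + \<epsilon>" "?S \<psi>' \<le> ?N \<psi>' + \<epsilon>" using n\<phi>(2) n\<psi>(2) \<epsilon> by linarith+
    note res = integrable_torus_variations[OF N(3,4) r
        J[OF periodic(4,7) ae(1) rf(1) nf(1,2)] J[OF periodic(5,8) ae(2) r\<phi>(1) n\<phi>(1) b(1)]
        J[OF periodic(6,9) ae(3) r\<psi>(1) n\<psi>(1) b(2)]]
    show ?thesis
      unfolding T_def B_def by (intro conjI AE_torus_variations res)
  qed
  note m1 = main[OF zero_less_one]
  show "AE x in T. variation1_exists \<alpha> p L f \<tau> \<phi> \<phi>' x"
    "AE x in T. variation2_exists \<alpha> p L f \<tau> \<phi> \<phi>' \<psi> \<psi>' x"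
    "integrable T (energy_density \<alpha> p L f \<tau>)" "integrable T (variation1 \<alpha> p L f \<tau> \<phi> \<phi>')"
    "integrable T (variation2 \<alpha> p L f \<tau> \<phi> \<phi>' \<psi> \<psi>')"
    "(\<integral>x. \<bar>energy_density \<alpha> p L f \<tau> x\<bar> \<partial>T) \<le> B" using m1 by simp_all
  show "(\<integral>x. \<bar>variation2 \<alpha> p L f \<tau> \<phi> \<phi>' \<psi> \<psi>' x\<bar> \<partial>T) \<le> B * ?N \<phi>' * ?N \<psi>'"
    by (rule le_of_le_mult_add_eps) (use main in blast)
  have "B \<ge> 0" unfolding B_def using variation_const_pos[OF \<alpha> p, of Cb] by simp
  \<comment> \<open>The limit lemma handles two factors; for the first variation the second factor
    is \<open>1 + \<epsilon>\<close>.\<close>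
  have "(\<integral>x. \<bar>variation1 \<alpha> p L f \<tau> \<phi> \<phi>' x\<bar> \<partial>T) \<le> B * ?N \<phi>' * 1"
  proof (rule le_of_le_mult_add_eps)
    fix \<epsilon> :: real assume \<epsilon>: "0 < \<epsilon>"
    have "(\<integral>x. \<bar>variation1 \<alpha> p L f \<tau> \<phi> \<phi>' x\<bar> \<partial>T) \<le> B * (?N \<phi>' + \<epsilon>)" using main[OF \<epsilon>] by simp
    also have "\<dots> \<le> B * (?N \<phi>' + \<epsilon>) * (1 + \<epsilon>)"
      using \<open>B \<ge> 0\<close> n\<phi>(3) \<epsilon> mult_left_mono[of 1 "1 + \<epsilon>" "B * (?N \<phi>' + \<epsilon>)"] by simp
    finally show "(\<integral>x. \<bar>variation1 \<alpha> p L f \<tau> \<phi> \<phi>' x\<bar> \<partial>T) \<le> B * (?N \<phi>' + \<epsilon>) * (1 + \<epsilon>)" .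
  qed
  then show "(\<integral>x. \<bar>variation1 \<alpha> p L f \<tau> \<phi> \<phi>' x\<bar> \<partial>T) \<le> B * ?N \<phi>'" by simp
qed

section \<open>Hoelder regularity\<close>

lemma arc_var_le_modulus:
  fixes w :: "real \<Rightarrow> 'a::euclidean_space"
  assumes w: "w \<in> borel_measurable borel" "\<And>x. norm (w x) \<le> N"
    and m: "\<And>x. 0 \<le> x \<Longrightarrow> x \<le> 1 \<Longrightarrow> norm (w (a + s * x) - w a) \<le> m"
  shows "arc_var w a s \<le> m\<^sup>2"
proof -
  have b: "norm ((norm (w (a + s * x) - w a))\<^sup>2) \<le> (2 * N)\<^sup>2" for x
  proof -
    have "norm (w (a + s * x) - w a) \<le> 2 * N"
      using norm_triangle_ineq4[of "w (a + s * x)" "w a"] w(2)[of "a + s * x"] w(2)[of a] by linarith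
    then show ?thesis using power_mono[OF _ norm_ge_zero, of "w (a + s * x) - w a" "2 * N" 2] by simp
  qed
  have i: "integrable unit_interval (\<lambda>x. (norm (w (a + s * x) - w a))\<^sup>2)"
    by (rule unit.integrable_bounded[OF _ b]) (use borel_measurable_arc[OF w(1), of a s] in simp)
  have "arc_var w a s \<le> (\<integral>x. (norm (w (a + s * x) - w a))\<^sup>2 \<partial>unit_interval)"
    unfolding arc_var_def by (rule unit.covar_self_le[OF borel_measurable_arc[OF w(1)] w(2)])
  also have "\<dots> \<le> (\<integral>x. m\<^sup>2 \<partial>unit_interval)"
  proof (rule integral_mono[OF i])
    fix x assume "x \<in> space unit_interval"
    then show "(norm (w (a + s * x) - w a))\<^sup>2 \<le> m\<^sup>2"
      by (intro power_mono m) (auto simp: unit_interval_def space_restrict_space)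
  qed simp
  finally show ?thesis by (simp add: unit.prob_space)
qed

text \<open>Here the derivatives are continuous and serve as their own representatives, so every
  parameter is a good one. For \<open>0 \<le> s \<le> L / 2\<close> the number s is the circle
  distance of a + s and a, so the increments express the Hoelder condition on the circle.\<close>

locale holder_variation =
  curve_variation L \<alpha> p N1 N2 Cb f \<phi> \<psi> t u v t u v UNIV
  for L \<alpha> p N1 N2 Cb :: real and f \<phi> \<psi> t u v :: "real \<Rightarrow> 'a::euclidean_space" +
  fixes \<beta> K :: real
  assumes \<beta>: "0 < \<beta>" "\<beta> \<le> 1" and continuous: "continuous_on UNIV t" "continuous_on UNIV u" "continuous_on UNIV v"
    and holder: "\<And>a s. 0 \<le> s \<Longrightarrow> s \<le> L / 2 \<Longrightarrow> norm (t (a + s) - t a) \<le> K * s powr \<beta>"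
      "\<And>a s. 0 \<le> s \<Longrightarrow> s \<le> L / 2 \<Longrightarrow> norm (u (a + s) - u a) \<le> N1 * s powr \<beta>"
      "\<And>a s. 0 \<le> s \<Longrightarrow> s \<le> L / 2 \<Longrightarrow> norm (v (a + s) - v a) \<le> N2 * s powr \<beta>"
begin

text \<open>\<open>K\<^sup>2\<close> takes care of the variance of the tangent, and the added 1 of
  the variances of u and v divided by \<open>N1\<^sup>2\<close> and
  \<open>N2\<^sup>2\<close>.\<close>

definition var_bound :: "real \<Rightarrow> real" where
  "var_bound s = (K\<^sup>2 + 1) * s powr (2 * \<beta>)"

lemma arc_var_holder:
  assumes w: "w \<in> borel_measurable borel" "\<And>x. norm (w x) \<le> N"
    and h: "\<And>a s. 0 \<le> s \<Longrightarrow> s \<le> L / 2 \<Longrightarrow> norm (w (a + s) - w a) \<le> H * s powr \<beta>" and H: "0 \<le> H"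
    and s: "0 \<le> s" "s \<le> L / 2"
  shows "arc_var w a s \<le> H\<^sup>2 * s powr (2 * \<beta>)"
proof -
  have "arc_var w a s \<le> (H * s powr \<beta>)\<^sup>2"
  proof (rule arc_var_le_modulus[OF w])
    fix x :: real assume x: "0 \<le> x" "x \<le> 1"
    then have sx: "0 \<le> s * x" "s * x \<le> s" using s by (auto intro: mult_left_le)
    then have "norm (w (a + s * x) - w a) \<le> H * (s * x) powr \<beta>" using s by (intro h) auto
    also have "\<dots> \<le> H * s powr \<beta>" using sx \<beta> H by (intro mult_left_mono powr_mono2) auto
    finally show "norm (w (a + s * x) - w a) \<le> H * s powr \<beta>" .
  qed
  also have "\<dots> = H\<^sup>2 * s powr (2 * \<beta>)"
    by (simp add: power_mult_distrib power2_eq_square powr_add[symmetric])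
  finally show ?thesis .
qed

lemma N_nonneg: "0 \<le> N1" "0 \<le> N2"
  by (rule order_trans[OF norm_ge_zero norms(2)], rule order_trans[OF norm_ge_zero norms(3)])

lemma K_nonneg: "0 \<le> K"
proof -
  have "0 \<le> K * (L / 2) powr \<beta>"
    by (rule order_trans[OF norm_ge_zero holder(1)[of "L / 2" 0]]) (use L in auto)
  then show ?thesis using L by (simp add: zero_le_mult_iff)
qed

lemma arc_var_bounds:
  assumes s: "0 \<le> s" "s \<le> L / 2"
  shows "arc_var t a s \<le> var_bound s" "arc_var u a s \<le> N1\<^sup>2 * var_bound s" "arc_var v a s \<le> N2\<^sup>2 * var_bound s"
proof -
  have b: "x * y \<le> x * ((K\<^sup>2 + 1) * y)" if "0 \<le> x" "0 \<le> y" for x y :: real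
    using that by (intro mult_left_mono) (auto simp: algebra_simps)
  have t1: "norm (t x) \<le> 1" for x using norms(1)[of x] by simp
  have "arc_var t a s \<le> K\<^sup>2 * s powr (2 * \<beta>)"
    by (rule arc_var_holder[OF borel(1) t1 holder(1) K_nonneg s])
  also have "\<dots> \<le> var_bound s" unfolding var_bound_def by (intro mult_right_mono) auto
  finally show "arc_var t a s \<le> var_bound s" .
  show "arc_var u a s \<le> N1\<^sup>2 * var_bound s"
    using order_trans[OF arc_var_holder[OF borel(2) norms(2) holder(2) N_nonneg(1) s] b]
    by (simp add: var_bound_def)
  show "arc_var v a s \<le> N2\<^sup>2 * var_bound s"
    using order_trans[OF arc_var_holder[OF borel(3) norms(3) holder(3) N_nonneg(2) s] b]
    by (simp add: var_bound_def)
qed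

definition weight :: "real \<Rightarrow> real" where
  "weight s = s powr ((\<alpha> - 2 * \<beta>) * p)"

lemma weight_var_bound:
  assumes "0 < s"
  shows "weight s * (s powr (- \<alpha> * p) * var_bound s powr p) = (K\<^sup>2 + 1) powr p"
proof -
  have e: "(\<alpha> - 2 * \<beta>) * p + (- \<alpha> * p) + 2 * \<beta> * p = 0" by (simp add: algebra_simps)
  have "weight s * (s powr (- \<alpha> * p) * var_bound s powr p)
      = (K\<^sup>2 + 1) powr p * s powr ((\<alpha> - 2 * \<beta>) * p + (- \<alpha> * p) + 2 * \<beta> * p)"
    unfolding weight_def var_bound_def powr_mult powr_powr powr_add by (simp only: ac_simps)
  then show ?thesis unfolding e using assms by simp
qed

lemma intrinsic_dist_eq: "circle_dist L s1 s2 \<noteq> 0 \<Longrightarrow> intrinsic_dist L t s1 s2 = circle_dist L s1 s2"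
  by (intro circle_dist_eq_intrinsic_dist[OF L _ borel(1) periodic(7) norms(1)]) auto

lemma weighted_eq:
  assumes "circle_dist L s1 s2 \<noteq> 0"
  shows "weighted \<alpha> \<beta> p L t (energy_density \<alpha> p L f t) (s1, s2) =
      weight (circle_dist L s1 s2) * arc_energy \<alpha> p t (arc_start L s1 s2) (circle_dist L s1 s2)"
    "circle_dist L s1 s2 \<noteq> L / 2 \<Longrightarrow> weighted \<alpha> \<beta> p L t (variation1 \<alpha> p L f t \<phi> u) (s1, s2) =
      weight (circle_dist L s1 s2) * arc_variation1 \<alpha> p t u (arc_start L s1 s2) (circle_dist L s1 s2)"
    "circle_dist L s1 s2 \<noteq> L / 2 \<Longrightarrow> weighted \<alpha> \<beta> p L t (variation2 \<alpha> p L f t \<phi> u \<psi> v) (s1, s2) =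
      weight (circle_dist L s1 s2) * arc_variation2 \<alpha> p t u v (arc_start L s1 s2) (circle_dist L s1 s2)"
  unfolding weighted_def prod.case intrinsic_dist_eq[OF assms] weight_def
    energy_density_eq[OF UNIV_I UNIV_I assms refl refl]
  by (simp_all add: variation1_eq(2)[OF UNIV_I UNIV_I assms refl refl _ refl]
      variation2_eq(2)[OF UNIV_I UNIV_I assms refl refl _ refl])

lemma weighted_bounds:
  assumes c: "circle_dist L s1 s2 \<noteq> 0"
  defines "B \<equiv> variation_const \<alpha> p Cb * (K\<^sup>2 + 1) powr p"
  shows "\<bar>weighted \<alpha> \<beta> p L t (energy_density \<alpha> p L f t) (s1, s2)\<bar> \<le> B"
    "circle_dist L s1 s2 \<noteq> L / 2 \<Longrightarrow> \<bar>weighted \<alpha> \<beta> p L t (variation1 \<alpha> p L f t \<phi> u) (s1, s2)\<bar> \<le> B * N1"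
    "circle_dist L s1 s2 \<noteq> L / 2 \<Longrightarrow> \<bar>weighted \<alpha> \<beta> p L t (variation2 \<alpha> p L f t \<phi> u \<psi> v) (s1, s2)\<bar> \<le> B * N1 * N2"
proof -
  define s where "s = circle_dist L s1 s2"
  have s: "0 < s" "0 \<le> s" "s \<le> L / 2" using circle_dist_bounds[OF L, of s1 s2] c by (auto simp: s_def)
  have w0: "0 \<le> weight s" by (simp add: weight_def)
  note b = arc_bounds[OF \<alpha> p bi_lip(1) borel norms expectation_t(1)[OF UNIV_I UNIV_I c refl refl], folded s_def,
      OF arc_var_bounds[OF s(2,3)]]
  have m: "weight s * \<bar>x\<bar> \<le> k * (K\<^sup>2 + 1) powr p" if "\<bar>x\<bar> \<le> k * (s powr (- \<alpha> * p) * var_bound s powr p)" for x k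
    using mult_left_mono[OF that w0] weight_var_bound[OF s(1)] by (simp only: mult.left_commute[of "weight s" k])
  show "\<bar>weighted \<alpha> \<beta> p L t (energy_density \<alpha> p L f t) (s1, s2)\<bar> \<le> B"
    unfolding weighted_eq(1)[OF c] using m[OF b(1)] w0 by (simp add: s_def abs_mult B_def)
  show "\<bar>weighted \<alpha> \<beta> p L t (variation1 \<alpha> p L f t \<phi> u) (s1, s2)\<bar> \<le> B * N1" if "circle_dist L s1 s2 \<noteq> L / 2"
    unfolding weighted_eq(2)[OF c that] using m[OF b(2)] w0 by (simp add: s_def abs_mult B_def ac_simps)
  show "\<bar>weighted \<alpha> \<beta> p L t (variation2 \<alpha> p L f t \<phi> u \<psi> v) (s1, s2)\<bar> \<le> B * N1 * N2" if "circle_dist L s1 s2 \<noteq> L / 2"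
    unfolding weighted_eq(3)[OF c that] using m[OF b(3)] w0 by (simp add: s_def abs_mult B_def ac_simps)
qed

lemma borel_measurable_weighted:
  assumes F: "F \<in> borel_measurable (torus_measure L)"
  shows "weighted \<alpha> \<beta> p L t F \<in> borel_measurable (torus_measure L)"
proof (rule borel_measurable_torus_AE)
  have [measurable]: "(fst :: real \<times> real \<Rightarrow> real) \<in> borel_measurable borel" "(snd :: real \<times> real \<Rightarrow> real) \<in> borel_measurable borel"
    by (intro borel_measurable_continuous_onI continuous_intros)+
  have "(\<lambda>q. weight (circle_dist L (fst q) (snd q))) \<in> borel_measurable (torus_measure L)"
    unfolding weight_def by (intro borel_measurable_torus) measurable
  then show "(\<lambda>q. weight (circle_dist L (fst q) (snd q)) * F q) \<in> borel_measurable (torus_measure L)"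
    using F by simp
  show "AE q in torus_measure L. weighted \<alpha> \<beta> p L t F q = weight (circle_dist L (fst q) (snd q)) * F q"
    using AE_torus_good by eventually_elim (auto simp: weighted_def weight_def case_prod_beta intrinsic_dist_eq)
qed

end

section \<open>From norms of Hoelder functions to increments along arcs\<close>

lemma Linf_norm_le:
  fixes f :: "'b \<Rightarrow> real"
  assumes f: "f \<in> borel_measurable M" and B: "AE x in M. \<bar>f x\<bar> \<le> B" "0 \<le> B"
  shows "in_Linf M f" "Linf_norm M f \<le> B"
proof -
  have e: "esssup M (\<lambda>x. ereal (norm (f x))) \<le> ereal B"
    using f B by (intro esssup_I) auto
  then show "in_Linf M f" using f by (auto simp: in_Linf_def less_ereal.simps le_less_trans)
  show "Linf_norm M f \<le> B"
    unfolding Linf_norm_def using e B(2) by (cases "esssup M (\<lambda>x. ereal (norm (f x)))") auto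
qed

lemma periodic_continuous_bdd:
  fixes w :: "real \<Rightarrow> 'a::euclidean_space"
  assumes L: "0 < L" and w: "periodic_fun_simple w L" "continuous_on UNIV w"
  shows "bdd_above (range (\<lambda>s. norm (w s)))" "norm (w s) \<le> C0_norm w" "0 \<le> C0_norm w"
proof -
  have "bounded (w ` {0..L})"
    by (intro compact_imp_bounded compact_continuous_image continuous_on_subset[OF w(2)]) auto
  then obtain B where B: "\<forall>s\<in>{0..L}. norm (w s) \<le> B" by (auto simp: bounded_iff)
  have "norm (w s) \<le> B" for s
    using B rmod_nonneg[of L s] rmod_less[OF L, of s] L periodic_rmod[OF L w(1), of s] by (metis atLeastAtMost_iff less_imp_le less_irrefl)
  then show bdd: "bdd_above (range (\<lambda>s. norm (w s)))" by (rule bdd_aboveI2)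
  show le: "norm (w s) \<le> C0_norm w" for s unfolding C0_norm_def by (intro cSUP_upper bdd) simp
  show "0 \<le> C0_norm w" by (rule order_trans[OF norm_ge_zero le])
qed

lemma circle_dist_shift:
  assumes "0 < L" "0 \<le> s" "s \<le> L / 2" shows "circle_dist L (a + s) a = s"
proof -
  have "(a + s - a) rmod L = s" using assms by (intro rmod_unique[of _ _ _ 0]) auto
  then show ?thesis using assms by (simp add: circle_dist_def)
qed

lemma holder_norm_bounds:
  fixes w :: "real \<Rightarrow> 'a::euclidean_space"
  assumes L: "0 < L" and w: "w \<in> C0_holder L \<beta>"
  shows "norm (w x) \<le> holder_norm L \<beta> w" "0 \<le> holder_norm L \<beta> w"
    "\<And>a s. 0 \<le> s \<Longrightarrow> s \<le> L / 2 \<Longrightarrow> norm (w (a + s) - w a) \<le> holder_norm L \<beta> w * s powr \<beta>"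
proof -
  have c: "periodic_fun_simple w L" "continuous_on UNIV w" "bdd_above (holder_quotients L \<beta> w)"
    using w by (auto simp: C0_holder_def)
  note C0 = periodic_continuous_bdd[OF L c(1,2)]
  have sup: "norm (w (a + s) - w a) / s powr \<beta> \<le> Sup (holder_quotients L \<beta> w)" if s: "0 < s" "s \<le> L / 2" for a s
  proof (rule cSup_upper[OF _ c(3)])
    have "circle_dist L (a + s) a = s" using circle_dist_shift[OF L] s by simp
    then show "norm (w (a + s) - w a) / s powr \<beta> \<in> holder_quotients L \<beta> w"
      unfolding holder_quotients_def using s by (intro CollectI exI[of _ "a + s"] exI[of _ a]) simp
  qed
  \<comment> \<open>Two points at half a period provide a quotient, so the supremum is at least a
    nonnegative number.\<close>
  have "0 \<le> norm (w (0 + L / 2) - w 0) / (L / 2) powr \<beta>" by simp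
  also have "\<dots> \<le> Sup (holder_quotients L \<beta> w)" using L by (intro sup) auto
  finally have S0: "0 \<le> Sup (holder_quotients L \<beta> w)" .
  show "norm (w x) \<le> holder_norm L \<beta> w" "0 \<le> holder_norm L \<beta> w"
    using C0(2)[of x] C0(3) S0 by (simp_all add: holder_norm_def)
  show "norm (w (a + s) - w a) \<le> holder_norm L \<beta> w * s powr \<beta>" if s: "0 \<le> s" "s \<le> L / 2" for a s
  proof (cases "s = 0")
    case False
    then have "norm (w (a + s) - w a) \<le> Sup (holder_quotients L \<beta> w) * s powr \<beta>"
      using sup[of s a] s by (simp add: divide_le_eq)
    also have "\<dots> \<le> holder_norm L \<beta> w * s powr \<beta>" using C0(3) by (intro mult_right_mono) (auto simp: holder_norm_def)
    finally show ?thesis .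
  qed simp
qed

lemma derivative_of_periodic:
  assumes "periodic_fun_simple f L" "\<And>s. (f has_vector_derivative f' s) (at s)"
  shows "periodic_fun_simple f' L"
proof -
  have "f' (s + L) = f' s" for s
  proof (rule vector_derivative_unique_at)
    have "((\<lambda>x. f (x + L)) has_vector_derivative 1 *\<^sub>R f' (s + L)) (at s)"
      using vector_diff_chain_at[of "\<lambda>x. x + L" 1 s f "f' (s + L)"] assms(2)
      by (simp add: o_def has_vector_derivative_add_const has_vector_derivative_id)
    then show "(f has_vector_derivative f' (s + L)) (at s)"
      using assms(1) by (simp add: periodic_fun_simple_def)
  qed (rule assms(2))
  then show ?thesis by (simp add: periodic_fun_simple_def)
qed

lemma holder_variation_C1:
  fixes f \<phi> \<psi> \<tau> \<phi>' \<psi>' :: "real \<Rightarrow> 'a::euclidean_space"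
  assumes \<alpha>: "0 < \<alpha>" and p: "1 \<le> p" and \<beta>: "0 < \<beta>" "\<beta> \<le> 1"
    and arc: "arclength_curve L f \<tau>" and bl: "bi_lipschitz_curve L f \<tau> Cb"
    and per: "periodic_fun_simple \<phi> L" "periodic_fun_simple \<psi> L"
    and d: "\<forall>s. (f has_vector_derivative \<tau> s) (at s)" "\<forall>s. (\<phi> has_vector_derivative \<phi>' s) (at s)"
      "\<forall>s. (\<psi> has_vector_derivative \<psi>' s) (at s)"
    and c: "continuous_on UNIV \<tau>" "continuous_on UNIV \<phi>'" "continuous_on UNIV \<psi>'"
    and n: "\<And>x. norm (\<phi>' x) \<le> N1" "\<And>x. norm (\<psi>' x) \<le> N2"
    and h: "\<And>a s. 0 \<le> s \<Longrightarrow> s \<le> L / 2 \<Longrightarrow> norm (\<tau> (a + s) - \<tau> a) \<le> K * s powr \<beta>"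
      "\<And>a s. 0 \<le> s \<Longrightarrow> s \<le> L / 2 \<Longrightarrow> norm (\<phi>' (a + s) - \<phi>' a) \<le> N1 * s powr \<beta>"
      "\<And>a s. 0 \<le> s \<Longrightarrow> s \<le> L / 2 \<Longrightarrow> norm (\<psi>' (a + s) - \<psi>' a) \<le> N2 * s powr \<beta>"
  shows "holder_variation L \<alpha> p N1 N2 Cb f \<phi> \<psi> \<tau> \<phi>' \<psi>' \<beta> K"
proof -
  have L: "0 < L" and perf: "periodic_fun_simple f L" and unit: "AE s in lebesgue. norm (\<tau> s) = 1"
    using arc by (auto simp: arclength_curve_def)
  \<comment> \<open>A closed set of full measure is the whole line, so the tangent is a unit vector
    at every point.\<close>
  have "closed {s. norm (\<tau> s) = 1}"
    by (intro closed_Collect_eq continuous_intros c)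
  then have t1: "norm (\<tau> s) = 1" for s
    using mem_closed_if_AE_lebesgue[of "{s. norm (\<tau> s) = 1}" s] unit by simp
  have per': "periodic_fun_simple \<tau> L" "periodic_fun_simple \<phi>' L" "periodic_fun_simple \<psi>' L"
    using derivative_of_periodic perf per d by blast+
  have b: "\<tau> \<in> borel_measurable borel" "\<phi>' \<in> borel_measurable borel" "\<psi>' \<in> borel_measurable borel"
    by (intro borel_measurable_continuous_onI c)+
  note bl' = bi_lipschitz_circle_dist[OF bl L _ b(1) per'(1) t1]
  have "curve_variation L \<alpha> p N1 N2 Cb f \<phi> \<psi> \<tau> \<phi>' \<psi>' \<tau> \<phi>' \<psi>' UNIV"
  proof (rule curve_variation.intro)
    show "f b - f a = (\<integral>x. \<tau> x \<partial>lebesgue_on {a..b})" if "a \<le> b" for a b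
      using d(1) by (intro integral_derivative[symmetric] that c) blast
    show "\<phi> b - \<phi> a = (\<integral>x. \<phi>' x \<partial>lebesgue_on {a..b})" if "a \<le> b" for a b
      using d(2) by (intro integral_derivative[symmetric] that c) blast
    show "\<psi> b - \<psi> a = (\<integral>x. \<psi>' x \<partial>lebesgue_on {a..b})" if "a \<le> b" for a b
      using d(3) by (intro integral_derivative[symmetric] that c) blast
  qed (use L \<alpha> p perf per per' b t1 n bl' in \<open>auto simp: periodic_fun_simple_def\<close>)
  then show ?thesis
    by (intro holder_variation.intro holder_variation_axioms.intro \<beta> c h)
qed

theorem holder_bounds:
  fixes f \<phi> \<psi> \<tau> \<phi>' \<psi>' :: "real \<Rightarrow> 'a::euclidean_space"
  assumes \<alpha>: "0 < \<alpha>" and p: "1 \<le> p" and \<beta>: "0 < \<beta>" "\<beta> \<le> 1"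
    and arc: "arclength_curve L f \<tau>" and bl: "bi_lipschitz_curve L f \<tau> Cb"
    and C1: "{f, \<phi>, \<psi>} \<subseteq> C1_holder L \<beta>"
    and d: "\<forall>s. (f has_vector_derivative \<tau> s) (at s)" "\<forall>s. (\<phi> has_vector_derivative \<phi>' s) (at s)"
      "\<forall>s. (\<psi> has_vector_derivative \<psi>' s) (at s)"
  defines "T \<equiv> torus_measure L" and "B \<equiv> variation_const \<alpha> p Cb * ((holder_norm L \<beta> \<tau>)\<^sup>2 + 1) powr p"
    and "M \<equiv> weighted \<alpha> \<beta> p L \<tau> (energy_density \<alpha> p L f \<tau>)"
    and "G \<equiv> weighted \<alpha> \<beta> p L \<tau> (variation1 \<alpha> p L f \<tau> \<phi> \<phi>')"
    and "H \<equiv> weighted \<alpha> \<beta> p L \<tau> (variation2 \<alpha> p L f \<tau> \<phi> \<phi>' \<psi> \<psi>')"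
  shows "(AE x in T. variation1_exists \<alpha> p L f \<tau> \<phi> \<phi>' x) \<and>
    (AE x in T. variation2_exists \<alpha> p L f \<tau> \<phi> \<phi>' \<psi> \<psi>' x) \<and>
    in_Linf T M \<and> in_Linf T G \<and> in_Linf T H \<and>
    Linf_norm T M \<le> B \<and> Linf_norm T G \<le> B * holder_norm L \<beta> \<phi>' \<and>
    Linf_norm T H \<le> B * holder_norm L \<beta> \<phi>' * holder_norm L \<beta> \<psi>'"
proof -
  let ?n = "holder_norm L \<beta>"
  have L: "0 < L" using arc by (simp add: arclength_curve_def)
  have C0: "w' \<in> C0_holder L \<beta>" "periodic_fun_simple w L"
    if w: "w \<in> C1_holder L \<beta>" "\<forall>s. (w has_vector_derivative w' s) (at s)" for w w' :: "real \<Rightarrow> 'a"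
  proof -
    obtain z where z: "z \<in> C0_holder L \<beta>" "\<forall>s. (w has_vector_derivative z s) (at s)"
      using w(1) by (auto simp: C1_holder_def)
    have "z = w'" using z(2) w(2) vector_derivative_unique_at by (intro ext) blast
    then show "w' \<in> C0_holder L \<beta>" using z(1) by simp
    show "periodic_fun_simple w L" using w(1) by (simp add: C1_holder_def)
  qed
  have m: "f \<in> C1_holder L \<beta>" "\<phi> \<in> C1_holder L \<beta>" "\<psi> \<in> C1_holder L \<beta>" using C1 by auto
  note t = C0[OF m(1) d(1)] and u = C0[OF m(2) d(2)] and v = C0[OF m(3) d(3)]
  note bt = holder_norm_bounds[OF L t(1)] and bu = holder_norm_bounds[OF L u(1)] and bv = holder_norm_bounds[OF L v(1)]
  have c: "continuous_on UNIV \<tau>" "continuous_on UNIV \<phi>'" "continuous_on UNIV \<psi>'"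
    using t u v by (auto simp: C0_holder_def)
  interpret holder_variation L \<alpha> p "?n \<phi>'" "?n \<psi>'" Cb f \<phi> \<psi> \<tau> \<phi>' \<psi>' \<beta> "?n \<tau>"
    by (rule holder_variation_C1[OF \<alpha> p \<beta> arc bl u(2) v(2) d c bu(1) bv(1) bt(3) bu(3) bv(3)])
  have B0: "0 \<le> B" unfolding B_def using variation_const_pos[OF \<alpha> p, of Cb] by simp
  have ae: "AE q in T. \<bar>M q\<bar> \<le> B" "AE q in T. \<bar>G q\<bar> \<le> B * ?n \<phi>'" "AE q in T. \<bar>H q\<bar> \<le> B * ?n \<phi>' * ?n \<psi>'"
    unfolding T_def M_def G_def H_def B_def
    using AE_torus_good by (eventually_elim, use weighted_bounds in force)+
  have meas: "M \<in> borel_measurable T" "G \<in> borel_measurable T" "H \<in> borel_measurable T"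
    unfolding T_def M_def G_def H_def
    by (intro borel_measurable_weighted borel_measurable_torus_variations)+
  have B1: "0 \<le> B * ?n \<phi>'" "0 \<le> B * ?n \<phi>' * ?n \<psi>'" using B0 bu(2) bv(2) by simp_all
  have ex: "AE x in T. variation1_exists \<alpha> p L f \<tau> \<phi> \<phi>' x" "AE x in T. variation2_exists \<alpha> p L f \<tau> \<phi> \<phi>' \<psi> \<psi>' x"
    unfolding T_def by (rule AE_torus_variations)+
  show ?thesis
    by (intro conjI ex Linf_norm_le[OF meas(1) ae(1) B0] Linf_norm_le[OF meas(2) ae(2) B1(1)]
        Linf_norm_le[OF meas(3) ae(3) B1(2)])
qed

section \<open>Continuity up to the diagonal\<close>

lemma continuous_on_expectation:
  fixes g :: "'b::topological_space \<Rightarrow> real \<Rightarrow> 'a::euclidean_space"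
  assumes g: "continuous_on (S \<times> {0..1}) (\<lambda>(q, x). g q x)"
  shows "continuous_on S (\<lambda>q. \<integral>x. g q x \<partial>unit_interval)"
proof -
  have eq: "(\<integral>x. g q x \<partial>unit_interval) = integral (cbox 0 1) (g q)" if "q \<in> S" for q
  proof -
    have "continuous_on {0..1} (\<lambda>x. case (q, x) of (q, x) \<Rightarrow> g q x)"
      by (rule continuous_on_compose2[OF g]) (use that in \<open>auto intro!: continuous_intros\<close>)
    then have c: "continuous_on {0..1} (g q)" by simp
    have "(\<integral>x. g q x \<partial>unit_interval) = (LINT x:{0..1}|lborel. g q x)"
      unfolding unit_interval_def set_lebesgue_integral_def by (rule integral_restrict_space) simp
    then show ?thesis
      using set_borel_integral_eq_integral(2)[OF borel_integrable_atLeastAtMost'[OF c]] by simp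
  qed
  have "continuous_on S (\<lambda>q. integral (cbox 0 1) (g q))"
    using integral_continuous_on_param[of S 0 "1::real" g] g by simp
  then show ?thesis by (simp add: eq cong: continuous_on_cong)
qed

lemma continuous_on_covar:
  fixes g h :: "'b::topological_space \<Rightarrow> real \<Rightarrow> 'a::euclidean_space"
  assumes g: "continuous_on (S \<times> {0..1}) (\<lambda>(q, x). g q x)" and h: "continuous_on (S \<times> {0..1}) (\<lambda>(q, x). h q x)"
  shows "continuous_on S (\<lambda>q. covar unit_interval (g q) (h q))"
proof -
  have "continuous_on (S \<times> {0..1}) (\<lambda>(q, x). g q x \<bullet> h q x)"
    using continuous_on_inner[OF g h] by (simp add: case_prod_beta')
  then show ?thesis unfolding covar_def by (intro continuous_intros continuous_on_expectation g h)
qed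

lemma continuous_on_arc:
  fixes w :: "real \<Rightarrow> 'a::euclidean_space"
  assumes w: "continuous_on UNIV w"
  shows "continuous_on (S \<times> T) (\<lambda>(q, x). w (fst q + snd q * x))"
  unfolding case_prod_beta by (intro continuous_on_compose2[OF w] continuous_intros) auto

lemma increment_eq:
  fixes w w' :: "real \<Rightarrow> 'a::euclidean_space"
  assumes d: "\<And>s. (w has_vector_derivative w' s) (at s)" and c: "continuous_on UNIV w'" and s: "0 \<le> s"
  shows "w (a + s) - w a = s *\<^sub>R (\<integral>x. w' (a + s * x) \<partial>unit_interval)"
proof (cases "s = 0")
  case False
  then show ?thesis
    using integral_derivative[of a "a + s", OF _ d c] integral_arc[of w' s a] s borel_measurable_continuous_onI[OF c] by simp
qed simp

text \<open>The property that \<open>X\<^bsup>\<beta>\<^esup>\<close> contributes beyond Hoelder continuity, for \<open>\<beta> < 1\<close> and for \<open>\<beta> = 1\<close>.\<close>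

definition little_regular :: "real \<Rightarrow> (real \<Rightarrow> 'a::euclidean_space) \<Rightarrow> bool" where
  "little_regular \<beta> w \<longleftrightarrow> continuous_on UNIV w \<and>
     (if \<beta> < 1 then \<forall>e>0. \<exists>d>0. \<forall>a s. 0 \<le> s \<longrightarrow> s \<le> d \<longrightarrow> norm (w (a + s) - w a) \<le> e * s powr \<beta>
      else \<exists>w'. continuous_on UNIV w' \<and> (\<forall>s. (w has_vector_derivative w' s) (at s)))"

lemma little_regular_inner:
  fixes y z :: "real \<Rightarrow> 'a::euclidean_space"
  assumes y: "little_regular \<beta> y" "\<And>x. norm (y x) \<le> Y" and z: "little_regular \<beta> z" "\<And>x. norm (z x) \<le> Z"
  shows "little_regular \<beta> (\<lambda>x. y x \<bullet> z x)"
proof -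
  have N: "0 \<le> Y" "0 \<le> Z" by (rule order_trans[OF norm_ge_zero y(2)], rule order_trans[OF norm_ge_zero z(2)])
  have c: "continuous_on UNIV y" "continuous_on UNIV z" using y z by (auto simp: little_regular_def)
  show ?thesis
  proof (cases "\<beta> < 1")
    case True
    have "\<exists>d>0. \<forall>a s. 0 \<le> s \<longrightarrow> s \<le> d \<longrightarrow> norm (y (a + s) \<bullet> z (a + s) - y a \<bullet> z a) \<le> e * s powr \<beta>" if e: "0 < e" for e
    proof -
      define k where "k = e / (Y + Z + 1)"
      have k: "0 < k" "k * (Y + Z) \<le> e" using e N by (simp_all add: k_def field_simps)
      obtain d1 d2 where d: "0 < d1" "0 < d2"
        "\<And>a s. 0 \<le> s \<Longrightarrow> s \<le> d1 \<Longrightarrow> norm (y (a + s) - y a) \<le> k * s powr \<beta>"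
        "\<And>a s. 0 \<le> s \<Longrightarrow> s \<le> d2 \<Longrightarrow> norm (z (a + s) - z a) \<le> k * s powr \<beta>"
        using y(1) z(1) True k(1) unfolding little_regular_def by (metis (no_types, lifting))
      have "norm (y (a + s) \<bullet> z (a + s) - y a \<bullet> z a) \<le> e * s powr \<beta>" if s: "0 \<le> s" "s \<le> min d1 d2" for a s
      proof -
        have "y (a + s) \<bullet> z (a + s) - y a \<bullet> z a = (y (a + s) - y a) \<bullet> z (a + s) + y a \<bullet> (z (a + s) - z a)"
          by (simp add: inner_diff_left inner_diff_right)
        also have "norm \<dots> \<le> norm (y (a + s) - y a) * norm (z (a + s)) + norm (y a) * norm (z (a + s) - z a)"
          by (intro norm_triangle_mono) (simp_all add: Cauchy_Schwarz_ineq2)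
        also have "\<dots> \<le> (k * s powr \<beta>) * Z + Y * (k * s powr \<beta>)"
          using s d k N y z by (intro add_mono mult_mono) auto
        also have "\<dots> = k * (Y + Z) * s powr \<beta>" by (simp add: algebra_simps)
        also have "\<dots> \<le> e * s powr \<beta>" using k by (intro mult_right_mono) auto
        finally show ?thesis .
      qed
      then show ?thesis using d(1,2) by (intro exI[of _ "min d1 d2"]) auto
    qed
    then show ?thesis unfolding little_regular_def using True c by (auto intro!: continuous_intros)
  next
    case False
    obtain y' z' where d: "continuous_on UNIV y'" "\<forall>s. (y has_vector_derivative y' s) (at s)"
      "continuous_on UNIV z'" "\<forall>s. (z has_vector_derivative z' s) (at s)"
      using y(1) z(1) False by (auto simp: little_regular_def)
    have "((\<lambda>x. y x \<bullet> z x) has_vector_derivative y s \<bullet> z' s + y' s \<bullet> z s) (at s)" for s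
      using bounded_bilinear.has_vector_derivative[OF bounded_bilinear_inner] d by blast
    then show ?thesis unfolding little_regular_def using False c d by (auto intro!: continuous_intros exI[of _ "\<lambda>s. y s \<bullet> z' s + y' s \<bullet> z s"])
  qed
qed

text \<open>For \<beta> < 1 Cauchy-Schwarz bounds the quotient by the product of two moduli that
  tend to 0 uniformly in a. For \<beta> = 1 every increment along the arc is s times an average of
  the derivative; centring at the starting values turns the covariance into \<open>s\<^sup>2\<close>
  times that of the averages, which are continuous at s = 0 too.\<close>

lemma covar_scaled:
  fixes y z :: "real \<Rightarrow> 'a::euclidean_space"
  assumes \<beta>: "0 < \<beta>" "\<beta> \<le> 1"
    and y: "little_regular \<beta> y" "\<And>x. norm (y x) \<le> Y" and z: "little_regular \<beta> z" "\<And>x. norm (z x) \<le> Z"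
  shows "\<exists>c. continuous_on (UNIV \<times> {0..}) c \<and>
    (\<forall>a s. 0 \<le> s \<longrightarrow> covar unit_interval (\<lambda>x. y (a + s * x)) (\<lambda>x. z (a + s * x)) = s powr (2 * \<beta>) * c (a, s)) \<and>
    (\<beta> < 1 \<longrightarrow> (\<forall>a. c (a, 0) = 0))"
proof -
  have cont: "continuous_on UNIV y" "continuous_on UNIV z" using y z by (auto simp: little_regular_def)
  have b: "y \<in> borel_measurable borel" "z \<in> borel_measurable borel" by (intro borel_measurable_continuous_onI cont)+
  define C where "C = (\<lambda>q. covar unit_interval (\<lambda>x. y (fst q + snd q * x)) (\<lambda>x. z (fst q + snd q * x)))"
  have C: "continuous_on S C" for S unfolding C_def by (intro continuous_on_covar continuous_on_arc cont)
  show ?thesis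
  proof (cases "\<beta> < 1")
    case True
    \<comment> \<open>Division by \<open>0 powr (2 * \<beta>) = 0\<close> gives the value 0 at s =
      0, and this is the limit established below.\<close>
    define c where "c = (\<lambda>q. C q / snd q powr (2 * \<beta>))"
    have C0: "C (a, 0) = 0" for a by (simp add: C_def covar_def unit.prob_space)
    have small: "\<exists>d>0. \<forall>a s. 0 \<le> s \<longrightarrow> s \<le> d \<longrightarrow> \<bar>c (a, s)\<bar> \<le> e" if e: "0 < e" for e
    proof -
      obtain d1 d2 where d: "0 < d1" "0 < d2"
        "\<And>a s. 0 \<le> s \<Longrightarrow> s \<le> d1 \<Longrightarrow> norm (y (a + s) - y a) \<le> sqrt e * s powr \<beta>"
        "\<And>a s. 0 \<le> s \<Longrightarrow> s \<le> d2 \<Longrightarrow> norm (z (a + s) - z a) \<le> sqrt e * s powr \<beta>"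
        using y(1) z(1) True e unfolding little_regular_def by (metis (no_types, lifting) real_sqrt_gt_zero)
      have "\<bar>c (a, s)\<bar> \<le> e" if s: "0 \<le> s" "s \<le> min d1 d2" for a s
      proof (cases "s = 0")
        case False
        have m: "sqrt e * (s * x) powr \<beta> \<le> sqrt e * s powr \<beta>" "0 \<le> s * x" "s * x \<le> s" if "0 \<le> x" "x \<le> 1" for x
          using s that e \<beta> by (auto intro!: mult_left_mono powr_mono2 mult_left_le)
        have "arc_var y a s \<le> (sqrt e * s powr \<beta>)\<^sup>2"
          by (rule arc_var_le_modulus[OF b(1) y(2)]) (use s in \<open>auto intro!: order_trans[OF d(3) m(1)] order_trans[OF m(3)] m(2)\<close>)
        moreover have "arc_var z a s \<le> (sqrt e * s powr \<beta>)\<^sup>2"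
          by (rule arc_var_le_modulus[OF b(2) z(2)]) (use s in \<open>auto intro!: order_trans[OF d(4) m(1)] order_trans[OF m(3)] m(2)\<close>)
        ultimately have "sqrt (arc_var y a s * arc_var z a s) \<le> sqrt ((sqrt e * s powr \<beta>)\<^sup>2 * (sqrt e * s powr \<beta>)\<^sup>2)"
          unfolding arc_var_def
          by (intro real_sqrt_le_mono mult_mono unit.covar_self_nonneg[OF borel_measurable_arc[OF b(2)] z(2)]) auto
        also have "\<dots> = e * (s powr \<beta> * s powr \<beta>)" using e by (simp add: real_sqrt_mult power_mult_distrib power2_eq_square)
        also have "s powr \<beta> * s powr \<beta> = s powr (2 * \<beta>)" by (simp add: powr_add[symmetric])
        finally have "\<bar>C (a, s)\<bar> \<le> e * s powr (2 * \<beta>)"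
          using unit.covar_Cauchy_Schwarz[OF borel_measurable_arc[OF b(1)] y(2) borel_measurable_arc[OF b(2)] z(2), of a s a s]
          unfolding C_def arc_var_def by simp
        then show ?thesis using False s by (simp add: c_def divide_le_eq)
      qed (use e in \<open>simp add: c_def\<close>)
      then show ?thesis using d(1,2) by (intro exI[of _ "min d1 d2"]) auto
    qed
    have "continuous (at q within UNIV \<times> {0..}) c" if q: "q \<in> UNIV \<times> {0..}" for q
    proof (cases "snd q = 0")
      case True
      have "(c \<longlongrightarrow> 0) (at q within UNIV \<times> {0..})"
      proof (rule tendstoI)
        fix e :: real assume "0 < e"
        then obtain d where d: "0 < d" "\<And>a s. 0 \<le> s \<Longrightarrow> s \<le> d \<Longrightarrow> \<bar>c (a, s)\<bar> \<le> e / 2"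
          using small[of "e / 2"] by auto
        have "\<forall>\<^sub>F r in at q within UNIV \<times> {0..}. snd r < d"
          by (rule order_tendstoD(2)[OF tendsto_snd[OF tendsto_ident_at]]) (use True d in simp)
        moreover have "\<forall>\<^sub>F r in at q within UNIV \<times> {0..}. r \<in> UNIV \<times> {0..}"
          by (auto simp: eventually_at_filter)
        ultimately show "\<forall>\<^sub>F r in at q within UNIV \<times> {0..}. dist (c r) 0 < e"
        proof eventually_elim
          case (elim r)
          then show ?case using d(2)[of "snd r" "fst r"] \<open>0 < e\<close> by auto
        qed
      qed
      then show ?thesis using True by (simp add: continuous_within c_def)
    next
      case False
      have "continuous_on (UNIV \<times> {0<..}) c" unfolding c_def by (intro continuous_intros C) auto
      moreover have "open (UNIV \<times> {0<..} :: (real \<times> real) set)" by (intro open_Times) auto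
      moreover have "q \<in> UNIV \<times> {0<..}" using q False by auto
      ultimately show ?thesis by (meson continuous_at_imp_continuous_at_within continuous_on_eq_continuous_at)
    qed
    then have "continuous_on (UNIV \<times> {0..}) c" by (simp add: continuous_on_eq_continuous_within)
    moreover have "C (a, s) = s powr (2 * \<beta>) * c (a, s)" for a s by (simp add: c_def C0)
    moreover have "c (a, 0) = 0" for a by (simp add: c_def)
    ultimately show ?thesis by (intro exI[of _ c]) (simp add: C_def)
  next
    case False
    then have \<beta>1: "\<beta> = 1" using \<beta> by simp
    obtain y' z' where y': "continuous_on UNIV y'" "\<And>s. (y has_vector_derivative y' s) (at s)"
      and z': "continuous_on UNIV z'" "\<And>s. (z has_vector_derivative z' s) (at s)"
      using y(1) z(1) False by (auto simp: little_regular_def)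
    \<comment> \<open>Divided difference: the increment of the function over \<open>s * x\<close> is
      s times this expression, which makes sense for s = 0.\<close>
    define D where "D = (\<lambda>w' q x. x *\<^sub>R (\<integral>\<theta>. w' (fst q + (snd q * x) * \<theta>) \<partial>unit_interval) :: 'a)"
    have contD: "continuous_on (UNIV \<times> {0..1}) (\<lambda>(q, x). D w' q x)" if "continuous_on UNIV w'" for w'
      unfolding D_def case_prod_beta
      by (intro continuous_intros continuous_on_expectation)
         (unfold case_prod_beta, intro continuous_on_compose2[OF that] continuous_intros, auto)
    define c where "c = (\<lambda>q. covar unit_interval (D y' q) (D z' q))"
    have "continuous_on UNIV c" unfolding c_def by (intro continuous_on_covar contD y' z')
    then have c: "continuous_on (UNIV \<times> {0..}) c" by (rule continuous_on_subset) simp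
    have "covar unit_interval (\<lambda>x. y (a + s * x)) (\<lambda>x. z (a + s * x)) = s powr (2 * \<beta>) * c (a, s)" if s: "0 \<le> s" for a s
    proof -
      have D: "w (a + s * x) - w a = s *\<^sub>R D w' (a, s) x"
        if "x \<in> space unit_interval" "continuous_on UNIV w'" "\<And>s. (w has_vector_derivative w' s) (at s)" for w w' :: "real \<Rightarrow> 'a" and x
        using increment_eq[of w w' "s * x" a, OF that(3,2)] that(1) s
        by (simp add: D_def unit_interval_def space_restrict_space)
      have i: "integrable unit_interval (\<lambda>x. y (a + s * x))" "integrable unit_interval (\<lambda>x. z (a + s * x))"
        by (rule unit.integrable_bounded[OF borel_measurable_arc[OF b(1)] y(2)],
            rule unit.integrable_bounded[OF borel_measurable_arc[OF b(2)] z(2)])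
      have m: "(\<integral>x. w (a + s * x) \<partial>unit_interval) - w a = s *\<^sub>R (\<integral>x. D w' (a, s) x \<partial>unit_interval)"
        if "integrable unit_interval (\<lambda>x. w (a + s * x))" "continuous_on UNIV w'" "\<And>s. (w has_vector_derivative w' s) (at s)" for w w' :: "real \<Rightarrow> 'a"
      proof -
        have "(\<integral>x. w (a + s * x) \<partial>unit_interval) - w a = (\<integral>x. w (a + s * x) - w a \<partial>unit_interval)"
          using that(1) by (simp add: unit.prob_space)
        also have "\<dots> = (\<integral>x. s *\<^sub>R D w' (a, s) x \<partial>unit_interval)"
          by (rule Bochner_Integration.integral_cong[OF refl D[OF _ that(2,3)]])
        finally show ?thesis by simp
      qed
      have p: "(\<integral>x. (y (a + s * x) - y a) \<bullet> (z (a + s * x) - z a) \<partial>unit_interval) =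
          (\<integral>x. s\<^sup>2 * (D y' (a, s) x \<bullet> D z' (a, s) x) \<partial>unit_interval)"
        by (rule Bochner_Integration.integral_cong[OF refl])
           (simp add: D[OF _ y'] D[OF _ z'] power2_eq_square)
      have "covar unit_interval (\<lambda>x. y (a + s * x)) (\<lambda>x. z (a + s * x)) = s\<^sup>2 * c (a, s)"
        unfolding unit.covar_centered[OF borel_measurable_arc[OF b(1)] y(2) borel_measurable_arc[OF b(2)] z(2), of a s a s "y a" "z a"]
          p m[OF i(1) y'] m[OF i(2) z']
        by (simp add: c_def covar_def right_diff_distrib power2_eq_square)
      then show ?thesis using s by (simp add: \<beta>1 powr_numeral)
    qed
    then show ?thesis using c \<beta>1 by (intro exI[of _ c]) simp
  qed
qed

section \<open>Continuity on the torus away from antipodal pairs\<close>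

lemma circle_dist_near:
  assumes L: "0 < L" and d: "\<bar>s1 - s2 - of_int n * L\<bar> \<le> L"
  shows "circle_dist L s1 s2 = min \<bar>s1 - s2 - of_int n * L\<bar> (L - \<bar>s1 - s2 - of_int n * L\<bar>)"
proof -
  define x where "x = s1 - s2 - of_int n * L"
  consider "0 \<le> x" "x < L" | "- L \<le> x" "x < 0" | "x = L" using d unfolding x_def by linarith
  then show ?thesis
  proof cases
    case 1
    then have "(s1 - s2) rmod L = x" using L by (intro rmod_unique[of _ _ _ n]) (auto simp: x_def)
    then show ?thesis using 1 by (simp add: circle_dist_def x_def[symmetric])
  next
    case 2
    then have "(s1 - s2) rmod L = x + L" using L by (intro rmod_unique[of _ _ _ "n - 1"]) (auto simp: x_def algebra_simps)
    then show ?thesis using 2 by (simp add: circle_dist_def x_def[symmetric] min.commute)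
  next
    case 3
    then have "(s1 - s2) rmod L = 0" using L by (intro rmod_unique[of _ _ _ "n + 1"]) (auto simp: x_def algebra_simps)
    then show ?thesis using 3 L by (simp add: circle_dist_def x_def[symmetric])
  qed
qed

text \<open>Inside a strip of half-width \<open>L / 2\<close> the reduction modulo L disappears and
  the sign of the offset decides the orientation of the arc. These open strips cover the
  non-antipodal pairs, so continuity can be checked on each of them.\<close>

lemma circle_dist_strip:
  assumes L: "0 < L" and d: "\<bar>s1 - s2 - of_int n * L\<bar> < L / 2"
  shows "circle_dist L s1 s2 = \<bar>s1 - s2 - of_int n * L\<bar>"
    "0 \<le> s1 - s2 - of_int n * L \<Longrightarrow> arc_start L s1 s2 = s2"
    "s1 - s2 - of_int n * L < 0 \<Longrightarrow> arc_start L s1 s2 = s1 + of_int (1 - n) * L"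
proof -
  show "circle_dist L s1 s2 = \<bar>s1 - s2 - of_int n * L\<bar>"
    using circle_dist_near[OF L, of s1 s2 n] d by linarith
  show "arc_start L s1 s2 = s2" if "0 \<le> s1 - s2 - of_int n * L"
  proof -
    have "(s1 - s2) rmod L = s1 - s2 - of_int n * L" using that d L by (intro rmod_unique[of _ _ _ n]) auto
    then show ?thesis using that d by (simp add: arc_start_def)
  qed
  show "arc_start L s1 s2 = s1 + of_int (1 - n) * L" if "s1 - s2 - of_int n * L < 0"
  proof -
    have "(s1 - s2) rmod L = s1 - s2 - of_int n * L + L"
      using that d L by (intro rmod_unique[of _ _ _ "n - 1"]) (auto simp: algebra_simps)
    then show ?thesis using that d by (simp add: arc_start_def algebra_simps)
  qed
qed

lemma nearest_period:
  fixes x L :: real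
  assumes L: "0 < L"
  shows "\<exists>n::int. \<bar>x - of_int n * L\<bar> < L" "x rmod L \<noteq> L / 2 \<Longrightarrow> \<exists>n::int. \<bar>x - of_int n * L\<bar> < L / 2"
proof -
  define n where "n = \<lfloor>x / L\<rfloor>"
  have r: "x - of_int n * L = x rmod L" "0 \<le> x rmod L" "x rmod L < L"
    using rmod_decomp[OF L, of x] rmod_nonneg[of L x] rmod_less[OF L, of x] L by (auto simp: n_def mult.commute)
  then show "\<exists>n::int. \<bar>x - of_int n * L\<bar> < L" by (intro exI[of _ n]) simp
  have r': "x - of_int (n + 1) * L = x rmod L - L" using r(1) by (simp add: algebra_simps)
  assume "x rmod L \<noteq> L / 2"
  then consider "x rmod L < L / 2" | "L / 2 < x rmod L" by linarith
  then show "\<exists>n::int. \<bar>x - of_int n * L\<bar> < L / 2"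
  proof cases
    case 1
    then show ?thesis using r by (intro exI[of _ n]) simp
  next
    case 2
    then have "\<bar>x - of_int (n + 1) * L\<bar> < L / 2" unfolding r' using r(3) by linarith
    then show ?thesis by blast
  qed
qed

text \<open>Reduction modulo L jumps, but the minimum with the complementary length does not: on
  overlapping open strips of half-width L the distance is one fixed minimum of continuous
  functions.\<close>

lemma continuous_circle_dist:
  assumes L: "0 < L"
  shows "continuous_on UNIV (\<lambda>x. circle_dist L (fst x) (snd x))"
proof -
  let ?U = "\<lambda>n::int. {x :: real \<times> real. \<bar>fst x - snd x - of_int n * L\<bar> < L}"
  have "continuous_on (?U n) (\<lambda>x. min \<bar>fst x - snd x - of_int n * L\<bar> (L - \<bar>fst x - snd x - of_int n * L\<bar>))" for n
    by (intro continuous_intros)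
  then have "continuous_on (?U n) (\<lambda>x. circle_dist L (fst x) (snd x))" for n
    by (rule continuous_on_eq, intro circle_dist_near[OF L, symmetric] less_imp_le) simp
  moreover have "open (?U n)" for n by (intro open_Collect_less continuous_intros)
  ultimately have "continuous_on (\<Union>n. ?U n) (\<lambda>x. circle_dist L (fst x) (snd x))"
    by (intro continuous_on_open_UN) auto
  moreover have "(\<Union>n. ?U n) = UNIV" using nearest_period(1)[OF L] by auto
  ultimately show ?thesis by simp
qed

lemma open_off_diagonal: "0 < L \<Longrightarrow> open (off_diagonal L)"
  and open_non_antipodal: "0 < L \<Longrightarrow> open (non_antipodal L)"
proof -
  assume L: "0 < L"
  have "off_diagonal L = {x. circle_dist L (fst x) (snd x) \<noteq> 0}" "non_antipodal L = {x. circle_dist L (fst x) (snd x) \<noteq> L / 2}"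
    by (auto simp: off_diagonal_def non_antipodal_def)
  then show "open (off_diagonal L)" "open (non_antipodal L)"
    using continuous_circle_dist[OF L] by (auto intro!: open_Collect_neq continuous_intros)
qed

lemma non_antipodal_strips:
  assumes L: "0 < L"
  shows "non_antipodal L = (\<Union>n::int. {x. \<bar>fst x - snd x - of_int n * L\<bar> < L / 2})"
proof -
  have "\<exists>n::int. \<bar>s1 - s2 - of_int n * L\<bar> < L / 2" if "circle_dist L s1 s2 \<noteq> L / 2" for s1 s2
    using that by (intro nearest_period(2)[OF L]) (auto simp: circle_dist_def)
  moreover have "circle_dist L s1 s2 \<noteq> L / 2" if "\<bar>s1 - s2 - of_int n * L\<bar> < L / 2" for s1 s2 and n :: int
    using circle_dist_strip(1)[OF L that] that by simp
  ultimately show ?thesis by (auto simp: non_antipodal_def)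
qed

text \<open>Within a strip the orientation changes only across the diagonal, where the start passes
  to another representative of the same point. Periodicity of E in the start makes the two formulas
  agree there.\<close>

lemma continuous_on_arcs:
  fixes E :: "real \<times> real \<Rightarrow> real"
  assumes L: "0 < L" and E: "continuous_on (UNIV \<times> {0..<L / 2}) E"
    and per: "\<And>a s. 0 \<le> s \<Longrightarrow> s < L / 2 \<Longrightarrow> E (a + L, s) = E (a, s)"
  shows "continuous_on (non_antipodal L) (\<lambda>x. E (arc_start L (fst x) (snd x), circle_dist L (fst x) (snd x)))"
  unfolding non_antipodal_strips[OF L]
proof (rule continuous_on_open_UN)
  fix n :: int
  let ?U = "{x :: real \<times> real. \<bar>fst x - snd x - of_int n * L\<bar> < L / 2}"
  have per': "E (a + of_int k * L, s) = E (a, s)" if "0 \<le> s" "s < L / 2" for a s and k :: int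
    by (rule periodic_add_int(1)[of "\<lambda>a. E (a, s)"]) (use per that in \<open>auto simp: periodic_fun_simple_def\<close>)
  show "open ?U" by (intro open_Collect_less continuous_intros)
  let ?d = "\<lambda>x :: real \<times> real. fst x - snd x - of_int n * L"
  have "continuous_on ?U (\<lambda>x. if - ?d x \<le> 0 then E (snd x, ?d x) else E (fst x, - ?d x))"
  proof (rule continuous_on_cases_le)
    show "continuous_on {x \<in> ?U. - ?d x \<le> 0} (\<lambda>x. E (snd x, ?d x))"
      "continuous_on {x \<in> ?U. 0 \<le> - ?d x} (\<lambda>x. E (fst x, - ?d x))"
      by (intro continuous_on_compose2[OF E] continuous_intros; auto)+
    fix x assume "x \<in> ?U" "- ?d x = 0"
    then show "E (snd x, ?d x) = E (fst x, - ?d x)" using per'[of 0 "snd x" n] L by (simp add: algebra_simps)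
  qed (intro continuous_intros)
  then show "continuous_on ?U (\<lambda>x. E (arc_start L (fst x) (snd x), circle_dist L (fst x) (snd x)))"
  proof (rule continuous_on_eq)
    fix x assume x: "x \<in> ?U"
    then have d: "\<bar>?d x\<bar> < L / 2" by simp
    show "(if - ?d x \<le> 0 then E (snd x, ?d x) else E (fst x, - ?d x)) = E (arc_start L (fst x) (snd x), circle_dist L (fst x) (snd x))"
    proof (cases "0 \<le> ?d x")
      case True
      then show ?thesis using circle_dist_strip(1,2)[OF L d] by simp
    next
      case False
      then have "?d x < 0" by simp
      then show ?thesis using circle_dist_strip(1,3)[OF L d] per'[of "- ?d x" "fst x" "1 - n"] d by simp
    qed
  qed
qed

lemma arc_limit:
  fixes E :: "real \<times> real \<Rightarrow> real"
  assumes "0 < l" "continuous_on (UNIV \<times> {0..<l}) E"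
  shows "((\<lambda>s. E (a, s)) \<longlongrightarrow> E (a, 0)) (at_right 0)"
proof -
  have "continuous_on {0..l / 2} (\<lambda>s. E (a, s))"
    by (intro continuous_on_compose2[OF assms(2)] continuous_intros) (use assms(1) in auto)
  then have "((\<lambda>s. E (a, s)) \<longlongrightarrow> E (a, 0)) (at 0 within {0..l / 2})" using assms(1) by (simp add: continuous_on_def)
  then show ?thesis using assms(1) by (simp add: at_within_Icc_at_right)
qed

lemma arc_limit_le:
  fixes E E' :: "real \<times> real \<Rightarrow> real"
  assumes l: "0 < l" and c: "continuous_on (UNIV \<times> {0..<l}) E" "continuous_on (UNIV \<times> {0..<l}) E'"
    and le: "\<And>s. 0 < s \<Longrightarrow> s < l \<Longrightarrow> E (a, s) \<le> E' (b, s)" and s: "0 \<le> s" "s < l"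
  shows "E (a, s) \<le> E' (b, s)"
proof (cases "s = 0")
  case True
  have "E (a, 0) \<le> E' (b, 0)"
    by (rule tendsto_le[OF trivial_limit_at_right_real arc_limit[OF l c(2)] arc_limit[OF l c(1)]])
       (use eventually_at_right_real[OF l] le in \<open>auto elim: eventually_mono\<close>)
  then show ?thesis using True by simp
qed (use le s in auto)

text \<open>At antipodal pairs the start of the shorter arc jumps, so in general the extension is
  limited to the other pairs. A function already known to be continuous off the diagonal, as the
  energy density is, extends to the whole torus.\<close>

lemma diagonal_extension:
  fixes E F :: "real \<times> real \<Rightarrow> real"
  assumes L: "0 < L" and E: "continuous_on (UNIV \<times> {0..<L / 2}) E"
    and per: "\<And>a s. 0 < s \<Longrightarrow> s < L / 2 \<Longrightarrow> E (a + L, s) = E (a, s)"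
    and bound: "\<And>a s. 0 < s \<Longrightarrow> s < L / 2 \<Longrightarrow> \<bar>E (a, s)\<bar> \<le> B"
    and F: "\<And>s1 s2. circle_dist L s1 s2 \<noteq> 0 \<Longrightarrow> circle_dist L s1 s2 \<noteq> L / 2 \<Longrightarrow>
      F (s1, s2) = E (arc_start L s1 s2, circle_dist L s1 s2)"
  shows "extends_continuously L (non_antipodal L) F B"
    "(F \<longlongrightarrow> E (s, 0)) (at (s, s) within off_diagonal L)"
    "continuous_on (off_diagonal L) F \<Longrightarrow> (\<And>x. x \<in> off_diagonal L \<Longrightarrow> \<bar>F x\<bar> \<le> B) \<Longrightarrow> extends_continuously L UNIV F B"
proof -
  have L2: "0 < L / 2" using L by simp
  define G where "G = (\<lambda>x. E (arc_start L (fst x) (snd x), circle_dist L (fst x) (snd x)))"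
  have per0: "E (a + L, s) = E (a, s)" if "0 \<le> s" "s < L / 2" for a s
    by (intro order_antisym arc_limit_le[OF L2 E E _ that]) (simp_all add: per)
  have G: "continuous_on (non_antipodal L) G"
    unfolding G_def by (rule continuous_on_arcs[OF L E per0])
  have "E (a, s) \<le> B" "- B \<le> E (a, s)" if "0 \<le> s" "s < L / 2" for a s
  proof -
    have b: "E (a, s) \<le> B" "- B \<le> E (a, s)" if "0 < s" "s < L / 2" for s using bound[OF that, of a] by linarith+
    show "E (a, s) \<le> B" by (rule arc_limit_le[OF L2 E continuous_on_const b(1) that])
    show "- B \<le> E (a, s)" by (rule arc_limit_le[OF L2 continuous_on_const E b(2) that])
  qed
  then have bE: "\<bar>E (a, s)\<bar> \<le> B" if "0 \<le> s" "s < L / 2" for a s using that by (simp add: abs_le_iff minus_le_iff)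
  have bG: "\<bar>G x\<bar> \<le> B" if "x \<in> non_antipodal L" for x
    unfolding G_def using circle_dist_bounds[OF L, of "fst x" "snd x"] that
    by (intro bE) (auto simp: non_antipodal_def)
  have GF: "G x = F x" if "x \<in> non_antipodal L \<inter> off_diagonal L" for x
    using F[of "fst x" "snd x"] that by (auto simp: G_def non_antipodal_def off_diagonal_def)
  show "extends_continuously L (non_antipodal L) F B"
    unfolding extends_continuously_def using G GF bG by blast
  have cd: "circle_dist L s s = 0" using circle_dist_shift[OF L, of 0 s] L by simp
  have ss: "(s, s) \<in> non_antipodal L" using cd L by (simp add: non_antipodal_def)
  have "(s - s) rmod L = 0" using L by (intro rmod_unique[of _ _ _ 0]) auto
  then have "G (s, s) = E (s, 0)" using cd L by (simp add: G_def arc_start_def)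
  moreover have "isCont G (s, s)" using G ss open_non_antipodal[OF L] by (simp add: continuous_on_eq_continuous_at)
  ultimately have lim: "(G \<longlongrightarrow> E (s, 0)) (at (s, s) within off_diagonal L)"
    using tendsto_within_subset[of G _ "(s, s)" UNIV "off_diagonal L"] by (simp add: isCont_def)
  have "\<forall>\<^sub>F x in at (s, s) within off_diagonal L. x \<in> non_antipodal L \<inter> off_diagonal L"
    using eventually_at_in_open'[OF open_non_antipodal[OF L] ss] by (auto simp: eventually_at_filter elim: eventually_mono)
  then have "\<forall>\<^sub>F x in at (s, s) within off_diagonal L. G x = F x"
    by eventually_elim (rule GF)
  then show "(F \<longlongrightarrow> E (s, 0)) (at (s, s) within off_diagonal L)" by (rule Lim_transform_eventually[OF lim])
  assume cF: "continuous_on (off_diagonal L) F" and bF: "\<And>x. x \<in> off_diagonal L \<Longrightarrow> \<bar>F x\<bar> \<le> B"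
  \<comment> \<open>The two open sets cover the torus; F takes care of the antipodal pairs, G of the
    diagonal, and they agree on the overlap.\<close>
  define H where "H = (\<lambda>x. if x \<in> off_diagonal L then F x else G x)"
  have "continuous_on (off_diagonal L) H" by (rule continuous_on_eq[OF cF]) (simp add: H_def)
  moreover have "continuous_on (non_antipodal L) H" by (rule continuous_on_eq[OF G]) (simp add: H_def GF)
  moreover have U: "off_diagonal L \<union> non_antipodal L = UNIV" using L by (auto simp: off_diagonal_def non_antipodal_def)
  ultimately have "continuous_on UNIV H"
    using continuous_on_open_Un[OF open_off_diagonal[OF L] open_non_antipodal[OF L]] by metis
  moreover have "\<bar>H x\<bar> \<le> B" for x using bF[of x] bG[of x] U by (cases "x \<in> off_diagonal L") (auto simp: H_def)
  moreover have "H x = F x" if "x \<in> off_diagonal L" for x using that by (simp add: H_def)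
  ultimately show "extends_continuously L UNIV F B"
    unfolding extends_continuously_def by (intro exI[of _ H] conjI ballI) simp_all
qed

section \<open>Gaps divided by the power of the arc length\<close>

definition gap_quotient :: "real \<Rightarrow> real \<Rightarrow> real" where
  "gap_quotient q R = (if R = 0 then q else ((1 - R) powr (- q) - 1) / R)"

lemma gap_quotient_mult: "(1 - R) powr (- q) = 1 + R * gap_quotient q R"
  by (simp add: gap_quotient_def)

text \<open>The value q at R = 0 is the derivative of \<open>(1 - R) powr (- q)\<close> there, so
  the singularity of the difference quotient is removable.\<close>

lemma continuous_on_gap_quotient: "continuous_on {..<1} (gap_quotient q)"
proof -
  have "isCont (gap_quotient q) R" if R: "R < 1" for R
  proof (cases "R = 0")
    case True
    have "((\<lambda>R. (1 - R) powr (- q)) has_real_derivative q) (at 0)"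
      by (rule derivative_eq_intros refl | simp)+
    then have "((\<lambda>R. ((1 - R) powr (- q) - 1) / R) \<longlongrightarrow> q) (at 0)"
      by (simp add: DERIV_def)
    then have "(gap_quotient q \<longlongrightarrow> q) (at 0)"
      by (rule Lim_transform_eventually) (auto simp: gap_quotient_def eventually_at_filter)
    then show ?thesis using True by (simp add: isCont_def gap_quotient_def)
  next
    case False
    have "continuous_on ({..<1} - {0}) (\<lambda>R. ((1 - R) powr (- q) - 1) / R)" by (intro continuous_intros) auto
    then have "continuous_on ({..<1} - {0}) (gap_quotient q)"
      by (rule continuous_on_eq) (simp add: gap_quotient_def)
    moreover have "open ({..<1} - {0 :: real})" by auto
    ultimately show ?thesis using R False by (simp add: continuous_on_eq_continuous_at)
  qed
  then show ?thesis by (simp add: continuous_at_imp_continuous_on)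
qed

text \<open>With variance and covariances written as k times quotients, every term of the gap and
  its derivatives contains a factor k. Here m stands for derivatives of the squared chord, and those
  of the squared length exceed them by twice a covariance; products of the latter are
  telescoped.\<close>

lemma gap_scaled:
  fixes k c :: real
  defines "R \<equiv> k * c"
  shows "gap q (1 - R) 1 = k * (c * gap_quotient q R)"
    "gap1 q (1 - R) 1 m1 (m1 + 2 * (k * x1)) = k * (- q * (c * gap_quotient (q + 1) R * m1 - 2 * x1))"
    "gap2 q (1 - R) 1 m1 (m1 + 2 * (k * x1)) m2 (m2 + 2 * (k * x2)) m12 (m12 + 2 * (k * x12)) =
      k * (q * (q + 1) * (c * gap_quotient (q + 2) R * m1 * m2 - 2 * (m1 * x2 + x1 * (m2 + 2 * (k * x2))))
        - q * (c * gap_quotient (q + 1) R * m12 - 2 * x12))"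
proof -
  have e: "- q - 1 = - (q + 1)" "- q - 2 = - (q + 2)" by simp_all
  show "gap q (1 - R) 1 = k * (c * gap_quotient q R)"
    unfolding gap_def gap_quotient_mult by (simp add: R_def)
  show "gap1 q (1 - R) 1 m1 (m1 + 2 * (k * x1)) = k * (- q * (c * gap_quotient (q + 1) R * m1 - 2 * x1))"
    unfolding gap1_def e gap_quotient_mult by (simp add: R_def algebra_simps)
  show "gap2 q (1 - R) 1 m1 (m1 + 2 * (k * x1)) m2 (m2 + 2 * (k * x2)) m12 (m12 + 2 * (k * x12)) =
      k * (q * (q + 1) * (c * gap_quotient (q + 2) R * m1 * m2 - 2 * (m1 * x2 + x1 * (m2 + 2 * (k * x2))))
        - q * (c * gap_quotient (q + 1) R * m12 - 2 * x12))"
    unfolding gap2_def e gap_quotient_mult powr_one_eq_one by (simp add: R_def) algebra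
qed

lemma arc_shift:
  assumes "0 < L" "0 \<le> s" "s \<le> L / 2" shows "arc_start L (a + s) a = a"
proof -
  have "(a + s - a) rmod L = s" using assms by (intro rmod_unique[of _ _ _ 0]) auto
  then show ?thesis using assms by (simp add: arc_start_def)
qed

locale little_holder_variation = holder_variation +
  assumes regular: "little_regular \<beta> t" "little_regular \<beta> u" "little_regular \<beta> v"
begin

definition arcs :: "(real \<times> real) set" where "arcs = UNIV \<times> {0..<L / 2}"

lemma continuous_at_ends: "continuous_on S (\<lambda>q. w (fst q))" "continuous_on S (\<lambda>q. w (fst q + snd q))"
  if "continuous_on UNIV w" for w :: "real \<Rightarrow> 'a" and S
  by (intro continuous_on_compose2[OF that] continuous_intros; simp)+

lemma expectation_arc:
  assumes "0 < s" "s < L / 2"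
  shows "1 / Cb\<^sup>2 \<le> (norm (\<integral>x. t (a + s * x) \<partial>unit_interval))\<^sup>2"
  using expectation_t(1)[OF UNIV_I UNIV_I _ refl refl, of "a + s" a] circle_dist_shift[OF L, of s a]
    arc_shift[OF L, of s a] assms by simp

text \<open>Once all covariances are a common power of s times continuous quotients, so are the gap
  and its derivatives. Each summand of their quotients contains a quotient of a covariance, which
  explains the zeros at s = 0 for \<beta> < 1.\<close>

lemma scaled_gaps:
  "\<exists>g g1 g2 g12. continuous_on arcs g \<and> continuous_on arcs g1 \<and> continuous_on arcs g2 \<and> continuous_on arcs g12 \<and>
    (\<forall>a s. 0 < s \<longrightarrow> s < L / 2 \<longrightarrow>
      arc_gap unit_interval \<alpha> (\<lambda>x. t (a + s * x)) = s powr (2 * \<beta>) * g (a, s) \<and>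
      arc_gap1 unit_interval \<alpha> (\<lambda>x. t (a + s * x)) (\<lambda>x. u (a + s * x)) = s powr (2 * \<beta>) * g1 (a, s) \<and>
      arc_gap1 unit_interval \<alpha> (\<lambda>x. t (a + s * x)) (\<lambda>x. v (a + s * x)) = s powr (2 * \<beta>) * g2 (a, s) \<and>
      arc_gap2 unit_interval \<alpha> (\<lambda>x. t (a + s * x)) (\<lambda>x. u (a + s * x)) (\<lambda>x. v (a + s * x)) = s powr (2 * \<beta>) * g12 (a, s)) \<and>
    (\<beta> < 1 \<longrightarrow> (\<forall>a. g (a, 0) = 0 \<and> g1 (a, 0) = 0 \<and> g2 (a, 0) = 0 \<and> g12 (a, 0) = 0))"
proof -
  have t1: "norm (t x) \<le> 1" for x using norms(1)[of x] by simp
  have ti: "norm (t x \<bullet> u x) \<le> N1" "norm (t x \<bullet> v x) \<le> N2" for x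
    using Cauchy_Schwarz_ineq2[of "t x" "u x"] Cauchy_Schwarz_ineq2[of "t x" "v x"] norms(1-3)[of x] by simp_all
  note sc = covar_scaled[OF \<beta>]
  note ru = little_regular_inner[OF regular(1) t1 regular(2) norms(2)]
    and rv = little_regular_inner[OF regular(1) t1 regular(3) norms(3)]
  have sub: "arcs \<subseteq> UNIV \<times> {0..}" by (auto simp: arcs_def)
  obtain ct where ct: "continuous_on arcs ct" "\<And>a s. 0 \<le> s \<Longrightarrow> covar unit_interval (\<lambda>x. t (a + s * x)) (\<lambda>x. t (a + s * x)) = s powr (2 * \<beta>) * ct (a, s)"
    "\<And>a. \<beta> < 1 \<Longrightarrow> ct (a, 0) = 0" using sc[OF regular(1) t1 regular(1) t1] continuous_on_subset[OF _ sub] by blast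
  obtain cu where cu: "continuous_on arcs cu" "\<And>a s. 0 \<le> s \<Longrightarrow> covar unit_interval (\<lambda>x. t (a + s * x)) (\<lambda>x. u (a + s * x)) = s powr (2 * \<beta>) * cu (a, s)"
    "\<And>a. \<beta> < 1 \<Longrightarrow> cu (a, 0) = 0" using sc[OF regular(1) t1 regular(2) norms(2)] continuous_on_subset[OF _ sub] by blast
  obtain cv where cv: "continuous_on arcs cv" "\<And>a s. 0 \<le> s \<Longrightarrow> covar unit_interval (\<lambda>x. t (a + s * x)) (\<lambda>x. v (a + s * x)) = s powr (2 * \<beta>) * cv (a, s)"
    "\<And>a. \<beta> < 1 \<Longrightarrow> cv (a, 0) = 0" using sc[OF regular(1) t1 regular(3) norms(3)] continuous_on_subset[OF _ sub] by blast
  obtain cuv where cuv: "continuous_on arcs cuv" "\<And>a s. 0 \<le> s \<Longrightarrow> covar unit_interval (\<lambda>x. u (a + s * x)) (\<lambda>x. v (a + s * x)) = s powr (2 * \<beta>) * cuv (a, s)"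
    "\<And>a. \<beta> < 1 \<Longrightarrow> cuv (a, 0) = 0" using sc[OF regular(2) norms(2) regular(3) norms(3)] continuous_on_subset[OF _ sub] by blast
  obtain ci where ci: "continuous_on arcs ci" "\<And>a s. 0 \<le> s \<Longrightarrow> covar unit_interval (\<lambda>x. t (a + s * x) \<bullet> u (a + s * x)) (\<lambda>x. t (a + s * x) \<bullet> v (a + s * x)) = s powr (2 * \<beta>) * ci (a, s)"
    "\<And>a. \<beta> < 1 \<Longrightarrow> ci (a, 0) = 0" using sc[OF ru ti(1) rv ti(2)] continuous_on_subset[OF _ sub] by blast
  define R where "R = (\<lambda>q. snd q powr (2 * \<beta>) * ct q)"
  define Q where "Q = (\<lambda>r q. gap_quotient (\<alpha> / 2 + r) (R q))"
  define m where "m = (\<lambda>(y :: real \<Rightarrow> 'a) (z :: real \<Rightarrow> 'a) q.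
    2 * ((\<integral>x. y (fst q + snd q * x) \<partial>unit_interval) \<bullet> (\<integral>x. z (fst q + snd q * x) \<partial>unit_interval)))"
  have chord: "(norm (\<integral>x. t (a + s * x) \<partial>unit_interval))\<^sup>2 = 1 - R (a, s)" if "0 \<le> s" for a s
    using ct(2)[OF that, of a] by (simp add: R_def covar_def dot_square_norm norms unit.prob_space)
  \<comment> \<open>\<open>gap_quotient\<close> is continuous below 1 only. The bi-Lipschitz bound
    keeps \<open>1 - R\<close> at least \<open>1 / Cb\<^sup>2\<close> for s > 0, and R is 0 at s =
    0.\<close>
  have R1: "R q < 1" if "q \<in> arcs" for q
  proof (cases "snd q = 0")
    case False
    then have "1 / Cb\<^sup>2 \<le> 1 - R (fst q, snd q)"
      using chord[of "snd q" "fst q"] expectation_arc[of "snd q" "fst q"] that by (auto simp: arcs_def)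
    moreover have "0 < 1 / Cb\<^sup>2" using bi_lip(1) by simp
    ultimately show ?thesis unfolding prod.collapse by linarith
  qed (simp add: R_def)
  have k: "continuous_on arcs (\<lambda>q. snd q powr (2 * \<beta>))"
    by (intro continuous_on_powr' continuous_intros) (use \<beta> in \<open>auto simp: arcs_def\<close>)
  have cR: "continuous_on arcs R" unfolding R_def by (intro continuous_intros k ct)
  have cQ: "continuous_on arcs (Q r)" for r
    unfolding Q_def by (rule continuous_on_compose2[OF continuous_on_gap_quotient cR]) (use R1 in auto)
  have cm: "continuous_on arcs (m y z)" if "continuous_on UNIV y" "continuous_on UNIV z" for y z
    unfolding m_def by (intro continuous_intros continuous_on_expectation continuous_on_arc that)
  define h where "h = (\<lambda>w cw q. - (\<alpha> / 2) * (ct q * Q 1 q * m t w q - 2 * cw q) :: real)"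
  define h2 where "h2 = (\<lambda>q. \<alpha> / 2 * (\<alpha> / 2 + 1) * (ct q * Q 2 q * m t u q * m t v q
       - 2 * (m t u q * cv q + cu q * (m t v q + 2 * (snd q powr (2 * \<beta>) * cv q))))
     - \<alpha> / 2 * (ct q * Q 1 q * m u v q - 2 * (cuv q - ci q)))"
  show ?thesis
  proof (rule exI[of _ "\<lambda>q. ct q * Q 0 q"], rule exI[of _ "h u cu"], rule exI[of _ "h v cv"], rule exI[of _ h2],
      intro conjI allI impI)
    show "continuous_on arcs (\<lambda>q. ct q * Q 0 q)" by (intro continuous_intros ct cQ)
    show "continuous_on arcs (h u cu)" "continuous_on arcs (h v cv)" "continuous_on arcs h2"
      unfolding h_def h2_def by (intro continuous_intros ct cu cv cuv ci cQ cm k continuous)+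
    fix a s :: real
    assume "0 < s" "s < L / 2"
    then have s: "0 \<le> s" by simp
    define k where "k = s powr (2 * \<beta>)"
    have Rk: "R (a, s) = k * ct (a, s)" by (simp add: R_def k_def)
    have n1: "2 * (\<integral>x. t (a + s * x) \<bullet> u (a + s * x) \<partial>unit_interval) = m t u (a, s) + 2 * (k * cu (a, s))"
      using cu(2)[OF s, of a] by (simp add: m_def k_def covar_def)
    have n2: "2 * (\<integral>x. t (a + s * x) \<bullet> v (a + s * x) \<partial>unit_interval) = m t v (a, s) + 2 * (k * cv (a, s))"
      using cv(2)[OF s, of a] by (simp add: m_def k_def covar_def)
    \<comment> \<open>The mixed derivative of the squared length exceeds that of the squared chord
      by twice a difference of two covariances, again a multiple of k.\<close>
    have n12: "2 * (\<integral>x. t (a + s * x) \<bullet> u (a + s * x) \<partial>unit_interval) * (\<integral>x. t (a + s * x) \<bullet> v (a + s * x) \<partial>unit_interval)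
       + 2 * ((\<integral>x. u (a + s * x) \<bullet> v (a + s * x) \<partial>unit_interval)
          - (\<integral>x. (t (a + s * x) \<bullet> u (a + s * x)) * (t (a + s * x) \<bullet> v (a + s * x)) \<partial>unit_interval))
      = m u v (a, s) + 2 * (k * (cuv (a, s) - ci (a, s)))"
    proof -
      have "k * (cuv (a, s) - ci (a, s)) = covar unit_interval (\<lambda>x. u (a + s * x)) (\<lambda>x. v (a + s * x))
          - covar unit_interval (\<lambda>x. t (a + s * x) \<bullet> u (a + s * x)) (\<lambda>x. t (a + s * x) \<bullet> v (a + s * x))"
        by (simp only: right_diff_distrib k_def cuv(2)[OF s] ci(2)[OF s])
      then show ?thesis by (simp add: m_def covar_def)
    qed
    have mm: "2 * ((\<integral>x. y (a + s * x) \<partial>unit_interval) \<bullet> (\<integral>x. z (a + s * x) \<partial>unit_interval)) = m y z (a, s)" for y z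
      by (simp add: m_def)
    show "arc_gap unit_interval \<alpha> (\<lambda>x. t (a + s * x)) = s powr (2 * \<beta>) * (ct (a, s) * Q 0 (a, s))"
      unfolding arc_gap_def chord[OF s] Rk gap_scaled by (simp add: Q_def Rk k_def)
    show "arc_gap1 unit_interval \<alpha> (\<lambda>x. t (a + s * x)) (\<lambda>x. u (a + s * x)) = s powr (2 * \<beta>) * h u cu (a, s)"
      "arc_gap1 unit_interval \<alpha> (\<lambda>x. t (a + s * x)) (\<lambda>x. v (a + s * x)) = s powr (2 * \<beta>) * h v cv (a, s)"
      unfolding arc_gap1_def chord[OF s] Rk n1 n2 mm gap_scaled by (simp_all add: Q_def Rk k_def h_def)
    show "arc_gap2 unit_interval \<alpha> (\<lambda>x. t (a + s * x)) (\<lambda>x. u (a + s * x)) (\<lambda>x. v (a + s * x)) = s powr (2 * \<beta>) * h2 (a, s)"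
      unfolding arc_gap2_def chord[OF s] Rk n12 unfolding n1 n2 mm gap_scaled by (simp add: Q_def Rk k_def h2_def)
  next
    fix a assume "\<beta> < 1"
    then show "ct (a, 0) * Q 0 (a, 0) = 0" "h u cu (a, 0) = 0" "h v cv (a, 0) = 0" "h2 (a, 0) = 0"
      by (simp_all add: h_def h2_def ct(3) cu(3) cv(3) cuv(3) ci(3))
  qed
qed

lemma weight_scale: "0 < s \<Longrightarrow> weight s * (s powr (- \<alpha> * p) * (s powr (2 * \<beta>)) powr p) = 1"
proof -
  assume s: "0 < s"
  have "(\<alpha> - 2 * \<beta>) * p + (- \<alpha> * p + 2 * \<beta> * p) = 0" by (simp add: algebra_simps)
  then show ?thesis unfolding weight_def powr_powr powr_add[symmetric] using s by simp
qed

text \<open>By homogeneity the power of s leaves the densities with the exponent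
  \<open>2 * \<beta> * p\<close>, which the weight and the prefactor cancel. What remains are
  densities of continuous functions; where the gap quotient vanishes, their continuity needs the
  bound of squared derivatives by the gap once more.\<close>

lemma weighted_arcs:
  "\<exists>E E1 E2. continuous_on arcs E \<and> continuous_on arcs E1 \<and> continuous_on arcs E2 \<and>
    (\<forall>a s. 0 < s \<longrightarrow> s < L / 2 \<longrightarrow> E (a, s) = weight s * arc_energy \<alpha> p t a s \<and>
      E1 (a, s) = weight s * arc_variation1 \<alpha> p t u a s \<and> E2 (a, s) = weight s * arc_variation2 \<alpha> p t u v a s) \<and>
    (\<beta> < 1 \<longrightarrow> (\<forall>a. E (a, 0) = 0 \<and> E1 (a, 0) = 0 \<and> E2 (a, 0) = 0))"
proof -
  obtain g g1 g2 g12 where cont: "continuous_on arcs g" "continuous_on arcs g1" "continuous_on arcs g2" "continuous_on arcs g12"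
    and eq': "\<forall>a s. 0 < s \<longrightarrow> s < L / 2 \<longrightarrow>
      arc_gap unit_interval \<alpha> (\<lambda>x. t (a + s * x)) = s powr (2 * \<beta>) * g (a, s) \<and>
      arc_gap1 unit_interval \<alpha> (\<lambda>x. t (a + s * x)) (\<lambda>x. u (a + s * x)) = s powr (2 * \<beta>) * g1 (a, s) \<and>
      arc_gap1 unit_interval \<alpha> (\<lambda>x. t (a + s * x)) (\<lambda>x. v (a + s * x)) = s powr (2 * \<beta>) * g2 (a, s) \<and>
      arc_gap2 unit_interval \<alpha> (\<lambda>x. t (a + s * x)) (\<lambda>x. u (a + s * x)) (\<lambda>x. v (a + s * x)) = s powr (2 * \<beta>) * g12 (a, s)"
    and zero: "\<beta> < 1 \<longrightarrow> (\<forall>a. g (a, 0) = 0 \<and> g1 (a, 0) = 0 \<and> g2 (a, 0) = 0 \<and> g12 (a, 0) = 0)"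
    using scaled_gaps by (elim exE conjE) (rule that)
  note eq = eq'[rule_format, THEN conjunct1] eq'[rule_format, THEN conjunct2, THEN conjunct1]
    eq'[rule_format, THEN conjunct2, THEN conjunct2, THEN conjunct1] eq'[rule_format, THEN conjunct2, THEN conjunct2, THEN conjunct2]
  \<comment> \<open>\<open>var_bound s\<close> is \<open>K\<^sup>2 + 1\<close> times the power of s
    that is divided out of the squared derivative bound; the root of the remaining factor enters
    c.\<close>
  define c where "c = gap_const (\<alpha> / 2) (Cb\<^sup>2) * sqrt (K\<^sup>2 + 1)"
  have c0: "0 \<le> c" unfolding c_def using gap_const_ge[of "\<alpha> / 2" "Cb\<^sup>2"] \<alpha> by simp
  have pos: "0 \<le> g (a, s)" "(g1 (a, s))\<^sup>2 \<le> (N1 * c)\<^sup>2 * g (a, s)" "(g2 (a, s))\<^sup>2 \<le> (N2 * c)\<^sup>2 * g (a, s)"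
    if s: "0 < s" "s < L / 2" for a s
  proof -
    define k where "k = s powr (2 * \<beta>)"
    have k: "0 < k" using s by (simp add: k_def)
    note mt = borel_measurable_arc[OF borel(1), of a s]
    have Cb2: "0 < Cb\<^sup>2" using bi_lip(1) by simp
    have s': "0 \<le> s" "s \<le> L / 2" using s by auto
    note T = arc_var_bounds[OF s', of a, unfolded arc_var_def]
    note est = \<alpha> Cb2 mt norms(1) expectation_arc[OF s] T(1)
    have "0 \<le> k * g (a, s)" using unit.arc_gap_estimates(1)[OF est] unfolding eq(1)[OF s] k_def .
    then show "0 \<le> g (a, s)" using k by (simp add: zero_le_mult_iff)
    have le: "y\<^sup>2 \<le> (N * c)\<^sup>2 * g (a, s)"
      if "(k * y)\<^sup>2 \<le> (N * gap_const (\<alpha> / 2) (Cb\<^sup>2))\<^sup>2 * var_bound s * (k * g (a, s))" for y N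
    proof -
      have "var_bound s = (K\<^sup>2 + 1) * k" by (simp add: var_bound_def k_def)
      then have "k\<^sup>2 * y\<^sup>2 \<le> k\<^sup>2 * ((N * c)\<^sup>2 * g (a, s))"
        using that by (simp add: c_def power_mult_distrib power2_eq_square[of k] ac_simps)
      then show ?thesis using k by simp
    qed
    show "(g1 (a, s))\<^sup>2 \<le> (N1 * c)\<^sup>2 * g (a, s)"
      using unit.arc_gap1_estimates(2)[OF est borel_measurable_arc[OF borel(2)] norms(2) T(2)] unfolding eq[OF s]
      by (intro le) (simp add: k_def)
    show "(g2 (a, s))\<^sup>2 \<le> (N2 * c)\<^sup>2 * g (a, s)"
      using unit.arc_gap1_estimates(2)[OF est borel_measurable_arc[OF borel(3)] norms(3) T(3)] unfolding eq[OF s]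
      by (intro le) (simp add: k_def)
  qed
  have L2: "0 < L / 2" using L by simp
  note cont' = cont[unfolded arcs_def]
  \<comment> \<open>The estimates pass from s > 0 to s = 0 by continuity.
    \<open>tendsto_density2\<close> takes a single constant for both derivatives, hence the sum of
    N1 and N2.\<close>
  have bounds: "0 \<le> g q" "(g1 q)\<^sup>2 \<le> ((N1 + N2) * c)\<^sup>2 * g q" "(g2 q)\<^sup>2 \<le> ((N1 + N2) * c)\<^sup>2 * g q" if "q \<in> arcs" for q
  proof -
    obtain a s where q: "q = (a, s)" "0 \<le> s" "s < L / 2" using \<open>q \<in> arcs\<close> by (auto simp: arcs_def)
    show g0: "0 \<le> g q" unfolding q(1)
      by (rule arc_limit_le[OF L2 _ cont'(1) pos(1) q(2,3)]) (rule continuous_on_const)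
    have "(g1 q)\<^sup>2 \<le> (N1 * c)\<^sup>2 * g q" unfolding q(1)
      by (rule arc_limit_le[where E = "\<lambda>q. (g1 q)\<^sup>2" and E' = "\<lambda>q. (N1 * c)\<^sup>2 * g q", OF L2 _ _ pos(2) q(2,3)])
         (intro continuous_intros cont')+
    also have "\<dots> \<le> ((N1 + N2) * c)\<^sup>2 * g q"
      using g0 c0 N_nonneg by (intro mult_right_mono power_mono) auto
    finally show "(g1 q)\<^sup>2 \<le> ((N1 + N2) * c)\<^sup>2 * g q" .
    have "(g2 q)\<^sup>2 \<le> (N2 * c)\<^sup>2 * g q" unfolding q(1)
      by (rule arc_limit_le[where E = "\<lambda>q. (g2 q)\<^sup>2" and E' = "\<lambda>q. (N2 * c)\<^sup>2 * g q", OF L2 _ _ pos(3) q(2,3)])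
         (intro continuous_intros cont')+
    also have "\<dots> \<le> ((N1 + N2) * c)\<^sup>2 * g q"
      using g0 c0 N_nonneg by (intro mult_right_mono power_mono) auto
    finally show "(g2 q)\<^sup>2 \<le> ((N1 + N2) * c)\<^sup>2 * g q" .
  qed
  define e1 where "e1 = (\<lambda>w q. ends1 (t (fst q)) (t (fst q + snd q)) (w (fst q)) (w (fst q + snd q)))"
  define e2 where "e2 = (\<lambda>q. ends2 (t (fst q)) (t (fst q + snd q)) (u (fst q)) (u (fst q + snd q)) (v (fst q)) (v (fst q + snd q)))"
  have ends: "continuous_on arcs (e1 w)" if "continuous_on UNIV w" for w
    unfolding e1_def ends1_def by (intro continuous_intros continuous_at_ends continuous that)
  have ends2: "continuous_on arcs e2"
    unfolding e2_def ends2_def by (intro continuous_intros continuous_at_ends continuous)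
  have ev: "\<forall>\<^sub>F y in at x within arcs. Q y" if "\<And>y. y \<in> arcs \<Longrightarrow> Q y" for x and Q :: "real \<times> real \<Rightarrow> bool"
    using that by (simp add: eventually_at_filter)
  show ?thesis
  proof (rule exI[of _ "\<lambda>q. g q powr p"], rule exI[of _ "\<lambda>q. density1 p (g q) (g1 q) 1 (e1 u q)"],
      rule exI[of _ "\<lambda>q. density2 p (g q) (g1 q) (g2 q) (g12 q) 1 (e1 u q) (e1 v q) (e2 q)"], intro conjI allI impI)
    show "continuous_on arcs (\<lambda>q. g q powr p)"
      by (intro continuous_on_powr' cont continuous_intros) (use bounds p in auto)
    show "continuous_on arcs (\<lambda>q. density1 p (g q) (g1 q) 1 (e1 u q))"
      unfolding continuous_on_def
      by (intro ballI tendsto_density1[OF p] tendsto_const ev bounds(1))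
         (use cont ends[OF continuous(2)] in \<open>auto simp: continuous_on_def\<close>)
    show "continuous_on arcs (\<lambda>q. density2 p (g q) (g1 q) (g2 q) (g12 q) 1 (e1 u q) (e1 v q) (e2 q))"
      unfolding continuous_on_def
      by (intro ballI tendsto_density2[OF p, where q = "(N1 + N2) * c"] tendsto_const ev bounds mult_nonneg_nonneg c0 add_nonneg_nonneg N_nonneg)
         (use cont ends[OF continuous(2)] ends[OF continuous(3)] ends2 in \<open>auto simp: continuous_on_def\<close>)
    fix a s :: real assume s: "0 < s" "s < L / 2"
    define k where "k = s powr (2 * \<beta>)"
    have k: "0 < k" using s by (simp add: k_def)
    have w: "weight s * (s powr (- \<alpha> * p) * (k powr p * x)) = x" for x
      using weight_scale[OF s(1)] by (simp add: k_def)
    show "g (a, s) powr p = weight s * arc_energy \<alpha> p t a s"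
      unfolding arc_energy_def eq(1)[OF s] k_def[symmetric] powr_mult w ..
    show "density1 p (g (a, s)) (g1 (a, s)) 1 (e1 u (a, s)) = weight s * arc_variation1 \<alpha> p t u a s"
      unfolding arc_variation1_def density_variation1_def eq[OF s] k_def[symmetric] density1_scale[OF p k] w by (simp add: e1_def)
    show "density2 p (g (a, s)) (g1 (a, s)) (g2 (a, s)) (g12 (a, s)) 1 (e1 u (a, s)) (e1 v (a, s)) (e2 (a, s))
        = weight s * arc_variation2 \<alpha> p t u v a s"
      unfolding arc_variation2_def density_variation2_def eq[OF s] k_def[symmetric] density2_scale[OF p k] w by (simp add: e1_def e2_def)
  next
    fix a assume "\<beta> < 1"
    note z = zero[rule_format, OF this, of a]
    show "g (a, 0) powr p = 0" using z by simp
    show "density1 p (g (a, 0)) (g1 (a, 0)) 1 (e1 u (a, 0)) = 0" using z by (simp add: density1_def)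
    show "density2 p (g (a, 0)) (g1 (a, 0)) (g2 (a, 0)) (g12 (a, 0)) 1 (e1 u (a, 0)) (e1 v (a, 0)) (e2 (a, 0)) = 0"
      using z by (simp add: density2_def)
  qed
qed

end

context little_holder_variation
begin

lemma weighted_extensions:
  assumes f: "continuous_on UNIV f"
  defines "B \<equiv> variation_const \<alpha> p Cb * (K\<^sup>2 + 1) powr p"
    and "M \<equiv> weighted \<alpha> \<beta> p L t (energy_density \<alpha> p L f t)"
    and "G \<equiv> weighted \<alpha> \<beta> p L t (variation1 \<alpha> p L f t \<phi> u)"
    and "H \<equiv> weighted \<alpha> \<beta> p L t (variation2 \<alpha> p L f t \<phi> u \<psi> v)"
  shows "extends_continuously L UNIV M B" "extends_continuously L (non_antipodal L) G (B * N1)"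
    "extends_continuously L (non_antipodal L) H (B * N1 * N2)"
    "\<forall>F \<in> {M, G, H}. \<forall>s. (\<exists>l. (F \<longlongrightarrow> l) (at (s, s) within off_diagonal L)) \<and>
      (\<beta> < 1 \<longrightarrow> (F \<longlongrightarrow> 0) (at (s, s) within off_diagonal L))"
proof -
  obtain E E1 E2 where cont: "continuous_on arcs E" "continuous_on arcs E1" "continuous_on arcs E2"
    and eq': "\<forall>a s. 0 < s \<longrightarrow> s < L / 2 \<longrightarrow> E (a, s) = weight s * arc_energy \<alpha> p t a s \<and>
      E1 (a, s) = weight s * arc_variation1 \<alpha> p t u a s \<and> E2 (a, s) = weight s * arc_variation2 \<alpha> p t u v a s"
    and zero: "\<beta> < 1 \<longrightarrow> (\<forall>a. E (a, 0) = 0 \<and> E1 (a, 0) = 0 \<and> E2 (a, 0) = 0)"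
    using weighted_arcs by (elim exE conjE) (rule that)
  note eq = eq'[rule_format, THEN conjunct1] eq'[rule_format, THEN conjunct2, THEN conjunct1]
    eq'[rule_format, THEN conjunct2, THEN conjunct2]
  note cont = cont[unfolded arcs_def]
  have per: "w (a + L + y) = w (a + y)" if "periodic_fun_simple w L" for w :: "real \<Rightarrow> 'a" and a y
    using periodic_add[OF that, of "a + y"] by (simp add: ac_simps)
  have perL: "w (a + L) = w a" if "periodic_fun_simple w L" for w :: "real \<Rightarrow> 'a" and a
    by (rule periodic_add[OF that])
  have pE: "E (a + L, s) = E (a, s)" "E1 (a + L, s) = E1 (a, s)" "E2 (a + L, s) = E2 (a, s)" if s: "0 < s" "s < L / 2" for a s
    unfolding eq[OF s] arc_energy_def arc_variation1_def arc_variation2_def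
      per[OF periodic(7)] per[OF periodic(8)] per[OF periodic(9)] perL[OF periodic(7)] perL[OF periodic(8)] perL[OF periodic(9)]
    by (rule refl)+
  have s: "0 < circle_dist L s1 s2 \<and> circle_dist L s1 s2 < L / 2"
    if "circle_dist L s1 s2 \<noteq> 0" "circle_dist L s1 s2 \<noteq> L / 2" for s1 s2
    using circle_dist_bounds[OF L, of s1 s2] that by simp
  have FM: "M (s1, s2) = E (arc_start L s1 s2, circle_dist L s1 s2)"
    and FG: "G (s1, s2) = E1 (arc_start L s1 s2, circle_dist L s1 s2)"
    and FH: "H (s1, s2) = E2 (arc_start L s1 s2, circle_dist L s1 s2)"
    if c: "circle_dist L s1 s2 \<noteq> 0" "circle_dist L s1 s2 \<noteq> L / 2" for s1 s2
    using s[OF c] weighted_eq[OF c(1)] c(2) eq unfolding M_def G_def H_def by simp_all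
  have bE: "\<bar>E (a, s)\<bar> \<le> B" "\<bar>E1 (a, s)\<bar> \<le> B * N1" "\<bar>E2 (a, s)\<bar> \<le> B * N1 * N2" if s: "0 < s" "s < L / 2" for a s
  proof -
    have cd: "circle_dist L (a + s) a = s" "arc_start L (a + s) a = a"
      using circle_dist_shift[OF L] arc_shift[OF L] s by auto
    then have c: "circle_dist L (a + s) a \<noteq> 0" "circle_dist L (a + s) a \<noteq> L / 2" using s by auto
    show "\<bar>E (a, s)\<bar> \<le> B" "\<bar>E1 (a, s)\<bar> \<le> B * N1" "\<bar>E2 (a, s)\<bar> \<le> B * N1 * N2"
      using weighted_bounds[OF c(1)] c(2) FM[OF c] FG[OF c] FH[OF c] unfolding cd B_def M_def G_def H_def by simp_all
  qed
  have bM: "\<bar>M x\<bar> \<le> B" if "x \<in> off_diagonal L" for x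
    using weighted_bounds(1)[of "fst x" "snd x"] that by (auto simp: M_def B_def off_diagonal_def)
  \<comment> \<open>The energy density depends on the pair only through the chord and the circle
    distance. Both are continuous at antipodal pairs, although the choice of arc is not.\<close>
  have cM: "continuous_on (off_diagonal L) M"
  proof (rule continuous_on_eq)
    let ?c = "\<lambda>x. circle_dist L (fst x) (snd x)" and ?d = "\<lambda>x. norm (f (fst x) - f (snd x))"
    have pos: "0 < ?c x" "0 < ?d x" "?d x \<le> ?c x" if "x \<in> off_diagonal L" for x
    proof -
      show c: "0 < ?c x" using that circle_dist_bounds(1)[OF L, of "fst x" "snd x"] by (auto simp: off_diagonal_def)
      then show "0 < ?d x" using bi_lip(2)[of "fst x" "snd x"] bi_lip(1)
        by (cases "f (fst x) = f (snd x)") auto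
      have "?d x = ?c x * norm (\<integral>y. t (arc_start L (fst x) (snd x) + ?c x * y) \<partial>unit_interval)"
        unfolding norm_diff_arc[OF L periodic(1), of "fst x" "snd x"]
        using ftc(1)[OF UNIV_I UNIV_I, of "arc_start L (fst x) (snd x)" "arc_start L (fst x) (snd x) + ?c x"] circle_dist_bounds[OF L, of "fst x" "snd x"] L
          integral_arc[OF borel(1) c] by simp
      moreover have "norm (\<integral>y. t (arc_start L (fst x) (snd x) + ?c x * y) \<partial>unit_interval) \<le> 1"
        by (rule unit.norm_expectation_le[OF borel_measurable_arc[OF borel(1)]]) (simp add: norms)
      ultimately show "?d x \<le> ?c x" using c by (simp add: mult_left_le)
    qed
    \<comment> \<open>The chord is at most the arc; the base of the p-th power is therefore
      nonnegative and continuity of the power holds also where it vanishes.\<close>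
    have "0 \<le> 1 / ?d x powr \<alpha> - 1 / ?c x powr \<alpha>" if "x \<in> off_diagonal L" for x
      using pos[OF that] \<alpha> by (simp add: frac_le powr_mono2)
    note nonneg = this
    have c: "continuous_on (off_diagonal L) ?c" by (rule continuous_on_subset[OF continuous_circle_dist[OF L]]) simp
    have d: "continuous_on (off_diagonal L) ?d" by (intro continuous_intros continuous_on_compose2[OF f]; simp)
    have ne: "?c x \<noteq> 0" "?d x \<noteq> 0" if "x \<in> off_diagonal L" for x using pos[OF that] by auto
    have "continuous_on (off_diagonal L) (\<lambda>x. 1 / ?d x powr \<alpha> - 1 / ?c x powr \<alpha>)"
      by (intro continuous_on_diff continuous_on_divide continuous_on_powr c d continuous_on_const ballI)
         (use ne in auto)
    then have e: "continuous_on (off_diagonal L) (\<lambda>x. (1 / ?d x powr \<alpha> - 1 / ?c x powr \<alpha>) powr p)"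
      by (rule continuous_on_powr') (use nonneg p in auto)
    show "continuous_on (off_diagonal L) (\<lambda>x. ?c x powr ((\<alpha> - 2 * \<beta>) * p) * (1 / ?d x powr \<alpha> - 1 / ?c x powr \<alpha>) powr p)"
      by (rule continuous_on_mult[OF continuous_on_powr[OF c continuous_on_const] e]) (use ne in auto)
    fix x assume "x \<in> off_diagonal L"
    then show "?c x powr ((\<alpha> - 2 * \<beta>) * p) * (1 / ?d x powr \<alpha> - 1 / ?c x powr \<alpha>) powr p = M x"
      using intrinsic_dist_eq[of "fst x" "snd x"]
      by (auto simp: M_def weighted_def energy_density_def off_diagonal_def)
  qed
  note ext = diagonal_extension[OF L cont(1) pE(1) bE(1) FM] diagonal_extension[OF L cont(2) pE(2) bE(2) FG]
    diagonal_extension[OF L cont(3) pE(3) bE(3) FH]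
  show "extends_continuously L UNIV M B" by (rule ext(3)) (assumption | rule cM bM)+
  show "extends_continuously L (non_antipodal L) G (B * N1)" "extends_continuously L (non_antipodal L) H (B * N1 * N2)"
    by (rule ext(4,7); assumption)+
  show "\<forall>F \<in> {M, G, H}. \<forall>s. (\<exists>l. (F \<longlongrightarrow> l) (at (s, s) within off_diagonal L)) \<and>
      (\<beta> < 1 \<longrightarrow> (F \<longlongrightarrow> 0) (at (s, s) within off_diagonal L))"
  proof -
    have lim: "(M \<longlongrightarrow> E (s, 0)) (at (s, s) within off_diagonal L)" "(G \<longlongrightarrow> E1 (s, 0)) (at (s, s) within off_diagonal L)"
      "(H \<longlongrightarrow> E2 (s, 0)) (at (s, s) within off_diagonal L)" for s
      by (rule ext(2,5,8); assumption)+
    have "(\<exists>l. (F \<longlongrightarrow> l) (at (s, s) within off_diagonal L)) \<and> (\<beta> < 1 \<longrightarrow> (F \<longlongrightarrow> 0) (at (s, s) within off_diagonal L))"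
      if "(F \<longlongrightarrow> l) (at (s, s) within off_diagonal L)" "\<beta> < 1 \<Longrightarrow> l = 0" for F :: "real \<times> real \<Rightarrow> real" and l s
      using that by auto
    note * = this
    show ?thesis
      using *[OF lim(1)] *[OF lim(2)] *[OF lim(3)] zero by simp
  qed
qed

end

section \<open>Increments of functions in little Hoelder spaces\<close>

lemma increment_le:
  fixes w w' :: "real \<Rightarrow> 'a::euclidean_space"
  assumes d: "\<And>s. (w has_vector_derivative w' s) (at s)" and c: "continuous_on UNIV w'" and s: "0 \<le> s"
    and B: "\<And>x. norm (w' x) \<le> B"
  shows "norm (w (a + s) - w a) \<le> B * s"
proof -
  have "norm (\<integral>x. w' (a + s * x) \<partial>unit_interval) \<le> B"
    by (rule unit.norm_expectation_le[OF borel_measurable_arc[OF borel_measurable_continuous_onI[OF c]] B])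
  then have "s * norm (\<integral>x. w' (a + s * x) \<partial>unit_interval) \<le> s * B" using s by (rule mult_left_mono)
  then show ?thesis using s unfolding increment_eq[OF d c s] by (simp add: mult.commute[of B])
qed

text \<open>The supremum in \<open>holder_norm\<close> bounds the quotients only if they are bounded
  above. This secures it for the smooth approximants, and thus for their differences from a Hoelder
  function.\<close>

lemma C1_in_C0_holder:
  fixes w w' :: "real \<Rightarrow> 'a::euclidean_space"
  assumes L: "0 < L" and \<beta>: "0 < \<beta>" "\<beta> \<le> 1" and per: "periodic_fun_simple w L"
    and d: "\<And>s. (w has_vector_derivative w' s) (at s)" and c: "continuous_on UNIV w'"
  shows "w \<in> C0_holder L \<beta>"
proof -
  note b = periodic_continuous_bdd[OF L derivative_of_periodic[OF per d] c]
  have "norm (w s1 - w s2) / circle_dist L s1 s2 powr \<beta> \<le> C0_norm w' * (L / 2) powr (1 - \<beta>)"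
    if "circle_dist L s1 s2 \<noteq> 0" for s1 s2
  proof -
    define r where "r = circle_dist L s1 s2"
    have r: "0 < r" "r \<le> L / 2" using circle_dist_bounds[OF L, of s1 s2] that by (auto simp: r_def)
    have "norm (w s1 - w s2) \<le> C0_norm w' * r"
      unfolding norm_diff_arc[OF L per, of s1 s2] r_def[symmetric] using r by (intro increment_le[OF d c _ b(2)]) simp
    also have "r = r powr (1 - \<beta>) * r powr \<beta>" using r by (simp add: powr_add[symmetric])
    also have "C0_norm w' * (r powr (1 - \<beta>) * r powr \<beta>) \<le> C0_norm w' * ((L / 2) powr (1 - \<beta>) * r powr \<beta>)"
      using r \<beta> b(3) by (intro mult_left_mono mult_right_mono powr_mono2) auto
    finally show ?thesis using r by (simp add: r_def[symmetric] divide_le_eq ac_simps)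
  qed
  then have "bdd_above (holder_quotients L \<beta> w)" unfolding holder_quotients_def by (intro bdd_aboveI) blast
  moreover have "continuous_on UNIV w"
    using d by (auto intro!: continuous_at_imp_continuous_on has_vector_derivative_continuous)
  ultimately show ?thesis using per by (simp add: C0_holder_def)
qed

lemma C0_holder_diff:
  fixes w z :: "real \<Rightarrow> 'a::euclidean_space"
  assumes w: "w \<in> C0_holder L \<beta>" and z: "z \<in> C0_holder L \<beta>"
  shows "(\<lambda>s. w s - z s) \<in> C0_holder L \<beta>"
proof -
  obtain A B where b: "\<And>x. x \<in> holder_quotients L \<beta> w \<Longrightarrow> x \<le> A" "\<And>x. x \<in> holder_quotients L \<beta> z \<Longrightarrow> x \<le> B"
    using w z by (auto simp: C0_holder_def bdd_above_def)
  have "norm (w s1 - z s1 - (w s2 - z s2)) / circle_dist L s1 s2 powr \<beta> \<le> A + B" if "circle_dist L s1 s2 \<noteq> 0" for s1 s2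
  proof -
    have "norm (w s1 - z s1 - (w s2 - z s2)) \<le> norm (w s1 - w s2) + norm (z s1 - z s2)"
      using norm_triangle_ineq4[of "w s1 - w s2" "z s1 - z s2"] by (simp add: algebra_simps)
    then have "norm (w s1 - z s1 - (w s2 - z s2)) / circle_dist L s1 s2 powr \<beta>
        \<le> norm (w s1 - w s2) / circle_dist L s1 s2 powr \<beta> + norm (z s1 - z s2) / circle_dist L s1 s2 powr \<beta>"
      by (simp add: add_divide_distrib[symmetric] divide_right_mono)
    also have "\<dots> \<le> A + B" using that by (intro add_mono b) (auto simp: holder_quotients_def)
    finally show ?thesis .
  qed
  then have "bdd_above (holder_quotients L \<beta> (\<lambda>s. w s - z s))"
    unfolding holder_quotients_def by (intro bdd_aboveI) blast
  then show ?thesis using w z by (auto simp: C0_holder_def periodic_fun_simple_def intro: continuous_on_diff)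
qed

text \<open>For \<beta> < 1 the function is split into a smooth part and a remainder of small
  Hoelder norm; increments of the smooth part are Lipschitz and thus small compared with
  \<open>s powr \<beta>\<close>. For \<beta> = 1 the bounded derivative gives the increments
  directly.\<close>

lemma X_space_bounds:
  fixes w :: "real \<Rightarrow> 'a::euclidean_space"
  assumes L: "0 < L" and \<beta>: "0 < \<beta>" "\<beta> \<le> 1" and w: "w \<in> X_space L \<beta>"
  shows "little_regular \<beta> w" "norm (w x) \<le> X_norm L \<beta> w"
    "\<And>a s. 0 \<le> s \<Longrightarrow> s \<le> L / 2 \<Longrightarrow> norm (w (a + s) - w a) \<le> X_norm L \<beta> w * s powr \<beta>"
proof -
  have "little_regular \<beta> w \<and> norm (w x) \<le> X_norm L \<beta> w \<and>
    (\<forall>a s. 0 \<le> s \<longrightarrow> s \<le> L / 2 \<longrightarrow> norm (w (a + s) - w a) \<le> X_norm L \<beta> w * s powr \<beta>)"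
  proof (cases "\<beta> < 1")
    case True
    then have N: "X_norm L \<beta> w = holder_norm L \<beta> w" and h: "w \<in> C0_holder L \<beta>"
      and a: "\<And>e. 0 < e \<Longrightarrow> \<exists>z. smooth z \<and> periodic_fun_simple z L \<and> holder_norm L \<beta> (\<lambda>s. w s - z s) < e"
      using w by (auto simp: X_space_def X_norm_def little_holder_def)
    note b = holder_norm_bounds[OF L h]
    have "\<exists>d>0. \<forall>a s. 0 \<le> s \<longrightarrow> s \<le> d \<longrightarrow> norm (w (a + s) - w a) \<le> e * s powr \<beta>" if e: "0 < e" for e
    proof -
      obtain z where z: "smooth z" "periodic_fun_simple z L" "holder_norm L \<beta> (\<lambda>s. w s - z s) < e / 2"
        using a[of "e / 2"] e by auto
      obtain D where D: "D 0 = z" "\<And>(k::nat) s. (D k has_vector_derivative D (Suc k) s) (at s)"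
        using z(1) by (auto simp: smooth_def)
      have d: "\<And>s. (z has_vector_derivative D 1 s) (at s)" using D(2)[of 0] D(1) by simp
      have c: "continuous_on UNIV (D 1)"
        using D(2)[of 1] by (auto intro!: continuous_at_imp_continuous_on has_vector_derivative_continuous)
      note bD = periodic_continuous_bdd[OF L derivative_of_periodic[OF z(2) d] c]
      define B where "B = C0_norm (D 1)"
      have B: "0 \<le> B" using bD(3) by (simp add: B_def)
      note bz = holder_norm_bounds(3)[OF L C0_holder_diff[OF h C1_in_C0_holder[OF L \<beta> z(2) d c]]]
      \<comment> \<open>\<open>k\<close> is the size allowed to \<open>s powr (1 - \<beta>)\<close>
        so that the smooth part uses at most half of e; adding 1 avoids division by 0. The radius r
        below enforces it.\<close>
      define k where "k = e / (2 * (B + 1))"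
      have k: "0 < k" "B * k \<le> e / 2" using e B by (simp_all add: k_def field_simps)
      define r where "r = min (L / 2) (k powr (1 / (1 - \<beta>)))"
      have "norm (w (a + s) - w a) \<le> e * s powr \<beta>" if s: "0 \<le> s" "s \<le> r" for a s
      proof (cases "s = 0")
        case False
        then have s0: "0 < s" using s by simp
        have "s powr (1 - \<beta>) \<le> (k powr (1 / (1 - \<beta>))) powr (1 - \<beta>)"
          using s True by (intro powr_mono2) (auto simp: r_def)
        also have "\<dots> = k" using True k by (simp add: powr_powr)
        finally have sk: "s powr (1 - \<beta>) \<le> k" .
        have "norm (z (a + s) - z a) \<le> B * s" unfolding B_def by (rule increment_le[OF d c s(1) bD(2)])
        also have "B * s = B * (s powr (1 - \<beta>) * s powr \<beta>)" using s0 by (simp add: powr_add[symmetric])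
        also have "B * (s powr (1 - \<beta>) * s powr \<beta>) \<le> B * (k * s powr \<beta>)"
          using B sk by (intro mult_left_mono mult_right_mono) auto
        also have "\<dots> \<le> e / 2 * s powr \<beta>" using mult_right_mono[OF k(2), of "s powr \<beta>"] by (simp add: ac_simps)
        finally have 1: "norm (z (a + s) - z a) \<le> e / 2 * s powr \<beta>" .
        have "norm ((w (a + s) - z (a + s)) - (w a - z a)) \<le> holder_norm L \<beta> (\<lambda>s. w s - z s) * s powr \<beta>"
          using s by (intro bz) (auto simp: r_def)
        also have "\<dots> \<le> e / 2 * s powr \<beta>" using z(3) by (intro mult_right_mono) auto
        finally have 2: "norm ((w (a + s) - z (a + s)) - (w a - z a)) \<le> e / 2 * s powr \<beta>" .
        have "norm (w (a + s) - w a) \<le> norm ((w (a + s) - z (a + s)) - (w a - z a)) + norm (z (a + s) - z a)"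
          using norm_triangle_ineq[of "(w (a + s) - z (a + s)) - (w a - z a)" "z (a + s) - z a"] by (simp add: algebra_simps)
        then show ?thesis using 1 2 by simp
      qed simp
      moreover have "0 < r" using L k by (simp add: r_def)
      ultimately show ?thesis by blast
    qed
    then have "little_regular \<beta> w" using True h by (simp add: little_regular_def C0_holder_def)
    then show ?thesis using b by (simp add: N)
  next
    case False
    then have \<beta>1: "\<beta> = 1" and per: "periodic_fun_simple w L" and "w C1_differentiable_on UNIV"
      using w \<beta> by (auto simp: X_space_def)
    then obtain w' where d: "\<And>s. (w has_vector_derivative w' s) (at s)" and c: "continuous_on UNIV w'"
      by (auto simp: C1_differentiable_on_def)
    have "(\<lambda>s. vector_derivative w (at s)) = w'" using d vector_derivative_at by blast
    then have N: "X_norm L \<beta> w = C0_norm w + C0_norm w'" using False by (simp add: X_norm_def)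
    have cw: "continuous_on UNIV w"
      using d by (auto intro!: continuous_at_imp_continuous_on has_vector_derivative_continuous)
    note b = periodic_continuous_bdd[OF L per cw] and b' = periodic_continuous_bdd[OF L derivative_of_periodic[OF per d] c]
    have "norm (w (a + s) - w a) \<le> X_norm L \<beta> w * s powr \<beta>" if s: "0 \<le> s" for a s
    proof -
      have "norm (w (a + s) - w a) \<le> C0_norm w' * s" by (rule increment_le[OF d c s b'(2)])
      also have "\<dots> \<le> X_norm L \<beta> w * s powr \<beta>" using s b(3) unfolding N by (simp add: \<beta>1 mult_right_mono)
      finally show ?thesis .
    qed
    moreover have "norm (w x) \<le> X_norm L \<beta> w" using b(2)[of x] b'(3) by (simp add: N)
    moreover have "little_regular \<beta> w" using False cw d c by (auto simp: little_regular_def)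
    ultimately show ?thesis by simp
  qed
  then show "little_regular \<beta> w" "norm (w x) \<le> X_norm L \<beta> w"
    "\<And>a s. 0 \<le> s \<Longrightarrow> s \<le> L / 2 \<Longrightarrow> norm (w (a + s) - w a) \<le> X_norm L \<beta> w * s powr \<beta>" by blast+
qed

theorem little_holder_extensions:
  fixes f \<phi> \<psi> \<tau> \<phi>' \<psi>' :: "real \<Rightarrow> 'a::euclidean_space"
  assumes \<alpha>: "0 < \<alpha>" and p: "1 \<le> p" and \<beta>: "0 < \<beta>" "\<beta> \<le> 1"
    and arc: "arclength_curve L f \<tau>" and bl: "bi_lipschitz_curve L f \<tau> Cb"
    and per: "periodic_fun_simple \<phi> L" "periodic_fun_simple \<psi> L"
    and d: "\<forall>s. (f has_vector_derivative \<tau> s) (at s)" "\<forall>s. (\<phi> has_vector_derivative \<phi>' s) (at s)"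
      "\<forall>s. (\<psi> has_vector_derivative \<psi>' s) (at s)"
    and X: "{\<tau>, \<phi>', \<psi>'} \<subseteq> X_space L \<beta>"
  defines "B \<equiv> variation_const \<alpha> p Cb * ((X_norm L \<beta> \<tau>)\<^sup>2 + 1) powr p"
    and "M \<equiv> weighted \<alpha> \<beta> p L \<tau> (energy_density \<alpha> p L f \<tau>)"
    and "G \<equiv> weighted \<alpha> \<beta> p L \<tau> (variation1 \<alpha> p L f \<tau> \<phi> \<phi>')"
    and "H \<equiv> weighted \<alpha> \<beta> p L \<tau> (variation2 \<alpha> p L f \<tau> \<phi> \<phi>' \<psi> \<psi>')"
  shows "(\<forall>x \<in> off_diagonal L \<inter> non_antipodal L. variation1_exists \<alpha> p L f \<tau> \<phi> \<phi>' x \<and>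
       variation2_exists \<alpha> p L f \<tau> \<phi> \<phi>' \<psi> \<psi>' x) \<and>
    extends_continuously L UNIV M B \<and>
    extends_continuously L (non_antipodal L) G (B * X_norm L \<beta> \<phi>') \<and>
    extends_continuously L (non_antipodal L) H (B * X_norm L \<beta> \<phi>' * X_norm L \<beta> \<psi>') \<and>
    (\<forall>F \<in> {M, G, H}. \<forall>s. (\<exists>l. (F \<longlongrightarrow> l) (at (s, s) within off_diagonal L)) \<and>
      (\<beta> < 1 \<longrightarrow> (F \<longlongrightarrow> 0) (at (s, s) within off_diagonal L)))"
proof -
  let ?n = "X_norm L \<beta>"
  have L: "0 < L" using arc by (simp add: arclength_curve_def)
  have m: "\<tau> \<in> X_space L \<beta>" "\<phi>' \<in> X_space L \<beta>" "\<psi>' \<in> X_space L \<beta>" using X by auto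
  note t = X_space_bounds[OF L \<beta> m(1)] and u = X_space_bounds[OF L \<beta> m(2)] and v = X_space_bounds[OF L \<beta> m(3)]
  have c: "continuous_on UNIV \<tau>" "continuous_on UNIV \<phi>'" "continuous_on UNIV \<psi>'"
    using t(1) u(1) v(1) by (simp_all add: little_regular_def)
  interpret holder_variation L \<alpha> p "?n \<phi>'" "?n \<psi>'" Cb f \<phi> \<psi> \<tau> \<phi>' \<psi>' \<beta> "?n \<tau>"
    by (rule holder_variation_C1[OF \<alpha> p \<beta> arc bl per d c u(2) v(2) t(3) u(3) v(3)])
  interpret little_holder_variation L \<alpha> p "?n \<phi>'" "?n \<psi>'" Cb f \<phi> \<psi> \<tau> \<phi>' \<psi>' \<beta> "?n \<tau>"
    by unfold_locales (rule t(1) u(1) v(1))+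
  have f: "continuous_on UNIV f"
    using d(1) by (auto intro!: continuous_at_imp_continuous_on has_vector_derivative_continuous)
  have ex: "\<forall>x \<in> off_diagonal L \<inter> non_antipodal L. variation1_exists \<alpha> p L f \<tau> \<phi> \<phi>' x \<and>
       variation2_exists \<alpha> p L f \<tau> \<phi> \<phi>' \<psi> \<psi>' x"
    using variation1_eq(1)[OF UNIV_I UNIV_I _ refl refl _ refl] variation2_eq(1)[OF UNIV_I UNIV_I _ refl refl _ refl]
    by (auto simp: off_diagonal_def non_antipodal_def)
  show ?thesis
    unfolding B_def M_def G_def H_def by (intro conjI ex weighted_extensions[OF f])
qed

theorem theorem1p1:
  fixes \<alpha> p \<sigma> :: real
  assumes "0 < \<alpha>" and "1 \<le> p" and "2 \<le> \<alpha> * p" and "\<alpha> * p < 2 * p + 1"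
    and "\<sigma> = (\<alpha> * p - 1) / (2 * p)"
  shows
    "(\<exists>C :: real \<Rightarrow> real \<Rightarrow> real. (\<forall>K Cb. 0 < C K Cb) \<and>
      (\<forall>L Cb (f :: real \<Rightarrow> real ^ 'n) \<tau> \<phi> \<phi>' \<psi> \<psi>'.
        arclength_curve L f \<tau> \<longrightarrow> bi_lipschitz_curve L f \<tau> Cb \<longrightarrow>
        {f, \<phi>, \<psi>} \<subseteq> W1_frac L \<sigma> (2 * p) \<inter> W1_inf L \<longrightarrow>
        has_weak_deriv L \<phi> \<phi>' \<longrightarrow> has_weak_deriv L \<psi> \<psi>' \<longrightarrow>
        (let T = torus_measure L; B = C (frac_Linf_norm L \<sigma> (2 * p) \<tau>) Cb;
             M = energy_density \<alpha> p L f \<tau>;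
             G = variation1 \<alpha> p L f \<tau> \<phi> \<phi>';
             H = variation2 \<alpha> p L f \<tau> \<phi> \<phi>' \<psi> \<psi>'
         in (AE x in T. variation1_exists \<alpha> p L f \<tau> \<phi> \<phi>' x) \<and>
            (AE x in T. variation2_exists \<alpha> p L f \<tau> \<phi> \<phi>' \<psi> \<psi>' x) \<and>
            integrable T M \<and> integrable T G \<and> integrable T H \<and>
            (\<integral>x. \<bar>M x\<bar> \<partial>T) \<le> B \<and>
            (\<integral>x. \<bar>G x\<bar> \<partial>T) \<le> B * frac_Linf_norm L \<sigma> (2 * p) \<phi>' \<and>
            (\<integral>x. \<bar>H x\<bar> \<partial>T)
              \<le> B * frac_Linf_norm L \<sigma> (2 * p) \<phi>' * frac_Linf_norm L \<sigma> (2 * p) \<psi>')))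
    \<and>
     (\<exists>C :: real \<Rightarrow> real \<Rightarrow> real. (\<forall>K Cb. 0 < C K Cb) \<and>
      (\<forall>\<beta> L Cb (f :: real \<Rightarrow> real ^ 'n) \<tau> \<phi> \<phi>' \<psi> \<psi>'.
        0 < \<beta> \<longrightarrow> \<beta> \<le> 1 \<longrightarrow>
        arclength_curve L f \<tau> \<longrightarrow> bi_lipschitz_curve L f \<tau> Cb \<longrightarrow>
        {f, \<phi>, \<psi>} \<subseteq> C1_holder L \<beta> \<longrightarrow>
        (\<forall>s. (f has_vector_derivative \<tau> s) (at s)) \<longrightarrow>
        (\<forall>s. (\<phi> has_vector_derivative \<phi>' s) (at s)) \<longrightarrow>
        (\<forall>s. (\<psi> has_vector_derivative \<psi>' s) (at s)) \<longrightarrow>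
        (let T = torus_measure L; B = C (holder_norm L \<beta> \<tau>) Cb;
             M = weighted \<alpha> \<beta> p L \<tau> (energy_density \<alpha> p L f \<tau>);
             G = weighted \<alpha> \<beta> p L \<tau> (variation1 \<alpha> p L f \<tau> \<phi> \<phi>');
             H = weighted \<alpha> \<beta> p L \<tau> (variation2 \<alpha> p L f \<tau> \<phi> \<phi>' \<psi> \<psi>')
         in (AE x in T. variation1_exists \<alpha> p L f \<tau> \<phi> \<phi>' x) \<and>
            (AE x in T. variation2_exists \<alpha> p L f \<tau> \<phi> \<phi>' \<psi> \<psi>' x) \<and>
            in_Linf T M \<and> in_Linf T G \<and> in_Linf T H \<and>
            Linf_norm T M \<le> B \<and>
            Linf_norm T G \<le> B * holder_norm L \<beta> \<phi>' \<and>
            Linf_norm T H \<le> B * holder_norm L \<beta> \<phi>' * holder_norm L \<beta> \<psi>')))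
    \<and>
     (\<exists>C :: real \<Rightarrow> real \<Rightarrow> real. (\<forall>K Cb. 0 < C K Cb) \<and>
      (\<forall>\<beta> L Cb (f :: real \<Rightarrow> real ^ 'n) \<tau> \<phi> \<phi>' \<psi> \<psi>'.
        0 < \<beta> \<longrightarrow> \<beta> \<le> 1 \<longrightarrow>
        arclength_curve L f \<tau> \<longrightarrow> bi_lipschitz_curve L f \<tau> Cb \<longrightarrow>
        periodic_fun_simple \<phi> L \<longrightarrow> periodic_fun_simple \<psi> L \<longrightarrow>
        (\<forall>s. (f has_vector_derivative \<tau> s) (at s)) \<longrightarrow>
        (\<forall>s. (\<phi> has_vector_derivative \<phi>' s) (at s)) \<longrightarrow>
        (\<forall>s. (\<psi> has_vector_derivative \<psi>' s) (at s)) \<longrightarrow>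
        {\<tau>, \<phi>', \<psi>'} \<subseteq> X_space L \<beta> \<longrightarrow>
        (let B = C (X_norm L \<beta> \<tau>) Cb;
             M = weighted \<alpha> \<beta> p L \<tau> (energy_density \<alpha> p L f \<tau>);
             G = weighted \<alpha> \<beta> p L \<tau> (variation1 \<alpha> p L f \<tau> \<phi> \<phi>');
             H = weighted \<alpha> \<beta> p L \<tau> (variation2 \<alpha> p L f \<tau> \<phi> \<phi>' \<psi> \<psi>')
         in (\<forall>x \<in> off_diagonal L \<inter> non_antipodal L.
               variation1_exists \<alpha> p L f \<tau> \<phi> \<phi>' x \<and>
               variation2_exists \<alpha> p L f \<tau> \<phi> \<phi>' \<psi> \<psi>' x) \<and>
            extends_continuously L UNIV M B \<and>
            extends_continuously L (non_antipodal L) G (B * X_norm L \<beta> \<phi>') \<and>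
            extends_continuously L (non_antipodal L) H (B * X_norm L \<beta> \<phi>' * X_norm L \<beta> \<psi>') \<and>
            (\<forall>F \<in> {M, G, H}. \<forall>s.
               (\<exists>l. (F \<longlongrightarrow> l) (at (s, s) within off_diagonal L)) \<and>
               (\<beta> < 1 \<longrightarrow> (F \<longlongrightarrow> 0) (at (s, s) within off_diagonal L))))))"
proof -
  have ap: "1 \<le> \<alpha> * p" using assms(3) by simp
  \<comment> \<open>The constants have to be positive for every real K. The summands 2 and 1 that
    stem from the normalized perturbations ensure this even when the part depending on K is
    0.\<close>
  have pos: "0 < variation_const \<alpha> p Cb * (3 powr p * (K powr (2 * p) + 2))"
    "0 < variation_const \<alpha> p Cb * (K\<^sup>2 + 1) powr p" for K Cb :: real
  proof -
    have "0 < K powr (2 * p) + 2" "K\<^sup>2 + 1 \<noteq> 0"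
      using powr_ge_zero[of K "2 * p"] zero_le_power2[of K] by linarith+
    then show "0 < variation_const \<alpha> p Cb * (3 powr p * (K powr (2 * p) + 2))"
      "0 < variation_const \<alpha> p Cb * (K\<^sup>2 + 1) powr p"
      using variation_const_pos[OF assms(1,2), of Cb] by simp_all
  qed
  show ?thesis
  proof (intro conjI, goal_cases)
    case 1
    show ?case
    proof (intro exI[of _ "\<lambda>K Cb. variation_const \<alpha> p Cb * (3 powr p * (K powr (2 * p) + 2))"] conjI allI impI pos, goal_cases)
      case 1
      then show ?case unfolding Let_def by (intro conjI fractional_Sobolev_bounds[OF assms(1,2) ap assms(5)])
    qed
  next
    case 2
    show ?case
    proof (intro exI[of _ "\<lambda>K Cb. variation_const \<alpha> p Cb * (K\<^sup>2 + 1) powr p"] conjI allI impI pos, goal_cases)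
      case 1
      then show ?case unfolding Let_def by (intro holder_bounds[OF assms(1,2)])
    qed
  next
    case 3
    show ?case
    proof (intro exI[of _ "\<lambda>K Cb. variation_const \<alpha> p Cb * (K\<^sup>2 + 1) powr p"] conjI allI impI pos, goal_cases)
      case 1
      then show ?case unfolding Let_def by (intro little_holder_extensions[OF assms(1,2)])
    qed
  qed
qed

end
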